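(* Let $\Gamma$ be a finite simplicial graph, with each vertex $v$ labelled by a group $G_v$. If each $G_v$ is a hierarchically hyperbolic group, then the graph product $G_\Gamma$ is a hierarchically hyperbolic group.
   Context: **Graph products.** Let $\Gamma$ be a finite non-empty simplicial graph with each vertex $v$ labelled by a group $G_v$; vertex groups are always assumed non-trivial. The graph product is $G_\Gamma=\left(\ast_{v\in V(\Gamma)}G_v\right)/\langle\langle [g_v,g_w] : g_v\in G_v,\ g_w\in G_w,\ \{v,w\}\in E(\Gamma)\rangle\rangle$. **Proto-hierarchy structure.** Let $\mathcal X$ be a quasi-geodesic metric space and $E>0$. An $E$-proto-hierarchy structure on $\mathcal X$ is an index set $\mathfrak S$ and geodesic spaces $(C(W),\mathsf d_W)$, $W\in\mathfrak S$, such that (for subsets $A,B$ of $C(W)$, $\mathsf d_W(A,B)$ denotes the infimal distance): - (Projections) For each $W$ there is $\pi_W:\mathcal X\to 2^{C(W)}$ with $\pi_W(x)\ne\emptyset$, $\operatorname{diam}\pi_W(x)\le E$ for all $x$; $\pi_W$ is $(E,E)$-coarsely Lipschitz; and $C(W)$ is contained in the $E$-neighbourhood of $\pi_W(\mathcal X)$. - (Nesting) If $\mathfrak S\neq\emptyset$, it has a partial order $\sqsubseteq$ with a unique maximal element. $\mathfrak S_W=\{V: V\sqsubseteq W\}$. If $V\sqsubsetneq W$ there is a specified non-empty $\rho^V_W\subseteq C(W)$ with $\operatorname{diam}\rho^V_W\le E$. - (Orthogonality) There is a symmetric relation $\perp$ on $\mathfrak S$; orthogonal elements are not $\sqsubseteq$-comparable;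 $V\sqsubseteq W$ and $W\perp U$ imply $V\perp U$. $\mathfrak S_W^\perp=\{V:V\perp W\}$. - (Transversality) If $V,W$ are not orthogonal and neither is nested in the other, write $V\pitchfork W$; then there are specified non-empty $\rho^V_W\subseteq C(W)$, $\rho^W_V\subseteq C(V)$ of diameter at most $E$. **HHS structure.** An $E$-proto-hierarchy structure is an $E$-HHS structure if in addition (writing $\mathsf d_W(x,y)$ for $\mathsf d_W(\pi_W(x),\pi_W(y))$): 1. (Hyperbolicity) Every $C(W)$ is $E$-hyperbolic. 2. (Finite complexity) Any set of pairwise $\sqsubseteq$-comparable elements has at most $E$ elements. 3. (Containers) For $W\in\mathfrak S$ and $U\in\mathfrak S_W$ with $\mathfrak S_W\cap\mathfrak S_U^\perp\ne\emptyset$ there is $Q\in\mathfrak S_W$ with $V\sqsubseteq Q$ for all $V\in\mathfrak S_W\cap\mathfrak S_U^\perp$. 4. (Uniqueness) There is $\theta:[0,\infty)\to[0,\infty)$ such that for all $r\ge0$, if $\mathsf d_{\mathcal X}(x,y)\ge\theta(r)$ then $\mathsf d_W(x,y)\ge r$ for some $W$. 5. (Bounded geodesic image) If $V\sqsubsetneq W$ and $\mathsf d_V(x,y)\ge E$, then every $C(W)$-geodesic from $\pi_W(x)$ to $\pi_W(y)$ meets the $E$-neighbourhood of $\rho^V_W$. 6. (Large links) For all $W$ and $x,y\in\mathcal X$ there is $\{V_1,\dots,V_m\}\subseteq\mathfrak S_W\smallsetminus\{W\}$ with $m\le E\,\mathsf d_W(x,y)+E$ such that for all $U\in\mathfrak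 S_W\smallsetminus\{W\}$, either $U\sqsubseteq V_i$ for some $i$ or $\mathsf d_U(x,y)\le E$. 7. (Consistency) If $V\pitchfork W$ then $\min\{\mathsf d_W(\pi_W(x),\rho^V_W),\mathsf d_V(\pi_V(x),\rho^W_V)\}\le E$ for all $x$. If $U\sqsubseteq V$ and either $V\sqsubsetneq W$, or $V\pitchfork W$ and $W\not\perp U$, then $\mathsf d_W(\rho^U_W,\rho^V_W)\le E$. 8. (Partial realisation) If $\{V_i\}$ is a finite collection of pairwise orthogonal elements and $p_i\in C(V_i)$, there is $x\in\mathcal X$ with $\mathsf d_{V_i}(\pi_{V_i}(x),p_i)\le E$ for all $i$, and $\mathsf d_W(\pi_W(x),\rho^{V_i}_W)\le E$ whenever $V_i\sqsubsetneq W$ or $W\pitchfork V_i$. **Hierarchically hyperbolic group.** A finitely generated group $G$ with Cayley graph $X$ (for some finite generating set) is a hierarchically hyperbolic group (HHG) if for some $E>0$: (1) $X$ admits an $E$-HHS structure $\mathfrak S$; (2) $G$ acts on $\mathfrak S$ by bijections preserving $\sqsubseteq,\perp,\pitchfork$, with finitely many orbits; (3) for all $W\in\mathfrak S$, $g\in G$ there is an isometry $g_W:C(W)\to C(gW)$ such that $(gh)_W=g_{hW}\circ h_W$; $g_W(\pi_W(x))$ and $\pi_{gW}(gx)$ are at most $E$ apart for all $x\in X$; and if $V\pitchfork W$ or $V\sqsubsetneq W$, then $g_W(\rho^V_W)$ and $\rho^{gV}_{gW}$ are at most $E$ apart. *)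

theory Defs
  imports
    "HOL-Analysis.Abstract_Metric_Spaces"
    "HOL-Algebra.Generated_Groups"
    "HOL-Algebra.Group_Action"
begin

section \<open>Coarse geometry of metric spaces\<close>

definition set_dist :: "'p metric \<Rightarrow> 'p set \<Rightarrow> 'p set \<Rightarrow> real" where
  "set_dist m A B = (INF (a, b) \<in> A \<times> B. mdist m a b)"

definition nbhd :: "'p metric \<Rightarrow> real \<Rightarrow> 'p set \<Rightarrow> 'p set" where
  "nbhd m r A = {x \<in> mspace m. set_dist m {x} A \<le> r}"

definition diam_le :: "'p metric \<Rightarrow> 'p set \<Rightarrow> real \<Rightarrow> bool" where
  "diam_le m A r \<longleftrightarrow> (\<forall>a\<in>A. \<forall>b\<in>A. mdist m a b \<le> r)"

text \<open>A geodesic is identified with its image.\<close>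

definition geodesic_segment :: "'p metric \<Rightarrow> 'p \<Rightarrow> 'p \<Rightarrow> 'p set \<Rightarrow> bool" where
  "geodesic_segment m x y P \<longleftrightarrow>
     (\<exists>\<gamma> :: real \<Rightarrow> 'p. \<gamma> 0 = x \<and> \<gamma> (mdist m x y) = y \<and> P = \<gamma> ` {0..mdist m x y} \<and>
        P \<subseteq> mspace m \<and>
        (\<forall>s\<in>{0..mdist m x y}. \<forall>t\<in>{0..mdist m x y}. mdist m (\<gamma> s) (\<gamma> t) = \<bar>s - t\<bar>))"

definition geodesic_space :: "'p metric \<Rightarrow> bool" where
  "geodesic_space m \<longleftrightarrow> (\<forall>x\<in>mspace m. \<forall>y\<in>mspace m. \<exists>P. geodesic_segment m x y P)"

definition quasi_geodesic_space :: "'p metric \<Rightarrow> bool" where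
  "quasi_geodesic_space m \<longleftrightarrow>
     (\<exists>K\<ge>1. \<exists>c\<ge>0. \<forall>x\<in>mspace m. \<forall>y\<in>mspace m.
        \<exists>(\<gamma> :: real \<Rightarrow> 'p) L. 0 \<le> L \<and> \<gamma> 0 = x \<and> \<gamma> L = y \<and> \<gamma> ` {0..L} \<subseteq> mspace m \<and>
          (\<forall>s\<in>{0..L}. \<forall>t\<in>{0..L}. \<bar>s - t\<bar> / K - c \<le> mdist m (\<gamma> s) (\<gamma> t) \<and>
             mdist m (\<gamma> s) (\<gamma> t) \<le> K * \<bar>s - t\<bar> + c))"

text \<open>Slim triangles; since the three vertices and sides are arbitrary, it suffices to speak
  about one side of each triangle.\<close>

definition hyperbolic :: "'p metric \<Rightarrow> real \<Rightarrow> bool" where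
  "hyperbolic m \<delta> \<longleftrightarrow>
     (\<forall>x\<in>mspace m. \<forall>y\<in>mspace m. \<forall>z\<in>mspace m. \<forall>P Q R.
        geodesic_segment m x y P \<longrightarrow> geodesic_segment m y z Q \<longrightarrow> geodesic_segment m z x R \<longrightarrow>
        P \<subseteq> nbhd m \<delta> (Q \<union> R))"

definition isometry_onto :: "'p metric \<Rightarrow> 'q metric \<Rightarrow> ('p \<Rightarrow> 'q) \<Rightarrow> bool" where
  "isometry_onto m m' f \<longleftrightarrow> bij_betw f (mspace m) (mspace m') \<and>
     (\<forall>x\<in>mspace m. \<forall>y\<in>mspace m. mdist m' (f x) (f y) = mdist m x y)"


section \<open>Hierarchically hyperbolic spaces\<close>

text \<open>
  Subsets \<open>\<rho>\<^sup>V\<^sub>W\<close> of \<open>C W\<close> are written \<open>\<rho> V W\<close>; the values of \<open>\<rho>\<close> at pairs that are neither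
  properly nested nor transverse are irrelevant.
\<close>

locale proto_hierarchy_structure =
  fixes X :: "'x metric"
    and E :: real
    and \<SS> :: "'i set"
    and C :: "'i \<Rightarrow> 'p metric"
    and \<pi> :: "'i \<Rightarrow> 'x \<Rightarrow> 'p set"
    and nest :: "'i \<Rightarrow> 'i \<Rightarrow> bool"  (infix \<open>\<preceq>\<close> 50)
    and orth :: "'i \<Rightarrow> 'i \<Rightarrow> bool"
    and \<rho> :: "'i \<Rightarrow> 'i \<Rightarrow> 'p set"
  assumes E_pos: "0 < E"
    and quasi_geodesic: "quasi_geodesic_space X"
    and geodesic: "W \<in> \<SS> \<Longrightarrow> geodesic_space (C W)"
    \<comment> \<open>Projections\<close>
    and proj_subset: "W \<in> \<SS> \<Longrightarrow> x \<in> mspace X \<Longrightarrow> \<pi> W x \<subseteq> mspace (C W)"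
    and proj_nonempty: "W \<in> \<SS> \<Longrightarrow> x \<in> mspace X \<Longrightarrow> \<pi> W x \<noteq> {}"
    and proj_diam: "W \<in> \<SS> \<Longrightarrow> x \<in> mspace X \<Longrightarrow> diam_le (C W) (\<pi> W x) E"
    and proj_coarsely_Lipschitz:
      "W \<in> \<SS> \<Longrightarrow> x \<in> mspace X \<Longrightarrow> y \<in> mspace X \<Longrightarrow>
        set_dist (C W) (\<pi> W x) (\<pi> W y) \<le> E * mdist X x y + E"
    and proj_coarsely_onto:
      "W \<in> \<SS> \<Longrightarrow> mspace (C W) \<subseteq> nbhd (C W) E (\<Union>x\<in>mspace X. \<pi> W x)"
    \<comment> \<open>Nesting\<close>
    and nest_refl: "reflp_on \<SS> (\<preceq>)"
    and nest_antisym: "antisymp_on \<SS> (\<preceq>)"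
    and nest_trans: "transp_on \<SS> (\<preceq>)"
    and nest_maximal: "\<SS> \<noteq> {} \<Longrightarrow> \<exists>!M. M \<in> \<SS> \<and> (\<forall>V\<in>\<SS>. M \<preceq> V \<longrightarrow> V = M)"
    and rho_nest:
      "V \<in> \<SS> \<Longrightarrow> W \<in> \<SS> \<Longrightarrow> V \<preceq> W \<Longrightarrow> V \<noteq> W \<Longrightarrow>
        \<rho> V W \<noteq> {} \<and> \<rho> V W \<subseteq> mspace (C W) \<and> diam_le (C W) (\<rho> V W) E"
    \<comment> \<open>Orthogonality\<close>
    and orth_sym: "symp_on \<SS> orth"
    and orth_not_comparable:
      "V \<in> \<SS> \<Longrightarrow> W \<in> \<SS> \<Longrightarrow> orth V W \<Longrightarrow> \<not> V \<preceq> W \<and> \<not> W \<preceq> V"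
    and orth_nest:
      "V \<in> \<SS> \<Longrightarrow> W \<in> \<SS> \<Longrightarrow> U \<in> \<SS> \<Longrightarrow> V \<preceq> W \<Longrightarrow> orth W U \<Longrightarrow> orth V U"
    \<comment> \<open>Transversality\<close>
    and rho_transverse:
      "V \<in> \<SS> \<Longrightarrow> W \<in> \<SS> \<Longrightarrow> \<not> orth V W \<Longrightarrow> \<not> V \<preceq> W \<Longrightarrow> \<not> W \<preceq> V \<Longrightarrow>
        \<rho> V W \<noteq> {} \<and> \<rho> V W \<subseteq> mspace (C W) \<and> diam_le (C W) (\<rho> V W) E"
begin

definition strictly_nested :: "'i \<Rightarrow> 'i \<Rightarrow> bool"  (infix \<open>\<prec>\<close> 50) where
  "V \<prec> W \<longleftrightarrow> V \<preceq> W \<and> V \<noteq> W"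

definition transverse :: "'i \<Rightarrow> 'i \<Rightarrow> bool" where
  "transverse V W \<longleftrightarrow> \<not> orth V W \<and> \<not> V \<preceq> W \<and> \<not> W \<preceq> V"

definition below :: "'i \<Rightarrow> 'i set" where
  "below W = {V \<in> \<SS>. V \<preceq> W}"

definition orthogonal_to :: "'i \<Rightarrow> 'i set" where
  "orthogonal_to W = {V \<in> \<SS>. orth V W}"

definition proj_dist :: "'i \<Rightarrow> 'x \<Rightarrow> 'x \<Rightarrow> real" where
  "proj_dist W x y = set_dist (C W) (\<pi> W x) (\<pi> W y)"

end

locale hhs_structure = proto_hierarchy_structure +
  assumes hyperbolicity: "W \<in> \<SS> \<Longrightarrow> hyperbolic (C W) E"
    and finite_complexity:
      "A \<subseteq> \<SS> \<Longrightarrow> (\<forall>V\<in>A. \<forall>W\<in>A. V \<preceq> W \<or> W \<preceq> V) \<Longrightarrow> finite A \<and> real (card A) \<le> E"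
    and containers:
      "W \<in> \<SS> \<Longrightarrow> U \<in> below W \<Longrightarrow> below W \<inter> orthogonal_to U \<noteq> {} \<Longrightarrow>
        \<exists>Q\<in>below W. \<forall>V\<in>below W \<inter> orthogonal_to U. V \<preceq> Q"
    and uniqueness:
      "\<exists>\<theta> :: real \<Rightarrow> real. (\<forall>r\<ge>0. 0 \<le> \<theta> r) \<and>
        (\<forall>r\<ge>0. \<forall>x\<in>mspace X. \<forall>y\<in>mspace X. \<theta> r \<le> mdist X x y \<longrightarrow>
          (\<exists>W\<in>\<SS>. r \<le> proj_dist W x y))"
    and bounded_geodesic_image:
      "V \<in> \<SS> \<Longrightarrow> W \<in> \<SS> \<Longrightarrow> V \<prec> W \<Longrightarrow> x \<in> mspace X \<Longrightarrow> y \<in> mspace X \<Longrightarrow>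
        E \<le> proj_dist V x y \<Longrightarrow> a \<in> \<pi> W x \<Longrightarrow> b \<in> \<pi> W y \<Longrightarrow> geodesic_segment (C W) a b P \<Longrightarrow>
        P \<inter> nbhd (C W) E (\<rho> V W) \<noteq> {}"
    and large_links:
      "W \<in> \<SS> \<Longrightarrow> x \<in> mspace X \<Longrightarrow> y \<in> mspace X \<Longrightarrow>
        \<exists>\<V>. finite \<V> \<and> \<V> \<subseteq> below W - {W} \<and> real (card \<V>) \<le> E * proj_dist W x y + E \<and>
          (\<forall>U\<in>below W - {W}. (\<exists>V\<in>\<V>. U \<preceq> V) \<or> proj_dist U x y \<le> E)"
    and consistency:
      "V \<in> \<SS> \<Longrightarrow> W \<in> \<SS> \<Longrightarrow> transverse V W \<Longrightarrow> x \<in> mspace X \<Longrightarrow>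
        min (set_dist (C W) (\<pi> W x) (\<rho> V W)) (set_dist (C V) (\<pi> V x) (\<rho> W V)) \<le> E"
    and rho_consistency:
      "U \<in> \<SS> \<Longrightarrow> V \<in> \<SS> \<Longrightarrow> W \<in> \<SS> \<Longrightarrow> U \<preceq> V \<Longrightarrow>
        V \<prec> W \<or> (transverse V W \<and> \<not> orth W U) \<Longrightarrow>
        set_dist (C W) (\<rho> U W) (\<rho> V W) \<le> E"
    and partial_realisation:
      "finite \<V> \<Longrightarrow> \<V> \<subseteq> \<SS> \<Longrightarrow> pairwise orth \<V> \<Longrightarrow> (\<forall>V\<in>\<V>. p V \<in> mspace (C V)) \<Longrightarrow>
        \<exists>x\<in>mspace X.
          (\<forall>V\<in>\<V>. set_dist (C V) (\<pi> V x) {p V} \<le> E) \<and>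
          (\<forall>V\<in>\<V>. \<forall>W\<in>\<SS>. V \<prec> W \<or> transverse W V \<longrightarrow>
             set_dist (C W) (\<pi> W x) (\<rho> V W) \<le> E)"


section \<open>Cayley graphs\<close>

text \<open>
  Geometric realisation of a simplicial graph with vertex set \<open>V\<close> and (symmetric, irreflexive)
  adjacency relation \<open>R\<close>: points are given by their barycentric coordinates, so vertices are
  indicator functions and edges are isometric to the unit interval. A shortest path between two
  points either stays inside a closed edge containing both of them, or it leaves their edges
  through a vertex \<open>a\<close> (at distance \<open>1 - p a\<close> from \<open>p\<close>) and a vertex \<open>b\<close>.
\<close>

definition vertex_dist :: "('a \<times> 'a) set \<Rightarrow> 'a \<Rightarrow> 'a \<Rightarrow> nat" where
  "vertex_dist R a b = (LEAST n. (a, b) \<in> R ^^ n)"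

definition realisation_points :: "'a set \<Rightarrow> ('a \<times> 'a) set \<Rightarrow> ('a \<Rightarrow> real) set" where
  "realisation_points V R =
     {p. (\<forall>v. 0 \<le> p v) \<and>
         (\<exists>a\<in>V. \<exists>b\<in>V. (a = b \<or> (a, b) \<in> R) \<and> {v. p v \<noteq> 0} \<subseteq> {a, b} \<and> (\<Sum>v\<in>{a, b}. p v) = 1)}"

definition path_lengths :: "('a \<times> 'a) set \<Rightarrow> ('a \<Rightarrow> real) \<Rightarrow> ('a \<Rightarrow> real) \<Rightarrow> real set" where
  "path_lengths R p q =
     {\<bar>p a - q a\<bar> | a b. (a = b \<or> (a, b) \<in> R) \<and> {v. p v \<noteq> 0} \<union> {v. q v \<noteq> 0} \<subseteq> {a, b}} \<union>
     {(1 - p a) + real (vertex_dist R a b) + (1 - q b) | a b. p a \<noteq> 0 \<and> q b \<noteq> 0}"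

text \<open>Distances are set to 0 outside the space, as \<^locale>\<open>Metric_space\<close> demands symmetry and
  nonnegativity for arbitrary elements of the type.\<close>

definition realisation_dist ::
    "'a set \<Rightarrow> ('a \<times> 'a) set \<Rightarrow> ('a \<Rightarrow> real) \<Rightarrow> ('a \<Rightarrow> real) \<Rightarrow> real" where
  "realisation_dist V R p q =
     (if p \<in> realisation_points V R \<and> q \<in> realisation_points V R then Inf (path_lengths R p q) else 0)"

definition graph_realisation :: "'a set \<Rightarrow> ('a \<times> 'a) set \<Rightarrow> ('a \<Rightarrow> real) metric" where
  "graph_realisation V R = metric (realisation_points V R, realisation_dist V R)"

definition cayley_edges :: "('a, 'b) monoid_scheme \<Rightarrow> 'a set \<Rightarrow> ('a \<times> 'a) set" where
  "cayley_edges G T =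
     {(g, g \<otimes>\<^bsub>G\<^esub> s) | g s. g \<in> carrier G \<and> (s \<in> T \<or> inv\<^bsub>G\<^esub> s \<in> T) \<and> s \<in> carrier G \<and> s \<noteq> \<one>\<^bsub>G\<^esub>}"

definition cayley_graph :: "('a, 'b) monoid_scheme \<Rightarrow> 'a set \<Rightarrow> ('a \<Rightarrow> real) metric" where
  "cayley_graph G T = graph_realisation (carrier G) (cayley_edges G T)"

text \<open>The action on the Cayley graph extending left multiplication on the vertices.\<close>

definition cayley_act :: "('a, 'b) monoid_scheme \<Rightarrow> 'a \<Rightarrow> ('a \<Rightarrow> real) \<Rightarrow> ('a \<Rightarrow> real)" where
  "cayley_act G g p = (\<lambda>h. if h \<in> carrier G then p (inv\<^bsub>G\<^esub> g \<otimes>\<^bsub>G\<^esub> h) else 0)"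


section \<open>Hierarchically hyperbolic groups\<close>

text \<open>
  In \<open>equivariant_hhs_structure\<close>, \<open>act g\<close> is the action of \<open>g\<close> on the index set and \<open>tr g W\<close> is
  the isometry \<open>g\<^sub>W\<close> from \<open>C W\<close> to \<open>C (g W)\<close>.
\<close>

locale equivariant_hhs_structure =
  hhs_structure "cayley_graph G T" E \<SS> C \<pi> nest orth \<rho> + group_action G \<SS> act
  for G :: "('a, 'b) monoid_scheme"
    and T :: "'a set"
    and E :: real
    and \<SS> :: "'i set"
    and C :: "'i \<Rightarrow> 'p metric"
    and \<pi> :: "'i \<Rightarrow> ('a \<Rightarrow> real) \<Rightarrow> 'p set"
    and nest :: "'i \<Rightarrow> 'i \<Rightarrow> bool"  (infix \<open>\<preceq>\<close> 50)
    and orth :: "'i \<Rightarrow> 'i \<Rightarrow> bool"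
    and \<rho> :: "'i \<Rightarrow> 'i \<Rightarrow> 'p set"
    and act :: "'a \<Rightarrow> 'i \<Rightarrow> 'i"
    and tr :: "'a \<Rightarrow> 'i \<Rightarrow> 'p \<Rightarrow> 'p" +
  assumes act_nest:
      "g \<in> carrier G \<Longrightarrow> V \<in> \<SS> \<Longrightarrow> W \<in> \<SS> \<Longrightarrow> act g V \<preceq> act g W \<longleftrightarrow> V \<preceq> W"
    and act_orth:
      "g \<in> carrier G \<Longrightarrow> V \<in> \<SS> \<Longrightarrow> W \<in> \<SS> \<Longrightarrow> orth (act g V) (act g W) \<longleftrightarrow> orth V W"
    and act_transverse:
      "g \<in> carrier G \<Longrightarrow> V \<in> \<SS> \<Longrightarrow> W \<in> \<SS> \<Longrightarrow> transverse (act g V) (act g W) \<longleftrightarrow> transverse V W"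
    and finitely_many_orbits: "finite (orbits G \<SS> act)"
    and tr_isometry:
      "g \<in> carrier G \<Longrightarrow> W \<in> \<SS> \<Longrightarrow> isometry_onto (C W) (C (act g W)) (tr g W)"
    and tr_mult:
      "g \<in> carrier G \<Longrightarrow> h \<in> carrier G \<Longrightarrow> W \<in> \<SS> \<Longrightarrow> c \<in> mspace (C W) \<Longrightarrow>
        tr (g \<otimes>\<^bsub>G\<^esub> h) W c = tr g (act h W) (tr h W c)"
    and tr_proj:
      "g \<in> carrier G \<Longrightarrow> W \<in> \<SS> \<Longrightarrow> x \<in> mspace (cayley_graph G T) \<Longrightarrow>
        set_dist (C (act g W)) (tr g W ` \<pi> W x) (\<pi> (act g W) (cayley_act G g x)) \<le> E"
    and tr_rho:
      "g \<in> carrier G \<Longrightarrow> V \<in> \<SS> \<Longrightarrow> W \<in> \<SS> \<Longrightarrow> transverse V W \<or> V \<prec> W \<Longrightarrow>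
        set_dist (C (act g W)) (tr g W ` \<rho> V W) (\<rho> (act g V) (act g W)) \<le> E"

text \<open>
  The definition does not restrict the sets from which the index set and the points of the
  hyperbolic spaces are drawn. As HOL cannot quantify over types inside a formula, the two types
  are parameters of the predicate. An implication ``if there are types \<open>'i, 'p\<close> with \<open>P\<close>, then
  there are types with \<open>Q\<close>'' is stated with arbitrary \<open>'i\<close>, \<open>'p\<close> in the premise and with explicit
  types, built from \<open>'i\<close> and \<open>'p\<close>, in the conclusion.
\<close>

definition hierarchically_hyperbolic_group ::
    "'i itself \<Rightarrow> 'p itself \<Rightarrow> ('a, 'b) monoid_scheme \<Rightarrow> bool" where
  "hierarchically_hyperbolic_group _ _ G \<longleftrightarrow>
     group G \<and>
     (\<exists>T. finite T \<and> T \<subseteq> carrier G \<and> generate G T = carrier G \<and>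
       (\<exists>E (\<SS> :: 'i set) (C :: 'i \<Rightarrow> 'p metric) \<pi> nest orth \<rho> act tr.
          equivariant_hhs_structure G T E \<SS> C \<pi> nest orth \<rho> act tr))"


section \<open>Graph products\<close>

definition simplicial_graph :: "'v set \<Rightarrow> 'v set set \<Rightarrow> bool" where
  "simplicial_graph V E \<longleftrightarrow> (\<forall>e\<in>E. e \<subseteq> V \<and> card e = 2)"

text \<open>
  The free product consists of the words in the (disjoint union of the) groups \<open>G v\<close>, modulo
  deletion of identity letters and multiplication of adjacent letters from the same group.
\<close>

definition fp_words :: "'v set \<Rightarrow> ('v \<Rightarrow> ('a, 'b) monoid_scheme) \<Rightarrow> ('v \<times> 'a) list set" where
  "fp_words V G = lists (SIGMA v:V. carrier (G v))"

inductive_set fp_step ::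
    "'v set \<Rightarrow> ('v \<Rightarrow> ('a, 'b) monoid_scheme) \<Rightarrow> (('v \<times> 'a) list \<times> ('v \<times> 'a) list) set"
  for V :: "'v set" and G :: "'v \<Rightarrow> ('a, 'b) monoid_scheme" where
  delete_one: "u \<in> fp_words V G \<Longrightarrow> w \<in> fp_words V G \<Longrightarrow> v \<in> V \<Longrightarrow>
    (u @ [(v, \<one>\<^bsub>G v\<^esub>)] @ w, u @ w) \<in> fp_step V G"
| multiply: "u \<in> fp_words V G \<Longrightarrow> w \<in> fp_words V G \<Longrightarrow> v \<in> V \<Longrightarrow>
    g \<in> carrier (G v) \<Longrightarrow> h \<in> carrier (G v) \<Longrightarrow>
    (u @ [(v, g), (v, h)] @ w, u @ [(v, g \<otimes>\<^bsub>G v\<^esub> h)] @ w) \<in> fp_step V G"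

definition fp_rel ::
    "'v set \<Rightarrow> ('v \<Rightarrow> ('a, 'b) monoid_scheme) \<Rightarrow> (('v \<times> 'a) list \<times> ('v \<times> 'a) list) set" where
  "fp_rel V G = (fp_step V G \<union> (fp_step V G)\<inverse>)\<^sup>* \<inter> fp_words V G \<times> fp_words V G"

definition free_product ::
    "'v set \<Rightarrow> ('v \<Rightarrow> ('a, 'b) monoid_scheme) \<Rightarrow> ('v \<times> 'a) list set monoid" where
  "free_product V G =
     \<lparr>carrier = fp_words V G // fp_rel V G,
      mult = (\<lambda>A B. \<Union>u\<in>A. \<Union>w\<in>B. fp_rel V G `` {u @ w}),
      one = fp_rel V G `` {[]}\<rparr>"

definition fp_incl ::
    "'v set \<Rightarrow> ('v \<Rightarrow> ('a, 'b) monoid_scheme) \<Rightarrow> 'v \<Rightarrow> 'a \<Rightarrow> ('v \<times> 'a) list set" where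
  "fp_incl V G v g = fp_rel V G `` {[(v, g)]}"

definition commutator :: "('a, 'b) monoid_scheme \<Rightarrow> 'a \<Rightarrow> 'a \<Rightarrow> 'a" where
  "commutator G a b = a \<otimes>\<^bsub>G\<^esub> b \<otimes>\<^bsub>G\<^esub> inv\<^bsub>G\<^esub> a \<otimes>\<^bsub>G\<^esub> inv\<^bsub>G\<^esub> b"

definition normal_closure :: "('a, 'b) monoid_scheme \<Rightarrow> 'a set \<Rightarrow> 'a set" where
  "normal_closure G A = \<Inter> {N. N \<lhd> G \<and> A \<subseteq> N}"

definition graph_product ::
    "'v set \<Rightarrow> 'v set set \<Rightarrow> ('v \<Rightarrow> ('a, 'b) monoid_scheme) \<Rightarrow> ('v \<times> 'a) list set set monoid" where
  "graph_product V E G =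
     free_product V G Mod normal_closure (free_product V G)
       {commutator (free_product V G) (fp_incl V G v g) (fp_incl V G w h) | v w g h.
          {v, w} \<in> E \<and> g \<in> carrier (G v) \<and> h \<in> carrier (G w)}"


section \<open>Graph products are groups\<close>

lemma fp_step_words: "(u, w) \<in> fp_step V G \<Longrightarrow> (\<And>v. v \<in> V \<Longrightarrow> group (G v)) \<Longrightarrow> u \<in> fp_words V G \<and> w \<in> fp_words V G"
proof (induction rule: fp_step.induct)
  case (delete_one u w v)
  then show ?case by (auto simp: fp_words_def group.is_monoid monoid.one_closed)
next
  case (multiply u w v g h)
  then show ?case by (auto simp: fp_words_def group.is_monoid monoid.m_closed)
qed

lemma fp_step_context:
  assumes "(u, w) \<in> fp_step V G" "x \<in> fp_words V G" "y \<in> fp_words V G"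
  shows "(x @ u @ y, x @ w @ y) \<in> fp_step V G"
  using assms(1)
proof cases
  case (delete_one u w v)
  then show ?thesis
    using fp_step.delete_one[of "x @ u" V G "w @ y" v] assms by (auto simp: fp_words_def)
next
  case (multiply u w v g h)
  then show ?thesis
    using fp_step.multiply[of "x @ u" V G "w @ y" v g h] assms by (auto simp: fp_words_def)
qed

lemma fp_words_append: "u \<in> fp_words V G \<Longrightarrow> w \<in> fp_words V G \<Longrightarrow> u @ w \<in> fp_words V G"
  by (simp add: fp_words_def)

lemma equiv_fp_rel: "equiv (fp_words V G) (fp_rel V G)"
proof -
  let ?R = "fp_step V G \<union> (fp_step V G)\<inverse>"
  have "sym (?R\<^sup>*)" by (rule sym_rtrancl) (simp add: sym_Un_converse)
  then show ?thesis
    unfolding fp_rel_def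
    by (intro equivI) (auto simp: refl_on_def sym_def intro!: transI intro: rtrancl_trans)
qed

lemma fp_rel_context:
  assumes "(u, w) \<in> fp_rel V G" "x \<in> fp_words V G" "y \<in> fp_words V G"
  shows "(x @ u @ y, x @ w @ y) \<in> fp_rel V G"
proof -
  let ?R = "fp_step V G \<union> (fp_step V G)\<inverse>"
  have "(u, w) \<in> ?R\<^sup>*" using assms(1) by (simp add: fp_rel_def)
  then have "(x @ u @ y, x @ w @ y) \<in> ?R\<^sup>*"
  proof (induction rule: rtrancl_induct)
    case (step v w)
    then have "(x @ v @ y, x @ w @ y) \<in> ?R"
      using fp_step_context[OF _ assms(2,3)] by auto
    with step.IH show ?case by (rule rtrancl_into_rtrancl)
  qed simp
  with assms show ?thesis by (simp add: fp_rel_def fp_words_append)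
qed

lemma fp_rel_append:
  assumes "(u, u') \<in> fp_rel V G" "(w, w') \<in> fp_rel V G"
  shows "(u @ w, u' @ w') \<in> fp_rel V G"
proof -
  have words: "u \<in> fp_words V G" "u' \<in> fp_words V G" "w \<in> fp_words V G" "w' \<in> fp_words V G"
    using assms by (auto simp: fp_rel_def)
  have "(u @ w, u' @ w) \<in> fp_rel V G"
    using fp_rel_context[OF assms(1), of "[]" w] words by (simp add: fp_words_def)
  moreover have "(u' @ w, u' @ w') \<in> fp_rel V G"
    using fp_rel_context[OF assms(2), of u' "[]"] words by (simp add: fp_words_def)
  ultimately show ?thesis
    using equiv_fp_rel[of V G] by (meson equivE transE)
qed

lemma free_product_mult:
  assumes "u \<in> fp_words V G" "w \<in> fp_words V G"
  shows "fp_rel V G `` {u} \<otimes>\<^bsub>free_product V G\<^esub> fp_rel V G `` {w} = fp_rel V G `` {u @ w}"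
proof -
  let ?A = "fp_rel V G `` {u}" and ?B = "fp_rel V G `` {w}"
  have eq: "fp_rel V G `` {u' @ w'} = fp_rel V G `` {u @ w}" if "u' \<in> ?A" "w' \<in> ?B" for u' w'
  proof -
    have "(u @ w, u' @ w') \<in> fp_rel V G" using that by (intro fp_rel_append) simp_all
    then show ?thesis by (rule equiv_class_eq[OF equiv_fp_rel, symmetric])
  qed
  have mem: "u \<in> ?A" "w \<in> ?B"
    using equiv_class_self[OF equiv_fp_rel] assms by blast+
  have "(\<Union>u'\<in>?A. \<Union>w'\<in>?B. fp_rel V G `` {u' @ w'}) = fp_rel V G `` {u @ w}"
  proof
    show "(\<Union>u'\<in>?A. \<Union>w'\<in>?B. fp_rel V G `` {u' @ w'}) \<subseteq> fp_rel V G `` {u @ w}"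
      by (intro UN_least) (simp only: eq order_refl)
    show "fp_rel V G `` {u @ w} \<subseteq> (\<Union>u'\<in>?A. \<Union>w'\<in>?B. fp_rel V G `` {u' @ w'})"
      using mem by blast
  qed
  then show ?thesis by (simp add: free_product_def)
qed

lemma fp_word_inverse:
  assumes "u \<in> fp_words V G" and grp: "\<And>v. v \<in> V \<Longrightarrow> group (G v)"
  shows "\<exists>w\<in>fp_words V G. (w @ u, []) \<in> fp_rel V G"
  using assms(1)
proof (induction u rule: rev_induct)
  case Nil
  then show ?case by (intro bexI[of _ "[]"]) (auto simp: fp_rel_def fp_words_def)
next
  case (snoc s u)
  obtain v g where s: "s = (v, g)" by (cases s)
  have v: "v \<in> V" and g: "g \<in> carrier (G v)" and u: "u \<in> fp_words V G"
    using snoc.prems s by (auto simp: fp_words_def)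
  interpret group "G v" by (rule grp[OF v])
  obtain w where w: "w \<in> fp_words V G" "(w @ u, []) \<in> fp_rel V G"
    using snoc.IH u by blast
  define i where "i = inv\<^bsub>G v\<^esub> g"
  have i: "i \<in> carrier (G v)" and ig: "i \<otimes>\<^bsub>G v\<^esub> g = \<one>\<^bsub>G v\<^esub>"
    using g by (auto simp: i_def)
  have wi: "[(v, i)] \<in> fp_words V G" "[(v, g)] \<in> fp_words V G"
    using v i g by (auto simp: fp_words_def)
  have "([(v, i)] @ (w @ u) @ [(v, g)], [(v, i)] @ [] @ [(v, g)]) \<in> fp_rel V G"
    by (rule fp_rel_context[OF w(2) wi])
  moreover have "([(v, i), (v, g)], []) \<in> fp_rel V G"
  proof -
    have "([(v, i), (v, g)], [(v, \<one>\<^bsub>G v\<^esub>)]) \<in> fp_step V G"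
      using fp_step.multiply[of "[]" V G "[]" v i g] v i g ig by (simp add: fp_words_def)
    moreover have "([(v, \<one>\<^bsub>G v\<^esub>)], []) \<in> fp_step V G"
      using fp_step.delete_one[of "[]" V G "[]" v] v by (simp add: fp_words_def)
    ultimately show ?thesis
      using v i g by (auto simp: fp_rel_def fp_words_def intro: rtrancl_trans)
  qed
  ultimately have "(([(v, i)] @ w) @ u @ [s], []) \<in> fp_rel V G"
    using equiv_fp_rel[of V G] s by (auto elim!: equivE dest: transD)
  moreover have "[(v, i)] @ w \<in> fp_words V G" using fp_words_append wi(1) w(1) by blast
  ultimately show ?case by blast
qed

lemma group_free_product:
  assumes "\<And>v. v \<in> V \<Longrightarrow> group (G v)"
  shows "group (free_product V G)"
proof (rule groupI)
  let ?F = "free_product V G"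
  have carrierE: "\<exists>u\<in>fp_words V G. x = fp_rel V G `` {u}" if "x \<in> carrier ?F" for x
    using that by (auto simp: free_product_def quotient_def)
  have carrierI: "fp_rel V G `` {u} \<in> carrier ?F" if "u \<in> fp_words V G" for u
    using that by (auto simp: free_product_def quotient_def)
  have one: "\<one>\<^bsub>?F\<^esub> = fp_rel V G `` {[]}" and nil: "[] \<in> fp_words V G"
    by (auto simp: free_product_def fp_words_def)
  show "x \<otimes>\<^bsub>?F\<^esub> y \<in> carrier ?F" if "x \<in> carrier ?F" "y \<in> carrier ?F" for x y
    using carrierE[OF that(1)] carrierE[OF that(2)]
    by (metis carrierI free_product_mult fp_words_append)
  show "\<one>\<^bsub>?F\<^esub> \<in> carrier ?F" using one nil by (simp add: carrierI)
  show "x \<otimes>\<^bsub>?F\<^esub> y \<otimes>\<^bsub>?F\<^esub> z = x \<otimes>\<^bsub>?F\<^esub> (y \<otimes>\<^bsub>?F\<^esub> z)"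
    if "x \<in> carrier ?F" "y \<in> carrier ?F" "z \<in> carrier ?F" for x y z
    using carrierE[OF that(1)] carrierE[OF that(2)] carrierE[OF that(3)]
    by (auto simp: free_product_mult fp_words_append)
  show "\<one>\<^bsub>?F\<^esub> \<otimes>\<^bsub>?F\<^esub> x = x" if "x \<in> carrier ?F" for x
    using carrierE[OF that] one nil by (auto simp: free_product_mult)
  show "\<exists>y\<in>carrier ?F. y \<otimes>\<^bsub>?F\<^esub> x = \<one>\<^bsub>?F\<^esub>" if x: "x \<in> carrier ?F" for x
  proof -
    obtain u where u: "u \<in> fp_words V G" "x = fp_rel V G `` {u}" using carrierE[OF x] by blast
    obtain w where w: "w \<in> fp_words V G" "(w @ u, []) \<in> fp_rel V G"
      using fp_word_inverse[OF u(1) assms] by blast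
    have "fp_rel V G `` {w} \<otimes>\<^bsub>?F\<^esub> x = \<one>\<^bsub>?F\<^esub>"
      using u w equiv_class_eq[OF equiv_fp_rel w(2)] by (simp add: free_product_mult one)
    then show ?thesis using carrierI[OF w(1)] by blast
  qed
qed

lemma normal_normal_closure:
  assumes "group G" and "A \<subseteq> carrier G"
  shows "normal_closure G A \<lhd> G"
proof -
  interpret group G by (rule assms(1))
  let ?N = "{N. N \<lhd> G \<and> A \<subseteq> N}"
  have "carrier G \<in> ?N"
    using assms(2) by (auto simp: normal_inv_iff subgroup_self)
  then have ne: "?N \<noteq> {}" by blast
  have "subgroup (\<Inter> ?N) G"
    by (rule subgroups_Inter[OF _ ne]) (auto simp: normal_inv_iff)
  then show ?thesis
    unfolding normal_closure_def normal_inv_iff by (auto simp: normal_inv_iff)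
qed

lemma fp_incl_carrier: "v \<in> V \<Longrightarrow> g \<in> carrier (G v) \<Longrightarrow> fp_incl V G v g \<in> carrier (free_product V G)"
  by (auto simp: fp_incl_def free_product_def quotient_def fp_words_def)

lemma group_graph_product:
  assumes "simplicial_graph V E" and "\<And>v. v \<in> V \<Longrightarrow> group (G v)"
  shows "group (graph_product V E G)"
proof -
  interpret group "free_product V G" by (rule group_free_product[OF assms(2)])
  have "v \<in> V \<and> w \<in> V" if "{v, w} \<in> E" for v w
    using assms(1) that by (auto simp: simplicial_graph_def)
  then show ?thesis
    unfolding graph_product_def
    by (intro normal.factorgroup_is_group normal_normal_closure is_group)
       (auto simp: commutator_def intro!: m_closed inv_closed fp_incl_carrier)
qed


section \<open>The realisation of a connected graph is a metric space\<close>

locale connected_graph =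
  fixes V :: "'a set" and R :: "('a \<times> 'a) set"
  assumes sub: "R \<subseteq> V \<times> V" and symR: "sym R"
    and conn: "a \<in> V \<Longrightarrow> b \<in> V \<Longrightarrow> (a, b) \<in> R\<^sup>*"
begin

lemma relpow_sym: "(a, b) \<in> R ^^ n \<Longrightarrow> (b, a) \<in> R ^^ n"
proof (induction n arbitrary: b)
  case (Suc n)
  then obtain c where "(a, c) \<in> R ^^ n" "(c, b) \<in> R" by auto
  with Suc.IH symR have "(b, c) \<in> R" "(c, a) \<in> R ^^ n" by (auto simp: sym_def)
  then show ?case by (rule relpow_Suc_I2)
qed simp

lemma vertex_dist_path: "a \<in> V \<Longrightarrow> b \<in> V \<Longrightarrow> (a, b) \<in> R ^^ vertex_dist R a b"
  unfolding vertex_dist_def by (rule LeastI_ex) (metis conn rtrancl_imp_relpow)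

lemma vertex_dist_le: "(a, b) \<in> R ^^ n \<Longrightarrow> vertex_dist R a b \<le> n"
  unfolding vertex_dist_def by (rule Least_le)

lemma vertex_dist_self [simp]: "vertex_dist R a a = 0"
  using vertex_dist_le[of a a 0] by simp

lemma vertex_dist_sym: "a \<in> V \<Longrightarrow> b \<in> V \<Longrightarrow> vertex_dist R a b = vertex_dist R b a"
  by (meson antisym relpow_sym vertex_dist_le vertex_dist_path)

lemma vertex_dist_triangle:
  "a \<in> V \<Longrightarrow> b \<in> V \<Longrightarrow> c \<in> V \<Longrightarrow> vertex_dist R a c \<le> vertex_dist R a b + vertex_dist R b c"
  by (meson relpow_trans vertex_dist_le vertex_dist_path)

lemma vertex_dist_0: "a \<in> V \<Longrightarrow> b \<in> V \<Longrightarrow> vertex_dist R a b = 0 \<Longrightarrow> a = b"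
  using vertex_dist_path[of a b] by simp

lemma vertex_dist_edge: "(a, b) \<in> R \<Longrightarrow> vertex_dist R a b \<le> 1"
  by (rule vertex_dist_le) simp

abbreviation "Pts \<equiv> realisation_points V R"
abbreviation "supp p \<equiv> {v. p v \<noteq> (0::real)}"

definition "adj a b \<longleftrightarrow> a \<in> V \<and> b \<in> V \<and> (a = b \<or> (a, b) \<in> R)"

lemma adj_sym: "adj a b \<Longrightarrow> adj b a"
  using symR by (auto simp: adj_def sym_def)

lemma ptE:
  assumes "p \<in> Pts"
  obtains a b where "adj a b" "supp p \<subseteq> {a, b}" "p a \<noteq> 0" "a = b \<Longrightarrow> p a = 1"
    "a \<noteq> b \<Longrightarrow> p a + p b = 1" "\<And>v. 0 \<le> p v"
proof -
  obtain a b where ab: "adj a b" "supp p \<subseteq> {a, b}" "(\<Sum>v\<in>{a, b}. p v) = 1" "\<And>v. 0 \<le> p v"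
    using assms by (auto simp: realisation_points_def adj_def)
  show ?thesis
  proof (cases "p a = 0")
    case True
    with ab have "p b = 1" "a \<noteq> b" by (cases "a = b"; simp)+
    with ab True show ?thesis by (intro that[of b b]) (auto simp: adj_def)
  next
    case False
    with ab show ?thesis by (intro that[of a b]) (auto)
  qed
qed

lemma pt_edge:
  assumes "p \<in> Pts" "supp p \<subseteq> {a, b}"
  shows "a \<noteq> b \<Longrightarrow> p a + p b = 1" "a = b \<Longrightarrow> p a = 1"
proof -
  obtain c d where cd: "supp p \<subseteq> {c, d}" "(\<Sum>v\<in>{c, d}. p v) = 1"
    using assms(1) by (auto simp: realisation_points_def)
  have "sum p {a, b} = sum p (supp p)" "sum p {c, d} = sum p (supp p)"
    using assms(2) cd(1) by (auto intro!: sum.mono_neutral_right)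
  with cd have *: "sum p {a, b} = 1" by simp
  show "a \<noteq> b \<Longrightarrow> p a + p b = 1" "a = b \<Longrightarrow> p a = 1" using * by auto
qed

lemma pt_bounds: assumes "p \<in> Pts" shows "0 \<le> p v" "p v \<le> 1"
proof -
  obtain a b where ab: "supp p \<subseteq> {a, b}" "a = b \<Longrightarrow> p a = 1" "a \<noteq> b \<Longrightarrow> p a + p b = 1" 
    "\<And>v. 0 \<le> p v" using assms by (rule ptE) blast
  show "0 \<le> p v" by (rule ab)
  show "p v \<le> 1"
  proof (cases "p v = 0")
    case False
    then have "v \<in> {a, b}" using ab(1) by auto
    then show ?thesis using ab(2,3) ab(4)[of a] ab(4)[of b] by (cases "a = b") auto
  qed simp
qed

lemma supp_V: "p \<in> Pts \<Longrightarrow> p v \<noteq> 0 \<Longrightarrow> v \<in> V"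
  by (auto elim!: ptE simp: adj_def)

lemma supp_two:
  assumes "p \<in> Pts" "p a \<noteq> 0" "p b \<noteq> 0"
  shows "real (vertex_dist R a b) \<le> (1 - p a) + (1 - p b)"
proof -
  obtain c d where cd: "adj c d" "supp p \<subseteq> {c, d}" "c = d \<Longrightarrow> p c = 1" "c \<noteq> d \<Longrightarrow> p c + p d = 1"
    using assms(1) by (rule ptE) blast
  show ?thesis
  proof (cases "a = b")
    case True
    then show ?thesis using pt_bounds(2)[OF assms(1), of a] by simp
  next
    case False
    with assms cd have "{a, b} = {c, d}" by auto
    then have "p a + p b = 1" "(a, b) \<in> R"
      using cd False symR by (auto simp: adj_def doubleton_eq_iff sym_def)
    then show ?thesis using vertex_dist_edge[of a b] by simp
  qed
qed

lemma paths_ne: "p \<in> Pts \<Longrightarrow> q \<in> Pts \<Longrightarrow> path_lengths R p q \<noteq> {}"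
  unfolding path_lengths_def by (auto elim!: ptE)

lemma paths_nonneg:
  assumes "p \<in> Pts" "q \<in> Pts" "x \<in> path_lengths R p q" shows "0 \<le> x"
proof -
  have "0 \<le> (1 - p a) + real (vertex_dist R a b) + (1 - q b)" for a b
    using pt_bounds(2)[OF assms(1), of a] pt_bounds(2)[OF assms(2), of b] by simp
  then show ?thesis using assms(3) unfolding path_lengths_def by auto
qed

lemma bdd: "p \<in> Pts \<Longrightarrow> q \<in> Pts \<Longrightarrow> bdd_below (path_lengths R p q)"
  by (meson bdd_belowI paths_nonneg)

lemma supp_finite: "p \<in> Pts \<Longrightarrow> finite (supp p)"
  by (erule ptE) (auto intro: finite_subset)

lemma paths_sym: assumes "p \<in> Pts" "q \<in> Pts" shows "path_lengths R p q = path_lengths R q p"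
proof -
  have "path_lengths R p q \<subseteq> path_lengths R q p" if "p \<in> Pts" "q \<in> Pts" for p q
  proof
    fix x assume "x \<in> path_lengths R p q"
    then consider a b where "x = \<bar>p a - q a\<bar>" "a = b \<or> (a, b) \<in> R" "supp p \<union> supp q \<subseteq> {a, b}"
      | a b where "x = (1 - p a) + real (vertex_dist R a b) + (1 - q b)" "p a \<noteq> 0" "q b \<noteq> 0"
      by (auto simp: path_lengths_def)
    then show "x \<in> path_lengths R q p"
    proof cases
      case (1 a b)
      then show ?thesis unfolding path_lengths_def
        by (intro UnI1 CollectI exI[of _ a] exI[of _ b]) auto
    next
      case (2 a b)
      then show ?thesis unfolding path_lengths_def
        using vertex_dist_sym[OF supp_V supp_V, of p a q b] that
        by (intro UnI2 CollectI exI[of _ a] exI[of _ b] exI[of _ b] exI[of _ a]) auto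
    qed
  qed
  with assms show ?thesis by blast
qed

lemma paths_triangle:
  assumes pts: "p \<in> Pts" "q \<in> Pts" "r \<in> Pts"
    and x: "x \<in> path_lengths R p q" and y: "y \<in> path_lengths R q r"
  shows "\<exists>z\<in>path_lengths R p r. z \<le> x + y"
proof -
  have mixed: "\<exists>z\<in>path_lengths R p r. z \<le> \<bar>p a - q a\<bar> + ((1 - q c) + real (vertex_dist R c d) + (1 - r d))"
    if pts: "p \<in> Pts" "q \<in> Pts" "r \<in> Pts" and ab: "a = b \<or> (a, b) \<in> R" "supp p \<union> supp q \<subseteq> {a, b}"
      and cd: "q c \<noteq> 0" "r d \<noteq> 0" for p q r a b c d
  proof -
    have c: "c \<in> {a, b}" using ab cd by auto
    have eq: "\<bar>p a - q a\<bar> = \<bar>p c - q c\<bar>"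
    proof (cases "a = b")
      case False
      then have "p a + p b = 1" "q a + q b = 1" using pt_edge(1)[OF pts(1)] pt_edge(1)[OF pts(2)] ab by auto
      then show ?thesis using c by auto
    qed (use c in auto)
    show ?thesis
    proof (cases "p c = 0")
      case False
      then have "(1 - p c) + real (vertex_dist R c d) + (1 - r d) \<in> path_lengths R p r"
        using cd unfolding path_lengths_def by blast
      then show ?thesis using eq by (intro bexI) auto
    next
      case True
      have ne: "a \<noteq> b" using True pt_edge(2)[OF pts(1), of a b] ab c by auto
      obtain e where e: "e \<in> {a, b}" "e \<noteq> c" "{a, b} = {e, c}" using ne c by (metis insert_commute insert_iff singletonD)
      have "p e = 1" using True e pt_edge(1)[OF pts(1), of e c] ab by auto
      then have z: "(1 - p e) + real (vertex_dist R e d) + (1 - r d) \<in> path_lengths R p r"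
        using cd unfolding path_lengths_def by fastforce
      have ec: "(e, c) \<in> R" using ab ne e symR by (auto simp: sym_def doubleton_eq_iff)
      have "vertex_dist R e d \<le> vertex_dist R e c + vertex_dist R c d"
        using ec sub supp_V[OF pts(3) cd(2)] by (intro vertex_dist_triangle) auto
      then have "real (vertex_dist R e d) \<le> 1 + real (vertex_dist R c d)"
        using vertex_dist_edge[OF ec] by linarith
      then show ?thesis using z \<open>p e = 1\<close> eq True pt_bounds[OF pts(2), of c] by (intro bexI[OF _ z]) auto
    qed
  qed
  consider (dd) a b c d where "x = \<bar>p a - q a\<bar>" "a = b \<or> (a, b) \<in> R" "supp p \<union> supp q \<subseteq> {a, b}"
       "y = \<bar>q c - r c\<bar>" "c = d \<or> (c, d) \<in> R" "supp q \<union> supp r \<subseteq> {c, d}"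
    | (dt) a b c d where "x = \<bar>p a - q a\<bar>" "a = b \<or> (a, b) \<in> R" "supp p \<union> supp q \<subseteq> {a, b}"
       "y = (1 - q c) + real (vertex_dist R c d) + (1 - r d)" "q c \<noteq> 0" "r d \<noteq> 0"
    | (td) a b c d where "x = (1 - p a) + real (vertex_dist R a b) + (1 - q b)" "p a \<noteq> 0" "q b \<noteq> 0"
       "y = \<bar>q c - r c\<bar>" "c = d \<or> (c, d) \<in> R" "supp q \<union> supp r \<subseteq> {c, d}"
    | (tt) a b c d where "x = (1 - p a) + real (vertex_dist R a b) + (1 - q b)" "p a \<noteq> 0" "q b \<noteq> 0"
       "y = (1 - q c) + real (vertex_dist R c d) + (1 - r d)" "q c \<noteq> 0" "r d \<noteq> 0"
    using x y unfolding path_lengths_def by blast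
  then show ?thesis
  proof cases
    case dt
    then show ?thesis using mixed[OF pts dt(2,3,5,6)] by simp
  next
    case td
    have 1: "supp r \<union> supp q \<subseteq> {c, d}" using td by auto
    obtain z where "z \<in> path_lengths R r p" "z \<le> \<bar>r c - q c\<bar> + ((1 - q b) + real (vertex_dist R b a) + (1 - p a))"
      using mixed[OF pts(3,2,1) td(5) 1 td(3,2)] by blast
    then show ?thesis using td vertex_dist_sym[OF supp_V[OF pts(1) td(2)] supp_V[OF pts(2) td(3)]]
      paths_sym[OF pts(1,3)] by (intro bexI[of _ z]) auto
  next
    case tt
    have V: "a \<in> V" "b \<in> V" "c \<in> V" "d \<in> V" using tt supp_V pts by blast+
    have "vertex_dist R a d \<le> vertex_dist R a b + (vertex_dist R b c + vertex_dist R c d)"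
      using vertex_dist_triangle[OF V(1,2,4)] vertex_dist_triangle[OF V(2,3,4)] by linarith
    moreover have "real (vertex_dist R b c) \<le> (1 - q b) + (1 - q c)"
      using supp_two[OF pts(2)] tt by blast
    moreover have "(1 - p a) + real (vertex_dist R a d) + (1 - r d) \<in> path_lengths R p r"
      using tt unfolding path_lengths_def by blast
    ultimately show ?thesis using tt by (intro bexI) auto
  next
    case dd
    show ?thesis
    proof (cases "\<exists>e. supp q = {e}")
      case True
      then obtain e where e: "supp q = {e}" by blast
      then have qe: "q e \<noteq> 0" by blast
      have qe1: "q e = 1" using pt_edge(2)[OF pts(2), of e e] e by auto
      have eab: "e \<in> {a, b}" "e \<in> {c, d}" using dd e by auto
      have x': "x = 1 - p e"
      proof (cases "a = b")
        case False
        then have "p a + p b = 1" "q a + q b = 1" using pt_edge(1)[OF pts(1)] pt_edge(1)[OF pts(2)] dd by auto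
        then show ?thesis using dd eab qe1 pt_bounds(2)[OF pts(1), of e] by auto
      qed (use dd eab qe1 pt_bounds(2)[OF pts(1), of e] in auto)
      have y': "y = 1 - r e"
      proof (cases "c = d")
        case False
        then have "r c + r d = 1" "q c + q d = 1" using pt_edge(1)[OF pts(3)] pt_edge(1)[OF pts(2)] dd by auto
        then show ?thesis using dd eab qe1 pt_bounds(2)[OF pts(3), of e] by auto
      qed (use dd eab qe1 pt_bounds(2)[OF pts(3), of e] in auto)
      have 1: "supp q \<union> supp r \<subseteq> {c, d}" "supp r \<union> supp q \<subseteq> {c, d}" using dd by auto
      show ?thesis
      proof (cases "r e = 0")
        case False
        have "\<exists>z\<in>path_lengths R p r. z \<le> \<bar>p a - q a\<bar> + ((1 - q e) + real (vertex_dist R e e) + (1 - r e))"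
          using mixed[OF pts dd(2,3) qe False] .
        then show ?thesis using dd y' qe1 by auto
      next
        case r0: True
        show ?thesis
        proof (cases "p e = 0")
          case False
          have "\<exists>z\<in>path_lengths R r p. z \<le> \<bar>r c - q c\<bar> + ((1 - q e) + real (vertex_dist R e e) + (1 - p e))"
            using mixed[OF pts(3,2,1) dd(5) 1(2) qe False] .
          then show ?thesis using dd(4) x' qe1 paths_sym[OF pts(1,3)]
            by (simp add: abs_minus_commute[of "r c"] add.commute)
        next
          case p0: True
          have ab: "a \<noteq> b" using p0 pt_edge(2)[OF pts(1), of a b] dd(3) eab by auto
          have cd: "c \<noteq> d" using r0 pt_edge(2)[OF pts(3), of c d] dd(6) eab by auto
          obtain f where f: "f \<noteq> e" "{a, b} = {f, e}" using ab eab by (metis insert_commute insert_iff singletonD)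
          obtain g where g: "g \<noteq> e" "{c, d} = {g, e}" using cd eab by (metis insert_commute insert_iff singletonD)
          have "p f = 1" using pt_edge(1)[OF pts(1), of f e] f p0 dd(3) by auto
          moreover have "r g = 1" using pt_edge(1)[OF pts(3), of g e] g r0 dd(6) by auto
          ultimately have z: "(1 - p f) + real (vertex_dist R f g) + (1 - r g) \<in> path_lengths R p r"
            unfolding path_lengths_def by fastforce
          have fe: "(f, e) \<in> R" using f dd(2) ab symR by (auto simp: sym_def doubleton_eq_iff)
          have eg: "(e, g) \<in> R" using g dd(5) cd symR by (auto simp: sym_def doubleton_eq_iff)
          have "vertex_dist R f g \<le> 2"
            using vertex_dist_le[of f g 2] fe eg by (auto simp: numeral_2_eq_2)
          then show ?thesis using z \<open>p f = 1\<close> \<open>r g = 1\<close> x' y' p0 r0 by (intro bexI[OF _ z]) auto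
        qed
      qed
    next
      case False
      have two: "u \<noteq> w \<and> supp q = {u, w}" if sub: "supp q \<subseteq> {u, w}" for u w
      proof -
        have "u \<noteq> w"
        proof
          assume "u = w"
          with sub pt_edge(2)[OF pts(2) sub] have "supp q = {u}" by auto
          with False show False by blast
        qed
        moreover have "q u \<noteq> 0"
        proof
          assume "q u = 0"
          with sub pt_edge(1)[OF pts(2) sub \<open>u \<noteq> w\<close>] have "supp q = {w}" by auto
          with False show False by blast
        qed
        moreover have "q w \<noteq> 0"
        proof
          assume "q w = 0"
          with sub pt_edge(1)[OF pts(2) sub \<open>u \<noteq> w\<close>] have "supp q = {u}" by auto
          with False show False by blast
        qed
        ultimately show ?thesis using sub by auto
      qed
      have nab: "a \<noteq> b" and ncd: "c \<noteq> d" and q: "supp q = {a, b}" "supp q = {c, d}"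
        using two[of a b] two[of c d] dd(3,6) by simp_all
      then have eq: "{a, b} = {c, d}" by simp
      have s: "q a + q b = 1" "r a + r b = 1"
        using pt_edge(1)[OF pts(2) _ nab] pt_edge(1)[OF pts(3) _ nab] q dd(6) by auto
      have "\<bar>p a - r a\<bar> \<in> path_lengths R p r"
        unfolding path_lengths_def
        by (intro UnI1 CollectI exI[of _ a] exI[of _ b] conjI refl) (use dd(2,3,6) eq in auto)
      moreover have "y = \<bar>q a - r a\<bar>" using dd(4) eq s ncd nab by (auto simp: doubleton_eq_iff)
      ultimately show ?thesis using dd(1) by (intro bexI) auto
    qed
  qed
qed

lemma path_0:
  assumes pts: "p \<in> Pts" "q \<in> Pts" and "0 \<in> path_lengths R p q" shows "p = q"
proof -
  consider a b where "p a = q a" "supp p \<union> supp q \<subseteq> {a, b}"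
    | a b where "0 = (1 - p a) + real (vertex_dist R a b) + (1 - q b)" "p a \<noteq> 0" "q b \<noteq> 0"
    using assms(3) by (auto simp: path_lengths_def)
  then show ?thesis
  proof cases
    case (1 a b)
    have sub: "supp p \<subseteq> {a, b}" "supp q \<subseteq> {a, b}" using 1(2) by simp_all
    have b: "p b = q b"
    proof (cases "a = b")
      case False
      then show ?thesis using pt_edge(1)[OF pts(1) sub(1)] pt_edge(1)[OF pts(2) sub(2)] 1(1) by simp
    qed (use 1(1) in simp)
    show ?thesis
    proof
      fix v show "p v = q v"
      proof (cases "v \<in> {a, b}")
        case False
        then have "p v = 0" "q v = 0" using sub by blast+
        then show ?thesis by simp
      qed (use 1(1) b in auto)
    qed
  next
    case (2 a b)
    have "p a = 1" "q b = 1" "vertex_dist R a b = 0"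
      using 2(1) pt_bounds(2)[OF pts(1), of a] pt_bounds(2)[OF pts(2), of b] by linarith+
    then have ab: "p a = 1" "q a = 1"
      using vertex_dist_0[OF supp_V[OF pts(1) 2(2)] supp_V[OF pts(2) 2(3)]] by simp_all
    have z: "r v = 0" if r: "r \<in> Pts" "r a = 1" "v \<noteq> a" for r v
    proof (cases "r v = 0")
      case False
      obtain c d where cd: "supp r \<subseteq> {c, d}"
        using r(1) unfolding realisation_points_def by blast
      then have "a \<in> {c, d}" "v \<in> {c, d}" using cd False r(2) by (metis (mono_tags, lifting) mem_Collect_eq subsetD zero_neq_one)+
      with that(3) have e: "{c, d} = {a, v}" by auto
      with cd have "supp r \<subseteq> {a, v}" by simp
      then show ?thesis using pt_edge(1)[OF that(1), of a v] that by simp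
    qed simp
    show ?thesis
    proof
      fix v show "p v = q v"
        using ab z[OF pts(1) ab(1)] z[OF pts(2) ab(2)] by (cases "v = a") simp_all
    qed
  qed
qed

lemma paths_finite: assumes "p \<in> Pts" "q \<in> Pts" shows "finite (path_lengths R p q)"
proof -
  have "path_lengths R p q \<subseteq> 
     (\<lambda>a. \<bar>p a - q a\<bar>) ` (supp p \<union> supp q) \<union> {0} \<union> (\<lambda>(a, b). (1 - p a) + real (vertex_dist R a b) + (1 - q b)) ` (supp p \<times> supp q)"
    unfolding path_lengths_def by (auto simp: image_iff)
  then show ?thesis by (rule finite_subset) (use supp_finite assms in auto)
qed

lemma Inf_path: assumes "p \<in> Pts" "q \<in> Pts" shows "Inf (path_lengths R p q) \<in> path_lengths R p q"
  using paths_finite[OF assms] paths_ne[OF assms] by (metis Min_in cInf_eq_Min)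

sublocale realisation: Metric_space Pts "realisation_dist V R"
proof
  show "0 \<le> realisation_dist V R p q" for p q
    unfolding realisation_dist_def using Inf_path paths_nonneg by auto
  show "realisation_dist V R p q = realisation_dist V R q p" for p q
    unfolding realisation_dist_def using paths_sym by auto
  show "realisation_dist V R p q = 0 \<longleftrightarrow> p = q" if pts: "p \<in> Pts" "q \<in> Pts" for p q
  proof
    assume "realisation_dist V R p q = 0"
    then show "p = q" using pts Inf_path[OF pts] by (simp add: realisation_dist_def path_0)
  next
    assume "p = q"
    moreover have "0 \<in> path_lengths R p p" unfolding path_lengths_def
      by (rule ptE[OF pts(1)]) (auto simp: adj_def)
    ultimately have "Inf (path_lengths R p q) \<le> 0" by (metis cInf_lower bdd pts)
    then show "realisation_dist V R p q = 0" using Inf_path[OF pts] paths_nonneg[OF pts] pts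
      by (simp add: realisation_dist_def antisym)
  qed
  show "realisation_dist V R p r \<le> realisation_dist V R p q + realisation_dist V R q r"
    if pts: "p \<in> Pts" "q \<in> Pts" "r \<in> Pts" for p q r
  proof -
    obtain z where "z \<in> path_lengths R p r" "z \<le> Inf (path_lengths R p q) + Inf (path_lengths R q r)"
      using paths_triangle[OF pts Inf_path[OF pts(1,2)] Inf_path[OF pts(2,3)]] by blast
    then have "Inf (path_lengths R p r) \<le> Inf (path_lengths R p q) + Inf (path_lengths R q r)"
      using cInf_lower[OF _ bdd[OF pts(1,3)]] by fastforce
    then show ?thesis using pts by (simp add: realisation_dist_def)
  qed
qed

lemma mspace_graph_realisation: "mspace (graph_realisation V R) = Pts"
  and mdist_graph_realisation: "mdist (graph_realisation V R) = realisation_dist V R"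
  unfolding graph_realisation_def by simp_all

end

lemma connected_graph_cayley:
  assumes "group G" "T \<subseteq> carrier G" "generate G T = carrier G"
  shows "connected_graph (carrier G) (cayley_edges G T)"
proof
  interpret group G by fact
  let ?R = "cayley_edges G T"
  show "?R \<subseteq> carrier G \<times> carrier G" by (auto simp: cayley_edges_def)
  show "sym ?R"
  proof (rule symI)
    fix a b assume "(a, b) \<in> ?R"
    then obtain s where s: "a \<in> carrier G" "b = a \<otimes>\<^bsub>G\<^esub> s" "s \<in> T \<or> inv\<^bsub>G\<^esub> s \<in> T" "s \<in> carrier G" "s \<noteq> \<one>\<^bsub>G\<^esub>"
      by (auto simp: cayley_edges_def)
    have b: "b \<in> carrier G" using s by simp
    have inv_s: "inv\<^bsub>G\<^esub> s \<in> carrier G" "inv\<^bsub>G\<^esub> s \<noteq> \<one>\<^bsub>G\<^esub>" "inv\<^bsub>G\<^esub> s \<in> T \<or> inv\<^bsub>G\<^esub> (inv\<^bsub>G\<^esub> s) \<in> T"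
      using s(3,4,5) by auto
    have "b \<otimes>\<^bsub>G\<^esub> inv\<^bsub>G\<^esub> s = a" unfolding s(2) using s(1,4) by (simp add: m_assoc)
    then show "(b, a) \<in> ?R" unfolding cayley_edges_def using b inv_s by blast
  qed
  have gen: "(a, a \<otimes>\<^bsub>G\<^esub> h) \<in> ?R\<^sup>*" if "h \<in> generate G T" "a \<in> carrier G" for a h
    using that
  proof (induction arbitrary: a rule: generate.induct)
    case one
    then show ?case by simp
  next
    case (incl h)
    then show ?case using assms(2)
      by (cases "h = \<one>\<^bsub>G\<^esub>") (auto simp: cayley_edges_def)
  next
    case (inv h)
    then have "h \<in> carrier G" using assms(2) by auto
    show ?case
    proof (cases "inv\<^bsub>G\<^esub> h = \<one>\<^bsub>G\<^esub>")
      case False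
      with inv \<open>h \<in> carrier G\<close> have "(a, a \<otimes>\<^bsub>G\<^esub> inv\<^bsub>G\<^esub> h) \<in> ?R"
        unfolding cayley_edges_def
        by (intro CollectI exI[of _ a] exI[of _ "inv\<^bsub>G\<^esub> h"]) auto
      then show ?thesis by (rule r_into_rtrancl)
    qed (use inv in simp)
  next
    case (eng h1 h2)
    have c: "h1 \<in> carrier G" "h2 \<in> carrier G" using eng.hyps assms(3) by auto
    then have "(a, a \<otimes>\<^bsub>G\<^esub> h1) \<in> ?R\<^sup>*" "(a \<otimes>\<^bsub>G\<^esub> h1, a \<otimes>\<^bsub>G\<^esub> h1 \<otimes>\<^bsub>G\<^esub> h2) \<in> ?R\<^sup>*"
      using eng.IH eng.prems by auto
    then show ?case using c eng.prems by (simp add: m_assoc)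
  qed
  show "(a, b) \<in> ?R\<^sup>*" if "a \<in> carrier G" "b \<in> carrier G" for a b
    using gen[of "inv\<^bsub>G\<^esub> a \<otimes>\<^bsub>G\<^esub> b" a] that assms(3) by (simp add: m_assoc[symmetric])
qed

corollary cayley_graph_metric:
  assumes "group G" "T \<subseteq> carrier G" "generate G T = carrier G"
  shows "mspace (cayley_graph G T) = realisation_points (carrier G) (cayley_edges G T)"
    and "mdist (cayley_graph G T) = realisation_dist (carrier G) (cayley_edges G T)"
proof -
  interpret connected_graph "carrier G" "cayley_edges G T"
    by (rule connected_graph_cayley[OF assms])
  show "mspace (cayley_graph G T) = realisation_points (carrier G) (cayley_edges G T)"
    and "mdist (cayley_graph G T) = realisation_dist (carrier G) (cayley_edges G T)"
    by (simp_all add: cayley_graph_def mspace_graph_realisation mdist_graph_realisation)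
qed

end

theory Submission
  imports Defs "HOL-Library.Countable_Set"
begin

text \<open>
  For a set \<open>\<Lambda>\<close> of vertices let \<open>H \<Lambda>\<close> be the subgroup generated by the vertex groups in \<open>\<Lambda>\<close>. Every group
  element has a gate (closest point) in \<open>H \<Lambda>\<close>: read a word for it and keep exactly those letters whose
  wall crosses \<open>H \<Lambda>\<close>. This recipe is invariant under the defining relations, so no normal form theorem
  is needed.

  The domains are the parallelism classes of cosets of the subgroups \<open>H \<Lambda>\<close> with \<open>\<Lambda>\<close> non-empty, together with
  one copy of the domains of \<open>G v\<close> for each class of cosets of \<open>H {v}\<close>. The space of the first kind is \<open>H \<Lambda>\<close>
  coned off along the cosets of \<open>H \<Delta>\<close> for proper subsets \<open>\<Delta>\<close> of \<open>\<Lambda>\<close>; projections are gates, and the set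
  \<open>\<rho>\<close> is the projection of the product region \<open>H (st \<Lambda>)\<close>. In a coned-off space a path crosses a wall only
  close to the wall, so every path between two points passes close to each point between them; this
  gives slim triangles. The relations between different domains follow from two facts about walls: two walls
  with four populated quadrants cross; and if two points are separated by walls of all types in \<open>\<Lambda>\<close> that
  cross \<open>H \<Lambda>\<close>, then a geodesic between them can be routed through \<open>H (st \<Lambda>)\<close>. Finally, a bounded path in a
  coned-off space is a product of boundedly many elements of smaller parabolic subgroups, so the uniqueness
  axiom follows by induction on \<open>\<Lambda>\<close>.
\<close>

section \<open>Metric preliminaries\<close>

text \<open>Typing shapes the construction: one type must hold all indices and one the points of all
  hyperbolic spaces. The groups are finitely generated, hence countable. So classes of cosets can be
  numbered, and a point of a coned-off graph, given by a pair of vertices and a weight, can be coded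
  by a real number. This explains the types \<open>nat + nat \<times> 'i\<close> and
  \<open>'p + real\<close>. All that is known about equality in the graph product is that equal
  words are joined by elementary moves; a function on words descends to the group once it is
  invariant under the moves. The inductions along the way from one group element to another run on
  word length, which drops whenever a non-trivial gate is split off. The metric of a vertex group is
  invisible in the coned-off spaces. A class of cosets of \<open>H {v}\<close> therefore has a
  bounded space, which only serves as a top element above the copied domains of \<open>G v\<close>.
  Points inside edges of the Cayley graph are projected through a vertex of their support. This
  costs additive multiples of \<open>E0\<close>, which are collected in \<open>KK\<close>.\<close>

lemma set_dist_le: "a \<in> A \<Longrightarrow> b \<in> B \<Longrightarrow> set_dist m A B \<le> mdist m a b"
  unfolding set_dist_def by (rule cINF_lower2[of _ _ "(a, b)"]) (auto intro!: bdd_belowI[of _ 0])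

lemma set_dist_nonneg: "A \<noteq> {} \<Longrightarrow> B \<noteq> {} \<Longrightarrow> 0 \<le> set_dist m A B"
  unfolding set_dist_def by (rule cINF_greatest) auto

lemma set_dist_leI: "a \<in> A \<Longrightarrow> b \<in> B \<Longrightarrow> mdist m a b \<le> r \<Longrightarrow> set_dist m A B \<le> r"
  using set_dist_le order_trans by metis

lemma set_dist_less: 
  assumes "A \<noteq> {}" "B \<noteq> {}" "set_dist m A B < r" shows "\<exists>a\<in>A. \<exists>b\<in>B. mdist m a b < r"
proof -
  have "bdd_below ((\<lambda>(a, b). mdist m a b) ` (A \<times> B))" by (rule bdd_belowI[of _ 0]) auto
  then show ?thesis
    using assms cINF_less_iff[of "A \<times> B" "\<lambda>(a, b). mdist m a b" r] by (auto simp: set_dist_def)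
qed

lemma set_dist_singletons [simp]: "set_dist m {a} {b} = mdist m a b"
  by (simp add: set_dist_def)

lemma nbhdI: "x \<in> mspace m \<Longrightarrow> a \<in> A \<Longrightarrow> mdist m x a \<le> r \<Longrightarrow> x \<in> nbhd m r A"
  by (auto simp: nbhd_def intro: set_dist_leI)

text \<open>The infimum in \<open>set_dist\<close> need not be attained, so a witness exists only
  for a strictly larger radius.\<close>

lemma nbhdD: "x \<in> nbhd m r A \<Longrightarrow> A \<noteq> {} \<Longrightarrow> r < r' \<Longrightarrow> \<exists>a\<in>A. mdist m x a < r'"
  using set_dist_less[of "{x}" A m r'] by (auto simp: nbhd_def)

lemma nbhd_mono: "r \<le> r' \<Longrightarrow> nbhd m r A \<subseteq> nbhd m r' A"
  by (auto simp: nbhd_def)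

lemma diam_le_mono: "diam_le m A r \<Longrightarrow> r \<le> r' \<Longrightarrow> diam_le m A r'"
  unfolding diam_le_def by force

lemma hyperbolic_mono: "hyperbolic m r \<Longrightarrow> r \<le> r' \<Longrightarrow> hyperbolic m r'"
  unfolding hyperbolic_def using nbhd_mono by (meson order_trans)

lemma mdist_triangle': 
  "x \<in> mspace m \<Longrightarrow> y \<in> mspace m \<Longrightarrow> z \<in> mspace m \<Longrightarrow> mdist m x y \<le> a \<Longrightarrow> mdist m y z \<le> b \<Longrightarrow>
    mdist m x z \<le> a + b"
  using mdist_triangle[of x m y z] by simp

lemma geodesic_quasi_geodesic:
  assumes "geodesic_space m" shows "quasi_geodesic_space m"
  unfolding quasi_geodesic_space_def
proof (rule exI[of _ 1], rule conjI[OF order_refl], rule exI[of _ 0], rule conjI[OF order_refl], intro ballI)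
  fix x y assume "x \<in> mspace m" "y \<in> mspace m"
  then obtain \<gamma> where "\<gamma> 0 = x" "\<gamma> (mdist m x y) = y" "\<gamma> ` {0..mdist m x y} \<subseteq> mspace m"
    "\<forall>s\<in>{0..mdist m x y}. \<forall>t\<in>{0..mdist m x y}. mdist m (\<gamma> s) (\<gamma> t) = \<bar>s - t\<bar>"
    using assms unfolding geodesic_space_def geodesic_segment_def by blast
  then show "\<exists>\<gamma> L. 0 \<le> L \<and> \<gamma> 0 = x \<and> \<gamma> L = y \<and> \<gamma> ` {0..L} \<subseteq> mspace m \<and>
      (\<forall>s\<in>{0..L}. \<forall>t\<in>{0..L}. \<bar>s - t\<bar> / 1 - 0 \<le> mdist m (\<gamma> s) (\<gamma> t) \<and> mdist m (\<gamma> s) (\<gamma> t) \<le> 1 * \<bar>s - t\<bar> + 0)"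
    by (intro exI[of _ \<gamma>] exI[of _ "mdist m x y"]) auto
qed

subsection \<open>Isometries\<close>

lemma isometry_onto_mspace: "isometry_onto m m' f \<Longrightarrow> f ` mspace m = mspace m'"
  and isometry_onto_inj: "isometry_onto m m' f \<Longrightarrow> inj_on f (mspace m)"
  and isometry_onto_mdist: "isometry_onto m m' f \<Longrightarrow> x \<in> mspace m \<Longrightarrow> y \<in> mspace m \<Longrightarrow> mdist m' (f x) (f y) = mdist m x y"
  by (auto simp: isometry_onto_def bij_betw_def)

lemma isometry_onto_in: "isometry_onto m m' f \<Longrightarrow> x \<in> mspace m \<Longrightarrow> f x \<in> mspace m'"
  using isometry_onto_mspace by blast

lemma isometry_onto_inv: 
  assumes "isometry_onto m m' f" shows "isometry_onto m' m (inv_into (mspace m) f)"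
proof -
  have b: "bij_betw (inv_into (mspace m) f) (mspace m') (mspace m)"
    using assms bij_betw_inv_into by (auto simp: isometry_onto_def)
  have "mdist m (inv_into (mspace m) f x) (inv_into (mspace m) f y) = mdist m' x y"
    if "x \<in> mspace m'" "y \<in> mspace m'" for x y
  proof -
    have "inv_into (mspace m) f x \<in> mspace m" "inv_into (mspace m) f y \<in> mspace m"
      "f (inv_into (mspace m) f x) = x" "f (inv_into (mspace m) f y) = y"
      using that assms by (auto simp: isometry_onto_mspace[OF assms, symmetric] inv_into_into f_inv_into_f)
    then show ?thesis using isometry_onto_mdist[OF assms] by metis
  qed
  then show ?thesis using b by (simp add: isometry_onto_def)
qed

lemma isometry_onto_comp:
  "isometry_onto m m' f \<Longrightarrow> isometry_onto m' m'' g \<Longrightarrow> isometry_onto m m'' (g \<circ> f)"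
  unfolding isometry_onto_def using bij_betw_trans bij_betwE by (metis (no_types, lifting) comp_apply)

lemma isometry_set_dist:
  assumes "isometry_onto m m' f" "A \<subseteq> mspace m" "B \<subseteq> mspace m"
  shows "set_dist m' (f ` A) (f ` B) = set_dist m A B"
proof -
  have "(\<lambda>(a, b). mdist m' a b) ` (f ` A \<times> f ` B) = (\<lambda>(a, b). mdist m a b) ` (A \<times> B)"
    using assms isometry_onto_mdist[OF assms(1)] by (auto simp: image_iff subset_iff) (metis)+
  then show ?thesis by (simp add: set_dist_def)
qed

lemma isometry_diam_le:
  "isometry_onto m m' f \<Longrightarrow> A \<subseteq> mspace m \<Longrightarrow> diam_le m' (f ` A) r \<longleftrightarrow> diam_le m A r"
  unfolding diam_le_def using isometry_onto_mdist by (smt (verit) image_iff subset_iff)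

lemma isometry_nbhd:
  assumes "isometry_onto m m' f" "A \<subseteq> mspace m" shows "nbhd m' r (f ` A) = f ` nbhd m r A"
proof -
  have "set_dist m' {f x} (f ` A) = set_dist m {x} A" if "x \<in> mspace m" for x
    using isometry_set_dist[OF assms(1), of "{x}" A] that assms by simp
  then show ?thesis by (auto simp: nbhd_def isometry_onto_mspace[OF assms(1), symmetric])
qed

lemma isometry_segment:
  assumes "isometry_onto m m' f" "geodesic_segment m x y P" "x \<in> mspace m" "y \<in> mspace m"
  shows "geodesic_segment m' (f x) (f y) (f ` P)"
proof -
  obtain \<gamma> where g: "\<gamma> 0 = x" "\<gamma> (mdist m x y) = y" "P = \<gamma> ` {0..mdist m x y}" "P \<subseteq> mspace m"
    "\<forall>s\<in>{0..mdist m x y}. \<forall>t\<in>{0..mdist m x y}. mdist m (\<gamma> s) (\<gamma> t) = \<bar>s - t\<bar>"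
    using assms(2) unfolding geodesic_segment_def by blast
  have e: "mdist m' (f x) (f y) = mdist m x y" using isometry_onto_mdist assms by metis
  show ?thesis unfolding geodesic_segment_def e
  proof (intro exI[of _ "f \<circ> \<gamma>"] conjI ballI)
    show "f ` P \<subseteq> mspace m'" using g(4) isometry_onto_in[OF assms(1)] by blast
    fix s t assume "s \<in> {0..mdist m x y}" "t \<in> {0..mdist m x y}"
    then show "mdist m' ((f \<circ> \<gamma>) s) ((f \<circ> \<gamma>) t) = \<bar>s - t\<bar>"
      using g isometry_onto_mdist[OF assms(1)] by (metis comp_apply image_eqI subsetD)
  qed (use g in auto)
qed

lemma isometry_segment_back:
  assumes "isometry_onto m m' f" "geodesic_segment m' (f x) (f y) P" "x \<in> mspace m" "y \<in> mspace m"
  obtains Q where "P = f ` Q" "geodesic_segment m x y Q"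
proof
  let ?g = "inv_into (mspace m) f"
  have "f x \<in> mspace m'" "f y \<in> mspace m'" using assms isometry_onto_in by metis+
  then have "geodesic_segment m (?g (f x)) (?g (f y)) (?g ` P)"
    using isometry_segment[OF isometry_onto_inv[OF assms(1)] assms(2)] by blast
  then show "geodesic_segment m x y (?g ` P)"
    using isometry_onto_inj[OF assms(1)] assms by simp
  have "P \<subseteq> f ` mspace m" using assms(2) isometry_onto_mspace[OF assms(1)] by (auto simp: geodesic_segment_def)
  then show "P = f ` ?g ` P" by (simp add: image_inv_into_cancel)
qed

lemma isometry_geodesic_space:
  assumes "isometry_onto m m' f" "geodesic_space m" shows "geodesic_space m'"
  unfolding geodesic_space_def isometry_onto_mspace[OF assms(1), symmetric]
proof (intro ballI, elim imageE, hypsubst)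
  fix x y assume c: "x \<in> mspace m" "y \<in> mspace m"
  then obtain P where "geodesic_segment m x y P" using assms(2) unfolding geodesic_space_def by blast
  from isometry_segment[OF assms(1) this c] show "\<exists>P. geodesic_segment m' (f x) (f y) P" by blast
qed

lemma geodesic_segment_nonempty: "geodesic_segment m x y P \<Longrightarrow> x \<in> P \<and> y \<in> P \<and> P \<subseteq> mspace m"
proof -
  assume "geodesic_segment m x y P"
  then obtain \<gamma> where g: "\<gamma> 0 = x" "\<gamma> (mdist m x y) = y" "P = \<gamma> ` {0..mdist m x y}" "P \<subseteq> mspace m"
    unfolding geodesic_segment_def by blast
  have "\<gamma> 0 \<in> P" "\<gamma> (mdist m x y) \<in> P" unfolding g(3) by (intro imageI; simp)+
  then show ?thesis using g by simp
qed

lemma isometry_hyperbolic: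
  assumes iso: "isometry_onto m m' f" and h: "hyperbolic m \<delta>" shows "hyperbolic m' \<delta>"
  unfolding hyperbolic_def isometry_onto_mspace[OF iso, symmetric]
proof (intro ballI allI impI, elim imageE, hypsubst)
  fix P Q R x y z assume c: "x \<in> mspace m" "y \<in> mspace m" "z \<in> mspace m"
    and s: "geodesic_segment m' (f x) (f y) P" "geodesic_segment m' (f y) (f z) Q" "geodesic_segment m' (f z) (f x) R"
  obtain P' where P: "P = f ` P'" "geodesic_segment m x y P'" using isometry_segment_back[OF iso s(1) c(1,2)] .
  obtain Q' where Q: "Q = f ` Q'" "geodesic_segment m y z Q'" using isometry_segment_back[OF iso s(2) c(2,3)] .
  obtain R' where R: "R = f ` R'" "geodesic_segment m z x R'" using isometry_segment_back[OF iso s(3) c(3,1)] .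
  have "P' \<subseteq> nbhd m \<delta> (Q' \<union> R')" using h c P Q R unfolding hyperbolic_def by blast
  moreover have "Q' \<union> R' \<subseteq> mspace m" using geodesic_segment_nonempty[OF Q(2)] geodesic_segment_nonempty[OF R(2)] by blast
  ultimately show "P \<subseteq> nbhd m' \<delta> (Q \<union> R)"
    using isometry_nbhd[OF iso, of "Q' \<union> R'" \<delta>] P Q R by (auto simp: image_Un)
qed

text \<open>Transport of structure along an injection. It brings the vertex spaces (by
  \<open>Inl\<close>) and the coned-off spaces (by a coding with reals) into one type of
  points.\<close>

definition map_metric :: "('p \<Rightarrow> 'q) \<Rightarrow> 'p metric \<Rightarrow> 'q metric" where
  "map_metric f m = metric (f ` mspace m,
     \<lambda>x y. mdist m (inv_into (mspace m) f x) (inv_into (mspace m) f y))"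

lemma isometry_map_metric: assumes "inj_on f (mspace m)" shows "isometry_onto m (map_metric f m) f"
proof -
  interpret Metric_space "f ` mspace m" "\<lambda>x y. mdist m (inv_into (mspace m) f x) (inv_into (mspace m) f y)"
    by unfold_locales (use assms in \<open>auto simp: mdist_commute mdist_triangle\<close>)
  show ?thesis using assms unfolding map_metric_def isometry_onto_def by (auto simp: bij_betw_def)
qed

subsection \<open>Realisations of connected graphs\<close>

text \<open>A 1-Lipschitz path on \<open>{0..L}\<close>. Such paths can be concatenated without any
  care for minimality; \<open>lpath_geodesic\<close> recovers a geodesic in the end.\<close>

definition lpath :: "'p metric \<Rightarrow> 'p \<Rightarrow> 'p \<Rightarrow> real \<Rightarrow> bool" where
  "lpath m x y L \<longleftrightarrow> 0 \<le> L \<and> (\<exists>\<gamma>. \<gamma> 0 = x \<and> \<gamma> L = y \<and> \<gamma> ` {0..L} \<subseteq> mspace m \<and>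
     (\<forall>s\<in>{0..L}. \<forall>t\<in>{0..L}. mdist m (\<gamma> s) (\<gamma> t) \<le> \<bar>s - t\<bar>))"

lemma mdist_self [simp]: "x \<in> mspace m \<Longrightarrow> mdist m x x = 0"
  by simp

lemma lpath_const: "x \<in> mspace m \<Longrightarrow> 0 \<le> L \<Longrightarrow> lpath m x x L"
  unfolding lpath_def by (auto intro!: exI[of _ "\<lambda>_. x"])

lemma lpath_trans:
  assumes "lpath m x y L" "lpath m y z L'" shows "lpath m x z (L + L')"
proof -
  obtain \<gamma> where g: "\<gamma> 0 = x" "\<gamma> L = y" "\<gamma> ` {0..L} \<subseteq> mspace m" "0 \<le> L"
    "\<And>s t. s \<in> {0..L} \<Longrightarrow> t \<in> {0..L} \<Longrightarrow> mdist m (\<gamma> s) (\<gamma> t) \<le> \<bar>s - t\<bar>"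
    using assms(1) unfolding lpath_def by blast
  obtain \<gamma>' where g': "\<gamma>' 0 = y" "\<gamma>' L' = z" "\<gamma>' ` {0..L'} \<subseteq> mspace m" "0 \<le> L'"
    "\<And>s t. s \<in> {0..L'} \<Longrightarrow> t \<in> {0..L'} \<Longrightarrow> mdist m (\<gamma>' s) (\<gamma>' t) \<le> \<bar>s - t\<bar>"
    using assms(2) unfolding lpath_def by blast
  define \<eta> where "\<eta> = (\<lambda>t. if t \<le> L then \<gamma> t else \<gamma>' (t - L))"
  have in1: "\<gamma> s \<in> mspace m" if "s \<in> {0..L}" for s using g(3) that by blast
  have in2: "\<gamma>' s \<in> mspace m" if "s \<in> {0..L'}" for s using g'(3) that by blast
  have mixed: "mdist m (\<eta> s) (\<eta> t) \<le> \<bar>s - t\<bar>" if "s \<in> {0..L + L'}" "t \<in> {0..L + L'}" "s \<le> L" "\<not> t \<le> L" for s t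
  proof -
    have "mdist m (\<gamma> s) (\<gamma>' (t - L)) \<le> \<bar>s - L\<bar> + \<bar>0 - (t - L)\<bar>"
    proof (rule mdist_triangle'[of _ m y])
      show "mdist m (\<gamma> s) y \<le> \<bar>s - L\<bar>" using g(5)[of s L] g(2,4) that by simp
      show "mdist m y (\<gamma>' (t - L)) \<le> \<bar>0 - (t - L)\<bar>" using g'(5)[of 0 "t - L"] g'(1,4) that by simp
      show "y \<in> mspace m" using in1[of L] g by simp
    qed (use in1 in2 that in auto)
    then show ?thesis using that by (simp add: \<eta>_def)
  qed
  have "mdist m (\<eta> s) (\<eta> t) \<le> \<bar>s - t\<bar>" if st: "s \<in> {0..L + L'}" "t \<in> {0..L + L'}" for s t
  proof -
    consider "s \<le> L" "t \<le> L" | "s \<le> L" "\<not> t \<le> L" | "\<not> s \<le> L" "t \<le> L" | "\<not> s \<le> L" "\<not> t \<le> L" by blast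
    then show ?thesis
    proof cases
      case 1 then show ?thesis using g(5)[of s t] st by (simp add: \<eta>_def)
    next
      case 2 then show ?thesis using mixed st by blast
    next
      case 3 then show ?thesis using mixed[of t s] st by (simp add: mdist_commute abs_minus_commute)
    next
      case 4 then show ?thesis using g'(5)[of "s - L" "t - L"] st by (simp add: \<eta>_def)
    qed
  qed
  moreover have "\<eta> 0 = x" "\<eta> (L + L') = z" using g g' by (auto simp: \<eta>_def)
  moreover have "\<eta> ` {0..L + L'} \<subseteq> mspace m" using in1 in2 by (auto simp: \<eta>_def)
  ultimately show ?thesis using g(4) g'(4) unfolding lpath_def by (intro conjI exI[of _ \<eta>]) auto
qed

lemma lpath_sym: assumes "lpath m x y L" shows "lpath m y x L"
proof -
  obtain \<gamma> where g: "\<gamma> 0 = x" "\<gamma> L = y" "\<gamma> ` {0..L} \<subseteq> mspace m" "0 \<le> L"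
    "\<And>s t. s \<in> {0..L} \<Longrightarrow> t \<in> {0..L} \<Longrightarrow> mdist m (\<gamma> s) (\<gamma> t) \<le> \<bar>s - t\<bar>"
    using assms(1) unfolding lpath_def by blast
  have "mdist m (\<gamma> (L - s)) (\<gamma> (L - t)) \<le> \<bar>s - t\<bar>" if "s \<in> {0..L}" "t \<in> {0..L}" for s t
    using g(5)[of "L - s" "L - t"] that by (simp add: abs_minus_commute)
  then show ?thesis using g unfolding lpath_def by (intro conjI exI[of _ "\<lambda>t. \<gamma> (L - t)"]) auto
qed

text \<open>Cut the path at \<open>s\<close> and \<open>t\<close>: the lengths of the three pieces
  add up to the distance of the end points, so by the triangle inequality no piece can join its ends
  at a smaller distance than its length.\<close>

lemma lpath_geodesic:
  assumes "lpath m x y (mdist m x y)" shows "\<exists>P. geodesic_segment m x y P"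
proof -
  define L where "L = mdist m x y"
  obtain \<gamma> where g: "\<gamma> 0 = x" "\<gamma> L = y" "\<gamma> ` {0..L} \<subseteq> mspace m" "0 \<le> L"
    "\<And>s t. s \<in> {0..L} \<Longrightarrow> t \<in> {0..L} \<Longrightarrow> mdist m (\<gamma> s) (\<gamma> t) \<le> \<bar>s - t\<bar>"
    using assms unfolding lpath_def L_def by blast
  have le: "\<bar>s - t\<bar> \<le> mdist m (\<gamma> s) (\<gamma> t)" if "s \<in> {0..L}" "t \<in> {0..L}" "s \<le> t" for s t
  proof -
    have "\<gamma> 0 \<in> mspace m" "\<gamma> s \<in> mspace m" "\<gamma> t \<in> mspace m" "\<gamma> L \<in> mspace m"
      using g(3,4) that by auto
    then have "mdist m (\<gamma> 0) (\<gamma> L) \<le> mdist m (\<gamma> 0) (\<gamma> s) + mdist m (\<gamma> s) (\<gamma> L)"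
      "mdist m (\<gamma> s) (\<gamma> L) \<le> mdist m (\<gamma> s) (\<gamma> t) + mdist m (\<gamma> t) (\<gamma> L)"
      using mdist_triangle[of "\<gamma> 0" m "\<gamma> s" "\<gamma> L"] mdist_triangle[of "\<gamma> s" m "\<gamma> t" "\<gamma> L"] by simp_all
    then have "L \<le> mdist m (\<gamma> 0) (\<gamma> s) + (mdist m (\<gamma> s) (\<gamma> t) + mdist m (\<gamma> t) (\<gamma> L))"
      using g(1,2) L_def by simp
    then show ?thesis using g(5)[of 0 s] g(5)[of t L] that by simp
  qed
  have "mdist m (\<gamma> s) (\<gamma> t) = \<bar>s - t\<bar>" if "s \<in> {0..L}" "t \<in> {0..L}" for s t
    using le[OF that] le[OF that(2,1)] g(5)[OF that] mdist_commute[of m "\<gamma> s" "\<gamma> t"] by (cases "s \<le> t") auto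
  then show ?thesis using g unfolding geodesic_segment_def L_def[symmetric]
    by (intro exI[of _ "\<gamma> ` {0..L}"] exI[of _ \<gamma>]) auto
qed

abbreviation vpt :: "'a \<Rightarrow> 'a \<Rightarrow> real" where "vpt a \<equiv> (\<lambda>x. if x = a then 1 else 0)"

context connected_graph
begin

abbreviation "M \<equiv> graph_realisation V R"

lemmas mspace_M = mspace_graph_realisation
lemmas mdist_M = mdist_graph_realisation

lemma mdist_le_path: "p \<in> Pts \<Longrightarrow> q \<in> Pts \<Longrightarrow> l \<in> path_lengths R p q \<Longrightarrow> mdist M p q \<le> l"
  unfolding mdist_M realisation_dist_def using cInf_lower[OF _ bdd] by simp

lemma mdist_is_path: "p \<in> Pts \<Longrightarrow> q \<in> Pts \<Longrightarrow> mdist M p q \<in> path_lengths R p q"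
  unfolding mdist_M realisation_dist_def using Inf_path by simp

lemma vpt_Pts [simp]: "vpt a \<in> Pts \<longleftrightarrow> a \<in> V"
proof
  assume "vpt a \<in> Pts" then show "a \<in> V" using supp_V[of "vpt a" a] by simp
next
  assume "a \<in> V" then show "vpt a \<in> Pts" unfolding realisation_points_def by (auto intro!: bexI[of _ a])
qed

lemma mdist_vpt: assumes "a \<in> V" "b \<in> V" shows "mdist M (vpt a) (vpt b) = real (vertex_dist R a b)"
proof (rule antisym)
  show "mdist M (vpt a) (vpt b) \<le> real (vertex_dist R a b)"
  proof (rule mdist_le_path)
    show "real (vertex_dist R a b) \<in> path_lengths R (vpt a) (vpt b)"
      unfolding path_lengths_def by (rule UnI2) (auto intro!: exI[of _ a] exI[of _ b])
  qed (use assms in auto)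
  have "real (vertex_dist R a b) \<le> l" if "l \<in> path_lengths R (vpt a) (vpt b)" for l
  proof -
    consider c d where "l = \<bar>vpt a c - vpt b c\<bar>" "c = d \<or> (c, d) \<in> R" "{v. vpt a v \<noteq> 0} \<union> {v. vpt b v \<noteq> 0} \<subseteq> {c, d}"
      | c d where "l = (1 - vpt a c) + real (vertex_dist R c d) + (1 - vpt b d)" "vpt a c \<noteq> 0" "vpt b d \<noteq> 0"
      using \<open>l \<in> _\<close> unfolding path_lengths_def by blast
    then show ?thesis
    proof cases
      case 1
      then have "{a} \<subseteq> {c, d}" "{b} \<subseteq> {c, d}" by (auto simp: if_distrib[of "\<lambda>x. x \<noteq> 0"])
      then have ab: "a \<in> {c, d}" "b \<in> {c, d}" by auto
      show ?thesis
      proof (cases "a = b")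
        case False
        then have "(c, d) \<in> R" "l = 1" using 1 ab by auto
        moreover then have "vertex_dist R c d \<le> 1" "vertex_dist R d c \<le> 1" using vertex_dist_edge symR
          by (auto simp: sym_def)
        ultimately show ?thesis using ab False by auto
      qed (use 1 in auto)
    next
      case 2
      then have "c = a" "d = b" by (auto split: if_splits)
      then show ?thesis using 2 by simp
    qed
  qed
  then show "real (vertex_dist R a b) \<le> mdist M (vpt a) (vpt b)"
    using mdist_is_path assms by simp
qed

lemma mdist_vpt_near: assumes "p \<in> Pts" "p a \<noteq> 0" shows "mdist M p (vpt a) \<le> 1 - p a" "mdist M p (vpt a) \<le> 1"
proof -
  have a: "a \<in> V" using supp_V assms by blast
  have "1 - p a \<in> path_lengths R p (vpt a)" unfolding path_lengths_def
    by (rule UnI2) (use assms in \<open>auto intro!: exI[of _ a]\<close>)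
  then show "mdist M p (vpt a) \<le> 1 - p a" using mdist_le_path assms a by simp
  then show "mdist M p (vpt a) \<le> 1" using pt_bounds(1)[OF assms(1), of a] by linarith
qed

lemma supp_nonempty: assumes "p \<in> Pts" obtains a where "p a \<noteq> 0"
proof -
  obtain a b where "(\<Sum>v\<in>{a, b}. p v) = 1" using assms by (auto simp: realisation_points_def)
  then have "p a \<noteq> 0 \<or> p b \<noteq> 0" by (cases "a = b") auto
  then show ?thesis using that by blast
qed

definition "edge_pt a b t = (\<lambda>x. if x = a then t else if x = b then 1 - t else (0::real))"

lemma edge_pt: 
  assumes "(a, b) \<in> R" "a \<noteq> b"
  shows "0 \<le> t \<Longrightarrow> t \<le> 1 \<Longrightarrow> edge_pt a b t \<in> Pts" 
    and "p \<in> Pts \<Longrightarrow> {v. p v \<noteq> 0} \<subseteq> {a, b} \<Longrightarrow> p = edge_pt a b (p a)"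
    and "0 \<le> t \<Longrightarrow> t \<le> 1 \<Longrightarrow> 0 \<le> s \<Longrightarrow> s \<le> 1 \<Longrightarrow> mdist M (edge_pt a b s) (edge_pt a b t) \<le> \<bar>s - t\<bar>"
proof -
  have V: "a \<in> V" "b \<in> V" using assms sub by auto
  show P: "edge_pt a b t \<in> Pts" if "0 \<le> t" "t \<le> 1" for t
    unfolding realisation_points_def edge_pt_def
    by (intro CollectI conjI allI, use that in simp, rule bexI[of _ a], rule bexI[of _ b]) (use assms V in auto)
  show "p = edge_pt a b (p a)" if "p \<in> Pts" "{v. p v \<noteq> 0} \<subseteq> {a, b}"
    using pt_edge(1)[OF that assms(2)] that(2) by (auto simp: edge_pt_def fun_eq_iff)
  show "mdist M (edge_pt a b s) (edge_pt a b t) \<le> \<bar>s - t\<bar>" if "0 \<le> t" "t \<le> 1" "0 \<le> s" "s \<le> 1"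
  proof (rule mdist_le_path)
    show "\<bar>s - t\<bar> \<in> path_lengths R (edge_pt a b s) (edge_pt a b t)"
      unfolding path_lengths_def
      by (intro UnI1 CollectI exI[of _ a] exI[of _ b]) (use assms in \<open>auto simp: edge_pt_def\<close>)
  qed (use P that in auto)
qed

lemma lpath_edge_pt:
  assumes "(a, b) \<in> R" "a \<noteq> b" "0 \<le> s" "s \<le> 1" "0 \<le> t" "t \<le> 1"
  shows "lpath M (edge_pt a b s) (edge_pt a b t) \<bar>s - t\<bar>"
proof -
  have *: "lpath M (edge_pt a b s) (edge_pt a b t) (t - s)" if "s \<le> t" "0 \<le> s" "t \<le> 1" for s t
    unfolding lpath_def using edge_pt[OF assms(1,2)] that mspace_M
    by (auto intro!: exI[of _ "\<lambda>u. edge_pt a b (s + u)"] order_trans[OF edge_pt(3)[OF assms(1,2)]])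
  show ?thesis
  proof (cases "s \<le> t")
    case True then show ?thesis using * assms by simp
  next
    case False then show ?thesis using lpath_sym[OF *[of t s]] assms by simp
  qed
qed

lemma lpath_same_edge:
  assumes "p \<in> Pts" "q \<in> Pts" "a = b \<or> (a, b) \<in> R" "{v. p v \<noteq> 0} \<union> {v. q v \<noteq> 0} \<subseteq> {a, b}"
  shows "lpath M p q \<bar>p a - q a\<bar>"
proof (cases "a = b")
  case True
  then have "{v. p v \<noteq> 0} \<subseteq> {a, a}" "{v. q v \<noteq> 0} \<subseteq> {a, a}" using assms by auto
  then have "p a = 1" "q a = 1" and s: "{v. p v \<noteq> 0} \<subseteq> {a, a}" "{v. q v \<noteq> 0} \<subseteq> {a, a}"
    using pt_edge(2)[OF assms(1), of a a] pt_edge(2)[OF assms(2), of a a] by auto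
  moreover have "p = q"
  proof
    fix v
    have "v = a \<or> (p v = 0 \<and> q v = 0)" using s by blast
    then show "p v = q v" using \<open>p a = 1\<close> \<open>q a = 1\<close> by auto
  qed
  ultimately show ?thesis using lpath_const[of p M 0] assms mspace_M by simp
next
  case False
  then have R: "(a, b) \<in> R" using assms by auto
  have "p = edge_pt a b (p a)" "q = edge_pt a b (q a)" using edge_pt(2)[OF R False] assms by auto
  moreover have "lpath M (edge_pt a b (p a)) (edge_pt a b (q a)) \<bar>p a - q a\<bar>"
    using lpath_edge_pt[OF R False] pt_bounds assms by blast
  ultimately show ?thesis by metis
qed

lemma lpath_vpt: assumes "p \<in> Pts" "p a \<noteq> 0" shows "lpath M p (vpt a) (1 - p a)"
proof -
  obtain c d where cd: "c \<in> V" "d \<in> V" "c = d \<or> (c, d) \<in> R" "{v. p v \<noteq> 0} \<subseteq> {c, d}"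
    using assms by (auto simp: realisation_points_def)
  then have "a \<in> {c, d}" using assms by auto
  then obtain b where b: "a = b \<or> (a, b) \<in> R" "{v. p v \<noteq> 0} \<subseteq> {a, b}"
    using cd symR by (auto simp: sym_def)
  have "a \<in> V" using supp_V assms by blast
  then have "lpath M p (vpt a) \<bar>p a - vpt a a\<bar>" using b assms by (intro lpath_same_edge[of _ _ a b]) auto
  then show ?thesis using pt_bounds[OF assms(1), of a] by simp
qed

lemma lpath_vertices: "(a, b) \<in> R ^^ n \<Longrightarrow> a \<in> V \<Longrightarrow> b \<in> V \<Longrightarrow> lpath M (vpt a) (vpt b) (real n)"
proof (induction n arbitrary: b)
  case 0 then show ?case using lpath_const[of "vpt a" M 0] mspace_M by simp
next
  case (Suc n)
  then obtain c where c: "(a, c) \<in> R ^^ n" "(c, b) \<in> R" by auto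
  have cV: "c \<in> V" using c sub by auto
  have "lpath M (vpt c) (vpt b) 1"
  proof (cases "c = b")
    case True
    then show ?thesis using lpath_const[of "vpt b" M 1] mspace_M Suc.prems by simp
  next
    case False
    have "lpath M (edge_pt c b 1) (edge_pt c b 0) 1" using lpath_edge_pt[OF c(2) False, of 1 0] by simp
    moreover have "edge_pt c b 1 = vpt c" "edge_pt c b 0 = vpt b" using False by (auto simp: edge_pt_def fun_eq_iff)
    ultimately show ?thesis by simp
  qed
  then show ?case using lpath_trans[OF Suc.IH[OF c(1) Suc.prems(2) cV], of "vpt b" 1] by (simp add: add.commute)
qed

text \<open>The infimum over \<open>path_lengths\<close> is attained, and a length of either kind
  belongs to an explicit Lipschitz path: inside one edge, or to a vertex, along an edge path and on
  from a vertex.\<close>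

lemma geodesic_realisation: "geodesic_space M"
  unfolding geodesic_space_def mspace_M
proof (intro ballI lpath_geodesic)
  fix p q assume pq: "p \<in> Pts" "q \<in> Pts"
  consider a b where "mdist M p q = \<bar>p a - q a\<bar>" "a = b \<or> (a, b) \<in> R" "{v. p v \<noteq> 0} \<union> {v. q v \<noteq> 0} \<subseteq> {a, b}"
    | a b where "mdist M p q = (1 - p a) + real (vertex_dist R a b) + (1 - q b)" "p a \<noteq> 0" "q b \<noteq> 0"
    using mdist_is_path[OF pq] unfolding path_lengths_def by blast
  then show "lpath M p q (mdist M p q)"
  proof cases
    case 1 then show ?thesis using lpath_same_edge[OF pq] by metis
  next
    case 2
    have ab: "a \<in> V" "b \<in> V" using 2 pq supp_V by blast+
    have "lpath M (vpt a) (vpt b) (real (vertex_dist R a b))"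
      using lpath_vertices[OF vertex_dist_path] ab by blast
    then show ?thesis using lpath_trans[OF lpath_trans[OF lpath_vpt[OF pq(1) 2(2)]] lpath_sym[OF lpath_vpt[OF pq(2) 2(3)]]] 2(1)
      by simp
  qed
qed

text \<open>\<open>f\<close> is a graph automorphism with inverse \<open>g\<close>, and
  \<open>T\<close> pushes barycentric coordinates forward along \<open>f\<close>. One inequality is
  enough, because \<open>realisation_isometry\<close> applies the lemma to \<open>f\<close> and to
  \<open>g\<close>.\<close>

lemma realisation_map:
  fixes f g :: "'a \<Rightarrow> 'a"
  assumes fV: "\<And>a. a \<in> V \<Longrightarrow> f a \<in> V" and gV: "\<And>a. a \<in> V \<Longrightarrow> g a \<in> V"
    and gf: "\<And>a. a \<in> V \<Longrightarrow> g (f a) = a" and fg: "\<And>a. a \<in> V \<Longrightarrow> f (g a) = a"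
    and Rf: "\<And>a b. (a, b) \<in> R \<Longrightarrow> (f a, f b) \<in> R" and Rg: "\<And>a b. (a, b) \<in> R \<Longrightarrow> (g a, g b) \<in> R"
  defines "T \<equiv> \<lambda>p x. if x \<in> V then p (g x) else (0::real)"
  shows "p \<in> Pts \<Longrightarrow> T p \<in> Pts" and "p \<in> Pts \<Longrightarrow> q \<in> Pts \<Longrightarrow> mdist M (T p) (T q) \<le> mdist M p q"
proof -
  have supp: "{x. T p x \<noteq> 0} = f ` {v. p v \<noteq> 0}" if "p \<in> Pts" for p
  proof (intro equalityI subsetI)
    fix x assume "x \<in> {x. T p x \<noteq> 0}"
    then have "x = f (g x)" "p (g x) \<noteq> 0" using fg by (auto simp: T_def split: if_splits)
    then show "x \<in> f ` {v. p v \<noteq> 0}" by blast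
  next
    fix x assume "x \<in> f ` {v. p v \<noteq> 0}"
    then show "x \<in> {x. T p x \<noteq> 0}" using supp_V[OF that] fV gf by (auto simp: T_def)
  qed
  have Tf: "T p (f a) = p a" if "a \<in> V" for p a using that fV gf by (simp add: T_def)
  have V_supp: "a \<in> V \<and> b \<in> V" if pq: "p \<in> Pts" and e: "a = b \<or> (a, b) \<in> R" "{v. p v \<noteq> 0} \<subseteq> {a, b}" for p a b
  proof -
    obtain c where c: "p c \<noteq> 0" using supp_nonempty[OF pq] .
    then have "c \<in> V" "c \<in> {a, b}" using supp_V pq e(2) by auto
    then show ?thesis using e(1) sub by auto
  qed
  show T_Pts: "T p \<in> Pts" if p: "p \<in> Pts" for p
  proof -
    obtain a b where ab: "a \<in> V" "b \<in> V" "a = b \<or> (a, b) \<in> R" "{v. p v \<noteq> 0} \<subseteq> {a, b}" "(\<Sum>v\<in>{a, b}. p v) = 1" "\<forall>v. 0 \<le> p v"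
      using p unfolding realisation_points_def by blast
    have "{x. T p x \<noteq> 0} \<subseteq> {f a, f b}" using supp[OF p] ab(4) by auto
    moreover have "(\<Sum>v\<in>{f a, f b}. T p v) = 1"
    proof (cases "a = b")
      case False
      then have "f a \<noteq> f b" using gf ab by metis
      then show ?thesis using ab False by (simp add: Tf)
    qed (use ab in \<open>simp add: Tf\<close>)
    moreover have "f a = f b \<or> (f a, f b) \<in> R" using ab Rf by blast
    moreover have "\<forall>v. 0 \<le> T p v" using ab by (simp add: T_def)
    ultimately show ?thesis unfolding realisation_points_def using fV ab by blast
  qed
  have Rn: "(f a, f b) \<in> R ^^ n" if "(a, b) \<in> R ^^ n" for a b n
    using that by (induction n arbitrary: b) (use Rf in fastforce)+
  have Rn': "(g a, g b) \<in> R ^^ n" if "(a, b) \<in> R ^^ n" for a b n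
    using that by (induction n arbitrary: b) (use Rg in fastforce)+
  have vd: "vertex_dist R (f a) (f b) = vertex_dist R a b" if "a \<in> V" "b \<in> V" for a b
  proof (rule antisym)
    show "vertex_dist R (f a) (f b) \<le> vertex_dist R a b"
      using Rn[OF vertex_dist_path] that by (intro vertex_dist_le) blast
    have "(g (f a), g (f b)) \<in> R ^^ vertex_dist R (f a) (f b)"
      using Rn'[OF vertex_dist_path, of "f a" "f b"] that fV by blast
    then show "vertex_dist R a b \<le> vertex_dist R (f a) (f b)" using gf that by (intro vertex_dist_le) simp
  qed
  have paths: "l \<in> path_lengths R (T p) (T q)" if pq: "p \<in> Pts" "q \<in> Pts" and l: "l \<in> path_lengths R p q" for p q l
  proof -
    from l consider a b where "l = \<bar>p a - q a\<bar>" "a = b \<or> (a, b) \<in> R" "{v. p v \<noteq> 0} \<union> {v. q v \<noteq> 0} \<subseteq> {a, b}"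
      | a b where "l = (1 - p a) + real (vertex_dist R a b) + (1 - q b)" "p a \<noteq> 0" "q b \<noteq> 0"
      unfolding path_lengths_def by blast
    then show ?thesis
    proof cases
      case 1
      have V: "a \<in> V" "b \<in> V" using V_supp[OF pq(1) 1(2)] 1(3) by auto
      have "{v. T p v \<noteq> 0} \<union> {v. T q v \<noteq> 0} \<subseteq> {f a, f b}"
        using supp[OF pq(1)] supp[OF pq(2)] 1(3) by auto
      moreover have "l = \<bar>T p (f a) - T q (f a)\<bar>" using 1 V by (simp add: Tf)
      moreover have "f a = f b \<or> (f a, f b) \<in> R" using 1 Rf by auto
      ultimately show ?thesis unfolding path_lengths_def by blast
    next
      case 2
      have V: "a \<in> V" "b \<in> V" using 2 supp_V pq by blast+
      then show ?thesis using 2 vd[OF V] unfolding path_lengths_def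
        by (intro UnI2 CollectI exI[of _ "f a"] exI[of _ "f b"]) (simp add: Tf)
    qed
  qed
  show "mdist M (T p) (T q) \<le> mdist M p q" if "p \<in> Pts" "q \<in> Pts"
    by (rule mdist_le_path[OF T_Pts[OF that(1)] T_Pts[OF that(2)] paths[OF that mdist_is_path[OF that]]])
qed

lemma realisation_isometry:
  fixes f g :: "'a \<Rightarrow> 'a"
  assumes "\<And>a. a \<in> V \<Longrightarrow> f a \<in> V" "\<And>a. a \<in> V \<Longrightarrow> g a \<in> V"
    and "\<And>a. a \<in> V \<Longrightarrow> g (f a) = a" "\<And>a. a \<in> V \<Longrightarrow> f (g a) = a"
    and "\<And>a b. (a, b) \<in> R \<Longrightarrow> (f a, f b) \<in> R" "\<And>a b. (a, b) \<in> R \<Longrightarrow> (g a, g b) \<in> R"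
  shows "isometry_onto M M (\<lambda>p x. if x \<in> V then p (g x) else 0)"
proof -
  define T where "T g p = (\<lambda>x. if x \<in> V then p (g x) else (0::real))" for g :: "'a \<Rightarrow> 'a" and p :: "'a \<Rightarrow> real"
  have Tg: "T g p \<in> Pts" if "p \<in> Pts" for p
    unfolding T_def by (rule realisation_map(1)[of f g]) (use assms that in blast)+
  have Tf: "T f p \<in> Pts" if "p \<in> Pts" for p
    unfolding T_def by (rule realisation_map(1)[of g f]) (use assms that in blast)+
  have Tg2: "mdist M (T g p) (T g q) \<le> mdist M p q" if "p \<in> Pts" "q \<in> Pts" for p q
    unfolding T_def by (rule realisation_map(2)[of f g]) (use assms that in blast)+
  have Tf2: "mdist M (T f p) (T f q) \<le> mdist M p q" if "p \<in> Pts" "q \<in> Pts" for p q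
    unfolding T_def by (rule realisation_map(2)[of g f]) (use assms that in blast)+
  have TT: "T f (T g p) = p" "T g (T f p) = p" if "p \<in> Pts" for p
    using supp_V[OF that] assms by (auto simp: T_def fun_eq_iff)
  have bij: "bij_betw (T g) Pts Pts"
    by (rule bij_betw_byWitness[where f' = "T f"]) (use TT Tf Tg in auto)
  have "mdist M (T g p) (T g q) = mdist M p q" if pq: "p \<in> Pts" "q \<in> Pts" for p q
    using Tg2[OF pq] Tf2[OF Tg[OF pq(1)] Tg[OF pq(2)]] TT pq by simp
  then show ?thesis using bij unfolding T_def[symmetric] isometry_onto_def mspace_M by blast
qed

text \<open>A point is determined by an ordered pair of vertices that carries it and by its weight
  at the first of them; a countable set of pairs can be numbered.\<close>

lemma countable_realisation_inj: assumes "countable V" shows "\<exists>c :: ('a \<Rightarrow> real) \<Rightarrow> real. inj_on c Pts"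
proof -
  define e where "e p = (SOME (a, b). a \<in> V \<and> b \<in> V \<and> {v. p v \<noteq> 0} \<subseteq> {a, b})" for p :: "'a \<Rightarrow> real"
  have e: "fst (e p) \<in> V \<and> snd (e p) \<in> V \<and> {v. p v \<noteq> 0} \<subseteq> {fst (e p), snd (e p)}" if p: "p \<in> Pts" for p
  proof -
    obtain a b where "a \<in> V" "b \<in> V" "{v. p v \<noteq> 0} \<subseteq> {a, b}" using p unfolding realisation_points_def by blast
    then show ?thesis
      using someI[of "\<lambda>(a, b). a \<in> V \<and> b \<in> V \<and> {v. p v \<noteq> 0} \<subseteq> {a, b}" "(a, b)"]
      by (auto simp: e_def case_prod_beta)
  qed
  \<comment> \<open>The weight ranges over the closed unit interval. Spacing the numbers by 2 keeps
    weight 1 over one pair apart from weight 0 over the next.\<close>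
  define c where "c p = 2 * real (to_nat_on (V \<times> V) (e p)) + p (fst (e p))" for p
  have "inj_on c Pts"
  proof (rule inj_onI)
    fix p q assume pq: "p \<in> Pts" "q \<in> Pts" "c p = c q"
    have b: "0 \<le> p (fst (e p))" "p (fst (e p)) \<le> 1" "0 \<le> q (fst (e q))" "q (fst (e q)) \<le> 1"
      using pt_bounds pq by auto
    have "to_nat_on (V \<times> V) (e p) = to_nat_on (V \<times> V) (e q)"
      using pq(3) b unfolding c_def by linarith
    moreover have "e p \<in> V \<times> V" "e q \<in> V \<times> V" using e pq by (auto simp: mem_Times_iff)
    ultimately have ee: "e p = e q"
      using inj_on_to_nat_on[of "V \<times> V"] assms by (auto dest: inj_onD)
    obtain a b where ab: "e q = (a, b)" by (cases "e q")
    have s: "{v. p v \<noteq> 0} \<subseteq> {a, b}" "{v. q v \<noteq> 0} \<subseteq> {a, b}" "p a = q a"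
      using e[OF pq(1)] e[OF pq(2)] ee ab pq(3) by (auto simp: c_def)
    have "p b = q b"
    proof (cases "a = b")
      case False
      then show ?thesis using pt_edge(1)[OF pq(1) s(1) False] pt_edge(1)[OF pq(2) s(2) False] s(3) by simp
    qed (use s in simp)
    show "p = q"
    proof
      fix v
      have "v = a \<or> v = b \<or> (p v = 0 \<and> q v = 0)" using s by blast
      then show "p v = q v" using s(3) \<open>p b = q b\<close> by auto
    qed
  qed
  then show ?thesis by blast
qed

end

section \<open>Gates and walls in graph products\<close>

inductive_set gp_step ::
    "'v set \<Rightarrow> 'v set set \<Rightarrow> ('v \<Rightarrow> ('a, 'b) monoid_scheme) \<Rightarrow> (('v \<times> 'a) list \<times> ('v \<times> 'a) list) set"
  for V :: "'v set" and E :: "'v set set" and G :: "'v \<Rightarrow> ('a, 'b) monoid_scheme" where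
  free: "(u, w) \<in> fp_step V G \<Longrightarrow> (u, w) \<in> gp_step V E G"
| commute: "u \<in> fp_words V G \<Longrightarrow> t \<in> fp_words V G \<Longrightarrow> {v, w} \<in> E \<Longrightarrow>
    g \<in> carrier (G v) \<Longrightarrow> h \<in> carrier (G w) \<Longrightarrow>
    (u @ [(v, g), (w, h)] @ t, u @ [(w, h), (v, g)] @ t) \<in> gp_step V E G"

text \<open>Everything up to the choice of indices needs only a group with an evaluation map on
  words whose fibres are connected by moves. Working in this abstraction avoids the nested quotients
  of the concrete graph product.\<close>

locale graph_group = group \<G>
  for \<G> :: "('g, 'c) monoid_scheme" (structure) +
  fixes V :: "'v set" and E :: "'v set set" and G :: "'v \<Rightarrow> ('a, 'b) monoid_scheme"
    and incl :: "'v \<Rightarrow> 'a \<Rightarrow> 'g"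
  assumes finV: "finite V" and simplicial: "simplicial_graph V E"
    and grp: "v \<in> V \<Longrightarrow> group (G v)"
    and incl_hom: "v \<in> V \<Longrightarrow> incl v \<in> hom (G v) \<G>"
    and incl_commute: "{v, v'} \<in> E \<Longrightarrow> g \<in> carrier (G v) \<Longrightarrow> h \<in> carrier (G v') \<Longrightarrow>
      incl v g \<otimes> incl v' h = incl v' h \<otimes> incl v g"
    and generated: "x \<in> carrier \<G> \<Longrightarrow>
      \<exists>w\<in>fp_words V G. foldr (\<lambda>s y. incl (fst s) (snd s) \<otimes> y) w \<one> = x"
    and presented: "u \<in> fp_words V G \<Longrightarrow> w \<in> fp_words V G \<Longrightarrow>
      foldr (\<lambda>s y. incl (fst s) (snd s) \<otimes> y) u \<one> = foldr (\<lambda>s y. incl (fst s) (snd s) \<otimes> y) w \<one> \<Longrightarrow>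
      (u, w) \<in> (gp_step V E G \<union> (gp_step V E G)\<inverse>)\<^sup>*"
begin

lemma cancel_left [simp]:
  assumes "x \<in> carrier \<G>" "y \<in> carrier \<G>"
  shows "inv x \<otimes> (x \<otimes> y) = y" "x \<otimes> (inv x \<otimes> y) = y"
  using assms by (simp_all add: m_assoc[symmetric])

lemmas group_simps = m_assoc inv_mult_group

section \<open>Words, parabolic subgroups, links and stars\<close>

definition letter :: "'v \<times> 'a \<Rightarrow> 'g" where "letter s = incl (fst s) (snd s)"

primrec ev :: "('v \<times> 'a) list \<Rightarrow> 'g" where
  "ev [] = \<one>"
| "ev (s # w) = letter s \<otimes> ev w"

definition wd :: "'v set \<Rightarrow> ('v \<times> 'a) list set" where "wd \<Lambda> = fp_words (\<Lambda> \<inter> V) G"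

definition H :: "'v set \<Rightarrow> 'g set" where "H \<Lambda> = ev ` wd \<Lambda>"

definition lk :: "'v set \<Rightarrow> 'v set" where "lk \<Lambda> = {w \<in> V. \<forall>v\<in>\<Lambda>. {v, w} \<in> E}"

definition st :: "'v set \<Rightarrow> 'v set" where "st \<Lambda> = \<Lambda> \<union> lk \<Lambda>"

lemma ev_foldr: "ev w = foldr (\<lambda>s y. incl (fst s) (snd s) \<otimes> y) w \<one>"
  by (induction w) (simp_all add: letter_def)

lemma wd_Nil [simp]: "[] \<in> wd \<Lambda>"
  and wd_Cons [simp]: "(v, g) # w \<in> wd \<Lambda> \<longleftrightarrow> v \<in> \<Lambda> \<and> v \<in> V \<and> g \<in> carrier (G v) \<and> w \<in> wd \<Lambda>"
  and wd_append [simp]: "u @ w \<in> wd \<Lambda> \<longleftrightarrow> u \<in> wd \<Lambda> \<and> w \<in> wd \<Lambda>"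
  by (auto simp: wd_def fp_words_def)

lemma wd_set: "w \<in> wd \<Lambda> \<longleftrightarrow> (\<forall>s\<in>set w. fst s \<in> \<Lambda> \<and> fst s \<in> V \<and> snd s \<in> carrier (G (fst s)))"
  unfolding wd_def fp_words_def by auto

lemma wd_mono: "w \<in> wd \<Lambda> \<Longrightarrow> \<Lambda> \<inter> V \<subseteq> \<Omega> \<Longrightarrow> w \<in> wd \<Omega>"
  by (auto simp: wd_set)

lemma wd_V: "wd V = fp_words V G" by (simp add: wd_def)

lemma wd_in_V: "w \<in> wd \<Lambda> \<Longrightarrow> w \<in> wd V"
  by (auto simp: wd_set)

lemma letter_closed [simp]: "v \<in> V \<Longrightarrow> g \<in> carrier (G v) \<Longrightarrow> incl v g \<in> carrier \<G>"
  using incl_hom by (auto simp: hom_def)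

lemma incl_mult: "v \<in> V \<Longrightarrow> g \<in> carrier (G v) \<Longrightarrow> h \<in> carrier (G v) \<Longrightarrow>
    incl v (g \<otimes>\<^bsub>G v\<^esub> h) = incl v g \<otimes> incl v h"
  using incl_hom by (auto simp: hom_def)

lemma incl_one: "v \<in> V \<Longrightarrow> incl v \<one>\<^bsub>G v\<^esub> = \<one>"
  using hom_one[OF incl_hom grp] is_group by blast

lemma incl_inv: "v \<in> V \<Longrightarrow> g \<in> carrier (G v) \<Longrightarrow> incl v (inv\<^bsub>G v\<^esub> g) = inv (incl v g)"
  by (metis (no_types, lifting) group.inv_closed group.l_inv grp incl_mult incl_one inv_equality letter_closed)

lemma ev_closed [simp]: "w \<in> wd \<Lambda> \<Longrightarrow> ev w \<in> carrier \<G>"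
  by (induction w) (auto simp: letter_def)

lemma ev_append: "u \<in> wd \<Lambda> \<Longrightarrow> w \<in> wd \<Omega> \<Longrightarrow> ev (u @ w) = ev u \<otimes> ev w"
  by (induction u) (auto simp: letter_def m_assoc)

lemma ev_surj: "x \<in> carrier \<G> \<Longrightarrow> \<exists>w\<in>wd V. ev w = x"
  using generated by (simp add: ev_foldr wd_V)

text \<open>This is the point where the presentation enters: an invariant of the moves depends only
  on the value of the word. It serves to define gates and to show that vertex groups embed.\<close>

lemma ev_induct:
  assumes "\<And>u w. (u, w) \<in> gp_step V E G \<Longrightarrow> F u = F w"
    and "ev u = ev w" "u \<in> wd V" "w \<in> wd V"
  shows "F u = F w"
proof -
  have "(u, w) \<in> (gp_step V E G \<union> (gp_step V E G)\<inverse>)\<^sup>*"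
    using presented assms(2-4) by (simp add: ev_foldr wd_V)
  then show ?thesis by (induction rule: rtrancl_induct) (use assms(1) in force)+
qed

lemma H_closed [simp]: "x \<in> H \<Lambda> \<Longrightarrow> x \<in> carrier \<G>"
  by (auto simp: H_def)

lemma HI: "w \<in> wd \<Lambda> \<Longrightarrow> ev w \<in> H \<Lambda>" by (simp add: H_def)

lemma HE: assumes "x \<in> H \<Lambda>" obtains w where "w \<in> wd \<Lambda>" "x = ev w"
  using assms by (auto simp: H_def)

lemma one_H [simp]: "\<one> \<in> H \<Lambda>" using HI[of "[]"] by simp

lemma letter_H: "v \<in> \<Lambda> \<Longrightarrow> v \<in> V \<Longrightarrow> g \<in> carrier (G v) \<Longrightarrow> incl v g \<in> H \<Lambda>"
  using HI[of "[(v, g)]" \<Lambda>] by (simp add: letter_def)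

lemma mult_H [simp]: "x \<in> H \<Lambda> \<Longrightarrow> y \<in> H \<Lambda> \<Longrightarrow> x \<otimes> y \<in> H \<Lambda>"
  unfolding H_def by (smt (verit) ev_append image_iff wd_append)

lemma inv_H [simp]: "x \<in> H \<Lambda> \<Longrightarrow> inv x \<in> H \<Lambda>"
proof -
  have "inv (ev w) \<in> H \<Lambda>" if "w \<in> wd \<Lambda>" for w
    using that
  proof (induction w)
    case (Cons s w)
    obtain v g where s: "s = (v, g)" by (cases s)
    have "inv (incl v g) \<in> H \<Lambda>"
      using Cons.prems s letter_H[of v \<Lambda> "inv\<^bsub>G v\<^esub> g"] incl_inv grp group.inv_closed by fastforce
    then show ?case using Cons s by (auto simp: letter_def inv_mult_group)
  qed simp
  then show "x \<in> H \<Lambda> \<Longrightarrow> inv x \<in> H \<Lambda>" by (auto simp: H_def)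
qed

lemma H_mono: "x \<in> H \<Lambda> \<Longrightarrow> \<Lambda> \<inter> V \<subseteq> \<Omega> \<Longrightarrow> x \<in> H \<Omega>"
  by (auto simp: H_def intro: wd_mono)

lemma H_V: "H V = carrier \<G>"
  using ev_surj by (auto simp: H_def)

lemma H_empty: "x \<in> H {} \<Longrightarrow> x = \<one>"
proof (elim HE)
  fix w assume "w \<in> wd {}" "x = ev w" then show "x = \<one>" by (cases w) auto
qed

lemma H_vertexE: assumes "x \<in> H {v}" "v \<in> V" obtains g where "g \<in> carrier (G v)" "x = incl v g"
proof -
  have "\<exists>g\<in>carrier (G v). ev w = incl v g" if "w \<in> wd {v}" for w
    using that
  proof (induction w)
    case Nil
    have "\<one>\<^bsub>G v\<^esub> \<in> carrier (G v)" using grp[OF assms(2)] by (simp add: group.is_monoid monoid.one_closed)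
    then show ?case using incl_one[OF assms(2)] by (metis ev.simps(1))
  next
    case (Cons s w)
    then obtain g h where "s = (v, g)" "g \<in> carrier (G v)" "h \<in> carrier (G v)" "ev w = incl v h"
      by (cases s) auto
    then show ?case using assms(2) incl_mult[of v g h] grp[OF assms(2)]
      by (intro bexI[of _ "g \<otimes>\<^bsub>G v\<^esub> h"]) (auto simp: letter_def group.is_monoid monoid.m_closed)
  qed
  then show ?thesis using assms(1) that by (auto elim!: HE)
qed

lemma lk_subset: "lk \<Lambda> \<subseteq> V" by (auto simp: lk_def)

lemma lk_antimono: "\<Lambda> \<subseteq> \<Omega> \<Longrightarrow> lk \<Omega> \<subseteq> lk \<Lambda>" by (auto simp: lk_def)

lemma lk_irrefl: assumes "v \<in> \<Lambda>" shows "v \<notin> lk \<Lambda>"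
proof
  assume "v \<in> lk \<Lambda>"
  then have "{v, v} \<in> E" using assms by (auto simp: lk_def)
  then show False using simplicial by (auto simp: simplicial_graph_def)
qed

lemma lk_sym: "v \<in> V \<Longrightarrow> w \<in> V \<Longrightarrow> w \<in> lk {v} \<longleftrightarrow> v \<in> lk {w}"
  by (auto simp: lk_def insert_commute)

lemma lk_subset_sym: "\<Lambda> \<subseteq> V \<Longrightarrow> \<Omega> \<subseteq> V \<Longrightarrow> \<Lambda> \<subseteq> lk \<Omega> \<Longrightarrow> \<Omega> \<subseteq> lk \<Lambda>"
  by (smt (verit) insert_commute lk_def mem_Collect_eq subset_iff)

lemma H_commute: assumes "x \<in> H \<Lambda>" "y \<in> H (lk \<Lambda>)" shows "x \<otimes> y = y \<otimes> x"
proof -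
  have 1: "incl v g \<otimes> ev w = ev w \<otimes> incl v g"
    if "w \<in> wd (lk \<Lambda>)" "v \<in> \<Lambda>" "v \<in> V" "g \<in> carrier (G v)" for v g w
    using that(1)
  proof (induction w)
    case (Cons s w)
    obtain u h where s: "s = (u, h)" by (cases s)
    with Cons.prems that have E: "{v, u} \<in> E" "u \<in> V" "h \<in> carrier (G u)" "w \<in> wd (lk \<Lambda>)"
      by (auto simp: lk_def)
    have "incl v g \<otimes> (incl u h \<otimes> ev w) = incl u h \<otimes> (incl v g \<otimes> ev w)"
      using incl_commute[OF E(1) that(4) E(3)] that E by (simp add: m_assoc[symmetric])
    also have "\<dots> = (incl u h \<otimes> ev w) \<otimes> incl v g"
      using Cons.IH that E by (simp add: m_assoc)
    finally show ?case by (simp add: s letter_def)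
  qed (use that in simp)
  obtain w where w: "w \<in> wd (lk \<Lambda>)" "y = ev w" using assms(2) by (elim HE)
  have "ev u \<otimes> ev w = ev w \<otimes> ev u" if "u \<in> wd \<Lambda>" for u
    using that
  proof (induction u)
    case (Cons s u)
    obtain v g where s: "s = (v, g)" by (cases s)
    have v: "v \<in> \<Lambda>" "v \<in> V" "g \<in> carrier (G v)" "u \<in> wd \<Lambda>" using Cons.prems s by auto
    have "incl v g \<otimes> ev u \<otimes> ev w = incl v g \<otimes> ev w \<otimes> ev u"
      using Cons.IH v w by (simp add: m_assoc)
    then show ?case using 1[OF w(1) v(1-3)] v w by (simp add: s letter_def m_assoc)
  qed (use w in simp)
  then show ?thesis using assms(1) w by (auto elim: HE)
qed

text \<open>Letters with types in the link commute with \<open>H \<Lambda>\<close>, so they can be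
  collected on the right.\<close>

lemma H_stE: assumes "x \<in> H (st \<Lambda>)" obtains l k where "l \<in> H \<Lambda>" "k \<in> H (lk \<Lambda>)" "x = l \<otimes> k"
proof -
  have "\<exists>l\<in>H \<Lambda>. \<exists>k\<in>H (lk \<Lambda>). ev w = l \<otimes> k" if "w \<in> wd (st \<Lambda>)" for w
    using that
  proof (induction w)
    case Nil show ?case using one_H by (intro bexI[of _ \<one>]) auto
  next
    case (Cons s w)
    obtain v g where s: "s = (v, g)" by (cases s)
    have v: "v \<in> st \<Lambda>" "v \<in> V" "g \<in> carrier (G v)" using Cons.prems s by auto
    obtain l k where lk: "l \<in> H \<Lambda>" "k \<in> H (lk \<Lambda>)" "ev w = l \<otimes> k" using Cons s by auto
    show ?case
    proof (cases "v \<in> \<Lambda>")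
      case True
      then have "incl v g \<otimes> l \<in> H \<Lambda>" "ev (s # w) = (incl v g \<otimes> l) \<otimes> k"
        using lk v letter_H[of v \<Lambda> g] by (auto simp: s letter_def m_assoc)
      then show ?thesis using lk by blast
    next
      case False
      then have g: "incl v g \<in> H (lk \<Lambda>)" using v letter_H[of v "lk \<Lambda>" g] by (auto simp: st_def)
      have "ev (s # w) = incl v g \<otimes> l \<otimes> k" using lk v by (simp add: s letter_def m_assoc)
      also have "\<dots> = l \<otimes> (incl v g \<otimes> k)" using H_commute[OF lk(1) g] lk v by (simp add: m_assoc[symmetric])
      finally show ?thesis using lk g by (intro bexI[of _ l] bexI[of _ "incl v g \<otimes> k"]) auto
    qed
  qed
  then show ?thesis using assms that by (metis HE)
qed

lemma H_st: "x \<in> H \<Lambda> \<Longrightarrow> x \<in> H (st \<Lambda>)" and H_lk_st: "x \<in> H (lk \<Lambda>) \<Longrightarrow> x \<in> H (st \<Lambda>)"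
  by (auto elim!: H_mono simp: st_def)

text \<open>For \<open>v \<in> \<Lambda>\<close>, \<open>near \<Lambda> v x\<close> says that the wall of type \<open>v\<close> at \<open>x\<close> crosses \<open>H \<Lambda>\<close>.\<close>

definition near :: "'v set \<Rightarrow> 'v \<Rightarrow> 'g \<Rightarrow> bool" where
  "near \<Lambda> v x \<longleftrightarrow> (\<exists>l\<in>H \<Lambda>. inv l \<otimes> x \<in> H (lk {v}))"

text \<open>\<open>x\<close> is the value of the prefix already read, so that the next letter
  crosses the wall of its type at \<open>x\<close>.\<close>

primrec gate_word :: "('v \<times> 'a) list \<Rightarrow> 'v set \<Rightarrow> 'g \<Rightarrow> 'g" where
  "gate_word [] \<Lambda> x = \<one>"
| "gate_word (s # w) \<Lambda> x =
    (if fst s \<in> \<Lambda> \<and> near \<Lambda> (fst s) x then letter s else \<one>) \<otimes> gate_word w \<Lambda> (x \<otimes> letter s)"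

text \<open>The letters that the gate discards. They spell the remainder of the element after its
  gate (\<open>rest_word_ev\<close>), which is how gates are related to word length.\<close>

primrec rest_word :: "('v \<times> 'a) list \<Rightarrow> 'v set \<Rightarrow> 'g \<Rightarrow> ('v \<times> 'a) list" where
  "rest_word [] \<Lambda> x = []"
| "rest_word (s # w) \<Lambda> x =
    (if fst s \<in> \<Lambda> \<and> near \<Lambda> (fst s) x then [] else [s]) @ rest_word w \<Lambda> (x \<otimes> letter s)"

text \<open>The factor of \<open>inv l \<otimes> x\<close> in \<open>H {v}\<close> can be moved into
  \<open>l\<close>, as \<open>v\<close> lies in \<Lambda>. Hence the star may replace the link when
  nearness is to be shown.\<close>

lemma near_stI: assumes "l \<in> H \<Lambda>" "v \<in> \<Lambda>" "x \<in> carrier \<G>" "inv l \<otimes> x \<in> H (st {v})" shows "near \<Lambda> v x"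
proof -
  obtain s k where sk: "s \<in> H {v}" "k \<in> H (lk {v})" "inv l \<otimes> x = s \<otimes> k" using H_stE[OF assms(4)] by blast
  have s: "s \<in> H \<Lambda>" using sk(1) assms(2) by (auto elim: H_mono)
  have "x = l \<otimes> (s \<otimes> k)" using sk(3) assms(1,3) by (metis H_closed cancel_left(2) inv_closed)
  then have "inv (l \<otimes> s) \<otimes> x = k" using assms(1) s sk by (simp add: group_simps)
  then show ?thesis using assms(1) s sk near_def mult_H by metis
qed

text \<open>The wall of type \<open>v\<close> at \<open>x\<close> is the coset of
  \<open>H (st {v})\<close> through \<open>x\<close>, which this multiplication does not
  change.\<close>

lemma near_right:
  assumes "k \<in> H (st {v})" "v \<in> \<Lambda>" "x \<in> carrier \<G>"
  shows "near \<Lambda> v (x \<otimes> k) \<longleftrightarrow> near \<Lambda> v x"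
proof -
  have *: "near \<Lambda> v (y \<otimes> j)" if "near \<Lambda> v y" "j \<in> H (st {v})" "y \<in> carrier \<G>" for y j
  proof -
    obtain l where l: "l \<in> H \<Lambda>" "inv l \<otimes> y \<in> H (lk {v})" using \<open>near \<Lambda> v y\<close> by (auto simp: near_def)
    have "inv l \<otimes> y \<otimes> j \<in> H (st {v})" using mult_H[OF H_lk_st[OF l(2)] that(2)] by simp
    then show ?thesis using l that assms(2) by (intro near_stI[of l]) (auto simp: m_assoc)
  qed
  from *[of x k] *[of "x \<otimes> k" "inv k"] assms show ?thesis by (auto simp: m_assoc)
qed

text \<open>A factor in \<open>H \<Lambda>\<close> is absorbed by the witness \<open>l\<close>. A
  factor in \<open>H (lk \<Lambda>)\<close> commutes with \<open>l\<close> and lies in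
  \<open>H (lk {v})\<close>, so it is absorbed on the other side.\<close>

lemma near_left:
  assumes "k \<in> H (st \<Lambda>)" "v \<in> \<Lambda>" "x \<in> carrier \<G>"
  shows "near \<Lambda> v (k \<otimes> x) \<longleftrightarrow> near \<Lambda> v x"
proof -
  have *: "near \<Lambda> v (j \<otimes> y)" if near: "near \<Lambda> v y" and j: "j \<in> H (st \<Lambda>)" and y: "y \<in> carrier \<G>" for y j
  proof -
    obtain m c where mc: "m \<in> H \<Lambda>" "c \<in> H (lk \<Lambda>)" "j = m \<otimes> c" using H_stE[OF j] by blast
    obtain l where l: "l \<in> H \<Lambda>" "inv l \<otimes> y \<in> H (lk {v})" using near by (auto simp: near_def)
    have c: "c \<in> H (lk {v})" using mc(2) lk_antimono[of "{v}" \<Lambda>] assms(2) by (auto elim: H_mono)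
    have "inv (m \<otimes> l) \<otimes> (j \<otimes> y) = inv l \<otimes> (c \<otimes> y)" using mc l y by (simp add: group_simps)
    also have "\<dots> = c \<otimes> (inv l \<otimes> y)"
      using H_commute[of "inv l" \<Lambda> c] l mc y by (simp add: m_assoc[symmetric])
    finally show ?thesis using c l mc mult_H near_def by metis
  qed
  from *[of x k] *[of "k \<otimes> x" "inv k"] assms show ?thesis by auto
qed

lemma near_mono: "near \<Lambda> v x \<Longrightarrow> \<Lambda> \<subseteq> \<Omega> \<Longrightarrow> near \<Omega> v x"
  unfolding near_def by (meson H_mono inf.coboundedI1)

section \<open>Gates are well defined; first properties\<close>

lemma gate_word_closed [simp]: "w \<in> wd \<Delta> \<Longrightarrow> gate_word w \<Lambda> x \<in> carrier \<G>"
  by (induction w arbitrary: x) (auto simp: letter_def)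

lemma gate_word_append:
  "u \<in> wd \<Delta> \<Longrightarrow> w \<in> wd \<Delta>' \<Longrightarrow> x \<in> carrier \<G> \<Longrightarrow>
    gate_word (u @ w) \<Lambda> x = gate_word u \<Lambda> x \<otimes> gate_word w \<Lambda> (x \<otimes> ev u)"
  by (induction u arbitrary: x) (auto simp: letter_def m_assoc)

lemma rest_word_append:
  "u \<in> wd \<Delta> \<Longrightarrow> w \<in> wd \<Delta>' \<Longrightarrow> x \<in> carrier \<G> \<Longrightarrow>
    rest_word (u @ w) \<Lambda> x = rest_word u \<Lambda> x @ rest_word w \<Lambda> (x \<otimes> ev u)"
  by (induction u arbitrary: x) (auto simp: letter_def m_assoc)

text \<open>Two adjacent letters of the same type cross the same wall, so they are both kept or both
  discarded. A letter whose type is adjacent to \<open>v\<close> stays on the carrier of the wall of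
  type \<open>v\<close>, so exchanging commuting letters changes no decision. Both facts are
  instances of \<open>near_right\<close>.\<close>

lemma gate_word_cong:
  assumes "ev u = ev w" "u \<in> wd V" "w \<in> wd V"
  shows "gate_word u \<Lambda> \<one> = gate_word w \<Lambda> \<one>"
proof (rule ev_induct[OF _ assms])
  have ctx: "gate_word (u @ m @ t) \<Lambda> \<one> = gate_word (u @ m' @ t) \<Lambda> \<one>"
    if "u \<in> wd V" "t \<in> wd V" "m \<in> wd V" "m' \<in> wd V" "ev m = ev m'"
      "gate_word m \<Lambda> (ev u) = gate_word m' \<Lambda> (ev u)" for u t m m'
    using that by (simp add: gate_word_append[of _ V _ V])
  fix u w assume "(u, w) \<in> gp_step V E G"
  then show "gate_word u \<Lambda> \<one> = gate_word w \<Lambda> \<one>"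
  proof cases
    case free
    then show ?thesis
    proof cases
      case (delete_one u t v)
      then show ?thesis
        using ctx[of u t "[(v, \<one>\<^bsub>G v\<^esub>)]" "[]"] grp[of v]
        by (auto simp: wd_V[symmetric] letter_def incl_one group.is_monoid monoid.one_closed)
    next
      case (multiply u t v g h)
      have gh: "g \<otimes>\<^bsub>G v\<^esub> h \<in> carrier (G v)"
        using multiply grp by (simp add: group.is_monoid monoid.m_closed)
      have "near \<Lambda> v (ev u \<otimes> incl v g) \<longleftrightarrow> near \<Lambda> v (ev u)" if "v \<in> \<Lambda>"
        using that multiply letter_H[of v "st {v}" g]
        by (intro near_right) (auto simp: wd_V[symmetric] st_def)
      then show ?thesis unfolding multiply(1,2) using multiply gh
        by (intro ctx) (auto simp: wd_V[symmetric] letter_def incl_mult m_assoc)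
    qed
  next
    case (commute u t v w g h)
    have vw: "v \<in> V" "w \<in> V" "v \<in> lk {w}" "w \<in> lk {v}"
      using simplicial commute(5) by (auto simp: simplicial_graph_def lk_def insert_commute)
    have n: "near \<Lambda> v (ev u \<otimes> incl w h) \<longleftrightarrow> near \<Lambda> v (ev u)" if "v \<in> \<Lambda>"
      using that commute vw letter_H[of w "st {v}" h]
      by (intro near_right) (auto simp: wd_V[symmetric] st_def)
    have n': "near \<Lambda> w (ev u \<otimes> incl v g) \<longleftrightarrow> near \<Lambda> w (ev u)" if "w \<in> \<Lambda>"
      using that commute vw letter_H[of v "st {w}" g]
      by (intro near_right) (auto simp: wd_V[symmetric] st_def)
    show ?thesis unfolding commute(1,2) using commute vw n n' incl_commute[OF commute(5-7)]
      by (intro ctx) (auto simp: wd_V[symmetric] letter_def)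
  qed
qed

text \<open>The closest point projection to \<open>H \<Lambda>\<close>; by \<open>gate_ev\<close> the choice of the word is irrelevant.\<close>

definition gate :: "'v set \<Rightarrow> 'g \<Rightarrow> 'g" where
  "gate \<Lambda> x = gate_word (SOME w. w \<in> wd V \<and> ev w = x) \<Lambda> \<one>"

lemma gate_ev: assumes "w \<in> wd \<Delta>" shows "gate \<Lambda> (ev w) = gate_word w \<Lambda> \<one>"
proof -
  define w' where "w' = (SOME w'. w' \<in> wd V \<and> ev w' = ev w)"
  have "w' \<in> wd V \<and> ev w' = ev w" unfolding w'_def by (rule someI[of _ w]) (use assms wd_in_V in auto)
  then show ?thesis using assms wd_in_V gate_word_cong unfolding gate_def w'_def by blast
qed

lemma gate_mult_ev:
  assumes "x \<in> carrier \<G>" "w \<in> wd \<Delta>"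
  shows "gate \<Lambda> (x \<otimes> ev w) = gate \<Lambda> x \<otimes> gate_word w \<Lambda> x"
proof -
  obtain u where u: "u \<in> wd V" "x = ev u" using ev_surj assms(1) by blast
  have "gate \<Lambda> (x \<otimes> ev w) = gate \<Lambda> (ev (u @ w))" using u assms by (simp add: ev_append)
  also have "\<dots> = gate_word u \<Lambda> \<one> \<otimes> gate_word w \<Lambda> x"
    using u assms wd_in_V[of w \<Delta>] gate_ev[of "u @ w" V] by (simp add: gate_word_append[of _ V _ V])
  finally show ?thesis using u gate_ev by simp
qed

text \<open>A letter is kept only if its wall meets both the coset \<open>x H \<Delta>\<close> and
  \<open>H \<Lambda>\<close>. Recording the possible types is the point: when a type of \<Lambda>
  does not occur among them, the gate moves inside a proper parabolic subgroup, and this bounds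
  projections later.\<close>

lemma gate_word_H:
  "w \<in> wd \<Delta> \<Longrightarrow> x \<in> carrier \<G> \<Longrightarrow>
    gate_word w \<Lambda> x \<in> H {v \<in> \<Lambda> \<inter> \<Delta>. \<exists>k\<in>H \<Delta>. near \<Lambda> v (x \<otimes> k)}"
proof (induction w arbitrary: x)
  case (Cons s w)
  obtain v g where s: "s = (v, g)" by (cases s)
  have v: "v \<in> \<Delta>" "v \<in> V" "g \<in> carrier (G v)" "w \<in> wd \<Delta>" using Cons.prems s by auto
  let ?D = "\<lambda>x. {v \<in> \<Lambda> \<inter> \<Delta>. \<exists>k\<in>H \<Delta>. near \<Lambda> v (x \<otimes> k)}"
  have g: "incl v g \<in> H \<Delta>" using v by (intro letter_H)
  have "incl v g \<in> H (?D x)" if "v \<in> \<Lambda>" "near \<Lambda> v x"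
    using that v Cons.prems by (intro letter_H) (auto intro!: bexI[of _ \<one>])
  moreover have "gate_word w \<Lambda> (x \<otimes> incl v g) \<in> H (?D (x \<otimes> incl v g))"
    using Cons.IH v Cons.prems by simp
  then have "gate_word w \<Lambda> (x \<otimes> incl v g) \<in> H (?D x)"
  proof (rule H_mono)
    have "\<exists>k\<in>H \<Delta>. near \<Lambda> u (x \<otimes> k)" if "k \<in> H \<Delta>" "near \<Lambda> u (x \<otimes> incl v g \<otimes> k)" for u k
      using that g Cons.prems v by (intro bexI[of _ "incl v g \<otimes> k"]) (auto simp: m_assoc)
    then show "?D (x \<otimes> incl v g) \<inter> V \<subseteq> ?D x" by blast
  qed
  ultimately show ?case by (auto simp: s letter_def)
qed simp

lemma gate_mult_H:
  assumes "x \<in> carrier \<G>" "y \<in> H \<Delta>"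
  obtains m where "m \<in> H {v \<in> \<Lambda> \<inter> \<Delta>. \<exists>k\<in>H \<Delta>. near \<Lambda> v (x \<otimes> k)}" "gate \<Lambda> (x \<otimes> y) = gate \<Lambda> x \<otimes> m"
proof -
  obtain w where w: "w \<in> wd \<Delta>" "y = ev w" using assms(2) by (elim HE)
  show ?thesis
    by (rule that[OF gate_word_H[OF w(1) assms(1)]]) (simp add: w gate_mult_ev[OF assms(1) w(1)])
qed

lemma gate_one [simp]: "gate \<Lambda> \<one> = \<one>"
  using gate_ev[of "[]" V] by simp

text \<open>Reading from \<one>, only letters with types in both sets are kept. With
  \<open>gate_id\<close> this shows that the intersection of two parabolic subgroups belongs to the
  intersection of their types.\<close>

lemma gate_H_Int: "y \<in> H \<Delta> \<Longrightarrow> gate \<Lambda> y \<in> H (\<Lambda> \<inter> \<Delta>)"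
proof -
  assume y: "y \<in> H \<Delta>"
  obtain m where "m \<in> H {v \<in> \<Lambda> \<inter> \<Delta>. \<exists>k\<in>H \<Delta>. near \<Lambda> v (\<one> \<otimes> k)}" "gate \<Lambda> (\<one> \<otimes> y) = gate \<Lambda> \<one> \<otimes> m"
    using gate_mult_H[OF one_closed y, of \<Lambda>] .
  then show ?thesis using y H_mono[of m _ "\<Lambda> \<inter> \<Delta>"] by auto
qed

lemma gate_H [simp]: "x \<in> carrier \<G> \<Longrightarrow> gate \<Lambda> x \<in> H \<Lambda>"
  using gate_H_Int[of x V \<Lambda>] H_mono[of "gate \<Lambda> x" "\<Lambda> \<inter> V" \<Lambda>] by (auto simp: H_V)

lemma gate_closed [simp]: "x \<in> carrier \<G> \<Longrightarrow> gate \<Lambda> x \<in> carrier \<G>"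
  using gate_H H_closed by blast

text \<open>By \<open>near_left\<close> a word for \<open>x\<close> has the same letters kept
  whether it is read from \<one> or from \<open>k\<close>.\<close>

lemma gate_left:
  assumes "k \<in> H (st \<Lambda>)" "x \<in> carrier \<G>"
  shows "gate \<Lambda> (k \<otimes> x) = gate \<Lambda> k \<otimes> gate \<Lambda> x"
proof -
  obtain w where w: "w \<in> wd V" "x = ev w" using ev_surj assms(2) by blast
  have k: "k \<in> carrier \<G>" using assms(1) by simp
  have "gate_word w \<Lambda> (k \<otimes> y) = gate_word w \<Lambda> y" if "w \<in> wd V" "y \<in> carrier \<G>" for w y
    using that by (induction w arbitrary: y) (auto simp: letter_def near_left[OF assms(1)] k m_assoc)
  from this[of w \<one>] show ?thesis
    using gate_mult_ev[of k w V \<Lambda>] w assms gate_ev[of w V] by simp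
qed

lemma gate_id: "x \<in> H \<Lambda> \<Longrightarrow> gate \<Lambda> x = x"
proof (elim HE)
  have near: "near \<Lambda> v y" if "y \<in> H \<Lambda>" for v y
    unfolding near_def using that by (intro bexI[of _ y]) auto
  have "gate_word w \<Lambda> y = ev w" if "w \<in> wd \<Lambda>" "y \<in> H \<Lambda>" for w y
    using that by (induction w arbitrary: y) (auto simp: letter_def near letter_H)
  then show "gate \<Lambda> x = x" if "w \<in> wd \<Lambda>" "x = ev w" for w
    using that gate_ev[of w \<Lambda>] by simp
qed

lemma gate_lk: "x \<in> H (lk \<Lambda>) \<Longrightarrow> gate \<Lambda> x = \<one>"
  using gate_H_Int[of x "lk \<Lambda>" \<Lambda>] lk_irrefl H_empty
  by (metis disjoint_iff)

lemma gate_left_H: "k \<in> H \<Lambda> \<Longrightarrow> x \<in> carrier \<G> \<Longrightarrow> gate \<Lambda> (k \<otimes> x) = k \<otimes> gate \<Lambda> x"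
  by (simp add: gate_left H_st gate_id)

lemma gate_inv_st: "k \<in> H (st \<Lambda>) \<Longrightarrow> gate \<Lambda> (inv k) = inv (gate \<Lambda> k)"
  using gate_left[of k \<Lambda> "inv k"] by (metis H_closed gate_closed gate_one inv_closed inv_equality inv_inv r_inv inv_H)

text \<open>Write \<open>x\<close> as \<open>l \<otimes> k\<close> with \<open>k\<close> in
  \<open>H (lk {v})\<close>. Since \<open>l\<close> can be pulled out of the gate, the remainder of
  \<open>x\<close> is that of \<open>k\<close>, and the gate of \<open>k\<close> stays in
  \<open>H (lk {v})\<close> by \<open>gate_H_Int\<close>.\<close>

lemma near_gate:
  assumes "x \<in> carrier \<G>" "v \<in> \<Lambda>" "near \<Lambda> v x"
  shows "inv (gate \<Lambda> x) \<otimes> x \<in> H (lk {v})"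
proof -
  obtain l where l: "l \<in> H \<Lambda>" "inv l \<otimes> x \<in> H (lk {v})" using assms(3) by (auto simp: near_def)
  define k where "k = inv l \<otimes> x"
  have k: "k \<in> H (lk {v})" "x = l \<otimes> k" using l assms(1) by (simp_all add: k_def)
  have "gate \<Lambda> k \<in> H (lk {v})" by (rule H_mono[OF gate_H_Int[OF k(1)]]) auto
  moreover have "inv (gate \<Lambda> x) \<otimes> x = inv (gate \<Lambda> k) \<otimes> k"
    using k l by (simp add: gate_left_H group_simps)
  ultimately show ?thesis using k by simp
qed

lemma near_gate_iff:
  assumes "x \<in> carrier \<G>" "v \<in> \<Lambda>" "\<Lambda> \<subseteq> \<Omega>" "near \<Omega> v x"
  shows "near \<Lambda> v (gate \<Omega> x) \<longleftrightarrow> near \<Lambda> v x"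
proof -
  have "inv (gate \<Omega> x) \<otimes> x \<in> H (st {v})" using near_gate assms by (intro H_lk_st) auto
  from near_right[OF this assms(2), of "gate \<Omega> x"] show ?thesis using assms(1) by simp
qed

lemma gate_snoc:
  assumes "x \<in> carrier \<G>" "v \<in> V" "g \<in> carrier (G v)"
  shows "gate \<Lambda> (x \<otimes> incl v g) = gate \<Lambda> x \<otimes> (if v \<in> \<Lambda> \<and> near \<Lambda> v x then incl v g else \<one>)"
  using gate_mult_ev[OF assms(1), of "[(v, g)]" V \<Lambda>] assms by (auto simp: letter_def)

text \<open>Read a word letter by letter. A letter whose wall crosses \<open>H \<Lambda>\<close>
  also crosses the larger \<open>H \<Omega>\<close>, and for a letter kept by the larger gate
  nearness to \<Lambda> may be tested at the gate instead of at \<open>x\<close>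
  (\<open>near_gate_iff\<close>).\<close>

lemma gate_gate: assumes "\<Lambda> \<subseteq> \<Omega>" "x \<in> carrier \<G>" shows "gate \<Lambda> (gate \<Omega> x) = gate \<Lambda> x"
proof -
  have "gate \<Lambda> (gate \<Omega> (ev w)) = gate \<Lambda> (ev w)" if "w \<in> wd V" for w
    using that
  proof (induction w rule: rev_induct)
    case (snoc s w)
    obtain v g where s: "s = (v, g)" by (cases s)
    have v: "v \<in> V" "g \<in> carrier (G v)" "w \<in> wd V" using snoc.prems s by auto
    have ev: "ev (w @ [s]) = ev w \<otimes> incl v g"
      using v ev_append[of w V "[s]" V] by (simp add: s letter_def)
    define x where "x = ev w"
    have x: "x \<in> carrier \<G>" "gate \<Lambda> (gate \<Omega> x) = gate \<Lambda> x" using snoc.IH v by (simp_all add: x_def)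
    show ?case
    proof (cases "v \<in> \<Omega> \<and> near \<Omega> v x")
      case True
      then have "v \<in> \<Lambda> \<Longrightarrow> near \<Lambda> v (gate \<Omega> x) \<longleftrightarrow> near \<Lambda> v x"
        using near_gate_iff[OF x(1) _ assms(1)] by blast
      then show ?thesis using True x v by (auto simp: ev x_def[symmetric] gate_snoc)
    next
      case False
      then have "\<not> (v \<in> \<Lambda> \<and> near \<Lambda> v x)" using near_mono[OF _ assms(1)] assms(1) by blast
      with False have "gate \<Omega> (x \<otimes> incl v g) = gate \<Omega> x" "gate \<Lambda> (x \<otimes> incl v g) = gate \<Lambda> x"
        using x(1) v by (auto simp: gate_snoc)
      then show ?thesis using x by (simp add: ev x_def[symmetric])
    qed
  qed simp
  then show ?thesis using ev_surj assms(2) by blast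
qed

subsection \<open>Word length\<close>

definition len :: "'g \<Rightarrow> nat" where
  "len x = (LEAST n. \<exists>w\<in>wd V. ev w = x \<and> length w = n)"

lemma len_word: "x \<in> carrier \<G> \<Longrightarrow> \<exists>w\<in>wd V. ev w = x \<and> length w = len x"
  unfolding len_def by (rule LeastI_ex) (use ev_surj in blast)

lemma len_le: "w \<in> wd V \<Longrightarrow> len (ev w) \<le> length w"
  unfolding len_def by (rule Least_le) blast

lemma rest_word_wd: "w \<in> wd \<Delta> \<Longrightarrow> rest_word w \<Lambda> x \<in> wd \<Delta>"
proof (induction w arbitrary: x)
  case (Cons s w)
  then show ?case by (cases s) simp
qed simp

text \<open>When a letter is kept, the remainder collected so far lies in \<open>H (lk {v})\<close>
  by \<open>near_gate\<close>. It commutes with the letter, which can thus pass to the gate at the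
  front.\<close>

lemma rest_word_ev:
  assumes "w \<in> wd V" shows "ev (rest_word w \<Lambda> \<one>) = inv (gate \<Lambda> (ev w)) \<otimes> ev w"
  using assms
proof (induction w rule: rev_induct)
  case (snoc s w)
  obtain v g where s: "s = (v, g)" by (cases s)
  have v: "v \<in> V" "g \<in> carrier (G v)" "w \<in> wd V" using snoc.prems s by auto
  have ev: "ev (w @ [s]) = ev w \<otimes> incl v g"
    using v ev_append[of w V "[s]" V] by (simp add: s letter_def)
  have IH: "ev (rest_word w \<Lambda> \<one>) = inv (gate \<Lambda> (ev w)) \<otimes> ev w" using snoc.IH v by simp
  have rw: "rest_word (w @ [s]) \<Lambda> \<one> = rest_word w \<Lambda> \<one> @ (if v \<in> \<Lambda> \<and> near \<Lambda> v (ev w) then [] else [s])"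
    using v rest_word_append[of w V "[s]" V \<one>] by (simp add: s)
  show ?case
  proof (cases "v \<in> \<Lambda> \<and> near \<Lambda> v (ev w)")
    case True
    define b where "b = inv (gate \<Lambda> (ev w)) \<otimes> ev w"
    have b: "b \<in> H (lk {v})" using near_gate True v by (simp add: b_def)
    have c: "incl v g \<otimes> b = b \<otimes> incl v g" using H_commute[OF letter_H[of v "{v}" g] b] v by simp
    have "inv (gate \<Lambda> (ev w) \<otimes> incl v g) \<otimes> (ev w \<otimes> incl v g) = inv (incl v g) \<otimes> (b \<otimes> incl v g)"
      using v by (simp add: b_def group_simps)
    also have "\<dots> = b" using b v by (simp add: c[symmetric])
    finally show ?thesis using True v IH unfolding ev rw by (simp add: gate_snoc b_def)
  next
    case False
    then have "ev (rest_word w \<Lambda> \<one> @ [s]) = inv (gate \<Lambda> (ev w)) \<otimes> ev w \<otimes> incl v g"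
      using v IH rest_word_wd[of w V] ev_append[of _ V "[s]" V] by (simp add: s letter_def)
    with False show ?thesis using v unfolding ev rw by (auto simp: gate_snoc m_assoc)
  qed
qed simp

lemma rest_word_length: "gate_word w \<Lambda> x \<noteq> \<one> \<Longrightarrow> length (rest_word w \<Lambda> x) < length w"
proof (induction w arbitrary: x)
  case (Cons s w)
  have le: "length (rest_word w \<Lambda> y) \<le> length w" for y
    by (induction w arbitrary: y) (auto intro: le_SucI)
  show ?case
  proof (cases "fst s \<in> \<Lambda> \<and> near \<Lambda> (fst s) x")
    case True then show ?thesis using le[of "x \<otimes> letter s"] by simp
  next
    case False
    then have "gate_word w \<Lambda> (x \<otimes> letter s) \<noteq> \<one>" using Cons.prems by auto
    with Cons.IH False show ?thesis by auto
  qed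
qed simp

text \<open>A non-trivial gate takes at least one letter out of a shortest word. This is the
  decreasing measure of all later inductions on \<open>len\<close>.\<close>

lemma len_gate:
  assumes "x \<in> carrier \<G>" "gate \<Lambda> x \<noteq> \<one>" shows "len (inv (gate \<Lambda> x) \<otimes> x) < len x"
proof -
  obtain w where w: "w \<in> wd V" "ev w = x" "length w = len x" using len_word assms(1) by blast
  have "len (inv (gate \<Lambda> x) \<otimes> x) \<le> length (rest_word w \<Lambda> \<one>)"
    using len_le[OF rest_word_wd[OF w(1)]] rest_word_ev[OF w(1)] w(2) by metis
  also have "\<dots> < length w" using assms(2) w gate_ev[OF w(1)] by (intro rest_word_length) auto
  finally show ?thesis using w by simp
qed

text \<open>If the first letter of a shortest word were invisible to the gate of its vertex group, it
  would cancel against the gate of the remainder.\<close>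

lemma gate_nontrivial:
  assumes "x \<in> carrier \<G>" "x \<noteq> \<one>" obtains v where "v \<in> V" "gate {v} x \<noteq> \<one>"
proof -
  obtain w where w: "w \<in> wd V" "ev w = x" "length w = len x" using len_word assms(1) by blast
  then obtain v g w' where s: "w = (v, g) # w'" using assms(2) by (cases w) auto
  define y where "y = ev w'"
  have v: "v \<in> V" "g \<in> carrier (G v)" "w' \<in> wd V" "y \<in> carrier \<G>" "x = incl v g \<otimes> y"
    using w s by (auto simp: y_def letter_def)
  have g: "incl v g \<in> H {v}" using v by (intro letter_H) auto
  have "gate {v} x \<noteq> \<one>"
  proof
    assume one: "gate {v} x = \<one>"
    have "incl v g \<otimes> gate {v} y = \<one>" using one g v by (simp add: gate_left_H)
    then have gy: "gate {v} y = inv (incl v g)"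
      using v by (metis gate_closed inv_comm inv_equality letter_closed)
    have ly: "len y < len x" using len_le[OF v(3)] w(3) s by (simp add: y_def)
    show False
    proof (cases "gate {v} y = \<one>")
      case True
      then have "incl v g = \<one>" using gy v by (metis inv_inv inv_one letter_closed)
      then show False using ly v by simp
    next
      case False
      from len_gate[OF v(4) this] show False using ly gy v by simp
    qed
  qed
  then show ?thesis using that v by blast
qed

lemma gate_vertex_in: assumes "x \<in> H \<Delta>" "gate {v} x \<noteq> \<one>" shows "v \<in> \<Delta>"
  using gate_H_Int[OF assms(1), of "{v}"] assms(2) H_empty by (cases "v \<in> \<Delta>") auto

lemma inv_ev: "w \<in> wd V \<Longrightarrow> \<exists>u\<in>wd V. ev u = inv (ev w) \<and> length u = length w"
proof (induction w)
  case (Cons s w)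
  obtain v g where s: "s = (v, g)" by (cases s)
  then obtain u where u: "u \<in> wd V" "ev u = inv (ev w)" "length u = length w" using Cons by auto
  have v: "v \<in> V" "g \<in> carrier (G v)" "w \<in> wd V" "inv\<^bsub>G v\<^esub> g \<in> carrier (G v)"
    using Cons.prems s grp group.inv_closed by fastforce+
  show ?case
    using u v by (intro bexI[of _ "u @ [(v, inv\<^bsub>G v\<^esub> g)]"])
      (auto simp: s letter_def ev_append[of _ V _ V] incl_inv inv_mult_group)
qed (auto intro: bexI[of _ "[]"])

lemma len_inv: assumes "x \<in> carrier \<G>" shows "len (inv x) = len x"
proof -
  have "len (inv x) \<le> len x" if "x \<in> carrier \<G>" for x
    using len_word[OF that] inv_ev len_le by metis
  from this[OF assms] this[of "inv x"] show ?thesis using assms by simp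
qed

subsection \<open>Walls and betweenness\<close>

text \<open>The walls of type \<open>v\<close> are the cosets \<open>g H (st {v})\<close>, and \<open>sector g v x\<close> tells on which
  side of the wall of \<open>g\<close> the point \<open>x\<close> lies.\<close>

definition sector :: "'g \<Rightarrow> 'v \<Rightarrow> 'g \<Rightarrow> 'g" where
  "sector g v x = gate {v} (inv g \<otimes> x)"

text \<open>This plays the part of the geodesic interval in the quasi-median geometry of the graph
  product. A wall has one side for each element of the vertex group, hence a two-element set of
  sides instead of a comparison of half-spaces.\<close>

definition between :: "'g \<Rightarrow> 'g \<Rightarrow> 'g \<Rightarrow> bool" where
  "between x p y \<longleftrightarrow> (\<forall>g\<in>carrier \<G>. \<forall>v\<in>V. sector g v p \<in> {sector g v x, sector g v y})"

lemma between_refl [simp]: "between x x y" "between x y y" by (auto simp: between_def)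

lemma between_trans: "between x p y \<Longrightarrow> between p q y \<Longrightarrow> between x q y"
  unfolding between_def by fastforce

lemma sector_left:
  "g \<in> carrier \<G> \<Longrightarrow> h \<in> carrier \<G> \<Longrightarrow> x \<in> carrier \<G> \<Longrightarrow> sector g v (h \<otimes> x) = sector (inv h \<otimes> g) v x"
  by (simp add: sector_def group_simps)

lemma between_left:
  assumes "between x p y" "h \<in> carrier \<G>" "x \<in> carrier \<G>" "p \<in> carrier \<G>" "y \<in> carrier \<G>"
  shows "between (h \<otimes> x) (h \<otimes> p) (h \<otimes> y)"
  using assms unfolding between_def by (simp add: sector_left)

text \<open>If the gate on \<open>H {v}\<close> changes along a coset of \<open>H \<Delta>\<close>,
  some letter was kept on the way; by \<open>gate_mult_H\<close> its type lies in \<Delta> and its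
  wall meets the coset.\<close>

lemma sector_move:
  assumes "g \<in> carrier \<G>" "x \<in> carrier \<G>" "y \<in> H \<Delta>" "sector g v (x \<otimes> y) \<noteq> sector g v x"
  shows "v \<in> \<Delta> \<and> (\<exists>k\<in>H \<Delta>. inv g \<otimes> x \<otimes> k \<in> H (st {v}))"
proof -
  have gx: "inv g \<otimes> x \<in> carrier \<G>" using assms by simp
  obtain m where m: "m \<in> H {u \<in> {v} \<inter> \<Delta>. \<exists>k\<in>H \<Delta>. near {v} u (inv g \<otimes> x \<otimes> k)}"
    "gate {v} (inv g \<otimes> x \<otimes> y) = gate {v} (inv g \<otimes> x) \<otimes> m"
    using gate_mult_H[OF gx assms(3), of "{v}"] .
  have "m \<noteq> \<one>" using m assms gx by (auto simp: sector_def m_assoc)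
  then have "{u \<in> {v} \<inter> \<Delta>. \<exists>k\<in>H \<Delta>. near {v} u (inv g \<otimes> x \<otimes> k)} \<noteq> {}" using m H_empty by metis
  then obtain k where k: "v \<in> \<Delta>" "k \<in> H \<Delta>" "near {v} v (inv g \<otimes> x \<otimes> k)" by auto
  then obtain l where l: "l \<in> H {v}" "inv l \<otimes> (inv g \<otimes> x \<otimes> k) \<in> H (lk {v})" by (auto simp: near_def)
  have "l \<otimes> (inv l \<otimes> (inv g \<otimes> x \<otimes> k)) \<in> H (st {v})" using mult_H[OF H_st[OF l(1)] H_lk_st[OF l(2)]] .
  then have "inv g \<otimes> x \<otimes> k \<in> H (st {v})" using l k gx by simp
  then show ?thesis using k by blast
qed

text \<open>Another representative of the same wall relabels its sides by a fixed left
  multiplication, so whether two points lie on the same side depends on the wall alone.\<close>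

lemma sector_st:
  assumes "g \<in> carrier \<G>" "k \<in> H (st {v})" "x \<in> carrier \<G>"
  shows "sector (g \<otimes> k) v x = inv (gate {v} k) \<otimes> sector g v x"
  using assms gate_left[of "inv k" "{v}" "inv g \<otimes> x"]
  by (simp add: sector_def group_simps gate_inv_st)

lemma sector_gate:
  assumes "\<omega> \<in> H \<Omega>" "v \<in> \<Omega>" "x \<in> carrier \<G>" shows "sector \<omega> v (gate \<Omega> x) = sector \<omega> v x"
proof -
  have "sector \<omega> v (gate \<Omega> x) = gate {v} (gate \<Omega> (inv \<omega> \<otimes> x))"
    using assms by (simp add: sector_def gate_left_H)
  then show ?thesis using assms gate_gate[of "{v}" \<Omega> "inv \<omega> \<otimes> x"] by (simp add: sector_def)
qed

text \<open>A wall crossed on the way from \<open>x\<close> to the gate meets the coset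
  \<open>x H \<Lambda>\<close> and has its type in \<Lambda>; such a wall does not separate the gate
  from \<open>y\<close>, by \<open>sector_gate\<close>.\<close>

lemma gate_between:
  assumes "x \<in> carrier \<G>" "y \<in> carrier \<G>"
  shows "between x (x \<otimes> gate \<Lambda> (inv x \<otimes> y)) y"
  unfolding between_def
proof (intro ballI)
  fix g v assume g: "g \<in> carrier \<G>" and "v \<in> V"
  define z l where "z = inv x \<otimes> y" and "l = gate \<Lambda> z"
  have zl: "z \<in> carrier \<G>" "l \<in> H \<Lambda>" using assms by (simp_all add: z_def l_def)
  have "sector g v (x \<otimes> l) = sector g v y" if ne: "sector g v (x \<otimes> l) \<noteq> sector g v x"
  proof -
    obtain k where v: "v \<in> \<Lambda>" and k: "k \<in> H \<Lambda>" "inv g \<otimes> x \<otimes> k \<in> H (st {v})"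
      using sector_move[OF g assms(1) zl(2) ne] by blast
    define j where "j = inv g \<otimes> x \<otimes> k"
    have kc: "k \<in> carrier \<G>" using k by simp
    have "x = g \<otimes> j \<otimes> inv k" using g assms kc by (simp add: j_def group_simps)
    \<comment> \<open>The wall of \<open>g\<close> passes through \<open>x \<otimes> k\<close>.
      Moving its base point there turns it into the wall at \<open>k\<close> in
      \<open>H \<Lambda>\<close>, to which \<open>sector_gate\<close> applies.\<close>
    then have *: "sector g v (x \<otimes> u) = gate {v} j \<otimes> sector k v u" if "u \<in> carrier \<G>" for u
      using that g k kc assms gate_left[of j "{v}" "inv k \<otimes> u"]
      by (simp add: sector_def m_assoc j_def)
    have "sector k v l = sector k v z" unfolding l_def by (rule sector_gate) (use k v zl in auto)
    then have "sector g v (x \<otimes> l) = sector g v (x \<otimes> z)" using *[of l] *[of z] zl by simp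
    then show ?thesis using assms by (simp add: z_def)
  qed
  then show "sector g v (x \<otimes> gate \<Lambda> (inv x \<otimes> y)) \<in> {sector g v x, sector g v y}"
    by (auto simp: l_def z_def)
qed

lemma wall_exists:
  assumes "x \<in> carrier \<G>" "y \<in> carrier \<G>" "x \<noteq> y" "inv x \<otimes> y \<in> H \<Delta>"
  obtains v where "v \<in> V" "v \<in> \<Delta>" "sector x v y \<noteq> sector x v x" "gate {v} (inv x \<otimes> y) \<noteq> \<one>"
proof -
  have "inv x \<otimes> y \<noteq> \<one>" using assms by (metis inv_closed inv_equality inv_inv l_inv m_closed)
  then obtain v where "v \<in> V" "gate {v} (inv x \<otimes> y) \<noteq> \<one>"
    using gate_nontrivial[of "inv x \<otimes> y"] assms by auto
  then show ?thesis using that gate_vertex_in[OF assms(4)] assms(1) by (auto simp: sector_def)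
qed

lemma step_towards:
  assumes "x \<in> carrier \<G>" "y \<in> carrier \<G>" "inv x \<otimes> y \<in> H \<Delta>" "gate {v} (inv x \<otimes> y) \<noteq> \<one>"
  defines "s \<equiv> gate {v} (inv x \<otimes> y)"
  shows "s \<in> H {v}" "s \<in> carrier \<G>" "v \<in> \<Delta>" "between x (x \<otimes> s) y" "inv (x \<otimes> s) \<otimes> y \<in> H \<Delta>"
    "len (inv (x \<otimes> s) \<otimes> y) < len (inv x \<otimes> y)"
proof -
  show s: "s \<in> H {v}" "s \<in> carrier \<G>" using assms by simp_all
  show v: "v \<in> \<Delta>" using gate_vertex_in assms by blast
  show "between x (x \<otimes> s) y" unfolding s_def by (rule gate_between) fact+
  have e: "inv (x \<otimes> s) \<otimes> y = inv s \<otimes> (inv x \<otimes> y)" using s assms by (simp add: group_simps)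
  have "s \<in> H \<Delta>" using H_mono[OF s(1)] v by auto
  then show "inv (x \<otimes> s) \<otimes> y \<in> H \<Delta>" unfolding e using assms by simp
  show "len (inv (x \<otimes> s) \<otimes> y) < len (inv x \<otimes> y)" using len_gate[of "inv x \<otimes> y" "{v}"] assms
    unfolding e by (simp add: s_def)
qed

text \<open>Discrete connectedness: walk from \<open>x\<close> to \<open>y\<close> by
  \<open>step_towards\<close> until \<open>R\<close> holds for the first time. If \<open>R\<close>
  holds at the start, the step is trivial.\<close>

lemma chain_switch:
  assumes "x \<in> carrier \<G>" "y \<in> carrier \<G>" "inv x \<otimes> y \<in> H \<Delta>" "Q x" "R y"
    and "\<And>p. p \<in> carrier \<G> \<Longrightarrow> between x p y \<Longrightarrow> inv x \<otimes> p \<in> H \<Delta> \<Longrightarrow> Q p \<or> R p"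
  shows "\<exists>p s v. p \<in> carrier \<G> \<and> between x p y \<and> between x (p \<otimes> s) y \<and> inv x \<otimes> p \<in> H \<Delta> \<and>
    s \<in> H {v} \<and> s \<in> H \<Delta> \<and> Q p \<and> R (p \<otimes> s)"
  using assms
proof (induction "len (inv x \<otimes> y)" arbitrary: x rule: less_induct)
  case less
  note c = less.prems(1,2)
  show ?case
  proof (cases "R x")
    case True
    then show ?thesis using less.prems by (intro exI[of _ x] exI[of _ \<one>]) auto
  next
    case False
    then have "x \<noteq> y" using less.prems by auto
    then obtain v where v: "gate {v} (inv x \<otimes> y) \<noteq> \<one>" using wall_exists[OF c _ less.prems(3)] by blast
    define s where "s = gate {v} (inv x \<otimes> y)"
    note s = step_towards[OF c less.prems(3) v, folded s_def]
    have sD: "s \<in> H \<Delta>" using H_mono[OF s(1)] s(3) by auto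
    show ?thesis
    proof (cases "R (x \<otimes> s)")
      case True
      then show ?thesis using s sD less.prems by (intro exI[of _ x] exI[of _ s] exI[of _ v]) auto
    next
      case notR: False
      have tr: "between x p y" if "between (x \<otimes> s) p y" for p
        using between_trans[OF s(4) that] .
      have HD: "inv x \<otimes> p \<in> H \<Delta>" if "inv (x \<otimes> s) \<otimes> p \<in> H \<Delta>" "p \<in> carrier \<G>" for p
      proof -
        have "inv x \<otimes> p = s \<otimes> (inv (x \<otimes> s) \<otimes> p)" using that c s by (simp add: group_simps)
        then show ?thesis using mult_H[OF sD that(1)] by simp
      qed
      have xs: "x \<otimes> s \<in> carrier \<G>" using c s by simp
      have Q: "Q (x \<otimes> s)" using less.prems(6)[OF xs s(4)] HD[of "x \<otimes> s"] xs notR by simp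
      have "Q p \<or> R p" if "p \<in> carrier \<G>" "between (x \<otimes> s) p y" "inv (x \<otimes> s) \<otimes> p \<in> H \<Delta>" for p
        using less.prems(6) tr HD that by blast
      then have "\<exists>p t u. p \<in> carrier \<G> \<and> between (x \<otimes> s) p y \<and> between (x \<otimes> s) (p \<otimes> t) y \<and>
          inv (x \<otimes> s) \<otimes> p \<in> H \<Delta> \<and> t \<in> H {u} \<and> t \<in> H \<Delta> \<and> Q p \<and> R (p \<otimes> t)"
        using less.hyps[OF s(6) xs c(2) s(5) Q less.prems(5)] by presburger
      then show ?thesis using tr HD by blast
    qed
  qed
qed

text \<open>Use \<open>chain_switch\<close> for the sides of \<open>x\<close> and of
  \<open>y\<close>. The step that changes sides must have type \<open>v\<close>, and so its starting
  point lies on the wall.\<close>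

lemma wall_between:
  assumes c: "x \<in> carrier \<G>" "y \<in> carrier \<G>" "g \<in> carrier \<G>" and v: "v \<in> V"
    and sep: "sector g v x \<noteq> sector g v y"
  obtains p where "p \<in> carrier \<G>" "between x p y" "inv g \<otimes> p \<in> H (st {v})"
proof -
  let ?Q = "\<lambda>p. sector g v p = sector g v x" and ?R = "\<lambda>p. sector g v p = sector g v y"
  have "?Q p \<or> ?R p" if "between x p y" for p using that c v by (auto simp: between_def)
  then obtain p s u where ps: "p \<in> carrier \<G>" "between x p y" "s \<in> H {u}" "?Q p" "?R (p \<otimes> s)"
    using chain_switch[of x y V ?Q ?R] c by (auto simp: H_V)
  then have "sector g v (p \<otimes> s) \<noteq> sector g v p" using sep by simp
  from sector_move[OF c(3) ps(1,3) this] obtain k where k: "v = u" "k \<in> H {u}" "inv g \<otimes> p \<otimes> k \<in> H (st {v})"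
    by auto
  have "inv k \<in> H (st {v})" using k by (intro H_st) auto
  from mult_H[OF k(3) this] have "inv g \<otimes> p \<in> H (st {v})" using c ps k by (simp add: m_assoc)
  then show ?thesis using that ps by blast
qed

text \<open>A point \<open>p\<close> between \<open>x\<close> and \<open>q\<close> and a point
  \<open>p'\<close> between \<open>w\<close> and \<open>w'\<close> lie on the wall of
  \<open>g\<close>, but on different sides of the wall of \<open>h\<close>. Moving from
  \<open>p\<close> to \<open>p'\<close> inside a coset of \<open>H (st {v})\<close> therefore
  crosses the wall of \<open>h\<close>, and \<open>sector_move\<close> applies.\<close>

lemma walls_cross:
  assumes c: "x \<in> carrier \<G>" "q \<in> carrier \<G>" "w \<in> carrier \<G>" "w' \<in> carrier \<G>" "g \<in> carrier \<G>" "h \<in> carrier \<G>"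
    and V: "v \<in> V" "u \<in> V"
    and H: "sector g v x = sector g v w" "sector g v q = sector g v w'" "sector g v x \<noteq> sector g v q"
    and K: "sector h u x = sector h u q" "sector h u w = sector h u w'" "sector h u x \<noteq> sector h u w"
  shows "u \<in> lk {v} \<and> (\<exists>k\<in>H (st {v}). inv h \<otimes> g \<otimes> k \<in> H (st {u}))"
proof -
  obtain p where p: "p \<in> carrier \<G>" "between x p q" "inv g \<otimes> p \<in> H (st {v})"
    using wall_between[OF c(1,2,5) V(1) H(3)] .
  have "sector g v w \<noteq> sector g v w'" using H by simp
  then obtain p' where p': "p' \<in> carrier \<G>" "between w p' w'" "inv g \<otimes> p' \<in> H (st {v})"
    using wall_between[OF c(3,4,5) V(1)] by blast
  have "sector h u p \<noteq> sector h u p'" proof -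
    have "sector h u p = sector h u x" using p(2) c(6) V(2) K(1) unfolding between_def by fastforce
    moreover have "sector h u p' = sector h u w" using p'(2) c(6) V(2) K(2) unfolding between_def by fastforce
    ultimately show ?thesis using K(3) by simp
  qed
  then have ne: "sector h u (p \<otimes> (inv p \<otimes> p')) \<noteq> sector h u p" using p p' by simp
  have "inv p \<otimes> p' = inv (inv g \<otimes> p) \<otimes> (inv g \<otimes> p')" using p p' c by (simp add: group_simps)
  then have pp: "inv p \<otimes> p' \<in> H (st {v})" using p p' by simp
  obtain k where k: "u \<in> st {v}" "k \<in> H (st {v})" "inv h \<otimes> p \<otimes> k \<in> H (st {u})"
    using sector_move[OF c(6) p(1) pp ne] by blast
  define j where "j = inv g \<otimes> p \<otimes> k"
  have j: "j \<in> H (st {v})" "inv h \<otimes> g \<otimes> j = inv h \<otimes> p \<otimes> k"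
    using mult_H[OF p(3) k(2)] p k c by (simp_all add: j_def m_assoc)
  have jj: "inv h \<otimes> g \<otimes> j \<in> H (st {u})" using j k by simp
  \<comment> \<open>Walls of the same type with a common point coincide. Then \<open>h\<close> and
    \<open>g\<close> would separate the same points, by \<open>sector_st\<close>, although only
    \<open>g\<close> separates \<open>x\<close> from \<open>q\<close>.\<close>
  have "u \<noteq> v"
  proof
    assume uv: "u = v"
    define d where "d = (inv h \<otimes> g \<otimes> j) \<otimes> inv j"
    have d: "d \<in> H (st {v})" using jj j uv unfolding d_def by simp
    have jc: "j \<in> carrier \<G>" using j(1) by simp
    have hg: "h = g \<otimes> inv d" using c jc by (simp add: d_def group_simps)
    have "sector h v y = gate {v} d \<otimes> sector g v y" if "y \<in> carrier \<G>" for y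
      unfolding hg using sector_st[of g "inv d" v y] that c d by (simp add: gate_inv_st)
    then have "sector g v x = sector g v q" using K(1) uv c d by (simp add: sector_def)
    then show False using H by simp
  qed
  then have "u \<in> lk {v}" using k(1) by (simp add: st_def)
  then show ?thesis using j(1) jj by blast
qed

text \<open>For each type in \<Omega> some wall crosses both \<open>H \<Omega>\<close> and the coset
  \<open>z H \<Lambda>\<close>; to be shown is that the coset meets \<open>H (st \<Omega>)\<close>.
  As long as \<open>z\<close> has a non-trivial gate on the left in \<open>H \<Omega>\<close> or on
  the right in \<open>H \<Lambda>\<close>, split it off. Otherwise a possible first letter of
  \<open>z\<close> has its wall between \<open>H \<Omega>\<close> and the coset, so all the given
  walls cross it; its type is in the link of \<Omega>, and the letter can be split off as
  well.\<close>

lemma star: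
  assumes "\<Omega> \<subseteq> V" "\<Omega> \<subseteq> \<Lambda>" "z \<in> carrier \<G>" "\<And>v. v \<in> \<Omega> \<Longrightarrow> \<exists>k\<in>H \<Lambda>. near \<Omega> v (z \<otimes> k)"
  shows "\<exists>\<sigma>\<in>H (st \<Omega>). \<exists>k\<in>H \<Lambda>. z = \<sigma> \<otimes> k"
  using assms(3,4)
proof (induction "len z" arbitrary: z rule: less_induct)
  case less
  note z = less.prems(1)
  have left: ?case if lj: "len (j \<otimes> z) < len z" and "j \<in> H (st \<Omega>)" for j
  proof -
    have j: "j \<in> carrier \<G>" using that by simp
    have "\<exists>k\<in>H \<Lambda>. near \<Omega> v (j \<otimes> z \<otimes> k)" if v: "v \<in> \<Omega>" for v
    proof -
      obtain k where k: "k \<in> H \<Lambda>" "near \<Omega> v (z \<otimes> k)" using less.prems(2)[OF v] by blast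
      then show ?thesis using near_left[OF \<open>j \<in> H (st \<Omega>)\<close> v, of "z \<otimes> k"] z j
        by (intro bexI[of _ k]) (auto simp: m_assoc)
    qed
    then obtain \<sigma> k where s: "\<sigma> \<in> H (st \<Omega>)" "k \<in> H \<Lambda>" "j \<otimes> z = \<sigma> \<otimes> k"
      using less.hyps[OF lj] z j by blast
    have "z = inv j \<otimes> (j \<otimes> z)" using z j by simp
    then have "z = inv j \<otimes> \<sigma> \<otimes> k" using s j by (simp add: m_assoc)
    then show ?thesis using s mult_H[OF inv_H[OF that(2)] s(1)] by blast
  qed
  have right: ?case if lj: "len (z \<otimes> j) < len z" and "j \<in> H \<Lambda>" for j
  proof -
    have j: "j \<in> carrier \<G>" using that by simp
    have "\<exists>k\<in>H \<Lambda>. near \<Omega> v (z \<otimes> j \<otimes> k)" if v: "v \<in> \<Omega>" for v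
    proof -
      obtain k where k: "k \<in> H \<Lambda>" "near \<Omega> v (z \<otimes> k)" using less.prems(2)[OF v] by blast
      then show ?thesis using z j \<open>j \<in> H \<Lambda>\<close>
        by (intro bexI[of _ "inv j \<otimes> k"]) (auto simp: m_assoc)
    qed
    then obtain \<sigma> k where s: "\<sigma> \<in> H (st \<Omega>)" "k \<in> H \<Lambda>" "z \<otimes> j = \<sigma> \<otimes> k"
      using less.hyps[OF lj] z j by blast
    have "z = \<sigma> \<otimes> (k \<otimes> inv j)"
    proof -
      have "z = z \<otimes> j \<otimes> inv j" using z j by (simp add: m_assoc)
      then show ?thesis using s j by (simp add: m_assoc)
    qed
    then show ?thesis using s that(2) by (intro bexI[of _ \<sigma>] bexI[of _ "k \<otimes> inv j"]) auto
  qed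
  show ?case
  proof (cases "z = \<one>")
    case True
    then show ?thesis by (intro bexI[of _ \<one>]) auto
  next
    case ne: False
    show ?thesis
    proof (cases "gate \<Omega> z = \<one> \<and> gate \<Lambda> (inv z) = \<one>")
      case False
      show ?thesis
      proof (cases "gate \<Omega> z = \<one>")
        case False
        then show ?thesis using len_gate[OF z False] z by (intro left[of "inv (gate \<Omega> z)"]) (auto intro: H_st)
      next
        case True
        with False have g: "gate \<Lambda> (inv z) \<noteq> \<one>" by simp
        have "len (inv (gate \<Lambda> (inv z)) \<otimes> inv z) < len (inv z)" using len_gate[OF _ g] z by simp
        then have "len (z \<otimes> gate \<Lambda> (inv z)) < len z"
          using len_inv[of "z \<otimes> gate \<Lambda> (inv z)"] len_inv[OF z] z by (simp add: inv_mult_group)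
        then show ?thesis using z by (intro right) auto
      qed
    next
      case True
      obtain u where u: "u \<in> V" "gate {u} z \<noteq> \<one>" using gate_nontrivial[OF z ne] .
      have un: "u \<notin> \<Omega>" using gate_gate[of "{u}" \<Omega> z] True z u by auto
      \<comment> \<open>The wall of type \<open>u\<close> at \<one> does not cut the coset.
        Otherwise it would cross \<open>H \<Lambda>\<close> as seen from \<open>inv z\<close>, and
        as \<open>inv z\<close> has trivial gate there, all of \<open>z\<close> would lie in
        \<open>H (lk {u})\<close>.\<close>
      have uk: "gate {u} (z \<otimes> k) = gate {u} z" if k: "k \<in> H \<Lambda>" for k
      proof (rule ccontr)
        assume "gate {u} (z \<otimes> k) \<noteq> gate {u} z"
        then have "sector \<one> u (z \<otimes> k) \<noteq> sector \<one> u z" using z k by (simp add: sector_def)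
        from sector_move[OF _ z k this] obtain k' where k': "u \<in> \<Lambda>" "k' \<in> H \<Lambda>" "z \<otimes> k' \<in> H (st {u})" using z by auto
        have "inv k' \<otimes> inv z \<in> H (st {u})" using inv_H[OF k'(3)] z k' by (simp add: inv_mult_group)
        then have "near \<Lambda> u (inv z)" using k' z by (intro near_stI[of k']) auto
        then have "inv (gate \<Lambda> (inv z)) \<otimes> inv z \<in> H (lk {u})" using near_gate k' z by blast
        then have "inv z \<in> H (lk {u})" using True z by simp
        from inv_H[OF this] have "gate {u} z = \<one>" using z by (simp add: gate_lk)
        then show False using u by simp
      qed
      \<comment> \<open>The points \<open>l\<close> and \<open>z \<otimes> k\<close> lie on
        different sides of the wall of type \<open>u\<close>, yet they differ by an element of
        \<open>H (lk {v})\<close>.\<close>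
      have lk: "u \<in> lk {v}" if v: "v \<in> \<Omega>" for v
      proof -
        obtain k where k: "k \<in> H \<Lambda>" "near \<Omega> v (z \<otimes> k)" using less.prems(2)[OF v] by blast
        obtain l where l: "l \<in> H \<Omega>" "inv l \<otimes> (z \<otimes> k) \<in> H (lk {v})" using k(2) by (auto simp: near_def)
        have "gate {u} l = \<one>" using gate_vertex_in[OF l(1)] un by blast
        then have "sector \<one> u (l \<otimes> (inv l \<otimes> (z \<otimes> k))) \<noteq> sector \<one> u l"
          using uk[OF k(1)] u z k l by (simp add: sector_def)
        from sector_move[OF _ _ l(2) this] l show ?thesis by auto
      qed
      have "u \<in> lk \<Omega>" using lk u by (auto simp: lk_def)
      then have "gate {u} z \<in> H (st \<Omega>)"
        using gate_H[OF z, of "{u}"] by (intro H_lk_st) (auto intro: H_mono)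
      then show ?thesis using len_gate[OF z u(2)] by (intro left[of "inv (gate {u} z)"]) auto
    qed
  qed
qed

text \<open>This is the origin of the distinction between domains with bounded projection and nested
  ones: either a type of \<Omega> is missing among the letters by which the gate moves along the
  coset, or \<open>star\<close> applies.\<close>

lemma gate_coset:
  assumes "\<Omega> \<subseteq> V" "z \<in> carrier \<G>"
  obtains (small) D where "D \<subset> \<Omega>" "D \<subseteq> \<Lambda>" "\<And>k. k \<in> H \<Lambda> \<Longrightarrow> inv (gate \<Omega> z) \<otimes> gate \<Omega> (z \<otimes> k) \<in> H D"
  | (meet) \<sigma> k where "\<Omega> \<subseteq> \<Lambda>" "\<sigma> \<in> H (st \<Omega>)" "k \<in> H \<Lambda>" "z = \<sigma> \<otimes> k"
proof -
  define D where "D = {v \<in> \<Omega> \<inter> \<Lambda>. \<exists>k\<in>H \<Lambda>. near \<Omega> v (z \<otimes> k)}"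
  have D: "inv (gate \<Omega> z) \<otimes> gate \<Omega> (z \<otimes> k) \<in> H D" if k: "k \<in> H \<Lambda>" for k
  proof -
    obtain m where "m \<in> H D" "gate \<Omega> (z \<otimes> k) = gate \<Omega> z \<otimes> m"
      using gate_mult_H[OF assms(2) k, of \<Omega>, folded D_def] .
    then show ?thesis using assms by simp
  qed
  show ?thesis
  proof (cases "D = \<Omega>")
    case True
    then have "\<Omega> \<subseteq> \<Lambda>" "\<And>v. v \<in> \<Omega> \<Longrightarrow> \<exists>k\<in>H \<Lambda>. near \<Omega> v (z \<otimes> k)" by (auto simp: D_def)
    with star[OF assms(1) _ assms(2)] show ?thesis using meet by blast
  next
    case False
    then have "D \<subset> \<Omega>" "D \<subseteq> \<Lambda>" by (auto simp: D_def)
    then show ?thesis using small D by blast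
  qed
qed

text \<open>If walls of all types in \<open>\<Omega>\<close> crossing \<open>H \<Omega>\<close> separate two points, then a geodesic between
  them can be routed through the product region \<open>H (st \<Omega>)\<close>.\<close>

lemma star_between:
  assumes "\<Omega> \<subseteq> V" "x \<in> carrier \<G>" "q \<in> carrier \<G>"
    and "\<And>v. v \<in> \<Omega> \<Longrightarrow> \<exists>\<omega>\<in>H \<Omega>. sector \<omega> v x \<noteq> sector \<omega> v q"
  shows "\<exists>w\<in>H (st \<Omega>). between x w q"
  using assms(2,4)
proof (induction "len (inv x \<otimes> q)" arbitrary: x rule: less_induct)
  case less
  note x = less.prems(1)
  define w where "w = gate (st \<Omega>) x"
  have w: "w \<in> H (st \<Omega>)" "w \<in> carrier \<G>" using x by (simp_all add: w_def)
  show ?case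
  proof (cases "x = w")
    case True
    then show ?thesis using w by (intro bexI[of _ w]) auto
  next
    case False
    then obtain u where u: "u \<in> V" "sector x u w \<noteq> sector x u x" "gate {u} (inv x \<otimes> w) \<noteq> \<one>"
      using wall_exists[OF x w(2), of V] x w by (auto simp: H_V)
    have no: "\<not> near (st \<Omega>) u x" if "u \<in> st \<Omega>"
    proof
      assume "near (st \<Omega>) u x"
      from inv_H[OF near_gate[OF x that this]] have "inv x \<otimes> w \<in> H (lk {u})"
        using x w by (simp add: w_def inv_mult_group)
      then show False using gate_lk u by blast
    qed
    show ?thesis
    proof (cases "sector x u q = sector x u x")
      case False
      then have ne: "gate {u} (inv x \<otimes> q) \<noteq> \<one>" using x by (simp add: sector_def)
      define s where "s = gate {u} (inv x \<otimes> q)"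
      have "inv x \<otimes> q \<in> H V" using x assms by (simp add: H_V)
      note s = step_towards[OF x assms(3) this ne, folded s_def]
      \<comment> \<open>A step of type \<open>u\<close> from \<open>x\<close> crosses only the wall
        of type \<open>u\<close> at \<open>x\<close>. This wall does not cross
        \<open>H (st \<Omega>)\<close>, so it is none of the walls in the hypothesis.\<close>
      have "\<exists>\<omega>\<in>H \<Omega>. sector \<omega> v (x \<otimes> s) \<noteq> sector \<omega> v q" if v: "v \<in> \<Omega>" for v
      proof -
        obtain \<omega> where o: "\<omega> \<in> H \<Omega>" "sector \<omega> v x \<noteq> sector \<omega> v q" using less.prems(2)[OF v] by blast
        have "sector \<omega> v (x \<otimes> s) = sector \<omega> v x"
        proof (rule ccontr)
          assume ne': "sector \<omega> v (x \<otimes> s) \<noteq> sector \<omega> v x"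
          have oc: "\<omega> \<in> carrier \<G>" using o by simp
          from sector_move[OF oc x s(1) ne'] obtain k where k: "v = u" "k \<in> H {u}" "inv \<omega> \<otimes> x \<otimes> k \<in> H (st {u})"
            by auto
          have "inv k \<in> H (st {u})" using k by (intro H_st) auto
          from mult_H[OF k(3) this] have "inv \<omega> \<otimes> x \<in> H (st {u})" using x o k by (simp add: m_assoc)
          moreover have "\<omega> \<in> H (st \<Omega>)" using o by (intro H_st)
          moreover have "u \<in> st \<Omega>" using k v by (simp add: st_def)
          ultimately show False using no near_stI x by blast
        qed
        then have "sector \<omega> v (x \<otimes> s) \<noteq> sector \<omega> v q" using o by simp
        then show ?thesis using o by blast
      qed
      then obtain w' where "w' \<in> H (st \<Omega>)" "between (x \<otimes> s) w' q"
        using less.hyps[OF s(6)] x s(2) by blast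
      then show ?thesis using between_trans[OF s(4)] by blast
    next
      case eq: True
      \<comment> \<open>Now the wall of type \<open>u\<close> at \<open>x\<close> has
        \<open>x\<close> and \<open>q\<close> on one side and both gates on another, whereas each
        wall of the hypothesis separates \<open>x\<close> and \<open>w\<close> from \<open>q\<close>
        and \<open>w'\<close>. All quadrants are populated, so the walls cross, and
        \<open>star\<close> makes the wall at \<open>x\<close> near \<open>H (st \<Omega>)\<close>,
        a contradiction.\<close>
      define w' where "w' = gate (st \<Omega>) q"
      have w': "w' \<in> H (st \<Omega>)" "w' \<in> carrier \<G>" using assms by (simp_all add: w'_def)
      have ww: "sector x u w = sector x u w'"
      proof (rule ccontr)
        assume "sector x u w \<noteq> sector x u w'"
        then have ne: "sector x u (w \<otimes> (inv w \<otimes> w')) \<noteq> sector x u w" using w w' by simp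
        have "inv w \<otimes> w' \<in> H (st \<Omega>)" using w w' by simp
        from sector_move[OF x w(2) this ne] obtain k where k: "u \<in> st \<Omega>" "k \<in> H (st \<Omega>)"
          "inv x \<otimes> w \<otimes> k \<in> H (st {u})" by blast
        have "inv (w \<otimes> k) \<otimes> x \<in> H (st {u})" using inv_H[OF k(3)] w x k by (simp add: group_simps)
        then have "near (st \<Omega>) u x" using k w x by (intro near_stI[of "w \<otimes> k"]) auto
        then show False using no k by blast
      qed
      have cross: "u \<in> lk {v} \<and> (\<exists>k\<in>H (st {u}). near \<Omega> v (x \<otimes> k))" if v: "v \<in> \<Omega>" for v
      proof -
        obtain \<omega> where o: "\<omega> \<in> H \<Omega>" "sector \<omega> v x \<noteq> sector \<omega> v q" using less.prems(2)[OF v] by blast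
        have oc: "\<omega> \<in> carrier \<G>" "\<omega> \<in> H (st \<Omega>)" "v \<in> st \<Omega>" "v \<in> V"
          using o H_st[OF o(1)] v assms(1) by (auto simp: st_def)
        have sw: "sector \<omega> v x = sector \<omega> v w" "sector \<omega> v q = sector \<omega> v w'"
          unfolding w_def w'_def using oc x assms by (simp_all add: sector_gate)
        have "u \<in> lk {v} \<and> (\<exists>k\<in>H (st {v}). inv x \<otimes> \<omega> \<otimes> k \<in> H (st {u}))"
          by (rule walls_cross[of x q w w']) (use x assms w w' oc u sw o eq ww in auto)
        then obtain k where k: "u \<in> lk {v}" "k \<in> H (st {v})" "inv x \<otimes> \<omega> \<otimes> k \<in> H (st {u})" by blast
        have kc: "k \<in> carrier \<G>" using k by simp
        have "inv \<omega> \<otimes> (x \<otimes> (inv x \<otimes> \<omega> \<otimes> k)) = k" using x oc kc by (simp add: m_assoc)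
        then have "near \<Omega> v (x \<otimes> (inv x \<otimes> \<omega> \<otimes> k))"
          using k o v x kc by (intro near_stI[of \<omega>]) auto
        then show ?thesis using k by blast
      qed
      have us: "u \<in> lk \<Omega>" "\<Omega> \<subseteq> st {u}" using cross u assms(1) lk_sym[of u] by (auto simp: lk_def st_def insert_commute)
      obtain \<sigma> k where sk: "\<sigma> \<in> H (st \<Omega>)" "k \<in> H (st {u})" "x = \<sigma> \<otimes> k"
        using star[OF assms(1) us(2) x] cross by blast
      have "near (st \<Omega>) u x" using sk us by (intro near_stI[of \<sigma>]) (auto simp: st_def)
      then show ?thesis using no us by (auto simp: st_def)
    qed
  qed
qed

end

section \<open>Coned-off spaces of parabolic subgroups\<close>

locale countable_graph_group = graph_group \<G> V E G incl
  for \<G> :: "('g, 'c) monoid_scheme" (structure)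
    and V :: "'v set" and E :: "'v set set" and G :: "'v \<Rightarrow> ('a, 'b) monoid_scheme"
    and incl :: "'v \<Rightarrow> 'a \<Rightarrow> 'g" +
  fixes emb :: "real \<Rightarrow> 'q"
  assumes countable_group: "countable (carrier \<G>)" and inj_emb: "inj emb"
begin

text \<open>For \<open>card \<Omega> \<le> 1\<close> all of \<open>H \<Omega>\<close> is coned off: the geometry of the vertex group itself is recorded by
  its own hierarchy structure.\<close>

definition cone :: "'v set \<Rightarrow> 'g set" where
  "cone \<Omega> = {c. \<exists>\<Delta>. \<Delta> \<subseteq> \<Omega> \<and> (\<Delta> \<noteq> \<Omega> \<or> card \<Omega> \<le> 1) \<and> c \<in> H \<Delta>}"

definition cone_edges :: "'v set \<Rightarrow> ('g \<times> 'g) set" where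
  "cone_edges \<Omega> = {(x, y). x \<in> H \<Omega> \<and> y \<in> H \<Omega> \<and> x \<noteq> y \<and> inv x \<otimes> y \<in> cone \<Omega>}"

lemma cone_H: "c \<in> cone \<Omega> \<Longrightarrow> c \<in> H \<Omega>"
  unfolding cone_def using H_mono by blast

lemma coneI: "c \<in> H \<Delta> \<Longrightarrow> \<Delta> \<subset> \<Omega> \<Longrightarrow> c \<in> cone \<Omega>"
  unfolding cone_def by blast

lemma cone_vertex: assumes "c \<in> H {v}" "v \<in> \<Omega>" shows "c \<in> cone \<Omega>"
proof (cases "\<Omega> = {v}")
  case False then show ?thesis using assms by (intro coneI[of _ "{v}"]) auto
qed (use assms in \<open>auto simp: cone_def\<close>)

lemma cone_inv: "c \<in> cone \<Omega> \<Longrightarrow> inv c \<in> cone \<Omega>"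
  unfolding cone_def using inv_H by blast

lemma connected_cone: "connected_graph (H \<Omega>) (cone_edges \<Omega>)"
proof
  show "cone_edges \<Omega> \<subseteq> H \<Omega> \<times> H \<Omega>" by (auto simp: cone_edges_def)
  show "sym (cone_edges \<Omega>)"
  proof (rule symI)
    fix a b assume "(a, b) \<in> cone_edges \<Omega>"
    then show "(b, a) \<in> cone_edges \<Omega>"
      using cone_inv[of "inv a \<otimes> b"] by (auto simp: cone_edges_def inv_mult_group)
  qed
  fix a b assume ab: "a \<in> H \<Omega>" "b \<in> H \<Omega>"
  have "(a, a \<otimes> ev w) \<in> (cone_edges \<Omega>)\<^sup>*" if "w \<in> wd \<Omega>" "a \<in> H \<Omega>" for w a
    using that
  proof (induction w arbitrary: a)
    case Nil
    then show ?case by simp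
  next
    case (Cons s w)
    obtain v g where s: "s = (v, g)" by (cases s)
    have v: "v \<in> \<Omega>" "v \<in> V" "g \<in> carrier (G v)" "w \<in> wd \<Omega>" using Cons.prems s by auto
    have g: "incl v g \<in> cone \<Omega>" using v by (intro cone_vertex[of _ v] letter_H) auto
    have ac: "a \<in> carrier \<G>" using Cons.prems by simp
    have ag: "a \<otimes> incl v g \<in> H \<Omega>" using Cons.prems cone_H[OF g] by simp
    have "(a, a \<otimes> incl v g) \<in> (cone_edges \<Omega>)\<^sup>*"
    proof (cases "a \<otimes> incl v g = a")
      case False
      then have "(a, a \<otimes> incl v g) \<in> cone_edges \<Omega>" using g ag Cons.prems ac v by (auto simp: cone_edges_def)
      then show ?thesis by blast
    qed simp
    moreover have "(a \<otimes> incl v g, a \<otimes> incl v g \<otimes> ev w) \<in> (cone_edges \<Omega>)\<^sup>*" using Cons.IH v ag by blast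
    ultimately show ?case using ac v by (simp add: s letter_def m_assoc)
  qed
  moreover obtain w where "w \<in> wd \<Omega>" "inv a \<otimes> b = ev w" using HE[of "inv a \<otimes> b" \<Omega>] ab by (metis inv_H mult_H)
  ultimately show "(a, b) \<in> (cone_edges \<Omega>)\<^sup>*" using ab by (metis H_closed cancel_left(2) inv_closed)
qed

definition cgraph :: "'v set \<Rightarrow> ('g \<Rightarrow> real) metric" where
  "cgraph \<Omega> = graph_realisation (H \<Omega>) (cone_edges \<Omega>)"

text \<open>The coned-off graphs of all \<Omega> have their points in one function type, which
  mentions the group. The detour through the reals yields a type that does not depend on the
  group.\<close>

definition ccode :: "'v set \<Rightarrow> ('g \<Rightarrow> real) \<Rightarrow> 'q" where
  "ccode \<Omega> = emb \<circ> (SOME c. inj_on c (mspace (cgraph \<Omega>)))"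

definition cspace :: "'v set \<Rightarrow> ('q) metric" where
  "cspace \<Omega> = map_metric (ccode \<Omega>) (cgraph \<Omega>)"

definition cpt :: "'v set \<Rightarrow> 'g \<Rightarrow> 'q" where
  "cpt \<Omega> x = ccode \<Omega> (vpt x)"

definition cact :: "'v set \<Rightarrow> 'g \<Rightarrow> 'q \<Rightarrow> 'q" where
  "cact \<Omega> k = ccode \<Omega> \<circ> (\<lambda>p x. if x \<in> H \<Omega> then p (inv k \<otimes> x) else 0) \<circ> inv_into (mspace (cgraph \<Omega>)) (ccode \<Omega>)"

lemma isometry_ccode: "isometry_onto (cgraph \<Omega>) (cspace \<Omega>) (ccode \<Omega>)"
proof -
  interpret connected_graph "H \<Omega>" "cone_edges \<Omega>" by (rule connected_cone)
  have "H \<Omega> \<subseteq> carrier \<G>" by (rule subsetI) (rule H_closed)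
  then have "countable (H \<Omega>)" using countable_group by (rule countable_subset)
  then obtain c :: "('g \<Rightarrow> real) \<Rightarrow> real" where "inj_on c (mspace (cgraph \<Omega>))"
    using countable_realisation_inj by (auto simp: cgraph_def mspace_M)
  then have "inj_on (SOME c :: ('g \<Rightarrow> real) \<Rightarrow> real. inj_on c (mspace (cgraph \<Omega>))) (mspace (cgraph \<Omega>))"
    by (rule someI[of "\<lambda>c :: ('g \<Rightarrow> real) \<Rightarrow> real. inj_on c (mspace (cgraph \<Omega>))"])
  then have "inj_on (ccode \<Omega> :: _ \<Rightarrow> 'q) (mspace (cgraph \<Omega>))"
    unfolding ccode_def by (intro comp_inj_on inj_on_subset[OF inj_emb]) auto
  then show ?thesis unfolding cspace_def by (rule isometry_map_metric)
qed

lemma geodesic_cspace: "geodesic_space (cspace \<Omega>)"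
proof -
  interpret connected_graph "H \<Omega>" "cone_edges \<Omega>" by (rule connected_cone)
  show ?thesis by (rule isometry_geodesic_space[OF isometry_ccode]) (simp add: cgraph_def geodesic_realisation)
qed

lemma cpt_in [simp]: "x \<in> H \<Omega> \<Longrightarrow> cpt \<Omega> x \<in> mspace (cspace \<Omega>)"
proof -
  interpret connected_graph "H \<Omega>" "cone_edges \<Omega>" by (rule connected_cone)
  show "x \<in> H \<Omega> \<Longrightarrow> cpt \<Omega> x \<in> mspace (cspace \<Omega>)"
    unfolding cpt_def by (rule isometry_onto_in[OF isometry_ccode]) (simp add: cgraph_def mspace_M)
qed

lemma mdist_cpt:
  assumes "x \<in> H \<Omega>" "y \<in> H \<Omega>"
  shows "mdist (cspace \<Omega>) (cpt \<Omega> x) (cpt \<Omega> y) = real (vertex_dist (cone_edges \<Omega>) x y)"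
proof -
  interpret connected_graph "H \<Omega>" "cone_edges \<Omega>" by (rule connected_cone)
  show ?thesis unfolding cpt_def
    using isometry_onto_mdist[OF isometry_ccode, of "vpt x" \<Omega> "vpt y"] assms mdist_vpt
    by (simp add: cgraph_def mspace_M)
qed

lemma cspace_near: assumes "p \<in> mspace (cspace \<Omega>)" obtains x where "x \<in> H \<Omega>" "mdist (cspace \<Omega>) p (cpt \<Omega> x) \<le> 1"
proof -
  interpret connected_graph "H \<Omega>" "cone_edges \<Omega>" by (rule connected_cone)
  obtain q where q: "q \<in> mspace (cgraph \<Omega>)" "p = ccode \<Omega> q"
    using assms isometry_onto_mspace[OF isometry_ccode, of \<Omega>] by blast
  then have qP: "q \<in> Pts" by (simp add: cgraph_def mspace_M)
  obtain x where x: "q x \<noteq> 0" using supp_nonempty[OF qP] .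
  then have xH: "x \<in> H \<Omega>" using supp_V[OF qP] by blast
  have "mdist (cspace \<Omega>) p (cpt \<Omega> x) = mdist M q (vpt x)"
    unfolding q cpt_def using isometry_onto_mdist[OF isometry_ccode q(1), of "vpt x"] xH
    by (simp add: cgraph_def mspace_M)
  then show ?thesis using that xH mdist_vpt_near(2)[OF qP x] by simp
qed

lemma mdist_cpt_cone: assumes "x \<in> H \<Omega>" "c \<in> cone \<Omega>" shows "mdist (cspace \<Omega>) (cpt \<Omega> x) (cpt \<Omega> (x \<otimes> c)) \<le> 1"
proof -
  interpret connected_graph "H \<Omega>" "cone_edges \<Omega>" by (rule connected_cone)
  have c: "c \<in> H \<Omega>" "x \<in> carrier \<G>" "c \<in> carrier \<G>" using assms cone_H H_closed by blast+
  show ?thesis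
  proof (cases "x \<otimes> c = x")
    case False
    then have "(x, x \<otimes> c) \<in> cone_edges \<Omega>" using assms c by (auto simp: cone_edges_def)
    from vertex_dist_edge[OF this] have "real (vertex_dist (cone_edges \<Omega>) x (x \<otimes> c)) \<le> 1" by simp
    then show ?thesis using mdist_cpt[of x \<Omega> "x \<otimes> c"] assms c by simp
  qed (use assms in simp)
qed

lemma cpt_chain:
  assumes "x \<in> H \<Omega>" "y \<in> H \<Omega>"
  obtains n where "mdist (cspace \<Omega>) (cpt \<Omega> x) (cpt \<Omega> y) = real n" "(x, y) \<in> cone_edges \<Omega> ^^ n"
proof -
  interpret connected_graph "H \<Omega>" "cone_edges \<Omega>" by (rule connected_cone)
  show ?thesis using that mdist_cpt[OF assms] vertex_dist_path[OF assms] by blast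
qed

lemma mdist_cpt_chain:
  assumes "x \<in> H \<Omega>" "y \<in> H \<Omega>" "(x, y) \<in> cone_edges \<Omega> ^^ n"
  shows "mdist (cspace \<Omega>) (cpt \<Omega> x) (cpt \<Omega> y) \<le> real n"
proof -
  interpret connected_graph "H \<Omega>" "cone_edges \<Omega>" by (rule connected_cone)
  show ?thesis using mdist_cpt[OF assms(1,2)] vertex_dist_le[OF assms(3)] by simp
qed

section \<open>The action of \<open>H \<Omega>\<close> on its coned-off space\<close>

lemma isometry_cgraph:
  assumes k: "k \<in> H \<Omega>"
  shows "isometry_onto (cgraph \<Omega>) (cgraph \<Omega>) (\<lambda>p x. if x \<in> H \<Omega> then p (inv k \<otimes> x) else 0)"
proof -
  interpret connected_graph "H \<Omega>" "cone_edges \<Omega>" by (rule connected_cone)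
  have kc: "k \<in> carrier \<G>" using k by simp
  have e: "(j \<otimes> a, j \<otimes> b) \<in> cone_edges \<Omega>" if "(a, b) \<in> cone_edges \<Omega>" "j \<in> H \<Omega>" for a b j
  proof -
    have c: "a \<in> carrier \<G>" "b \<in> carrier \<G>" "j \<in> carrier \<G>" using that by (auto simp: cone_edges_def)
    then have "inv (j \<otimes> a) \<otimes> (j \<otimes> b) = inv a \<otimes> b" "j \<otimes> a = j \<otimes> b \<longleftrightarrow> a = b" by (auto simp: group_simps)
    then show ?thesis using that by (simp add: cone_edges_def)
  qed
  show ?thesis unfolding cgraph_def
  proof (rule realisation_isometry[where f = "\<lambda>x. k \<otimes> x"])
    show "inv k \<otimes> (k \<otimes> a) = a" "k \<otimes> (inv k \<otimes> a) = a" if "a \<in> H \<Omega>" for a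
      using kc H_closed[OF that] by auto
    show "(k \<otimes> a, k \<otimes> b) \<in> cone_edges \<Omega>" "(inv k \<otimes> a, inv k \<otimes> b) \<in> cone_edges \<Omega>"
      if "(a, b) \<in> cone_edges \<Omega>" for a b
      using e[OF that] k by auto
  qed (use k in auto)
qed

lemma isometry_cact:
  assumes k: "k \<in> H \<Omega>"
  shows "isometry_onto (cspace \<Omega>) (cspace \<Omega>) (cact \<Omega> k)"
proof -
  have "isometry_onto (cspace \<Omega>) (cgraph \<Omega>)
      ((\<lambda>p x. if x \<in> H \<Omega> then p (inv k \<otimes> x) else 0) \<circ> inv_into (mspace (cgraph \<Omega>)) (ccode \<Omega>))"
    by (rule isometry_onto_comp[OF isometry_onto_inv[OF isometry_ccode] isometry_cgraph[OF k]])
  from isometry_onto_comp[OF this isometry_ccode] show ?thesis by (simp add: cact_def comp_assoc)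
qed

lemma cact_ccode: "q \<in> mspace (cgraph \<Omega>) \<Longrightarrow>
    cact \<Omega> k (ccode \<Omega> q) = ccode \<Omega> (\<lambda>x. if x \<in> H \<Omega> then q (inv k \<otimes> x) else 0)"
  using isometry_onto_inj[OF isometry_ccode] by (simp add: cact_def)

lemma cact_cpt: assumes "k \<in> H \<Omega>" "x \<in> H \<Omega>" shows "cact \<Omega> k (cpt \<Omega> x) = cpt \<Omega> (k \<otimes> x)"
proof -
  interpret connected_graph "H \<Omega>" "cone_edges \<Omega>" by (rule connected_cone)
  have c: "k \<in> carrier \<G>" "x \<in> carrier \<G>" using assms by auto
  have "inv k \<otimes> y = x \<longleftrightarrow> y = k \<otimes> x" if "y \<in> H \<Omega>" for y
    using c H_closed[OF that] by (metis cancel_left)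
  moreover have "k \<otimes> x \<in> H \<Omega>" using assms by simp
  ultimately have "(\<lambda>y. if y \<in> H \<Omega> then vpt x (inv k \<otimes> y) else 0) = vpt (k \<otimes> x)" by (auto simp: fun_eq_iff)
  then show ?thesis unfolding cpt_def using cact_ccode[of "vpt x" \<Omega> k] assms by (simp add: cgraph_def mspace_M)
qed

lemma cact_mult:
  assumes "k \<in> H \<Omega>" "j \<in> H \<Omega>" "p \<in> mspace (cspace \<Omega>)"
  shows "cact \<Omega> (k \<otimes> j) p = cact \<Omega> k (cact \<Omega> j p)"
proof -
  interpret connected_graph "H \<Omega>" "cone_edges \<Omega>" by (rule connected_cone)
  obtain q where q: "q \<in> mspace (cgraph \<Omega>)" "p = ccode \<Omega> q"
    using assms isometry_onto_mspace[OF isometry_ccode, of \<Omega>] by blast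
  let ?T = "\<lambda>k q x. if x \<in> H \<Omega> then q (inv k \<otimes> x) else (0::real)"
  have Tq: "?T j q \<in> mspace (cgraph \<Omega>)" by (rule isometry_onto_in[OF isometry_cgraph[OF assms(2)] q(1)])
  have "?T (k \<otimes> j) q = ?T k (?T j q)"
    using assms(1,2) by (auto simp: fun_eq_iff group_simps)
  then show ?thesis using cact_ccode[OF q(1)] cact_ccode[OF Tq] q(2) by simp
qed

text \<open>The difference splits into a factor in \<open>H {v}\<close> and one in
  \<open>H (\<Omega> \<inter> lk {v})\<close>. Both are coned off, the second because
  \<open>v\<close> itself is missing from the link; this gives 2.\<close>

lemma cpt_same_wall:
  assumes "p \<in> H \<Omega>" "q \<in> H \<Omega>" "v \<in> \<Omega>" "inv p \<otimes> q \<in> H (st {v})"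
  shows "mdist (cspace \<Omega>) (cpt \<Omega> p) (cpt \<Omega> q) \<le> 2"
proof -
  obtain s k where sk: "s \<in> H {v}" "k \<in> H (lk {v})" "inv p \<otimes> q = s \<otimes> k" using H_stE[OF assms(4)] .
  have s: "s \<in> H \<Omega>" using H_mono[OF sk(1)] assms(3) by auto
  have c: "p \<in> carrier \<G>" "q \<in> carrier \<G>" "s \<in> carrier \<G>" "k \<in> carrier \<G>" using assms sk by auto
  have "k = inv s \<otimes> (inv p \<otimes> q)" unfolding sk(3) using c by simp
  then have "k \<in> H \<Omega>" using s assms by simp
  then have "gate \<Omega> k = k" by (rule gate_id)
  then have "k \<in> H (\<Omega> \<inter> lk {v})" using gate_H_Int[OF sk(2), of \<Omega>] by simp
  moreover have "\<Omega> \<inter> lk {v} \<subset> \<Omega>" using assms(3) lk_irrefl[of v "{v}"] by auto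
  ultimately have k: "k \<in> cone \<Omega>" by (rule coneI)
  have "p \<otimes> s \<otimes> k = p \<otimes> (inv p \<otimes> q)" unfolding sk(3) using c by (simp add: m_assoc)
  then have q: "q = p \<otimes> s \<otimes> k" using c by simp
  have ps: "p \<otimes> s \<in> H \<Omega>" using assms s by simp
  have "mdist (cspace \<Omega>) (cpt \<Omega> p) (cpt \<Omega> q) \<le> 1 + 1"
    unfolding q by (rule mdist_triangle'[OF cpt_in cpt_in cpt_in mdist_cpt_cone mdist_cpt_cone])
      (use assms s ps k cone_H cone_vertex[OF sk(1) assms(3)] in auto)
  then show ?thesis by simp
qed

section \<open>Walls and hyperbolicity of the coned-off spaces\<close>

lemma relpow_switch:
  assumes "(a, b) \<in> R ^^ n" "F a \<noteq> F b"
  shows "\<exists>c c' j. j < n \<and> (a, c) \<in> R ^^ j \<and> (c, c') \<in> R \<and> F c \<noteq> F c'"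
  using assms
proof (induction n arbitrary: b)
  case (Suc n)
  then obtain c where c: "(a, c) \<in> R ^^ n" "(c, b) \<in> R" by auto
  show ?case
  proof (cases "F a = F c")
    case True
    then show ?thesis using c Suc.prems by auto
  next
    case False
    then show ?thesis using Suc.IH[OF c(1)] less_Suc_eq by blast
  qed
qed simp

text \<open>A path in the coned-off space can only cross a wall inside a coset of a smaller parabolic
  subgroup, and it meets the carrier of the wall there.\<close>

lemma chain_near_wall:
  assumes "x \<in> H \<Omega>" "y \<in> H \<Omega>" "p \<in> H \<Omega>" "v \<in> \<Omega>" "sector p v x \<noteq> sector p v y"
    and "(x, y) \<in> cone_edges \<Omega> ^^ n"
  shows "mdist (cspace \<Omega>) (cpt \<Omega> x) (cpt \<Omega> p) \<le> real n + 2"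
proof -
  obtain c c' j where j: "j < n" "(x, c) \<in> cone_edges \<Omega> ^^ j" "(c, c') \<in> cone_edges \<Omega>" "sector p v c \<noteq> sector p v c'"
    using relpow_switch[OF assms(6), of "sector p v"] assms(5) by blast
  then have c: "c \<in> H \<Omega>" "c' \<in> H \<Omega>" "inv c \<otimes> c' \<in> cone \<Omega>" by (auto simp: cone_edges_def)
  then obtain \<Delta> where D: "\<Delta> \<subseteq> \<Omega>" "\<Delta> \<noteq> \<Omega> \<or> card \<Omega> \<le> 1" "inv c \<otimes> c' \<in> H \<Delta>" by (auto simp: cone_def)
  have cc: "c \<in> carrier \<G>" "c' \<in> carrier \<G>" "p \<in> carrier \<G>" using c assms by auto
  have "sector p v (c \<otimes> (inv c \<otimes> c')) \<noteq> sector p v c" using j cc by simp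
  from sector_move[OF cc(3,1) D(3) this] obtain k where k: "k \<in> H \<Delta>" "inv p \<otimes> c \<otimes> k \<in> H (st {v})" by blast
  have kc: "k \<in> cone \<Omega>" using k D by (auto simp: cone_def)
  have ck: "c \<otimes> k \<in> H \<Omega>" using c cone_H[OF kc] by simp
  have 1: "mdist (cspace \<Omega>) (cpt \<Omega> x) (cpt \<Omega> c) \<le> real j" by (rule mdist_cpt_chain) fact+
  have 2: "mdist (cspace \<Omega>) (cpt \<Omega> c) (cpt \<Omega> (c \<otimes> k)) \<le> 1" by (rule mdist_cpt_cone) fact+
  have 3: "mdist (cspace \<Omega>) (cpt \<Omega> (c \<otimes> k)) (cpt \<Omega> p) \<le> 2"
  proof (subst mdist_commute, rule cpt_same_wall)
    show "inv p \<otimes> (c \<otimes> k) \<in> H (st {v})" using k cc by (simp add: m_assoc)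
  qed (use ck assms in auto)
  have "mdist (cspace \<Omega>) (cpt \<Omega> x) (cpt \<Omega> p) \<le> real j + (1 + 2)"
    by (rule mdist_triangle'[OF cpt_in cpt_in cpt_in 1]; (rule mdist_triangle'[OF cpt_in cpt_in cpt_in 2 3])?)
      (use c ck assms in auto)
  then show ?thesis using j(1) by linarith
qed

text \<open>Geodesics may end inside edges, so the group elements that stand for the end points are
  only required to be within 1.\<close>

definition cpath :: "'v set \<Rightarrow> (real \<Rightarrow> 'q) \<Rightarrow> real \<Rightarrow> 'g \<Rightarrow> 'g \<Rightarrow> bool" where
  "cpath \<Omega> \<gamma> L x y \<longleftrightarrow> 0 \<le> L \<and> x \<in> H \<Omega> \<and> y \<in> H \<Omega> \<and> (\<forall>t\<in>{0..L}. \<gamma> t \<in> mspace (cspace \<Omega>)) \<and>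
    (\<forall>s\<in>{0..L}. \<forall>t\<in>{0..L}. mdist (cspace \<Omega>) (\<gamma> s) (\<gamma> t) = \<bar>s - t\<bar>) \<and>
    mdist (cspace \<Omega>) (\<gamma> 0) (cpt \<Omega> x) \<le> 1 \<and> mdist (cspace \<Omega>) (\<gamma> L) (cpt \<Omega> y) \<le> 1"

text \<open>Sample the geodesic at unit steps and replace each sample by a group element within 1.
  Two consecutive elements are separated by the wall; they have distance at most 3, so
  \<open>chain_near_wall\<close> gives 1 + (3 + 2), which is below 7.\<close>

lemma cpath_near_wall:
  assumes path: "cpath \<Omega> \<gamma> L x y" and p: "p \<in> H \<Omega>" "v \<in> \<Omega>" "sector p v x \<noteq> sector p v y"
  shows "\<exists>t\<in>{0..L}. mdist (cspace \<Omega>) (\<gamma> t) (cpt \<Omega> p) \<le> 7"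
proof -
  have L: "0 \<le> L" and xy: "x \<in> H \<Omega>" "y \<in> H \<Omega>" and
    in_m: "\<And>t. t \<in> {0..L} \<Longrightarrow> \<gamma> t \<in> mspace (cspace \<Omega>)" and
    iso: "\<And>s t. s \<in> {0..L} \<Longrightarrow> t \<in> {0..L} \<Longrightarrow> mdist (cspace \<Omega>) (\<gamma> s) (\<gamma> t) = \<bar>s - t\<bar>" and
    ends: "mdist (cspace \<Omega>) (\<gamma> 0) (cpt \<Omega> x) \<le> 1" "mdist (cspace \<Omega>) (\<gamma> L) (cpt \<Omega> y) \<le> 1"
    using path unfolding cpath_def by auto
  have "\<forall>t\<in>{0..L}. \<exists>z\<in>H \<Omega>. mdist (cspace \<Omega>) (\<gamma> t) (cpt \<Omega> z) \<le> 1" using in_m cspace_near by metis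
  then obtain f where f: "\<And>t. t \<in> {0..L} \<Longrightarrow> f t \<in> H \<Omega>" "\<And>t. t \<in> {0..L} \<Longrightarrow> mdist (cspace \<Omega>) (\<gamma> t) (cpt \<Omega> (f t)) \<le> 1"
    by metis
  \<comment> \<open>The index \<open>Suc N\<close> is surely sampled at the end \<open>L\<close> of
    the path; so indices 0 and \<open>Suc N\<close> can be assigned to \<open>x\<close> and
    \<open>y\<close> themselves.\<close>
  define N where "N = nat \<lceil>L\<rceil>"
  define \<tau> where "\<tau> i = min (real i) L" for i
  define z where "z i = (if i = 0 then x else if i = Suc N then y else f (\<tau> i))" for i
  have NL: "L \<le> real N" unfolding N_def by (rule real_nat_ceiling_ge)
  have \<tau>: "\<tau> i \<in> {0..L}" "\<tau> 0 = 0" "\<tau> (Suc N) = L" "\<bar>\<tau> i - \<tau> (Suc i)\<bar> \<le> 1" for i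
    using L NL by (auto simp: \<tau>_def min_def)
  have z: "z i \<in> H \<Omega>" "mdist (cspace \<Omega>) (\<gamma> (\<tau> i)) (cpt \<Omega> (z i)) \<le> 1" for i
    using \<tau> f xy ends by (auto simp: z_def)
  have "\<exists>i\<le>N. sector p v (z i) \<noteq> sector p v (z (Suc i))"
  proof (rule ccontr)
    assume "\<not> ?thesis"
    then have eq: "sector p v (z i) = sector p v (z (Suc i))" if "i \<le> N" for i using that by blast
    have "sector p v (z i) = sector p v x" if "i \<le> Suc N" for i
      using that by (induction i) (use eq in \<open>auto simp: z_def\<close>)
    from this[of "Suc N"] p show False by (simp add: z_def)
  qed
  then obtain i where i: "sector p v (z i) \<noteq> sector p v (z (Suc i))" by blast
  obtain n where n: "mdist (cspace \<Omega>) (cpt \<Omega> (z i)) (cpt \<Omega> (z (Suc i))) = real n" "(z i, z (Suc i)) \<in> cone_edges \<Omega> ^^ n"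
    using cpt_chain[OF z(1) z(1)] .
  have "mdist (cspace \<Omega>) (cpt \<Omega> (z i)) (cpt \<Omega> (z (Suc i))) \<le> 1 + (1 + 1)"
  proof (rule mdist_triangle'[of _ _ "\<gamma> (\<tau> i)"], simp_all add: z in_m \<tau>(1))
    show "mdist (cspace \<Omega>) (cpt \<Omega> (z i)) (\<gamma> (\<tau> i)) \<le> 1" using z(2)[of i] by (simp add: mdist_commute)
    have "mdist (cspace \<Omega>) (\<gamma> (\<tau> i)) (cpt \<Omega> (z (Suc i))) \<le> 1 + 1"
      by (rule mdist_triangle'[of _ _ "\<gamma> (\<tau> (Suc i))"]) (use z in_m \<tau> iso in auto)
    then show "mdist (cspace \<Omega>) (\<gamma> (\<tau> i)) (cpt \<Omega> (z (Suc i))) \<le> 2" by simp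
  qed (rule in_m[OF \<tau>(1)])
  then have n3: "real n \<le> 3" using n by simp
  have 1: "mdist (cspace \<Omega>) (cpt \<Omega> (z i)) (cpt \<Omega> p) \<le> real n + 2" by (rule chain_near_wall) (use z p i n in auto)
  have "mdist (cspace \<Omega>) (\<gamma> (\<tau> i)) (cpt \<Omega> p) \<le> 1 + (real n + 2)"
    by (rule mdist_triangle'[OF _ _ _ z(2) 1]) (use z p in_m \<tau> in auto)
  then show ?thesis using n3 \<tau>(1) by (intro bexI[of _ "\<tau> i"]) auto
qed

text \<open>Restricting \<open>between\<close> to the walls that cross \<open>H \<Omega>\<close>
  gives a relation that is inherited by the gates in \<open>H \<Omega>\<close>, as
  \<open>pg_between\<close> needs it.\<close>

definition cbetween :: "'v set \<Rightarrow> 'g \<Rightarrow> 'g \<Rightarrow> 'g \<Rightarrow> bool" where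
  "cbetween \<Omega> x p y \<longleftrightarrow> (\<forall>g\<in>H \<Omega>. \<forall>v\<in>\<Omega>. sector g v p \<in> {sector g v x, sector g v y})"

lemma between_cbetween:
  assumes "between x p y" "x \<in> carrier \<G>" "p \<in> carrier \<G>" "y \<in> carrier \<G>"
  shows "cbetween \<Omega> x p y"
  unfolding cbetween_def
proof (intro ballI)
  fix g v assume g: "g \<in> H \<Omega>" and "v \<in> \<Omega>"
  show "sector g v p \<in> {sector g v x, sector g v y}"
  proof (cases "v \<in> V")
    case True
    then show ?thesis using assms(1) H_closed[OF g] unfolding between_def by blast
  next
    case False
    have "sector g v z = \<one>" if "z \<in> carrier \<G>" for z
    proof -
      have "gate {v} (inv g \<otimes> z) \<in> H {v}" using that g by simp
      then have "gate {v} (inv g \<otimes> z) \<in> H {}" by (rule H_mono) (use False in auto)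
      then show ?thesis using H_empty by (simp add: sector_def)
    qed
    then show ?thesis using assms by simp
  qed
qed

text \<open>A wall at \<open>p\<close> separates \<open>p\<close> from \<open>x\<close>. As
  \<open>p\<close> is between, it must then be on the side of \<open>y\<close>. Thus each point
  between \<open>x\<close> and \<open>y\<close>, except \<open>x\<close>, lies on a wall that every
  path from \<open>x\<close> to \<open>y\<close> has to cross.\<close>

lemma cbetween_wall:
  assumes "cbetween \<Omega> x p y" "x \<in> H \<Omega>" "p \<in> H \<Omega>" "p \<noteq> x"
  obtains v where "v \<in> \<Omega>" "v \<in> V" "sector p v x \<noteq> sector p v y"
proof -
  have c: "x \<in> carrier \<G>" "p \<in> carrier \<G>" "inv p \<otimes> x \<in> H \<Omega>" using assms by auto
  obtain v where v: "v \<in> V" "v \<in> \<Omega>" "sector p v x \<noteq> sector p v p"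
    using wall_exists[OF c(2,1) assms(4) c(3)] by blast
  then have "sector p v p = sector p v y" using assms unfolding cbetween_def by fastforce
  then show ?thesis using that v by auto
qed

lemma cbetween_near:
  assumes "cbetween \<Omega> x p y" "p \<in> H \<Omega>" "cpath \<Omega> \<gamma> L x y"
  shows "\<exists>t\<in>{0..L}. mdist (cspace \<Omega>) (\<gamma> t) (cpt \<Omega> p) \<le> 7"
proof (cases "p = x")
  case True
  then show ?thesis using assms(3) unfolding cpath_def by (intro bexI[of _ 0]) auto
next
  case False
  have "x \<in> H \<Omega>" using assms(3) by (simp add: cpath_def)
  then obtain v where "v \<in> \<Omega>" "sector p v x \<noteq> sector p v y" using cbetween_wall assms False by metis
  then show ?thesis using cpath_near_wall assms by blast
qed

lemma segment_cpath:
  assumes "geodesic_segment (cspace \<Omega>) a b P" "x \<in> H \<Omega>" "y \<in> H \<Omega>"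
    "mdist (cspace \<Omega>) a (cpt \<Omega> x) \<le> 1" "mdist (cspace \<Omega>) b (cpt \<Omega> y) \<le> 1"
  obtains \<gamma> where "cpath \<Omega> \<gamma> (mdist (cspace \<Omega>) a b) x y" "P = \<gamma> ` {0..mdist (cspace \<Omega>) a b}"
    "\<gamma> 0 = a" "\<gamma> (mdist (cspace \<Omega>) a b) = b"
proof -
  obtain \<gamma> where g: "\<gamma> 0 = a" "\<gamma> (mdist (cspace \<Omega>) a b) = b" "P = \<gamma> ` {0..mdist (cspace \<Omega>) a b}"
    "P \<subseteq> mspace (cspace \<Omega>)"
    "\<forall>s\<in>{0..mdist (cspace \<Omega>) a b}. \<forall>t\<in>{0..mdist (cspace \<Omega>) a b}. mdist (cspace \<Omega>) (\<gamma> s) (\<gamma> t) = \<bar>s - t\<bar>"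
    using assms(1) unfolding geodesic_segment_def by blast
  then show ?thesis using assms that[of \<gamma>] unfolding cpath_def by (auto simp: image_subset_iff)
qed

lemma cbetween_mdist:
  assumes "cbetween \<Omega> x p y" "x \<in> H \<Omega>" "p \<in> H \<Omega>" "y \<in> H \<Omega>"
  shows "mdist (cspace \<Omega>) (cpt \<Omega> x) (cpt \<Omega> p) \<le> mdist (cspace \<Omega>) (cpt \<Omega> x) (cpt \<Omega> y :: 'q) + 7"
proof -
  obtain P where "geodesic_segment (cspace \<Omega>) (cpt \<Omega> x) (cpt \<Omega> y :: 'q) P"
    using geodesic_cspace[of \<Omega>] cpt_in assms unfolding geodesic_space_def by blast
  from segment_cpath[OF this assms(2,4)] obtain \<gamma> where
    g: "cpath \<Omega> \<gamma> (mdist (cspace \<Omega>) (cpt \<Omega> x) (cpt \<Omega> y :: 'q)) x y" "\<gamma> 0 = cpt \<Omega> x"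
    using assms by auto
  obtain t where t: "t \<in> {0..mdist (cspace \<Omega>) (cpt \<Omega> x) (cpt \<Omega> y :: 'q)}" "mdist (cspace \<Omega>) (\<gamma> t) (cpt \<Omega> p) \<le> 7"
    using cbetween_near[OF assms(1,3) g(1)] by blast
  have "mdist (cspace \<Omega>) (\<gamma> 0) (\<gamma> t) = \<bar>0 - t\<bar>" "\<gamma> t \<in> mspace (cspace \<Omega>)" using g(1) t unfolding cpath_def by auto
  then have "mdist (cspace \<Omega>) (cpt \<Omega> x) (\<gamma> t) \<le> t" using g(2) t by simp
  from mdist_triangle'[OF cpt_in[OF assms(2)] _ cpt_in[OF assms(3)] this t(2)] \<open>\<gamma> t \<in> _\<close> t(1) show ?thesis by force
qed

text \<open>For a point \<open>q\<close> of one side find a group element \<open>p\<close> between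
  the ends of that side and close to \<open>q\<close>. A wall at \<open>p\<close> separating two
  corners also separates the third corner from one of them, so another side must pass near
  \<open>p\<close>. The distances are 22 from \<open>q\<close> to \<open>p\<close> and 7 from there
  to the other side.\<close>

lemma hyperbolic_cspace: "hyperbolic (cspace \<Omega> :: ('q) metric) 30"
  unfolding hyperbolic_def
proof (intro ballI allI impI subsetI)
  let ?C = "cspace \<Omega> :: ('q) metric" and ?c = "cpt \<Omega> :: 'g \<Rightarrow> 'q"
  fix a b c P Q R q
  assume m: "a \<in> mspace ?C" "b \<in> mspace ?C" "c \<in> mspace ?C"
    and P: "geodesic_segment ?C a b P" and Q: "geodesic_segment ?C b c Q" and R: "geodesic_segment ?C c a R"
    and q: "q \<in> P"
  obtain x where x: "x \<in> H \<Omega>" "mdist ?C a (?c x) \<le> 1" using cspace_near[OF m(1)] .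
  obtain y where y: "y \<in> H \<Omega>" "mdist ?C b (?c y) \<le> 1" using cspace_near[OF m(2)] .
  obtain z where z: "z \<in> H \<Omega>" "mdist ?C c (?c z) \<le> 1" using cspace_near[OF m(3)] .
  obtain \<gamma> where g: "cpath \<Omega> \<gamma> (mdist ?C a b) x y" "P = \<gamma> ` {0..mdist ?C a b}" "\<gamma> 0 = a" "\<gamma> (mdist ?C a b) = b"
    using segment_cpath[OF P x(1) y(1) x(2) y(2)] by blast
  obtain \<gamma>1 where g1: "cpath \<Omega> \<gamma>1 (mdist ?C b c) y z" "Q = \<gamma>1 ` {0..mdist ?C b c}"
    using segment_cpath[OF Q y(1) z(1) y(2) z(2)] by blast
  obtain \<gamma>2 where g2: "cpath \<Omega> \<gamma>2 (mdist ?C c a) z x" "R = \<gamma>2 ` {0..mdist ?C c a}" "\<gamma>2 (mdist ?C c a) = a"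
    using segment_cpath[OF R z(1) x(1) z(2) x(2)] by blast
  define L where "L = mdist ?C a b"
  obtain t where t: "t \<in> {0..L}" "q = \<gamma> t" using q g(2) by (auto simp: L_def)
  have in_m: "\<gamma> s \<in> mspace ?C" if "s \<in> {0..L}" for s using g(1) that unfolding cpath_def L_def by blast
  have iso: "mdist ?C (\<gamma> s) (\<gamma> u) = \<bar>s - u\<bar>" if "s \<in> {0..L}" "u \<in> {0..L}" for s u
    using g(1) that unfolding cpath_def L_def by blast
  let ?Q = "\<lambda>p. p \<in> H \<Omega> \<and> (\<exists>s\<in>{0..L}. s \<le> t \<and> mdist ?C (\<gamma> s) (?c p) \<le> 7)"
  let ?R = "\<lambda>p. p \<in> H \<Omega> \<and> (\<exists>s\<in>{0..L}. t \<le> s \<and> mdist ?C (\<gamma> s) (?c p) \<le> 7)"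
  have c: "x \<in> carrier \<G>" "y \<in> carrier \<G>" "inv x \<otimes> y \<in> H \<Omega>" using x y by auto
  have cb: "cbetween \<Omega> x p y" if "between x p y" "p \<in> carrier \<G>" for p
    using between_cbetween that c by blast
  have Q0: "?Q x" using x t g(3) by (intro conjI bexI[of _ 0]) auto
  have R0: "?R y" using y t g(4) by (intro conjI bexI[of _ L]) (auto simp: L_def)
  have QR: "?Q p \<or> ?R p" if p: "p \<in> carrier \<G>" "between x p y" "inv x \<otimes> p \<in> H \<Omega>" for p
  proof -
    have "x \<otimes> (inv x \<otimes> p) \<in> H \<Omega>" using x(1) p(3) by (rule mult_H)
    then have pH: "p \<in> H \<Omega>" using p c by simp
    from cbetween_near[OF cb[OF p(2,1)] pH g(1)] obtain s where "s \<in> {0..L}" "mdist ?C (\<gamma> s) (?c p) \<le> 7"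
      by (auto simp: L_def)
    then show ?thesis using pH by (cases "s \<le> t") auto
  qed
  \<comment> \<open>The side passes near each point between its ends, at a time before or after
    \<open>t\<close>. At the switch two elements joined by one edge are near times on both sides of
    \<open>t\<close>. These times differ by at most 7 + 1 + 7 = 15, so \<open>p\<close> is within 15
    + 7 = 22 of \<open>q\<close>.\<close>
  obtain p s v where p: "p \<in> carrier \<G>" "between x p y" "s \<in> H {v}" "s \<in> H \<Omega>" "?Q p" "?R (p \<otimes> s)"
    using chain_switch[OF c, of ?Q ?R, OF Q0 R0 QR] by blast
  obtain t1 where t1: "t1 \<in> {0..L}" "t1 \<le> t" "mdist ?C (\<gamma> t1) (?c p) \<le> 7" using p(5) by blast
  obtain t2 where t2: "t2 \<in> {0..L}" "t \<le> t2" "mdist ?C (\<gamma> t2) (?c (p \<otimes> s)) \<le> 7" using p(6) by blast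
  have s: "s \<in> cone \<Omega>"
  proof (cases "v \<in> \<Omega>")
    case True then show ?thesis using cone_vertex[OF p(3)] by blast
  next
    case False
    have "gate {v} s \<in> H ({v} \<inter> \<Omega>)" by (rule gate_H_Int) fact
    then have "s = \<one>" using gate_id[OF p(3)] False H_empty by simp
    then show ?thesis unfolding cone_def using H_empty[of \<one>] by (cases "\<Omega> = {}") (auto intro!: exI[of _ "{}"])
  qed
  have pH: "p \<in> H \<Omega>" "p \<otimes> s \<in> H \<Omega>" using p by auto
  have d12: "mdist ?C (\<gamma> t1) (\<gamma> t2) \<le> 7 + (1 + 7)"
    by (rule mdist_triangle'[OF _ _ _ t1(3)]; (rule mdist_triangle'[OF _ _ _ mdist_cpt_cone[OF pH(1) s]])?)
      (use in_m t1 t2 pH in \<open>auto simp: mdist_commute\<close>)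
  have "\<bar>t - t1\<bar> \<le> 15" using d12 iso[OF t1(1) t2(1)] t1 t2 by simp
  then have "mdist ?C q (\<gamma> t1) \<le> 15" using iso[OF t(1) t1(1)] t(2) by simp
  from mdist_triangle'[OF _ _ _ this t1(3)] have qp: "mdist ?C q (?c p) \<le> 22" using in_m t t1 pH by simp
  have qm: "q \<in> mspace ?C" using t in_m by simp
  have goal: "q \<in> nbhd ?C 30 (Q \<union> R)" if "e \<in> Q \<union> R" "e \<in> mspace ?C" "mdist ?C e (?c p) \<le> 7" for e
  proof (rule nbhdI[OF qm that(1)])
    have "mdist ?C (?c p) e \<le> 7" using that(3) by (simp add: mdist_commute)
    from mdist_triangle'[OF qm cpt_in[OF pH(1)] that(2) qp this] show "mdist ?C q e \<le> 30" by simp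
  qed
  show "q \<in> nbhd ?C 30 (Q \<union> R)"
  proof (cases "p = x")
    case True
    then have "mdist ?C a (?c p) \<le> 7" using x by simp
    moreover have "a \<in> R" using geodesic_segment_nonempty[OF R] by simp
    ultimately show ?thesis using goal m by blast
  next
    case False
    obtain v where v: "v \<in> \<Omega>" "sector p v x \<noteq> sector p v y"
      using cbetween_wall[OF cb[OF p(2,1)] x(1) pH(1) False] by blast
    \<comment> \<open>The sector of \<open>z\<close> cannot equal two different sectors.\<close>
    have "sector p v y \<noteq> sector p v z \<or> sector p v z \<noteq> sector p v x" using v by metis
    then show ?thesis
    proof
      assume "sector p v y \<noteq> sector p v z"
      from cpath_near_wall[OF g1(1) pH(1) v(1) this] obtain s where "s \<in> {0..mdist ?C b c}" "mdist ?C (\<gamma>1 s) (?c p) \<le> 7" by blast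
      moreover then have "\<gamma>1 s \<in> mspace ?C" using g1(1) unfolding cpath_def by blast
      ultimately show ?thesis using goal g1(2) by blast
    next
      assume "sector p v z \<noteq> sector p v x"
      from cpath_near_wall[OF g2(1) pH(1) v(1) this] obtain s where "s \<in> {0..mdist ?C c a}" "mdist ?C (\<gamma>2 s) (?c p) \<le> 7" by blast
      moreover then have "\<gamma>2 s \<in> mspace ?C" using g2(1) unfolding cpath_def by blast
      ultimately show ?thesis using goal g2(2) by blast
    qed
  qed
qed

end

section \<open>The graph product as a group of words\<close>

context graph_group
begin

primrec vprod :: "'v \<Rightarrow> ('v \<times> 'a) list \<Rightarrow> 'a" where
  "vprod v [] = \<one>\<^bsub>G v\<^esub>"
| "vprod v (s # w) = (if fst s = v then snd s \<otimes>\<^bsub>G v\<^esub> vprod v w else vprod v w)"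

text \<open>Multiplying the letters of type \<open>v\<close> and forgetting all others is invariant
  under the moves. It defines a retraction onto the vertex group.\<close>

lemma incl_inj:
  assumes v: "v \<in> V" and g: "g \<in> carrier (G v)" "h \<in> carrier (G v)" and eq: "incl v g = incl v h"
  shows "g = h"
proof -
  interpret Gv: group "G v" by (rule grp[OF v])
  have cl: "w \<in> fp_words V G \<Longrightarrow> vprod v w \<in> carrier (G v)" for w
    by (induction w) (auto simp: fp_words_def)
  have app: "u \<in> fp_words V G \<Longrightarrow> w \<in> fp_words V G \<Longrightarrow> vprod v (u @ w) = vprod v u \<otimes>\<^bsub>G v\<^esub> vprod v w" for u w
  proof (induction u)
    case (Cons s u)
    then have "u \<in> fp_words V G" "fst s = v \<Longrightarrow> snd s \<in> carrier (G v)" by (auto simp: fp_words_def)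
    then show ?case using Cons cl[of u] cl[of w] by (simp add: Gv.m_assoc)
  qed (use cl in simp)
  have ctx: "vprod v (u @ m @ t) = vprod v (u @ m' @ t)"
    if "u \<in> fp_words V G" "t \<in> fp_words V G" "m \<in> fp_words V G" "m' \<in> fp_words V G" "vprod v m = vprod v m'" for u t m m'
    using that by (simp add: app fp_words_append)
  have "vprod v [(v, g)] = vprod v [(v, h)]"
  proof (rule ev_induct)
    fix u w assume "(u, w) \<in> gp_step V E G"
    then show "vprod v u = vprod v w"
    proof cases
      case free
      then show ?thesis
      proof cases
        case (delete_one u t v')
        then show ?thesis using ctx[of u t "[(v', \<one>\<^bsub>G v'\<^esub>)]" "[]"] grp[of v']
          by (auto simp: fp_words_def group.is_monoid monoid.one_closed)
      next
        case (multiply u t v' g h)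
        have "g \<otimes>\<^bsub>G v'\<^esub> h \<in> carrier (G v')" using multiply grp by (simp add: group.is_monoid monoid.m_closed)
        then show ?thesis unfolding multiply(1,2) using multiply
          by (intro ctx) (auto simp: fp_words_def Gv.m_assoc)
      qed
    next
      case (commute u t v' w' g h)
      have "v' \<noteq> w'" "v' \<in> V" "w' \<in> V" using simplicial commute(5) by (auto simp: simplicial_graph_def)
      then show ?thesis unfolding commute(1,2) using commute by (intro ctx) (auto simp: fp_words_def)
    qed
  qed (use assms in \<open>auto simp: letter_def\<close>)
  then show ?thesis using g by simp
qed

definition coord :: "'v \<Rightarrow> 'g \<Rightarrow> 'a" where
  "coord v x = (SOME g. g \<in> carrier (G v) \<and> incl v g = gate {v} x)"

lemma coord: assumes "v \<in> V" "x \<in> carrier \<G>"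
  shows coord_closed: "coord v x \<in> carrier (G v)" and incl_coord: "incl v (coord v x) = gate {v} x"
proof -
  have "\<exists>g. g \<in> carrier (G v) \<and> incl v g = gate {v} x"
    using H_vertexE[OF gate_H[OF assms(2)] assms(1)] by metis
  from someI_ex[OF this] show "coord v x \<in> carrier (G v)" "incl v (coord v x) = gate {v} x"
    unfolding coord_def by auto
qed

lemma coord_eqI: "v \<in> V \<Longrightarrow> x \<in> carrier \<G> \<Longrightarrow> g \<in> carrier (G v) \<Longrightarrow> gate {v} x = incl v g \<Longrightarrow> coord v x = g"
  using incl_inj coord_closed incl_coord by simp

lemma coord_cong: "gate {v} x = gate {v} y \<Longrightarrow> coord v x = coord v y"
  by (simp add: coord_def)

lemma coord_left:
  assumes "v \<in> V" "k \<in> H (st {v})" "x \<in> carrier \<G>"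
  shows "coord v (k \<otimes> x) = coord v k \<otimes>\<^bsub>G v\<^esub> coord v x"
  using assms grp[of v] by (intro coord_eqI) (auto simp: coord gate_left incl_mult group.is_monoid monoid.m_closed)

lemma coord_incl: "v \<in> V \<Longrightarrow> g \<in> carrier (G v) \<Longrightarrow> coord v (incl v g) = g"
  by (intro coord_eqI) (auto intro: gate_id letter_H)

end

section \<open>The graph product is presented by the elementary moves\<close>

lemma gp_step_context:
  assumes "(u, w) \<in> gp_step V E G" "x \<in> fp_words V G" "y \<in> fp_words V G"
  shows "(x @ u @ y, x @ w @ y) \<in> gp_step V E G"
  using assms(1)
proof cases
  case free
  then show ?thesis using fp_step_context assms(2,3) gp_step.free by metis
next
  case (commute a t v w' g h)
  then show ?thesis
    using gp_step.commute[of "x @ a" V G "t @ y" v w' E g h] assms by (auto simp: fp_words_append)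
qed

definition gp_rel where
  "gp_rel V E G = (gp_step V E G \<union> (gp_step V E G)\<inverse>)\<^sup>*"

lemma gp_rel_context:
  assumes "(u, w) \<in> gp_rel V E G" "x \<in> fp_words V G" "y \<in> fp_words V G"
  shows "(x @ u @ y, x @ w @ y) \<in> gp_rel V E G"
  using assms(1) unfolding gp_rel_def
proof (induction rule: rtrancl_induct)
  case (step v w)
  then have "(x @ v @ y, x @ w @ y) \<in> gp_step V E G \<union> (gp_step V E G)\<inverse>"
    using gp_step_context[OF _ assms(2,3)] by auto
  with step.IH show ?case by (rule rtrancl_into_rtrancl)
qed simp

lemma gp_rel_sym: "(u, w) \<in> gp_rel V E G \<Longrightarrow> (w, u) \<in> gp_rel V E G"
proof -
  have "sym (gp_rel V E G)" unfolding gp_rel_def by (rule sym_rtrancl) (simp add: sym_Un_converse)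
  then show "(u, w) \<in> gp_rel V E G \<Longrightarrow> (w, u) \<in> gp_rel V E G" by (auto simp: sym_def)
qed

lemma gp_rel_trans: "(u, w) \<in> gp_rel V E G \<Longrightarrow> (w, t) \<in> gp_rel V E G \<Longrightarrow> (u, t) \<in> gp_rel V E G"
  unfolding gp_rel_def by (rule rtrancl_trans)

lemma fp_rel_gp_rel: "(u, w) \<in> fp_rel V G \<Longrightarrow> (u, w) \<in> gp_rel V E G"
proof -
  have "fp_step V G \<union> (fp_step V G)\<inverse> \<subseteq> gp_step V E G \<union> (gp_step V E G)\<inverse>" by (auto intro: gp_step.free)
  from rtrancl_mono[OF this] show "(u, w) \<in> fp_rel V G \<Longrightarrow> (u, w) \<in> gp_rel V E G"
    by (auto simp: fp_rel_def gp_rel_def)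
qed

locale graph_product_data =
  fixes V :: "'v set" and E :: "'v set set" and G :: "'v \<Rightarrow> ('a, 'b) monoid_scheme"
  assumes finV: "finite V" and simplicial: "simplicial_graph V E" and grp: "v \<in> V \<Longrightarrow> group (G v)"
begin

abbreviation "F \<equiv> free_product V G"
abbreviation "W \<equiv> fp_words V G"

definition cls where "cls w = fp_rel V G `` {w}"

definition comms where
  "comms = {commutator F (fp_incl V G v g) (fp_incl V G w h) | v w g h.
          {v, w} \<in> E \<and> g \<in> carrier (G v) \<and> h \<in> carrier (G w)}"

definition ncl where "ncl = normal_closure F comms"

definition gp_incl where "gp_incl v g = ncl #>\<^bsub>F\<^esub> cls [(v, g)]"

sublocale F: group F by (rule group_free_product) (rule grp)

lemma Nil_W [simp]: "[] \<in> W" by (simp add: fp_words_def)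

lemma cls_carrier [simp]: "w \<in> W \<Longrightarrow> cls w \<in> carrier F"
  by (auto simp: cls_def free_product_def quotient_def)

lemma carrier_cls: "x \<in> carrier F \<Longrightarrow> \<exists>w\<in>W. x = cls w"
  by (auto simp: cls_def free_product_def quotient_def)

lemma cls_mult: "u \<in> W \<Longrightarrow> w \<in> W \<Longrightarrow> cls u \<otimes>\<^bsub>F\<^esub> cls w = cls (u @ w)"
  by (simp add: cls_def free_product_mult)

lemma cls_one: "cls [] = \<one>\<^bsub>F\<^esub>" by (simp add: cls_def free_product_def)

lemma cls_eq: "u \<in> W \<Longrightarrow> w \<in> W \<Longrightarrow> cls u = cls w \<longleftrightarrow> (u, w) \<in> fp_rel V G"
  unfolding cls_def using eq_equiv_class_iff[OF equiv_fp_rel] .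

lemma cls_inv: assumes "w \<in> W" obtains w' where "w' \<in> W" "inv\<^bsub>F\<^esub> (cls w) = cls w'"
  using carrier_cls[of "inv\<^bsub>F\<^esub> (cls w)"] assms by auto

lemma edge_vertices: "{v, w} \<in> E \<Longrightarrow> v \<in> V \<and> w \<in> V"
  using simplicial by (auto simp: simplicial_graph_def)

lemma letter_W: "v \<in> V \<Longrightarrow> g \<in> carrier (G v) \<Longrightarrow> [(v, g)] \<in> W"
  by (simp add: fp_words_def)

lemma fp_incl_cls: "fp_incl V G v g = cls [(v, g)]"
  by (simp add: fp_incl_def cls_def)

lemma comms_carrier: "comms \<subseteq> carrier F"
  using edge_vertices by (auto simp: comms_def commutator_def fp_incl_cls letter_W)

lemma normal_ncl: "ncl \<lhd> F"
  unfolding ncl_def by (rule normal_normal_closure[OF F.is_group comms_carrier])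

sublocale ncl: normal ncl F by (rule normal_ncl)

lemma graph_product_Mod: "graph_product V E G = F Mod ncl"
  by (simp add: graph_product_def ncl_def comms_def)

text \<open>The classes of words that the moves reduce to the empty word. They form a normal
  subgroup containing the commutators, hence the whole normal closure; this inclusion is the half of
  the presentation that is needed to pass from equality in the quotient to moves.\<close>

definition kernel where "kernel = {cls w | w. w \<in> W \<and> (w, []) \<in> gp_rel V E G}"

lemma cls_kernel: "w \<in> W \<Longrightarrow> cls w \<in> kernel \<longleftrightarrow> (w, []) \<in> gp_rel V E G"
proof
  assume w: "w \<in> W" and "cls w \<in> kernel"
  then obtain t where t: "t \<in> W" "cls w = cls t" "(t, []) \<in> gp_rel V E G" by (auto simp: kernel_def)
  have "(w, t) \<in> gp_rel V E G" using t(2) cls_eq[OF w t(1)] fp_rel_gp_rel by blast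
  from gp_rel_trans[OF this t(3)] show "(w, []) \<in> gp_rel V E G" .
qed (auto simp: kernel_def)

lemma cls_eq_gp_rel: "u \<in> W \<Longrightarrow> w \<in> W \<Longrightarrow> cls u = cls w \<Longrightarrow> (u, w) \<in> gp_rel V E G"
  using cls_eq fp_rel_gp_rel by blast

lemma normal_kernel: "kernel \<lhd> F"
proof -
  have ctxl: "(u @ w, u @ w') \<in> gp_rel V E G" if "(w, w') \<in> gp_rel V E G" "u \<in> W" for u w w'
    using gp_rel_context[OF that Nil_W] by simp
  have ctxr: "(w @ u, w' @ u) \<in> gp_rel V E G" if "(w, w') \<in> gp_rel V E G" "u \<in> W" for u w w'
    using gp_rel_context[OF that(1) Nil_W that(2)] by simp
  have "subgroup kernel F"
  proof
    show "kernel \<subseteq> carrier F" by (auto simp: kernel_def)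
    show "\<one>\<^bsub>F\<^esub> \<in> kernel" using cls_kernel[OF Nil_W] by (simp add: cls_one gp_rel_def)
    fix x assume "x \<in> kernel"
    then obtain u where u: "u \<in> W" "x = cls u" "(u, []) \<in> gp_rel V E G" by (auto simp: kernel_def)
    {
      fix y assume "y \<in> kernel"
      then obtain w where w: "w \<in> W" "y = cls w" "(w, []) \<in> gp_rel V E G" by (auto simp: kernel_def)
      have "(u @ w, w) \<in> gp_rel V E G" using ctxr[OF u(3) w(1)] by simp
      then show "x \<otimes>\<^bsub>F\<^esub> y \<in> kernel" using u w gp_rel_trans[OF _ w(3)] by (simp add: cls_mult cls_kernel fp_words_append)
    }
    obtain u' where u': "u' \<in> W" "inv\<^bsub>F\<^esub> (cls u) = cls u'" using cls_inv[OF u(1)] .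
    have "cls (u' @ u) = cls []" using u u' F.l_inv[of "cls u"] by (simp add: cls_mult[symmetric] cls_one)
    then have "(u' @ u, []) \<in> gp_rel V E G" using u u' by (intro cls_eq_gp_rel) (simp_all add: fp_words_append)
    moreover have "(u', u' @ u) \<in> gp_rel V E G" using gp_rel_sym[OF ctxl[OF u(3) u'(1)]] by simp
    ultimately have "(u', []) \<in> gp_rel V E G" by (rule gp_rel_trans[rotated])
    then show "inv\<^bsub>F\<^esub> x \<in> kernel" using u u' cls_kernel by simp
  qed
  moreover have "x \<otimes>\<^bsub>F\<^esub> h \<otimes>\<^bsub>F\<^esub> inv\<^bsub>F\<^esub> x \<in> kernel" if xh: "x \<in> carrier F" "h \<in> kernel" for x h
  proof -
    obtain u where u: "u \<in> W" "x = cls u" using carrier_cls xh by blast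
    obtain w where w: "w \<in> W" "h = cls w" "(w, []) \<in> gp_rel V E G" using xh by (auto simp: kernel_def)
    obtain u' where u': "u' \<in> W" "inv\<^bsub>F\<^esub> (cls u) = cls u'" using cls_inv[OF u(1)] .
    have "cls (u @ u') = cls []" using u u' F.r_inv[of "cls u"] by (simp add: cls_mult[symmetric] cls_one)
    then have "(u @ u', []) \<in> gp_rel V E G" using u u' by (intro cls_eq_gp_rel) (simp_all add: fp_words_append)
    moreover have "(u @ w @ u', u @ u') \<in> gp_rel V E G" using gp_rel_context[OF w(3) u(1) u'(1)] by simp
    ultimately have "(u @ w @ u', []) \<in> gp_rel V E G" by (rule gp_rel_trans[rotated])
    then show ?thesis using u w u' by (simp add: cls_mult cls_kernel fp_words_append)
  qed
  ultimately show ?thesis unfolding F.normal_inv_iff by blast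
qed

lemma comms_kernel: "comms \<subseteq> kernel"
proof
  fix x assume "x \<in> comms"
  then obtain v w g h where x: "x = commutator F (cls [(v, g)]) (cls [(w, h)])"
    and e: "{v, w} \<in> E" "g \<in> carrier (G v)" "h \<in> carrier (G w)"
    by (auto simp: comms_def fp_incl_cls)
  have W: "[(v, g)] \<in> W" "[(w, h)] \<in> W" using letter_W e edge_vertices by auto
  obtain a where a: "a \<in> W" "inv\<^bsub>F\<^esub> (cls [(v, g)]) = cls a" using cls_inv[OF W(1)] .
  obtain b where b: "b \<in> W" "inv\<^bsub>F\<^esub> (cls [(w, h)]) = cls b" using cls_inv[OF W(2)] .
  have ab: "a @ b \<in> W" using a b by (simp add: fp_words_append)
  have W2: "[(v, g), (w, h)] \<in> W" "[(w, h), (v, g)] \<in> W" using W by (auto simp: fp_words_def)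
  have W3: "(v, g) # (w, h) # a \<in> W" "(w, h) # (v, g) # a \<in> W" using W a by (auto simp: fp_words_def)
  have x': "x = cls ([(v, g), (w, h)] @ a @ b)"
    using W a b W2 W3 ab by (simp add: x commutator_def cls_mult fp_words_append)
  have "([(v, g), (w, h)] @ a @ b, [(w, h), (v, g)] @ a @ b) \<in> gp_rel V E G"
    using gp_step.commute[OF Nil_W ab e] unfolding gp_rel_def by auto
  moreover have "cls ([(w, h), (v, g)] @ a @ b) = cls []"
  proof -
    have "cls ([(w, h), (v, g)] @ a @ b) = cls [(w, h)] \<otimes>\<^bsub>F\<^esub> cls [(v, g)] \<otimes>\<^bsub>F\<^esub> inv\<^bsub>F\<^esub> (cls [(v, g)]) \<otimes>\<^bsub>F\<^esub> inv\<^bsub>F\<^esub> (cls [(w, h)])"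
      using W a b W2 W3 ab by (simp add: cls_mult fp_words_append)
    also have "\<dots> = \<one>\<^bsub>F\<^esub>" using W by (simp add: F.m_assoc)
    finally show ?thesis by (simp add: cls_one)
  qed
  then have "([(w, h), (v, g)] @ a @ b, []) \<in> gp_rel V E G"
    using fp_words_append[OF W2(2) ab] by (intro cls_eq_gp_rel) simp_all
  ultimately have "([(v, g), (w, h)] @ a @ b, []) \<in> gp_rel V E G" by (rule gp_rel_trans)
  then show "x \<in> kernel" unfolding x' using cls_kernel[OF fp_words_append[OF W2(1) ab]] by blast
qed

lemma ncl_kernel: "ncl \<subseteq> kernel"
  unfolding ncl_def normal_closure_def using normal_kernel comms_kernel by blast

lemma foldr_gp_incl:
  assumes "w \<in> W"
  shows "foldr (\<lambda>s y. gp_incl (fst s) (snd s) \<otimes>\<^bsub>graph_product V E G\<^esub> y) w \<one>\<^bsub>graph_product V E G\<^esub> = ncl #>\<^bsub>F\<^esub> cls w"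
  using assms
proof (induction w)
  case Nil
  then show ?case using F.coset_mult_one[OF ncl.subset] by (simp add: graph_product_Mod FactGroup_def cls_one)
next
  case (Cons s w)
  then have W: "[s] \<in> W" "w \<in> W" by (auto simp: fp_words_def)
  then show ?case using Cons.IH ncl.rcos_sum[of "cls [s]" "cls w"]
    by (simp add: graph_product_Mod FactGroup_def gp_incl_def cls_mult)
qed

lemma graph_group_graph_product: "graph_group (graph_product V E G) V E G gp_incl"
proof -
  let ?P = "graph_product V E G"
  have mult: "(ncl #>\<^bsub>F\<^esub> cls u) \<otimes>\<^bsub>?P\<^esub> (ncl #>\<^bsub>F\<^esub> cls w) = ncl #>\<^bsub>F\<^esub> cls (u @ w)" if "u \<in> W" "w \<in> W" for u w
    using that ncl.rcos_sum[of "cls u" "cls w"] by (simp add: graph_product_Mod FactGroup_def cls_mult)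
  have carr: "carrier ?P = {ncl #>\<^bsub>F\<^esub> cls w | w. w \<in> W}"
  proof -
    have "carrier ?P = (\<lambda>a. ncl #>\<^bsub>F\<^esub> a) ` carrier F" by (auto simp: graph_product_Mod FactGroup_def RCOSETS_def)
    also have "carrier F = cls ` W"
    proof
      show "carrier F \<subseteq> cls ` W" using carrier_cls by blast
    qed (rule image_subsetI, rule cls_carrier)
    finally show ?thesis by blast
  qed
  interpret P: group ?P by (rule group_graph_product[OF simplicial grp])
  show ?thesis
  proof (intro graph_group.intro graph_group_axioms.intro)
    show "group ?P" by (rule P.is_group)
    show "finite V" by (rule finV)
    show "simplicial_graph V E" by (rule simplicial)
    show "group (G v)" if "v \<in> V" for v using that by (rule grp)
    show "gp_incl v \<in> hom (G v) ?P" if v: "v \<in> V" for v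
    proof (rule homI)
      interpret Gv: group "G v" by (rule grp[OF v])
      fix g assume g: "g \<in> carrier (G v)"
      then show "gp_incl v g \<in> carrier ?P" using letter_W[OF v] by (auto simp: carr gp_incl_def)
      fix h assume h: "h \<in> carrier (G v)"
      have "([(v, g), (v, h)], [(v, g \<otimes>\<^bsub>G v\<^esub> h)]) \<in> fp_step V G"
        using fp_step.multiply[OF Nil_W Nil_W v g h] by simp
      then have "([(v, g), (v, h)], [(v, g \<otimes>\<^bsub>G v\<^esub> h)]) \<in> fp_rel V G"
        using v g h by (auto simp: fp_rel_def fp_words_def)
      then have "cls [(v, g), (v, h)] = cls [(v, g \<otimes>\<^bsub>G v\<^esub> h)]" using cls_eq v g h by (auto simp: fp_words_def)
      then show "gp_incl v (g \<otimes>\<^bsub>G v\<^esub> h) = gp_incl v g \<otimes>\<^bsub>?P\<^esub> gp_incl v h"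
        using mult[OF letter_W[OF v g] letter_W[OF v h]] by (simp add: gp_incl_def)
    qed
    show "gp_incl v g \<otimes>\<^bsub>?P\<^esub> gp_incl w h = gp_incl w h \<otimes>\<^bsub>?P\<^esub> gp_incl v g"
      if e: "{v, w} \<in> E" "g \<in> carrier (G v)" "h \<in> carrier (G w)" for v w g h
    proof -
      have W: "[(v, g)] \<in> W" "[(w, h)] \<in> W" using letter_W e edge_vertices by auto
      define a b where "a = cls [(v, g)]" and "b = cls [(w, h)]"
      have ab: "a \<in> carrier F" "b \<in> carrier F" using W by (simp_all add: a_def b_def)
      have "commutator F a b \<in> comms" using e unfolding comms_def fp_incl_cls a_def b_def by blast
      then have c: "commutator F a b \<in> ncl" unfolding ncl_def normal_closure_def by blast
      have "a \<otimes>\<^bsub>F\<^esub> b = commutator F a b \<otimes>\<^bsub>F\<^esub> (b \<otimes>\<^bsub>F\<^esub> a)"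
      proof -
        have "inv\<^bsub>F\<^esub> b \<otimes>\<^bsub>F\<^esub> (b \<otimes>\<^bsub>F\<^esub> a) = a" using ab F.m_assoc[of "inv\<^bsub>F\<^esub> b" b a] by simp
        then show ?thesis using ab by (simp add: commutator_def F.m_assoc)
      qed
      then have "ncl #>\<^bsub>F\<^esub> (a \<otimes>\<^bsub>F\<^esub> b) = ncl #>\<^bsub>F\<^esub> (b \<otimes>\<^bsub>F\<^esub> a)"
        using F.coset_mult_assoc[OF ncl.subset, of "commutator F a b" "b \<otimes>\<^bsub>F\<^esub> a"] c ab ncl.mem_carrier[OF c]
          F.coset_join2[OF _ ncl.subgroup_axioms c] by simp
      then show ?thesis using ncl.rcos_sum[OF ab] ncl.rcos_sum[OF ab(2,1)]
        by (simp add: graph_product_Mod FactGroup_def gp_incl_def a_def b_def)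
    qed
    show "\<exists>w\<in>fp_words V G. foldr (\<lambda>s y. gp_incl (fst s) (snd s) \<otimes>\<^bsub>?P\<^esub> y) w \<one>\<^bsub>?P\<^esub> = x" if "x \<in> carrier ?P" for x
      using that foldr_gp_incl by (auto simp: carr)
    show "(u, w) \<in> (gp_step V E G \<union> (gp_step V E G)\<inverse>)\<^sup>*"
      if W: "u \<in> W" "w \<in> W" and eq: "foldr (\<lambda>s y. gp_incl (fst s) (snd s) \<otimes>\<^bsub>?P\<^esub> y) u \<one>\<^bsub>?P\<^esub> =
          foldr (\<lambda>s y. gp_incl (fst s) (snd s) \<otimes>\<^bsub>?P\<^esub> y) w \<one>\<^bsub>?P\<^esub>" for u w
    proof -
      have "ncl #>\<^bsub>F\<^esub> cls u = ncl #>\<^bsub>F\<^esub> cls w" using eq W foldr_gp_incl by simp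
      \<comment> \<open>The two words differ by an element of the normal closure, that is by a word
        \<open>t\<close> that reduces to nothing; so \<open>u\<close> is joined to
        \<open>t @ w\<close> and this to \<open>w\<close>.\<close>
      then have "cls u \<in> ncl #>\<^bsub>F\<^esub> cls w" using W F.rcos_self[OF _ ncl.subgroup_axioms, of "cls u"] by simp
      then obtain n where n: "n \<in> ncl" "cls u = n \<otimes>\<^bsub>F\<^esub> cls w" by (auto simp: r_coset_def)
      then obtain t where t: "t \<in> W" "n = cls t" "(t, []) \<in> gp_rel V E G" using ncl_kernel by (auto simp: kernel_def)
      have "(u, t @ w) \<in> gp_rel V E G"
        using n t W by (intro cls_eq_gp_rel) (simp_all add: cls_mult fp_words_append)
      moreover have "(t @ w, w) \<in> gp_rel V E G" using gp_rel_context[OF t(3) Nil_W W(2)] by simp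
      ultimately have "(u, w) \<in> gp_rel V E G" by (rule gp_rel_trans)
      then show ?thesis by (simp add: gp_rel_def)
    qed
  qed
qed

end

section \<open>Product regions\<close>

text \<open>The index \<open>n\<close> stands for the parallelism class of the coset \<open>r n H (L n)\<close>, that is, for the
  coset \<open>r n H (st (L n))\<close>; each class has exactly one index.\<close>

locale indexed_graph_group = countable_graph_group \<G> V E G incl emb
  for \<G> :: "('g, 'c) monoid_scheme" (structure)
    and V :: "'v set" and E :: "'v set set" and G :: "'v \<Rightarrow> ('a, 'b) monoid_scheme"
    and incl :: "'v \<Rightarrow> 'a \<Rightarrow> 'g" and emb :: "real \<Rightarrow> 'q" +
  fixes D :: "nat set" and L :: "nat \<Rightarrow> 'v set" and r :: "nat \<Rightarrow> 'g"
  assumes L_V: "n \<in> D \<Longrightarrow> L n \<subseteq> V" and L_ne: "n \<in> D \<Longrightarrow> L n \<noteq> {}" and r_in: "n \<in> D \<Longrightarrow> r n \<in> carrier \<G>"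
    and index_ex: "\<Lambda> \<subseteq> V \<Longrightarrow> \<Lambda> \<noteq> {} \<Longrightarrow> g \<in> carrier \<G> \<Longrightarrow> \<exists>n\<in>D. L n = \<Lambda> \<and> inv (r n) \<otimes> g \<in> H (st \<Lambda>)"
    and index_unique: "n \<in> D \<Longrightarrow> m \<in> D \<Longrightarrow> L n = L m \<Longrightarrow> inv (r n) \<otimes> r m \<in> H (st (L n)) \<Longrightarrow> n = m"
begin

text \<open>The union of all cosets in the parallelism class \<open>n\<close>, which is a product of
  a copy of \<open>H (L n)\<close> and one of \<open>H (lk (L n))\<close>. The element
  \<open>r n\<close> only serves as a base point.\<close>

definition P :: "nat \<Rightarrow> 'g set" where
  "P n = {x \<in> carrier \<G>. inv (r n) \<otimes> x \<in> H (st (L n))}"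

text \<open>All cosets in the class are identified with \<open>H (L n)\<close> through the base
  point. In this coordinate the gates onto parallel cosets agree (\<open>bp_base\<close>).\<close>

definition bp :: "nat \<Rightarrow> 'g \<Rightarrow> 'g" where
  "bp n x = gate (L n) (inv (r n) \<otimes> x)"

text \<open>A common point \<open>x\<close> of the regions yields the representatives
  \<open>x H (L m)\<close> and \<open>x H (L n)\<close>, the first contained in the second.\<close>

definition bnest :: "nat \<Rightarrow> nat \<Rightarrow> bool" where
  "bnest m n \<longleftrightarrow> L m \<subseteq> L n \<and> P m \<inter> P n \<noteq> {}"

definition borth :: "nat \<Rightarrow> nat \<Rightarrow> bool" where
  "borth m n \<longleftrightarrow> L m \<subseteq> lk (L n) \<and> P m \<inter> P n \<noteq> {}"

lemma P_carrier: "x \<in> P n \<Longrightarrow> x \<in> carrier \<G>" by (simp add: P_def)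

lemma r_P: "n \<in> D \<Longrightarrow> r n \<in> P n" by (simp add: P_def r_in)

lemma P_mult: assumes "n \<in> D" "x \<in> P n" "k \<in> H (st (L n))" shows "x \<otimes> k \<in> P n"
proof -
  have "inv (r n) \<otimes> (x \<otimes> k) = inv (r n) \<otimes> x \<otimes> k" using assms r_in by (simp add: P_def m_assoc)
  then show ?thesis using assms by (simp add: P_def)
qed

lemma P_diff: assumes "n \<in> D" "x \<in> P n" "y \<in> P n" shows "inv x \<otimes> y \<in> H (st (L n))"
proof -
  have "inv x \<otimes> y = inv (inv (r n) \<otimes> x) \<otimes> (inv (r n) \<otimes> y)"
    using assms r_in by (simp add: P_def group_simps)
  then show ?thesis using assms by (simp add: P_def)
qed

lemma P_eq: assumes "n \<in> D" "m \<in> D" "L n = L m" "P n \<inter> P m \<noteq> {}" shows "n = m"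
proof -
  obtain x where x: "x \<in> P n" "x \<in> P m" using assms by blast
  have c: "x \<in> carrier \<G>" "r n \<in> carrier \<G>" "r m \<in> carrier \<G>" using x P_carrier r_in assms by auto
  have "inv (r n) \<otimes> r m = (inv (r n) \<otimes> x) \<otimes> inv (inv (r m) \<otimes> x)" using c by (simp add: group_simps)
  then have "inv (r n) \<otimes> r m \<in> H (st (L n))" using x assms(3) by (simp add: P_def)
  then show ?thesis using index_unique assms by blast
qed

lemma bp_H [simp]: "n \<in> D \<Longrightarrow> x \<in> carrier \<G> \<Longrightarrow> bp n x \<in> H (L n)"
  by (simp add: bp_def r_in)

lemma bp_base:
  assumes "n \<in> D" "c \<in> P n" "y \<in> carrier \<G>" shows "bp n y = bp n c \<otimes> gate (L n) (inv c \<otimes> y)"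
proof -
  have "inv (r n) \<otimes> y = (inv (r n) \<otimes> c) \<otimes> (inv c \<otimes> y)" using assms r_in by (simp add: P_def m_assoc)
  then show ?thesis using assms gate_left[of "inv (r n) \<otimes> c" "L n" "inv c \<otimes> y"] by (simp add: P_def bp_def)
qed

lemma bp_in: assumes "n \<in> D" "k \<in> H (L n)" shows "bp n (r n \<otimes> k) = k"
proof -
  have "k \<in> carrier \<G>" using assms by simp
  then show ?thesis using assms r_in by (simp add: bp_def gate_id)
qed

text \<open>Points \<open>p\<close> and \<open>q\<close> in the two intersections differ by a factor
  \<open>a\<close> in \<open>H (L n)\<close> and a factor \<open>b\<close> in
  \<open>H (lk (L n))\<close>, which commute. Moving \<open>p\<close> along \<open>b\<close> stays
  in the first region, moving \<open>q\<close> back along \<open>a\<close> stays in the last, and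
  both lead to the same point.\<close>

lemma P_bridge:
  assumes "m \<in> D" "n \<in> D" "k \<in> D" "P m \<inter> P n \<noteq> {}" "P n \<inter> P k \<noteq> {}"
    and "lk (L n) \<subseteq> st (L m)" "L n \<subseteq> st (L k)"
  shows "P m \<inter> P k \<noteq> {}"
proof -
  obtain p q where pq: "p \<in> P m" "p \<in> P n" "q \<in> P n" "q \<in> P k" using assms by blast
  have c: "p \<in> carrier \<G>" "q \<in> carrier \<G>" using pq P_carrier by auto
  obtain a b where ab: "a \<in> H (L n)" "b \<in> H (lk (L n))" "inv p \<otimes> q = a \<otimes> b"
    using H_stE[OF P_diff[OF assms(2) pq(2,3)]] .
  have abc: "a \<in> carrier \<G>" "b \<in> carrier \<G>" using ab by auto
  have comm: "a \<otimes> b = b \<otimes> a" using H_commute ab by blast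
  have "p \<otimes> b \<in> P m" using P_mult[OF assms(1) pq(1)] H_mono[OF ab(2)] assms(6) by blast
  moreover have "q \<otimes> inv a \<in> P k" using P_mult[OF assms(3) pq(4)] H_mono[OF inv_H[OF ab(1)]] assms(7) by blast
  moreover have "q \<otimes> inv a = p \<otimes> b"
  proof -
    have "q = p \<otimes> (b \<otimes> a)" using c ab(3) comm by (metis cancel_left(2) inv_closed)
    then show ?thesis using c abc by (simp add: m_assoc)
  qed
  ultimately show ?thesis by auto
qed

section \<open>Nesting and orthogonality of classes\<close>

lemma bnest_refl: "n \<in> D \<Longrightarrow> bnest n n" using r_P by (auto simp: bnest_def)

lemma bnest_antisym: "m \<in> D \<Longrightarrow> n \<in> D \<Longrightarrow> bnest m n \<Longrightarrow> bnest n m \<Longrightarrow> m = n"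
  using P_eq[of m n] by (auto simp: bnest_def)

lemma bnest_same: "m \<in> D \<Longrightarrow> n \<in> D \<Longrightarrow> bnest m n \<Longrightarrow> L m = L n \<Longrightarrow> m = n"
  using P_eq[of m n] by (auto simp: bnest_def)

lemma bnest_trans: assumes "m \<in> D" "n \<in> D" "k \<in> D" "bnest m n" "bnest n k" shows "bnest m k"
proof -
  have "P m \<inter> P k \<noteq> {}"
    by (rule P_bridge[of m n k]) (use assms lk_antimono[of "L m" "L n"] in \<open>auto simp: bnest_def st_def\<close>)
  then show ?thesis using assms by (auto simp: bnest_def)
qed

lemma borth_sym: "m \<in> D \<Longrightarrow> n \<in> D \<Longrightarrow> borth m n \<Longrightarrow> borth n m"
  unfolding borth_def using lk_subset_sym L_V by (metis inf_commute)

lemma borth_not_bnest: "m \<in> D \<Longrightarrow> borth m n \<Longrightarrow> \<not> bnest m n"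
  unfolding borth_def bnest_def using L_ne lk_irrefl by blast

lemma borth_bnest: assumes "m \<in> D" "n \<in> D" "k \<in> D" "bnest m n" "borth n k" shows "borth m k"
proof -
  have "L n \<subseteq> st (L k)" using assms by (auto simp: borth_def st_def)
  then have "P m \<inter> P k \<noteq> {}"
    by (intro P_bridge[of m n k]) (use assms lk_antimono[of "L m" "L n"] in \<open>auto simp: bnest_def borth_def st_def\<close>)
  then show ?thesis using assms by (auto simp: bnest_def borth_def)
qed

text \<open>\<open>gate_coset\<close> for the coset that forms the region \<open>m\<close>: its
  second alternative would give a common point of both regions.\<close>

lemma bp_region_small:
  assumes "m \<in> D" "n \<in> D" "x \<in> P m" "y \<in> P m" "\<not> (L n \<subseteq> st (L m) \<and> P m \<inter> P n \<noteq> {})"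
  shows "\<exists>\<Delta>. \<Delta> \<subset> L n \<and> inv (bp n x) \<otimes> bp n y \<in> H \<Delta>"
proof -
  have c: "x \<in> carrier \<G>" "y \<in> carrier \<G>" "r n \<in> carrier \<G>" using assms P_carrier r_in by auto
  have z: "inv (r n) \<otimes> x \<in> carrier \<G>" using c by simp
  have k: "inv x \<otimes> y \<in> H (st (L m))" by (rule P_diff) fact+
  show ?thesis
  proof (cases rule: gate_coset[OF L_V[OF assms(2)] z, where \<Lambda> = "st (L m)"])
    case (1 \<Delta>)
    have "inv (gate (L n) (inv (r n) \<otimes> x)) \<otimes> gate (L n) (inv (r n) \<otimes> x \<otimes> (inv x \<otimes> y)) \<in> H \<Delta>"
      by (rule 1(3)[OF k])
    then show ?thesis using 1 c by (intro exI[of _ \<Delta>]) (simp add: bp_def m_assoc)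
  next
    case (2 \<sigma> j)
    have jc: "j \<in> carrier \<G>" "\<sigma> \<in> carrier \<G>" using 2 by auto
    have "x \<otimes> inv j = r n \<otimes> (inv (r n) \<otimes> x) \<otimes> inv j" using c jc by (simp add: m_assoc)
    also have "\<dots> = r n \<otimes> \<sigma>" unfolding 2(4) using c jc by (simp add: m_assoc)
    finally have e: "x \<otimes> inv j = r n \<otimes> \<sigma>" .
    have "x \<otimes> inv j \<in> P m" by (rule P_mult) (use assms 2 in auto)
    moreover have "r n \<otimes> \<sigma> \<in> P n" by (rule P_mult) (use assms 2 r_P in auto)
    ultimately have "P m \<inter> P n \<noteq> {}" using e by auto
    then show ?thesis using 2 assms by blast
  qed
qed

text \<open>In the case left over by \<open>bp_region_small\<close> the types of \<open>n\<close>
  lie in the star of \<open>L m\<close>, but neither all in \<open>L m\<close> nor all in its link.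
  Crossing the region along the two factors one after the other moves the projection by one
  coned-off step each.\<close>

lemma bp_region_diam:
  assumes "m \<in> D" "n \<in> D" "x \<in> P m" "y \<in> P m" "\<not> bnest n m" "\<not> borth n m"
  shows "mdist (cspace (L n)) (cpt (L n) (bp n x)) (cpt (L n) (bp n y)) \<le> 2"
proof (cases "L n \<subseteq> st (L m) \<and> P m \<inter> P n \<noteq> {}")
  case False
  have c: "x \<in> carrier \<G>" "y \<in> carrier \<G>" using assms P_carrier by auto
  obtain \<Delta> where D: "\<Delta> \<subset> L n" "inv (bp n x) \<otimes> bp n y \<in> H \<Delta>" using bp_region_small[OF assms(1-4) False] by blast
  have "bp n x \<in> H (L n)" "bp n y \<in> H (L n)" using assms c by auto
  moreover then have "bp n x \<in> carrier \<G>" "bp n y \<in> carrier \<G>" by auto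
  ultimately show ?thesis using mdist_cpt_cone[of "bp n x" "L n", OF _ coneI[OF D(2,1)]] by simp
next
  case True
  have c: "x \<in> carrier \<G>" "y \<in> carrier \<G>" "r n \<in> carrier \<G>" using assms P_carrier r_in by auto
  have "inv x \<otimes> y \<in> H (st (L m))" by (rule P_diff) fact+
  then obtain l k where lk: "l \<in> H (L m)" "k \<in> H (lk (L m))" "inv x \<otimes> y = l \<otimes> k" by (rule H_stE)
  define z where "z = inv (r n) \<otimes> x"
  have z: "z \<in> carrier \<G>" "z \<otimes> l \<in> carrier \<G>" "l \<in> carrier \<G>" "k \<in> carrier \<G>" using c lk by (auto simp: z_def)
  obtain a where a: "a \<in> H {v \<in> L n \<inter> L m. \<exists>k\<in>H (L m). near (L n) v (z \<otimes> k)}" "gate (L n) (z \<otimes> l) = gate (L n) z \<otimes> a"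
    using gate_mult_H[OF z(1) lk(1)] .
  obtain b where b: "b \<in> H {v \<in> L n \<inter> lk (L m). \<exists>j\<in>H (lk (L m)). near (L n) v (z \<otimes> l \<otimes> j)}"
    "gate (L n) (z \<otimes> l \<otimes> k) = gate (L n) (z \<otimes> l) \<otimes> b"
    using gate_mult_H[OF z(2) lk(2)] .
  have "\<not> L n \<subseteq> L m" using True assms(5) by (auto simp: bnest_def)
  then have ac: "a \<in> cone (L n)" by (intro coneI[OF a(1)]) auto
  have "\<not> L n \<subseteq> lk (L m)" using True assms(6) by (auto simp: borth_def)
  then have bc: "b \<in> cone (L n)" by (intro coneI[OF b(1)]) auto
  have "inv (r n) \<otimes> y = z \<otimes> (inv x \<otimes> y)" using c by (simp add: z_def m_assoc)
  also have "\<dots> = z \<otimes> l \<otimes> k" unfolding lk(3) using z by (simp add: m_assoc)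
  finally have y: "bp n y = bp n x \<otimes> a \<otimes> b" using a(2) b(2) by (simp add: bp_def z_def)
  have x: "bp n x \<in> H (L n)" using assms c by simp
  have "mdist (cspace (L n)) (cpt (L n) (bp n x)) (cpt (L n) (bp n x \<otimes> a \<otimes> b)) \<le> 1 + 1"
    by (rule mdist_triangle'[OF cpt_in cpt_in cpt_in mdist_cpt_cone[OF x ac] mdist_cpt_cone[OF _ bc]])
      (use x cone_H[OF ac] cone_H[OF bc] in auto)
  then show ?thesis by (simp add: y)
qed

text \<open>Walk from \<open>a\<close> to \<open>b\<close> by single letters. None has type
  \<open>v\<close>, as each step crosses a wall that separates the current point from
  \<open>b\<close>.\<close>

lemma sectors_omit:
  assumes "a \<in> H \<Omega>" "b \<in> H \<Omega>" "v \<in> V" "\<And>\<omega>. \<omega> \<in> H \<Omega> \<Longrightarrow> sector \<omega> v a = sector \<omega> v b"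
  shows "inv a \<otimes> b \<in> H (\<Omega> - {v})"
  using assms(1,4)
proof (induction "len (inv a \<otimes> b)" arbitrary: a rule: less_induct)
  case less
  have c: "a \<in> carrier \<G>" "b \<in> carrier \<G>" "inv a \<otimes> b \<in> H \<Omega>" using less.prems assms by auto
  show ?case
  proof (cases "a = b")
    case False
    then obtain u where u: "u \<in> \<Omega>" "sector a u b \<noteq> sector a u a" "gate {u} (inv a \<otimes> b) \<noteq> \<one>"
      using wall_exists[OF c(1,2) _ c(3)] by blast
    have uv: "u \<noteq> v" using u(2) less.prems by auto
    define s where "s = gate {u} (inv a \<otimes> b)"
    note s = step_towards[OF c u(3), folded s_def]
    have sD: "s \<in> H (\<Omega> - {v})" "s \<in> H \<Omega>" by (rule H_mono[OF s(1)], use u(1) uv in auto)+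
    have as: "a \<otimes> s \<in> H \<Omega>" using less.prems sD by simp
    have "sector \<omega> v (a \<otimes> s) = sector \<omega> v b" if "\<omega> \<in> H \<Omega>" for \<omega>
      using s(4) less.prems(2)[OF that] H_closed[OF that] assms(3) unfolding between_def by fastforce
    from less.hyps[OF s(6) as this] have "inv (a \<otimes> s) \<otimes> b \<in> H (\<Omega> - {v})" .
    from mult_H[OF sD(1) this] show ?thesis using c s(2) by (simp add: group_simps)
  qed (use c in simp)
qed

lemma sectors_eq:
  assumes "a \<in> H \<Omega>" "b \<in> H \<Omega>" "\<And>v \<omega>. v \<in> \<Omega> \<Longrightarrow> \<omega> \<in> H \<Omega> \<Longrightarrow> sector \<omega> v a = sector \<omega> v b"
  shows "a = b"
  using wall_exists[of a b \<Omega>] assms by (metis H_closed inv_H mult_H)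

lemma gate_region:
  assumes "m \<in> D" "x \<in> carrier \<G>"
  obtains q where "q \<in> P m" "q = r m \<otimes> gate (st (L m)) (inv (r m) \<otimes> x)"
    "\<And>v \<omega>. v \<in> L m \<Longrightarrow> \<omega> \<in> H (L m) \<Longrightarrow> sector \<omega> v (inv (r m) \<otimes> q) = sector \<omega> v (inv (r m) \<otimes> x)"
proof
  let ?q = "r m \<otimes> gate (st (L m)) (inv (r m) \<otimes> x)"
  have c: "r m \<in> carrier \<G>" using assms r_in by simp
  show "?q \<in> P m" using assms c by (simp add: P_def)
  fix v \<omega> assume "v \<in> L m" "\<omega> \<in> H (L m)"
  then show "sector \<omega> v (inv (r m) \<otimes> ?q) = sector \<omega> v (inv (r m) \<otimes> x)"
    using sector_gate[of \<omega> "st (L m)" v "inv (r m) \<otimes> x"] H_st assms c by (simp add: st_def)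
qed simp

text \<open>Let \<open>q\<close> be the gate of \<open>x\<close> in the region \<open>m\<close>. If
  some type of \<open>L n\<close> contributes no separating wall, then \<open>x\<close> and
  \<open>q\<close> have projections to \<open>n\<close> in a coset of a proper parabolic subgroup.
  Otherwise \<open>star_between\<close> provides a point \<open>w\<close> of the region
  \<open>n\<close> between \<open>x\<close> and \<open>q\<close>; as no wall relevant to
  \<open>m\<close> separates \<open>x\<close> from \<open>q\<close>, none separates \<open>x\<close>
  from \<open>w\<close>.\<close>

lemma base_consistency:
  assumes mn: "m \<in> D" "n \<in> D" and x: "x \<in> carrier \<G>"
  shows "(\<exists>q\<in>P m. \<exists>\<Delta>. \<Delta> \<subset> L n \<and> inv (bp n x) \<otimes> bp n q \<in> H \<Delta>) \<or> (\<exists>w\<in>P n. bp m w = bp m x)"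
proof -
  obtain q where q: "q \<in> P m" "\<And>v \<omega>. v \<in> L m \<Longrightarrow> \<omega> \<in> H (L m) \<Longrightarrow> sector \<omega> v (inv (r m) \<otimes> q) = sector \<omega> v (inv (r m) \<otimes> x)"
    using gate_region[OF mn(1) x] by metis
  have c: "r m \<in> carrier \<G>" "r n \<in> carrier \<G>" "q \<in> carrier \<G>" using mn r_in q P_carrier by auto
  define x' q' where "x' = inv (r n) \<otimes> x" and "q' = inv (r n) \<otimes> q"
  have c': "x' \<in> carrier \<G>" "q' \<in> carrier \<G>" using c x by (simp_all add: x'_def q'_def)
  show ?thesis
  proof (cases "\<forall>v\<in>L n. \<exists>\<omega>\<in>H (L n). sector \<omega> v x' \<noteq> sector \<omega> v q'")
    case True
    then obtain w where w: "w \<in> H (st (L n))" "between x' w q'" using star_between[OF L_V[OF mn(2)] c'] by blast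
    have wc: "w \<in> carrier \<G>" using w by simp
    have wP: "r n \<otimes> w \<in> P n" by (rule P_mult) (use mn r_P w in auto)
    have "between (r n \<otimes> x') (r n \<otimes> w) (r n \<otimes> q')" by (rule between_left) (use w c c' wc in auto)
    then have b: "between x (r n \<otimes> w) q" using c x by (simp add: x'_def q'_def)
    have b': "between (inv (r m) \<otimes> x) (inv (r m) \<otimes> (r n \<otimes> w)) (inv (r m) \<otimes> q)"
      by (rule between_left[OF b]) (use c x wc in auto)
    have "bp m (r n \<otimes> w) = bp m x"
    proof (rule sectors_eq[of _ "L m"])
      fix v \<omega> assume v: "v \<in> L m" "\<omega> \<in> H (L m)"
      then have "sector \<omega> v (inv (r m) \<otimes> (r n \<otimes> w)) = sector \<omega> v (inv (r m) \<otimes> x)"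
        using b' q(2)[OF v] L_V[OF mn(1)] H_closed[OF v(2)] unfolding between_def by fastforce
      then show "sector \<omega> v (bp m (r n \<otimes> w)) = sector \<omega> v (bp m x)"
        using v sector_gate c wc x by (simp add: bp_def)
    qed (use mn c wc x in auto)
    then show ?thesis using wP by blast
  next
    case False
    then obtain v where v: "v \<in> L n" "\<And>\<omega>. \<omega> \<in> H (L n) \<Longrightarrow> sector \<omega> v x' = sector \<omega> v q'" by blast
    have "inv (bp n x) \<otimes> bp n q \<in> H (L n - {v})"
    proof (rule sectors_omit)
      show "sector \<omega> v (bp n x) = sector \<omega> v (bp n q)" if "\<omega> \<in> H (L n)" for \<omega>
        using that v sector_gate c' by (simp add: bp_def x'_def q'_def)
    qed (use mn c x v L_V in auto)
    then show ?thesis using q(1) v(1) by blast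
  qed
qed

text \<open>The coset of \<open>L m\<close> may be chosen inside the coset
  \<open>r n H (L n)\<close>. By \<open>gate_gate\<close> the coordinate in \<open>m\<close> is then
  determined by the coordinate in \<open>n\<close>.\<close>

lemma bnest_rep:
  assumes "m \<in> D" "n \<in> D" "bnest m n"
  obtains h where "h \<in> H (L n)" "r n \<otimes> h \<in> P m"
    "\<And>y. y \<in> carrier \<G> \<Longrightarrow> bp m y = bp m (r n \<otimes> h) \<otimes> gate (L m) (inv h \<otimes> bp n y)"
proof -
  obtain x0 where x0: "x0 \<in> P m" "x0 \<in> P n" using assms by (auto simp: bnest_def)
  have c: "x0 \<in> carrier \<G>" "r n \<in> carrier \<G>" using x0 P_carrier r_in assms by auto
  obtain h k where hk: "h \<in> H (L n)" "k \<in> H (lk (L n))" "inv (r n) \<otimes> x0 = h \<otimes> k"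
    using H_stE[of "inv (r n) \<otimes> x0" "L n"] x0(2) unfolding P_def by blast
  have hkc: "h \<in> carrier \<G>" "k \<in> carrier \<G>" using hk by auto
  have "x0 = r n \<otimes> (h \<otimes> k)" unfolding hk(3)[symmetric] using c by simp
  then have e: "r n \<otimes> h = x0 \<otimes> inv k" using c hkc by (simp add: m_assoc)
  have "lk (L n) \<subseteq> lk (L m)" using assms lk_antimono by (auto simp: bnest_def)
  then have "inv k \<in> H (st (L m))" using H_mono[OF inv_H[OF hk(2)]] by (intro H_lk_st) blast
  then have P: "r n \<otimes> h \<in> P m" unfolding e by (rule P_mult[OF assms(1) x0(1)])
  have "bp m y = bp m (r n \<otimes> h) \<otimes> gate (L m) (inv h \<otimes> bp n y)" if y: "y \<in> carrier \<G>" for y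
  proof -
    have "inv (r n \<otimes> h) \<otimes> y = inv h \<otimes> (inv (r n) \<otimes> y)" using c hkc y by (simp add: group_simps)
    moreover have "gate (L m) (inv h \<otimes> (inv (r n) \<otimes> y)) = gate (L m) (gate (L n) (inv h \<otimes> (inv (r n) \<otimes> y)))"
      using assms c hkc y by (simp add: gate_gate bnest_def)
    moreover have "gate (L n) (inv h \<otimes> (inv (r n) \<otimes> y)) = inv h \<otimes> bp n y"
      using hk(1) c y by (simp add: gate_left_H bp_def)
    ultimately show ?thesis using bp_base[OF assms(1) P y] by simp
  qed
  then show ?thesis using that hk(1) P by blast
qed

lemma sector_gate_left:
  assumes "h \<in> H \<Omega>" "a \<in> H \<Lambda>" "v \<in> \<Lambda>" "q \<in> H \<Omega>"
  shows "sector (h \<otimes> a) v q = sector a v (gate \<Lambda> (inv h \<otimes> q))"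
  using assms sector_left[of a "inv h" q v] H_closed[OF assms(1)] H_closed[OF assms(2)] H_closed[OF assms(4)]
  by (simp add: sector_gate)

text \<open>Different coordinates in \<open>m\<close> are separated by a wall at a point of the
  coset \<open>h H (L m)\<close> inside \<open>H (L n)\<close>. The geodesic must cross this wall,
  hence passes within 7 of that point by \<open>cpath_near_wall\<close>.\<close>

lemma base_geodesic_image:
  assumes mn: "m \<in> D" "n \<in> D" "bnest m n" and x: "x \<in> carrier \<G>" "y \<in> carrier \<G>" "bp m x \<noteq> bp m y"
    and seg: "geodesic_segment (cspace (L n)) (cpt (L n) (bp n x)) (cpt (L n) (bp n y)) Q"
  shows "\<exists>g\<in>P m. \<exists>q\<in>Q. mdist (cspace (L n)) q (cpt (L n) (bp n g)) \<le> 7"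
proof -
  obtain h where h: "h \<in> H (L n)" "r n \<otimes> h \<in> P m"
    "\<And>y. y \<in> carrier \<G> \<Longrightarrow> bp m y = bp m (r n \<otimes> h) \<otimes> gate (L m) (inv h \<otimes> bp n y)"
    using bnest_rep[OF mn] by blast
  define a b where "a = gate (L m) (inv h \<otimes> bp n x)" and "b = gate (L m) (inv h \<otimes> bp n y)"
  have xn: "bp n x \<in> H (L n)" "bp n y \<in> H (L n)" using mn x by auto
  have c: "h \<in> carrier \<G>" "bp n x \<in> carrier \<G>" "bp n y \<in> carrier \<G>" "r n \<in> carrier \<G>" using h(1) xn r_in mn by auto
  have ab: "a \<in> H (L m)" "b \<in> H (L m)" using c by (simp_all add: a_def b_def)
  have abc: "a \<in> carrier \<G>" "b \<in> carrier \<G>" "inv a \<otimes> b \<in> H (L m)" using ab by auto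
  have sub: "L m \<subseteq> L n" using mn by (simp add: bnest_def)
  have "a \<noteq> b" using x h(3) by (auto simp: a_def b_def)
  then obtain v where v: "v \<in> L m" "sector a v b \<noteq> sector a v a" using wall_exists[OF abc(1,2) _ abc(3)] by blast
  have aH: "a \<in> H (L n)" using H_mono[OF ab(1)] sub by blast
  have "sector (h \<otimes> a) v (bp n x) \<noteq> sector (h \<otimes> a) v (bp n y)"
    using v sector_gate_left[OF h(1) ab(1) v(1) xn(1)] sector_gate_left[OF h(1) ab(1) v(1) xn(2)]
    by (simp add: a_def b_def)
  moreover have e: "mdist (cspace (L n)) (cpt (L n) (bp n x)) (cpt (L n) (bp n x)) \<le> 1"
    "mdist (cspace (L n)) (cpt (L n) (bp n y)) (cpt (L n) (bp n y)) \<le> 1" using xn by auto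
  obtain \<gamma> where g: "cpath (L n) \<gamma> (mdist (cspace (L n)) (cpt (L n) (bp n x)) (cpt (L n) (bp n y))) (bp n x) (bp n y)"
    "Q = \<gamma> ` {0..mdist (cspace (L n)) (cpt (L n) (bp n x)) (cpt (L n) (bp n y))}"
    using segment_cpath[OF seg xn e] by blast
  ultimately obtain t where "t \<in> {0..mdist (cspace (L n)) (cpt (L n) (bp n x)) (cpt (L n) (bp n y))}"
    "mdist (cspace (L n)) (\<gamma> t) (cpt (L n) (h \<otimes> a)) \<le> 7"
    using cpath_near_wall[OF g(1) mult_H[OF h(1) aH] subsetD[OF sub v(1)]] by blast
  moreover have "bp n (r n \<otimes> h \<otimes> a) = h \<otimes> a"
    using bp_in[OF mn(2), of "h \<otimes> a"] h(1) aH c abc by (simp add: m_assoc)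
  moreover have "r n \<otimes> h \<otimes> a \<in> P m" using P_mult[OF mn(1) h(2) H_st[OF ab(1)]] .
  ultimately show ?thesis using g(2) by (metis imageI)
qed

text \<open>Each edge of a geodesic edge path in the coned-off graph lies in a coset of a proper
  parabolic subgroup; these cosets are the links, at most as many as the distance. A class
  \<open>m\<close> nested in none of them is moved by each edge at most one step, and only edges
  near the coset of \<open>m\<close> move it at all. On a geodesic there are boundedly many such
  edges.\<close>

lemma base_large_links:
  assumes n: "n \<in> D" "card (L n) \<noteq> 1" and x: "x \<in> carrier \<G>" "y \<in> carrier \<G>"
  shows "\<exists>K. finite K \<and> K \<subseteq> D \<and> real (card K) \<le> mdist (cspace (L n)) (cpt (L n) (bp n x)) (cpt (L n) (bp n y)) \<and>
    (\<forall>k\<in>K. bnest k n \<and> k \<noteq> n) \<and>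
    (\<forall>m\<in>D. bnest m n \<and> m \<noteq> n \<and> (\<forall>k\<in>K. \<not> bnest m k) \<longrightarrow>
      (card (L m) = 1 \<longrightarrow> bp m x = bp m y) \<and>
      mdist (cspace (L m)) (cpt (L m) (bp m x)) (cpt (L m) (bp m y)) \<le> 9)"
proof -
  define \<Omega> where "\<Omega> = L n"
  have \<Omega>: "finite \<Omega>" "\<Omega> \<noteq> {}" using L_V[OF n(1)] L_ne[OF n(1)] finite_subset[OF _ finV] by (auto simp: \<Omega>_def)
  then have card: "\<not> card \<Omega> \<le> 1" using n(2) \<Omega>_def by (metis One_nat_def Suc_leI antisym card_gt_0_iff)
  have xn: "bp n x \<in> H \<Omega>" "bp n y \<in> H \<Omega>" using n x by (auto simp: \<Omega>_def)
  have rn: "r n \<in> carrier \<G>" using r_in n by simp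
  interpret cg: connected_graph "H \<Omega>" "cone_edges \<Omega>" by (rule connected_cone)
  define N where "N = vertex_dist (cone_edges \<Omega>) (bp n x) (bp n y)"
  have "(bp n x, bp n y) \<in> cone_edges \<Omega> ^^ N" unfolding N_def using cg.vertex_dist_path xn by blast
  then obtain q where q: "q 0 = bp n x" "q N = bp n y" "\<And>i. i < N \<Longrightarrow> (q i, q (Suc i)) \<in> cone_edges \<Omega>"
    by (auto simp: relpow_fun_conv)
  have qH: "q i \<in> H \<Omega>" if "i \<le> N" for i
  proof (cases "i = N")
    case False
    then show ?thesis using q(3)[of i] that by (simp add: cone_edges_def)
  qed (use q(2) xn in simp)
  have sub_path: "(q i, q (i + j)) \<in> cone_edges \<Omega> ^^ j" if "i + j \<le> N" for i j
    unfolding relpow_fun_conv by (rule exI[of _ "\<lambda>k. q (i + k)"]) (use that q(3) in auto)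
  \<comment> \<open>The edge path is shortest, and so are all its subpaths.\<close>
  have dq: "real j \<le> mdist (cspace \<Omega>) (cpt \<Omega> (q i)) (cpt \<Omega> (q (i + j)))" if ij: "i + j \<le> N" for i j
  proof -
    have "N \<le> vertex_dist (cone_edges \<Omega>) (q 0) (q i) + (vertex_dist (cone_edges \<Omega>) (q i) (q (i + j)) +
        vertex_dist (cone_edges \<Omega>) (q (i + j)) (q N))"
      using cg.vertex_dist_triangle[OF qH qH qH, of 0 i N] cg.vertex_dist_triangle[OF qH qH qH, of i "i + j" N] ij q
      by (simp add: N_def)
    moreover have "vertex_dist (cone_edges \<Omega>) (q 0) (q i) \<le> i"
      using cg.vertex_dist_le[OF sub_path[of 0 i]] ij by simp
    moreover have "vertex_dist (cone_edges \<Omega>) (q (i + j)) (q N) \<le> N - (i + j)"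
      using cg.vertex_dist_le[OF sub_path[of "i + j" "N - (i + j)"]] ij by simp
    ultimately have "j \<le> vertex_dist (cone_edges \<Omega>) (q i) (q (i + j))" using ij by linarith
    then show ?thesis using mdist_cpt[OF qH qH, of i "i + j"] ij by simp
  qed
  \<comment> \<open>As \<open>card \<Omega>\<close> exceeds 1, an edge comes from a proper subset of
    \<Omega>; the subset is non-empty because the edge has different ends.\<close>
  have "\<exists>k \<Delta>. k \<in> D \<and> L k = \<Delta> \<and> \<Delta> \<subset> \<Omega> \<and> inv (q i) \<otimes> q (Suc i) \<in> H \<Delta> \<and> r n \<otimes> q i \<in> P k" if i: "i < N" for i
  proof -
    obtain \<Delta> where D: "\<Delta> \<subset> \<Omega>" "inv (q i) \<otimes> q (Suc i) \<in> H \<Delta>" and ne: "q i \<noteq> q (Suc i)"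
      using q(3)[OF i] card by (auto simp: cone_edges_def cone_def)
    have qc: "q i \<in> carrier \<G>" "q (Suc i) \<in> carrier \<G>" using qH[of i] qH[of "Suc i"] i by auto
    have "\<Delta> \<noteq> {}"
    proof
      assume "\<Delta> = {}"
      then have "inv (q i) \<otimes> q (Suc i) = \<one>" using D H_empty by blast
      then have "q (Suc i) = q i" using qc by (metis cancel_left(2) r_one)
      then show False using ne by simp
    qed
    moreover have "\<Delta> \<subseteq> V" "r n \<otimes> q i \<in> carrier \<G>" using D L_V[OF n(1)] rn qc by (auto simp: \<Omega>_def)
    ultimately obtain k where "k \<in> D" "L k = \<Delta>" "inv (r k) \<otimes> (r n \<otimes> q i) \<in> H (st \<Delta>)" using index_ex by blast
    then show ?thesis using D rn qc by (intro exI[of _ k] exI[of _ \<Delta>]) (simp add: P_def)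
  qed
  then obtain k where k: "\<And>i. i < N \<Longrightarrow> k i \<in> D \<and> L (k i) \<subset> \<Omega> \<and> inv (q i) \<otimes> q (Suc i) \<in> H (L (k i)) \<and> r n \<otimes> q i \<in> P (k i)"
    by metis
  have far: "bp m x = bp m y \<or> card (L m) \<noteq> 1"
    "mdist (cspace (L m)) (cpt (L m) (bp m x)) (cpt (L m) (bp m y)) \<le> 9"
    if m: "m \<in> D" "bnest m n" "m \<noteq> n" and no: "\<And>i. i < N \<Longrightarrow> \<not> bnest m (k i)" for m
  proof -
    obtain h where h: "h \<in> H \<Omega>" "r n \<otimes> h \<in> P m"
      "\<And>y. y \<in> carrier \<G> \<Longrightarrow> bp m y = bp m (r n \<otimes> h) \<otimes> gate (L m) (inv h \<otimes> bp n y)"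
      using bnest_rep[OF m(1) n(1) m(2)] unfolding \<Omega>_def by blast
    have hc: "h \<in> carrier \<G>" using h by simp
    have sub: "L m \<subset> \<Omega>" using m bnest_same[OF m(1) n(1) m(2)] by (auto simp: bnest_def \<Omega>_def)
    define \<phi> where "\<phi> i = bp m (r n \<otimes> h) \<otimes> gate (L m) (inv h \<otimes> q i)" for i
    have gH: "gate (L m) (inv h \<otimes> q i) \<in> H (L m)" "q i \<in> carrier \<G>" if "i \<le> N" for i
      using hc H_closed[OF qH[OF that]] by auto
    have bpH: "bp m (r n \<otimes> h) \<in> H (L m)" using m rn hc by simp
    have \<phi>H: "\<phi> i \<in> H (L m)" if "i \<le> N" for i using gH[OF that] bpH by (simp add: \<phi>_def)
    have \<phi>0: "\<phi> 0 = bp m x" "\<phi> N = bp m y" using h(3) x q by (auto simp: \<phi>_def)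
    have small: "\<exists>\<Delta>. \<Delta> \<subset> L m \<and> inv (\<phi> i) \<otimes> \<phi> (Suc i) \<in> H \<Delta>" if i: "i < N" for i
    proof -
      have z: "inv h \<otimes> q i \<in> carrier \<G>" using hc gH[of i] i by simp
      have qq: "inv h \<otimes> q i \<otimes> (inv (q i) \<otimes> q (Suc i)) = inv h \<otimes> q (Suc i)"
        using hc gH(2)[of i] gH(2)[of "Suc i"] i by (simp add: m_assoc)
      show ?thesis
      proof (cases rule: gate_coset[OF L_V[OF m(1)] z, where \<Lambda> = "L (k i)"])
        case (1 \<Delta>)
        have "inv (gate (L m) (inv h \<otimes> q i)) \<otimes> gate (L m) (inv h \<otimes> q (Suc i)) \<in> H \<Delta>"
          using 1(3)[of "inv (q i) \<otimes> q (Suc i)"] k[OF i] qq by simp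
        moreover have "inv (\<phi> i) \<otimes> \<phi> (Suc i) = inv (gate (L m) (inv h \<otimes> q i)) \<otimes> gate (L m) (inv h \<otimes> q (Suc i))"
          using H_closed[OF bpH] H_closed[OF gH(1)[of i]] H_closed[OF gH(1)[of "Suc i"]] i by (simp add: \<phi>_def group_simps)
        ultimately show ?thesis using 1(1) by auto
      next
        case (2 \<sigma> j)
        have c: "j \<in> carrier \<G>" "\<sigma> \<in> carrier \<G>" "q i \<in> carrier \<G>" using 2 gH(2)[of i] i by auto
        have "q i \<otimes> inv j = h \<otimes> (inv h \<otimes> q i) \<otimes> inv j" using c hc by simp
        also have "\<dots> = h \<otimes> \<sigma>" unfolding 2(4) using c hc by (simp add: m_assoc)
        finally have e: "r n \<otimes> q i \<otimes> inv j = r n \<otimes> h \<otimes> \<sigma>" using c hc rn by (simp add: m_assoc)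
        have "r n \<otimes> q i \<otimes> inv j \<in> P (k i)" using P_mult[of "k i" "r n \<otimes> q i" "inv j"] k[OF i] H_st[OF inv_H[OF 2(3)]] by blast
        moreover have "r n \<otimes> h \<otimes> \<sigma> \<in> P m" using P_mult[OF m(1) h(2) 2(2)] .
        ultimately have "bnest m (k i)" using 2(1) e by (auto simp: bnest_def)
        then show ?thesis using no i by blast
      qed
    qed
    show "bp m x = bp m y \<or> card (L m) \<noteq> 1"
    proof (cases "card (L m) = 1")
      case True
      then obtain v where v: "L m = {v}" by (rule card_1_singletonE)
      have "\<phi> i = \<phi> 0" if "i \<le> N" for i
        using that
      proof (induction i)
        case (Suc i)
        obtain \<Delta> where "\<Delta> \<subset> {v}" "inv (\<phi> i) \<otimes> \<phi> (Suc i) \<in> H \<Delta>" using small[of i] Suc v by auto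
        then have "inv (\<phi> i) \<otimes> \<phi> (Suc i) = \<one>" using H_empty by (metis subset_singletonD psubset_imp_subset less_irrefl)
        moreover have "\<phi> i \<in> carrier \<G>" "\<phi> (Suc i) \<in> carrier \<G>" using H_closed[OF \<phi>H] Suc by auto
        ultimately have "\<phi> (Suc i) = \<phi> i" by (metis cancel_left(2) r_one)
        then show ?case using Suc by simp
      qed simp
      from this[of N] show ?thesis using \<phi>0 by simp
    qed simp
    let ?d = "\<lambda>i j. mdist (cspace (L m)) (cpt (L m) (\<phi> i)) (cpt (L m) (\<phi> j))"
    \<comment> \<open>The edges along which the coordinate in \<open>m\<close> really
      changes.\<close>
    define A where "A = {i. i < N \<and> \<phi> i \<noteq> \<phi> (Suc i)}"
    have step: "?d i (Suc i) \<le> (if i \<in> A then 1 else 0)" if i: "i < N" for i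
    proof (cases "i \<in> A")
      case True
      obtain \<Delta> where D: "\<Delta> \<subset> L m" "inv (\<phi> i) \<otimes> \<phi> (Suc i) \<in> H \<Delta>" using small[OF i] by blast
      have "\<phi> i \<in> carrier \<G>" "\<phi> (Suc i) \<in> carrier \<G>" using H_closed[OF \<phi>H] i by auto
      then show ?thesis using mdist_cpt_cone[OF \<phi>H coneI[OF D(2,1)], of i] True i by simp
    next
      case False
      then show ?thesis using i \<phi>H[of i] by (simp add: A_def)
    qed
    have "?d 0 i \<le> real (card {j \<in> A. j < i})" if "i \<le> N" for i
      using that
    proof (induction i)
      case 0 then show ?case using \<phi>H[of 0] by simp
    next
      case (Suc i)
      have A: "{j \<in> A. j < Suc i} = {j \<in> A. j < i} \<union> (if i \<in> A then {i} else {})" by (auto simp: less_Suc_eq)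
      have fin: "finite {j \<in> A. j < i}" by auto
      have "real (card {j \<in> A. j < Suc i}) = real (card {j \<in> A. j < i}) + (if i \<in> A then 1 else 0)"
        unfolding A using fin by (subst card_Un_disjoint) auto
      moreover have "?d 0 (Suc i) \<le> real (card {j \<in> A. j < i}) + (if i \<in> A then 1 else 0)"
        by (rule mdist_triangle'[OF cpt_in cpt_in cpt_in Suc.IH step]) (use Suc.prems \<phi>H in auto)
      ultimately show ?case by simp
    qed
    from this[of N] have dN: "?d 0 N \<le> real (card {j \<in> A. j < N})" by simp
    \<comment> \<open>Such an edge crosses a wall at a point \<open>h \<otimes> a\<close> of the
      coset of \<open>m\<close>. By \<open>chain_near_wall\<close> for a single edge this point is
      within 1 + 2, and it is one coned-off step away from \<open>h\<close>.\<close>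
    have near_h: "mdist (cspace \<Omega>) (cpt \<Omega> (q i)) (cpt \<Omega> h) \<le> 4" if i: "i \<in> A" for i
    proof -
      have iN: "i < N" "\<phi> i \<noteq> \<phi> (Suc i)" using i by (auto simp: A_def)
      define a b where "a = gate (L m) (inv h \<otimes> q i)" and "b = gate (L m) (inv h \<otimes> q (Suc i))"
      have ab: "a \<in> H (L m)" "b \<in> H (L m)" "a \<noteq> b" using gH iN by (auto simp: a_def b_def \<phi>_def)
      have abc: "a \<in> carrier \<G>" "b \<in> carrier \<G>" "inv a \<otimes> b \<in> H (L m)" using ab by auto
      obtain v where v: "v \<in> L m" "sector a v b \<noteq> sector a v a" using wall_exists[OF abc(1,2) ab(3) abc(3)] by blast
      have aH: "a \<in> H \<Omega>" using H_mono[OF ab(1)] sub by blast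
      have qi: "q i \<in> H \<Omega>" "q (Suc i) \<in> H \<Omega>" using qH iN by auto
      have "sector (h \<otimes> a) v (q i) \<noteq> sector (h \<otimes> a) v (q (Suc i))"
        using v sector_gate_left[OF h(1) ab(1) v(1) qi(1)] sector_gate_left[OF h(1) ab(1) v(1) qi(2)]
        by (simp add: a_def b_def)
      then have 1: "mdist (cspace \<Omega>) (cpt \<Omega> (q i)) (cpt \<Omega> (h \<otimes> a)) \<le> real 1 + 2"
        using q(3)[OF iN(1)] qi h(1) aH v(1) sub by (intro chain_near_wall[of _ _ "q (Suc i)"]) auto
      have "mdist (cspace \<Omega>) (cpt \<Omega> h) (cpt \<Omega> (h \<otimes> a)) \<le> 1" by (rule mdist_cpt_cone[OF h(1) coneI[OF ab(1) sub]])
      then have 2: "mdist (cspace \<Omega>) (cpt \<Omega> (h \<otimes> a)) (cpt \<Omega> h) \<le> 1" by (simp add: mdist_commute)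
      have "mdist (cspace \<Omega>) (cpt \<Omega> (q i)) (cpt \<Omega> h) \<le> (real 1 + 2) + 1"
        by (rule mdist_triangle'[OF cpt_in cpt_in cpt_in 1 2]) (use qi h aH in auto)
      then show ?thesis by simp
    qed
    \<comment> \<open>Two such edges start within 4 + 4 of each other, so at most 9 consecutive
      indices are possible.\<close>
    have window: "j \<le> i + 8" if "i \<in> A" "j \<in> A" "i \<le> j" for i j
    proof -
      have ij: "i \<le> N" "j \<le> N" using that by (auto simp: A_def)
      have "mdist (cspace \<Omega>) (cpt \<Omega> h) (cpt \<Omega> (q j)) \<le> 4" using near_h[OF that(2)] by (simp add: mdist_commute)
      from mdist_triangle'[OF cpt_in cpt_in cpt_in near_h[OF that(1)] this]
      have "mdist (cspace \<Omega>) (cpt \<Omega> (q i)) (cpt \<Omega> (q j)) \<le> 4 + 4" using qH ij h(1) by auto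
      then have "real (j - i) \<le> 8" using dq[of i "j - i"] ij that(3) by simp
      then show ?thesis by linarith
    qed
    have "card {j \<in> A. j < N} \<le> 9"
    proof (cases "A = {}")
      case False
      have fin: "finite A" by (auto simp: A_def)
      define i0 where "i0 = Min A"
      have "i0 \<in> A" "\<And>j. j \<in> A \<Longrightarrow> i0 \<le> j" using fin False by (auto simp: i0_def)
      then have "{j \<in> A. j < N} \<subseteq> {i0..i0 + 8}" using window by auto
      then have "card {j \<in> A. j < N} \<le> card {i0..i0 + 8}" by (intro card_mono) auto
      then show ?thesis by simp
    qed simp
    then have "real (card {j \<in> A. j < N}) \<le> 9" by simp
    then show "mdist (cspace (L m)) (cpt (L m) (bp m x)) (cpt (L m) (bp m y)) \<le> 9" using dN \<phi>0 by simp
  qed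
  define K where "K = k ` {..<N}"
  have "card K \<le> N" unfolding K_def using card_image_le[of "{..<N}" k] by simp
  then have "real (card K) \<le> mdist (cspace \<Omega>) (cpt \<Omega> (bp n x)) (cpt \<Omega> (bp n y))" using mdist_cpt[OF xn] by (simp add: N_def)
  moreover have "bnest j n \<and> j \<noteq> n" if j: "j \<in> K" for j
  proof -
    obtain i where i: "i < N" "j = k i" using j by (auto simp: K_def)
    have "r n \<otimes> q i \<in> P n" using P_mult[OF n(1) r_P[OF n(1)] H_st] qH[of i] i by (simp add: \<Omega>_def)
    then show ?thesis using k[OF i(1)] i by (auto simp: bnest_def \<Omega>_def)
  qed
  moreover have "finite K" "K \<subseteq> D" using k by (auto simp: K_def)
  moreover have "(card (L m) = 1 \<longrightarrow> bp m x = bp m y) \<and> mdist (cspace (L m)) (cpt (L m) (bp m x)) (cpt (L m) (bp m y)) \<le> 9"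
    if "m \<in> D" "bnest m n \<and> m \<noteq> n \<and> (\<forall>k\<in>K. \<not> bnest m k)" for m
    using far[of m] that by (auto simp: K_def)
  ultimately show ?thesis unfolding \<Omega>_def by (intro exI[of _ K]) blast
qed

text \<open>Classes are treated one at a time. For a new class \<open>n\<close> the point is first
  moved to its gate in the region \<open>n\<close> and then translated along \<open>H (L n)\<close>.
  Since \<open>L m\<close> and \<open>L n\<close> lie in each other's links, both moves preserve the
  regions and coordinates already arranged.\<close>

lemma base_realisation:
  assumes "finite B" "B \<subseteq> D" "\<And>m n. m \<in> B \<Longrightarrow> n \<in> B \<Longrightarrow> m \<noteq> n \<Longrightarrow> borth m n" "\<And>n. n \<in> B \<Longrightarrow> a n \<in> H (L n)"
  shows "\<exists>x\<in>carrier \<G>. \<forall>n\<in>B. x \<in> P n \<and> bp n x = a n"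
  using assms
proof (induction B rule: finite_induct)
  case (insert n B)
  obtain x where x: "x \<in> carrier \<G>" "\<And>m. m \<in> B \<Longrightarrow> x \<in> P m \<and> bp m x = a m" using insert by auto
  have n: "n \<in> D" "a n \<in> H (L n)" "r n \<in> carrier \<G>" using insert r_in by auto
  define z b where "z = gate (st (L n)) (inv (r n) \<otimes> x)" and "b = gate (L n) z"
  have z: "z \<in> H (st (L n))" "z \<in> carrier \<G>" "b \<in> H (L n)" "b \<in> carrier \<G>" "a n \<in> carrier \<G>"
    using n x H_closed[OF n(2)] by (simp_all add: z_def b_def)
  obtain l k where lk: "l \<in> H (L n)" "k \<in> H (lk (L n))" "z = l \<otimes> k" using H_stE[OF z(1)] .
  have lkc: "l \<in> carrier \<G>" "k \<in> carrier \<G>" using lk by auto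
  \<comment> \<open>The coordinate has to be corrected by \<open>a n \<otimes> inv b\<close> from
    the left, but only a right multiplication stays in the other regions. Conjugation by the part
    \<open>l\<close> of \<open>z\<close> turns one into the other.\<close>
  define \<mu> where "\<mu> = inv l \<otimes> (a n \<otimes> inv b) \<otimes> l"
  have \<mu>: "\<mu> \<in> H (L n)" "\<mu> \<in> carrier \<G>" using lk n z lkc by (simp_all add: \<mu>_def)
  define x' x'' where "x' = r n \<otimes> z" and "x'' = x' \<otimes> \<mu>"
  have xc: "x' \<in> carrier \<G>" "x'' \<in> carrier \<G>" using n z \<mu> by (simp_all add: x'_def x''_def)
  have "z \<otimes> \<mu> = l \<otimes> (k \<otimes> \<mu>)" using lk(3) lkc \<mu> by (simp add: m_assoc)
  also have "k \<otimes> \<mu> = \<mu> \<otimes> k" using H_commute[OF \<mu>(1) lk(2)] by simp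
  also have "l \<otimes> (\<mu> \<otimes> k) = a n \<otimes> inv b \<otimes> z" using lk(3) lkc z by (simp add: \<mu>_def m_assoc)
  finally have zm: "z \<otimes> \<mu> = a n \<otimes> inv b \<otimes> z" .
  have "x' \<in> P n" unfolding x'_def by (rule P_mult) (use n r_P z in auto)
  then have xP: "x'' \<in> P n" unfolding x''_def by (rule P_mult[OF n(1) _ H_st[OF \<mu>(1)]])
  have "inv (r n) \<otimes> x'' = a n \<otimes> inv b \<otimes> z" using n z \<mu> zm by (simp add: x''_def x'_def m_assoc)
  then have "bp n x'' = a n \<otimes> inv b \<otimes> b"
    using n z gate_left_H[of "a n \<otimes> inv b" "L n" z] by (simp add: bp_def b_def)
  then have bpn: "bp n x'' = a n" using z by (simp add: m_assoc)
  have "x'' \<in> P m \<and> bp m x'' = a m" if m: "m \<in> B" for m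
  proof -
    have mD: "m \<in> D" "borth m n" using m insert by auto
    then obtain c where c: "c \<in> P m" "c \<in> P n" by (auto simp: borth_def)
    have cc: "c \<in> carrier \<G>" using c P_carrier by blast
    have sub: "L m \<subseteq> lk (L n)" "L n \<subseteq> lk (L m)" using mD borth_sym[OF mD(1) n(1)] by (auto simp: borth_def)
    have cn: "inv (r n) \<otimes> c \<in> H (st (L n))" using c by (simp add: P_def)
    have "inv (r n) \<otimes> x = (inv (r n) \<otimes> c) \<otimes> (inv c \<otimes> x)" using n cc x by (simp add: m_assoc)
    then have "z = (inv (r n) \<otimes> c) \<otimes> gate (st (L n)) (inv c \<otimes> x)"
      using gate_left_H[OF cn, of "inv c \<otimes> x"] cc x by (simp add: z_def)
    then have x'c: "x' = c \<otimes> gate (st (L n)) (inv c \<otimes> x)" using n cc x by (simp add: x'_def m_assoc)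
    have "inv c \<otimes> x \<in> H (st (L m))" using P_diff[OF mD(1) c(1)] x m by blast
    then have "gate (st (L n)) (inv c \<otimes> x) \<in> H (st (L m))" using H_mono[OF gate_H_Int] by blast
    then have x'P: "x' \<in> P m" unfolding x'c by (rule P_mult[OF mD(1) c(1)])
    have "\<mu> \<in> H (st (L m))" by (rule H_mono[OF \<mu>(1)]) (use sub(2) in \<open>auto simp: st_def\<close>)
    then have "x'' \<in> P m" unfolding x''_def by (rule P_mult[OF mD(1) x'P])
    moreover have "bp m x'' = bp m x'"
    proof -
      have rm: "inv (r m) \<otimes> x' \<in> carrier \<G>" using r_in mD xc by simp
      obtain e where e: "e \<in> H {v \<in> L m \<inter> L n. \<exists>k\<in>H (L n). near (L m) v (inv (r m) \<otimes> x' \<otimes> k)}"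
        "gate (L m) (inv (r m) \<otimes> x' \<otimes> \<mu>) = gate (L m) (inv (r m) \<otimes> x') \<otimes> e"
        using gate_mult_H[OF rm \<mu>(1)] .
      have "L m \<inter> L n = {}" using sub(1) lk_irrefl by blast
      then have "e = \<one>" using e(1) H_empty by simp
      then show ?thesis using e(2) rm r_in[OF mD(1)] xc \<mu> by (simp add: bp_def x''_def m_assoc)
    qed
    moreover have "bp m x' = bp m x"
    proof -
      have "gate (L m) (gate (st (L n)) (inv c \<otimes> x)) = gate (L m) (inv c \<otimes> x)"
        using sub(1) cc x by (intro gate_gate) (auto simp: st_def)
      moreover have "inv c \<otimes> x' = gate (st (L n)) (inv c \<otimes> x)" using cc x by (simp add: x'c)
      ultimately show ?thesis using bp_base[OF mD(1) c(1) x(1)] bp_base[OF mD(1) c(1) xc(1)] by simp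
    qed
    ultimately show ?thesis using x m by simp
  qed
  then show ?case using xP bpn xc by (intro bexI[of _ x'']) auto
qed auto

subsection \<open>The action on product regions\<close>

definition mv :: "'g \<Rightarrow> nat \<Rightarrow> nat" where
  "mv g n = (THE m. m \<in> D \<and> L m = L n \<and> inv (r m) \<otimes> g \<otimes> r n \<in> H (st (L n)))"

text \<open>The error by which \<open>g\<close> fails to map the base point of \<open>n\<close> to
  the base point of its image. It satisfies a cocycle identity (\<open>kk_mult_arg\<close>).\<close>

definition kk :: "'g \<Rightarrow> nat \<Rightarrow> 'g" where
  "kk g n = inv (r (mv g n)) \<otimes> g \<otimes> r n"

lemma mv_eqI:
  assumes "g \<in> carrier \<G>" "n \<in> D" "m \<in> D" "L m = L n" "inv (r m) \<otimes> g \<otimes> r n \<in> H (st (L n))"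
  shows "mv g n = m"
  unfolding mv_def
proof (rule the_equality)
  fix m' assume m': "m' \<in> D \<and> L m' = L n \<and> inv (r m') \<otimes> g \<otimes> r n \<in> H (st (L n))"
  have c: "r m \<in> carrier \<G>" "r m' \<in> carrier \<G>" "r n \<in> carrier \<G>" using assms m' r_in by auto
  have "inv (r m') \<otimes> r m = (inv (r m') \<otimes> g \<otimes> r n) \<otimes> inv (inv (r m) \<otimes> g \<otimes> r n)"
    using c assms(1) by (simp add: group_simps)
  then have "inv (r m') \<otimes> r m \<in> H (st (L m'))" using m' assms by simp
  then show "m' = m" using index_unique m' assms by simp
qed (use assms in simp)

lemma mv:
  assumes "g \<in> carrier \<G>" "n \<in> D"
  shows mv_D: "mv g n \<in> D" and L_mv: "L (mv g n) = L n" and kk_H: "kk g n \<in> H (st (L n))"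
proof -
  have "g \<otimes> r n \<in> carrier \<G>" using assms r_in by simp
  then obtain m where m: "m \<in> D" "L m = L n" "inv (r m) \<otimes> (g \<otimes> r n) \<in> H (st (L n))"
    using index_ex[OF L_V[OF assms(2)] L_ne[OF assms(2)]] by blast
  then have m': "inv (r m) \<otimes> g \<otimes> r n \<in> H (st (L n))" using r_in assms by (simp add: m_assoc)
  have "mv g n = m" by (rule mv_eqI) (use assms m m' in auto)
  then show "mv g n \<in> D" "L (mv g n) = L n" "kk g n \<in> H (st (L n))" using m m' by (auto simp: kk_def)
qed

lemma mv_one: "n \<in> D \<Longrightarrow> mv \<one> n = n"
  by (rule mv_eqI) (auto simp: r_in)

lemma kk_carrier: "g \<in> carrier \<G> \<Longrightarrow> n \<in> D \<Longrightarrow> kk g n \<in> carrier \<G>"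
  by (rule H_closed[OF kk_H])

lemma kk_mult_arg:
  assumes "g \<in> carrier \<G>" "h \<in> carrier \<G>" "n \<in> D"
  shows "mv (g \<otimes> h) n = mv g (mv h n)" "kk (g \<otimes> h) n = kk g (mv h n) \<otimes> kk h n"
proof -
  define m where "m = mv h n"
  have m: "m \<in> D" "L m = L n" "mv g m \<in> D" "L (mv g m) = L n" using mv assms by (auto simp: m_def)
  have c: "r m \<in> carrier \<G>" "r n \<in> carrier \<G>" "r (mv g m) \<in> carrier \<G>" using m assms r_in by auto
  have e: "inv (r (mv g m)) \<otimes> (g \<otimes> h) \<otimes> r n = kk g m \<otimes> kk h n"
    using c assms by (simp add: kk_def m_def[symmetric] group_simps)
  have "kk g m \<otimes> kk h n \<in> H (st (L n))" using kk_H[OF assms(1) m(1)] kk_H[OF assms(2,3)] m by simp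
  then show *: "mv (g \<otimes> h) n = mv g (mv h n)" using assms m e by (intro mv_eqI) (auto simp: m_def)
  show "kk (g \<otimes> h) n = kk g (mv h n) \<otimes> kk h n" using e unfolding kk_def[of "g \<otimes> h"] * by (simp add: m_def)
qed

lemma mv_inv: "g \<in> carrier \<G> \<Longrightarrow> n \<in> D \<Longrightarrow> mv (inv g) (mv g n) = n" "g \<in> carrier \<G> \<Longrightarrow> n \<in> D \<Longrightarrow> mv g (mv (inv g) n) = n"
  using kk_mult_arg(1)[of "inv g" g n] kk_mult_arg(1)[of g "inv g" n] mv_one by auto

lemma mv_inj: "g \<in> carrier \<G> \<Longrightarrow> n \<in> D \<Longrightarrow> m \<in> D \<Longrightarrow> mv g n = mv g m \<longleftrightarrow> n = m"
  using mv_inv(1) by metis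

lemma kk_eq: 
  assumes "g \<in> carrier \<G>" "n \<in> D" "x \<in> carrier \<G>"
  shows "inv (r (mv g n)) \<otimes> (g \<otimes> x) = kk g n \<otimes> (inv (r n) \<otimes> x)"
  using assms r_in mv_D by (simp add: kk_def group_simps)

lemma P_mv:
  assumes "g \<in> carrier \<G>" "n \<in> D" "x \<in> P n" shows "g \<otimes> x \<in> P (mv g n)"
proof -
  have "x \<in> carrier \<G>" "inv (r n) \<otimes> x \<in> H (st (L n))" using assms by (simp_all add: P_def)
  moreover then have "kk g n \<otimes> (inv (r n) \<otimes> x) \<in> H (st (L n))" using kk_H assms by simp
  ultimately show ?thesis using assms kk_eq L_mv by (simp add: P_def)
qed

lemma P_mv_meet:
  assumes "g \<in> carrier \<G>" "n \<in> D" "m \<in> D" shows "P (mv g m) \<inter> P (mv g n) \<noteq> {} \<longleftrightarrow> P m \<inter> P n \<noteq> {}"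
proof -
  have *: "P (mv g m) \<inter> P (mv g n) \<noteq> {}" if "P m \<inter> P n \<noteq> {}" "g \<in> carrier \<G>" "n \<in> D" "m \<in> D" for g m n
    using that P_mv by blast
  from *[of m n g] *[of "mv g m" "mv g n" "inv g"] assms mv_inv mv_D show ?thesis by auto
qed

lemma bnest_mv: "g \<in> carrier \<G> \<Longrightarrow> n \<in> D \<Longrightarrow> m \<in> D \<Longrightarrow> bnest (mv g m) (mv g n) \<longleftrightarrow> bnest m n"
  by (simp add: bnest_def P_mv_meet L_mv)

lemma borth_mv: "g \<in> carrier \<G> \<Longrightarrow> n \<in> D \<Longrightarrow> m \<in> D \<Longrightarrow> borth (mv g m) (mv g n) \<longleftrightarrow> borth m n"
  by (simp add: borth_def P_mv_meet L_mv)

lemma bp_mv: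
  assumes "g \<in> carrier \<G>" "n \<in> D" "x \<in> carrier \<G>"
  shows "bp (mv g n) (g \<otimes> x) = gate (L n) (kk g n) \<otimes> bp n x"
  using assms kk_eq[OF assms] gate_left[OF kk_H[OF assms(1,2)], of "inv (r n) \<otimes> x"] r_in
  by (simp add: bp_def L_mv)

end

section \<open>The proto-hierarchy structure of the graph product\<close>

text \<open>All statements of a hierarchy structure are about infimal distances between sets of bounded
  diameter; \<open>close\<close> is easier to chain.\<close>

definition close :: "'p metric \<Rightarrow> real \<Rightarrow> 'p set \<Rightarrow> 'p set \<Rightarrow> bool" where
  "close m s A B \<longleftrightarrow> (\<exists>a\<in>A. \<exists>b\<in>B. mdist m a b \<le> s)"

lemma close_set_dist: "close m s A B \<Longrightarrow> s \<le> s' \<Longrightarrow> set_dist m A B \<le> s'"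
  unfolding close_def by (meson order_trans set_dist_le)

lemma set_dist_close: "set_dist m A B \<le> s \<Longrightarrow> A \<noteq> {} \<Longrightarrow> B \<noteq> {} \<Longrightarrow> close m (s + 1) A B"
  unfolding close_def using set_dist_less[of A B m "s + 1"] by (meson less_add_one less_imp_le order_le_less_trans)

lemma close_sym: "close m s A B \<Longrightarrow> close m s B A"
  unfolding close_def by (metis mdist_commute)

lemma close_refl: "A \<noteq> {} \<Longrightarrow> A \<subseteq> mspace m \<Longrightarrow> 0 \<le> s \<Longrightarrow> close m s A A"
  unfolding close_def using mdist_self by (metis equals0I subsetD)

lemma close_mono: "close m s A B \<Longrightarrow> A \<subseteq> A' \<Longrightarrow> B \<subseteq> B' \<Longrightarrow> close m s A' B'"
  unfolding close_def by blast

lemma close_trans: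
  assumes "close m s A B" "close m t B C" "diam_le m B d" "A \<subseteq> mspace m" "B \<subseteq> mspace m" "C \<subseteq> mspace m"
  shows "close m (s + d + t) A C"
proof -
  obtain a b where ab: "a \<in> A" "b \<in> B" "mdist m a b \<le> s" using assms(1) by (auto simp: close_def)
  obtain b' c where bc: "b' \<in> B" "c \<in> C" "mdist m b' c \<le> t" using assms(2) by (auto simp: close_def)
  have d: "mdist m b b' \<le> d" using assms(3) ab bc by (auto simp: diam_le_def)
  have m: "a \<in> mspace m" "b \<in> mspace m" "b' \<in> mspace m" "c \<in> mspace m" using ab bc assms by auto
  have "mdist m a c \<le> s + d + t"
    by (rule mdist_triangle'[OF m(1,3,4) mdist_triangle'[OF m(1,2,3) ab(3) d] bc(3)])
  then show ?thesis using ab bc by (auto simp: close_def)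
qed

lemma close_isometry:
  assumes "isometry_onto m m' f" "A \<subseteq> mspace m" "B \<subseteq> mspace m" "close m s A B"
  shows "close m' s (f ` A) (f ` B)"
proof -
  obtain a b where ab: "a \<in> A" "b \<in> B" "mdist m a b \<le> s" using assms(4) by (auto simp: close_def)
  have "a \<in> mspace m" "b \<in> mspace m" using ab assms by blast+
  then have "mdist m' (f a) (f b) \<le> s" using isometry_onto_mdist[OF assms(1)] ab(3) by simp
  then show ?thesis using ab by (auto simp: close_def)
qed

text \<open>A point inside an edge has two vertices in its support. The choice of one is not
  equivariant, which is repaired in \<open>trX_proj\<close> at bounded cost.\<close>

definition vx :: "('a \<Rightarrow> real) \<Rightarrow> 'a" where "vx p = (SOME a. p a \<noteq> 0)"

lemma
  assumes "group G" "T \<subseteq> carrier G" "generate G T = carrier G"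
  shows cayley_geodesic: "geodesic_space (cayley_graph G T)"
    and cayley_vpt: "vpt g \<in> mspace (cayley_graph G T) \<longleftrightarrow> g \<in> carrier G"
    and cayley_mdist: "g \<in> carrier G \<Longrightarrow> h \<in> carrier G \<Longrightarrow>
      mdist (cayley_graph G T) (vpt g) (vpt h) = real (vertex_dist (cayley_edges G T) g h)"
    and cayley_path: "g \<in> carrier G \<Longrightarrow> h \<in> carrier G \<Longrightarrow>
      (g, h) \<in> cayley_edges G T ^^ vertex_dist (cayley_edges G T) g h"
    and cayley_path_mdist: "g \<in> carrier G \<Longrightarrow> h \<in> carrier G \<Longrightarrow> (g, h) \<in> cayley_edges G T ^^ n \<Longrightarrow>
      mdist (cayley_graph G T) (vpt g) (vpt h) \<le> real n"
    and cayley_near: "p \<in> mspace (cayley_graph G T) \<Longrightarrow> p a \<noteq> 0 \<Longrightarrow>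
      a \<in> carrier G \<and> mdist (cayley_graph G T) p (vpt a) \<le> 1"
    and cayley_vx: "p \<in> mspace (cayley_graph G T) \<Longrightarrow> p (vx p) \<noteq> 0"
proof -
  interpret connected_graph "carrier G" "cayley_edges G T" by (rule connected_graph_cayley[OF assms])
  show "geodesic_space (cayley_graph G T)" unfolding cayley_graph_def by (rule geodesic_realisation)
  show "vpt g \<in> mspace (cayley_graph G T) \<longleftrightarrow> g \<in> carrier G" by (simp add: cayley_graph_def mspace_M)
  show 1: "mdist (cayley_graph G T) (vpt g) (vpt h) = real (vertex_dist (cayley_edges G T) g h)"
    if "g \<in> carrier G" "h \<in> carrier G" using that by (simp add: cayley_graph_def mdist_vpt)
  show "(g, h) \<in> cayley_edges G T ^^ vertex_dist (cayley_edges G T) g h"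
    if "g \<in> carrier G" "h \<in> carrier G" using that by (rule vertex_dist_path)
  show "mdist (cayley_graph G T) (vpt g) (vpt h) \<le> real n"
    if "g \<in> carrier G" "h \<in> carrier G" "(g, h) \<in> cayley_edges G T ^^ n"
    using 1[OF that(1,2)] vertex_dist_le[OF that(3)] by simp
  show "a \<in> carrier G \<and> mdist (cayley_graph G T) p (vpt a) \<le> 1" if "p \<in> mspace (cayley_graph G T)" "p a \<noteq> 0"
    using that mdist_vpt_near(2)[of p a] supp_V[of p a] by (simp add: cayley_graph_def mspace_M)
  show "p (vx p) \<noteq> 0" if "p \<in> mspace (cayley_graph G T)"
    unfolding vx_def by (rule someI_ex) (use that supp_nonempty in \<open>auto simp: cayley_graph_def mspace_M\<close>)
qed

locale hhg_product = indexed_graph_group \<G> V E G incl "Inr :: real \<Rightarrow> 'p + real" D L r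
  for \<G> :: "('g, 'c) monoid_scheme" (structure)
    and V :: "'v set" and E :: "'v set set" and G :: "'v \<Rightarrow> ('a, 'b) monoid_scheme"
    and incl :: "'v \<Rightarrow> 'a \<Rightarrow> 'g" and D :: "nat set" and L :: "nat \<Rightarrow> 'v set" and r :: "nat \<Rightarrow> 'g" +
  fixes T :: "'v \<Rightarrow> 'a set" and E0 :: real and SS :: "'v \<Rightarrow> 'i set" and CC :: "'v \<Rightarrow> 'i \<Rightarrow> 'p metric"
    and pr :: "'v \<Rightarrow> 'i \<Rightarrow> ('a \<Rightarrow> real) \<Rightarrow> 'p set" and nst ort :: "'v \<Rightarrow> 'i \<Rightarrow> 'i \<Rightarrow> bool"
    and rh :: "'v \<Rightarrow> 'i \<Rightarrow> 'i \<Rightarrow> 'p set" and ac :: "'v \<Rightarrow> 'a \<Rightarrow> 'i \<Rightarrow> 'i"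
    and tv :: "'v \<Rightarrow> 'a \<Rightarrow> 'i \<Rightarrow> 'p \<Rightarrow> 'p"
  assumes vertex_hhg: "v \<in> V \<Longrightarrow>
      equivariant_hhs_structure (G v) (T v) E0 (SS v) (CC v) (pr v) (nst v) (ort v) (rh v) (ac v) (tv v)"
    and T_finite: "v \<in> V \<Longrightarrow> finite (T v)" and T_sub: "v \<in> V \<Longrightarrow> T v \<subseteq> carrier (G v)"
    and T_gen: "v \<in> V \<Longrightarrow> generate (G v) (T v) = carrier (G v)"
    and E0: "1 \<le> E0" and V_ne: "V \<noteq> {}"
begin

definition TT :: "'g set" where "TT = (\<Union>v\<in>V. incl v ` T v)"

text \<open>A chain of domains has at most \<open>2 ^ card V\<close> classes of cosets, one for each
  set of types, and \<open>E0\<close> copied domains. The other summands are generous bounds for the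
  constant 30 of the coned-off spaces and for the multiples of \<open>E0\<close> that arise from
  changing vertices.\<close>

definition KK :: real where "KK = 50 + 50 * E0 + 2 ^ card V"

lemma KK: "50 + 50 * E0 \<le> KK" by (simp add: KK_def)

lemma TT_finite: "finite TT" using finV T_finite by (auto simp: TT_def)

lemma TT_sub: "TT \<subseteq> carrier \<G>"
  unfolding TT_def by (intro UN_least image_subsetI letter_closed) (use T_sub in auto)

lemma TT_gen: "generate \<G> TT = carrier \<G>"
proof
  show "generate \<G> TT \<subseteq> carrier \<G>" by (rule generate_incl[OF TT_sub])
  have let_gen: "incl v g \<in> generate \<G> TT" if v: "v \<in> V" and g: "g \<in> generate (G v) (T v)" for v g
    using g
  proof (induction rule: generate.induct)
    case one show ?case using generate.one by (simp add: incl_one[OF v])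
  next
    case (incl h) then show ?case using v by (auto simp: TT_def intro: generate.incl)
  next
    case (inv h)
    then have "inv (incl v h) \<in> generate \<G> TT" using v by (intro generate.inv) (auto simp: TT_def)
    then show ?case using incl_inv[OF v, of h] subsetD[OF T_sub[OF v]] inv by simp
  next
    case (eng h1 h2)
    then show ?case using incl_mult[OF v] generate.eng T_gen[OF v] by auto
  qed
  have "ev w \<in> generate \<G> TT" if "w \<in> wd V" for w
    using that
  proof (induction w)
    case (Cons s w)
    obtain v g where s: "s = (v, g)" by (cases s)
    then have "incl v g \<in> generate \<G> TT" using Cons.prems let_gen T_gen by auto
    then show ?case using Cons s by (auto simp: letter_def intro: generate.eng)
  qed (simp add: generate.one)
  then show "carrier \<G> \<subseteq> generate \<G> TT" using ev_surj by blast
qed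

abbreviation "CG \<equiv> cayley_graph \<G> TT"
abbreviation "CV v \<equiv> cayley_graph (G v) (T v)"

lemmas CG = cayley_geodesic[OF is_group TT_sub TT_gen] cayley_vpt[OF is_group TT_sub TT_gen]
  cayley_mdist[OF is_group TT_sub TT_gen] cayley_path[OF is_group TT_sub TT_gen]
  cayley_path_mdist[OF is_group TT_sub TT_gen] cayley_near[OF is_group TT_sub TT_gen]
  cayley_vx[OF is_group TT_sub TT_gen]

lemmas CV_vpt = cayley_vpt[OF grp T_sub T_gen]
lemmas CV_path_mdist = cayley_path_mdist[OF grp T_sub T_gen]
lemmas CV_near = cayley_near[OF grp T_sub T_gen]
lemmas CV_vx = cayley_vx[OF grp T_sub T_gen]

lemma CG_vx: "p \<in> mspace CG \<Longrightarrow> vx p \<in> carrier \<G>" "p \<in> mspace CG \<Longrightarrow> mdist CG p (vpt (vx p)) \<le> 1"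
  using CG(6,7) by blast+

lemma CV_vx': "v \<in> V \<Longrightarrow> p \<in> mspace (CV v) \<Longrightarrow> vx p \<in> carrier (G v)"
  "v \<in> V \<Longrightarrow> p \<in> mspace (CV v) \<Longrightarrow> mdist (CV v) p (vpt (vx p)) \<le> 1"
  using CV_near CV_vx by blast+

section \<open>Domains, their spaces, projections and relations\<close>

definition vtx :: "nat \<Rightarrow> 'v" where "vtx n = (THE v. L n = {v})"

lemma vtx: "L n = {v} \<Longrightarrow> vtx n = v" by (auto simp: vtx_def)

text \<open>\<open>Inl n\<close> stands for the class \<open>n\<close> of cosets with its coned-off space, and \<open>Inr (n, i)\<close> for the copy, over
  a coset of a vertex group, of the domain \<open>i\<close> of that vertex group.\<close>

definition dom :: "(nat + nat \<times> 'i) set" where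
  "dom = Inl ` D \<union> Inr ` {(n, i). n \<in> D \<and> (\<exists>v. L n = {v} \<and> i \<in> SS v)}"

lemma dom_cases [consumes 1, case_names coset vertex]:
  assumes "j \<in> dom"
  obtains n where "j = Inl n" "n \<in> D" | n i v where "j = Inr (n, i)" "n \<in> D" "L n = {v}" "vtx n = v" "v \<in> V" "i \<in> SS v"
  using assms L_V vtx unfolding dom_def by fastforce

lemma Inl_dom [simp]: "Inl n \<in> dom \<longleftrightarrow> n \<in> D" by (auto simp: dom_def)

lemma Inr_dom: "Inr (n, i) \<in> dom \<longleftrightarrow> n \<in> D \<and> L n = {vtx n} \<and> vtx n \<in> V \<and> i \<in> SS (vtx n)"
proof -
  have "vtx n \<in> V" if "n \<in> D" "L n = {vtx n}" using L_V[OF that(1)] that(2) by blast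
  moreover have "(\<exists>v. L n = {v} \<and> i \<in> SS v) \<longleftrightarrow> L n = {vtx n} \<and> i \<in> SS (vtx n)" using vtx[of n] by auto
  ultimately show ?thesis by (auto simp: dom_def)
qed

definition base :: "nat + nat \<times> 'i \<Rightarrow> nat" where
  "base j = (case j of Inl n \<Rightarrow> n | Inr (n, i) \<Rightarrow> n)"

definition cc :: "nat \<Rightarrow> 'g \<Rightarrow> 'a" where
  "cc n g = coord (vtx n) (inv (r n) \<otimes> g)"

definition CX :: "nat + nat \<times> 'i \<Rightarrow> ('p + real) metric" where
  "CX j = (case j of Inl n \<Rightarrow> cspace (L n) | Inr (n, i) \<Rightarrow> map_metric Inl (CC (vtx n) i))"

definition pg :: "nat + nat \<times> 'i \<Rightarrow> 'g \<Rightarrow> ('p + real) set" where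
  "pg j g = (case j of Inl n \<Rightarrow> {cpt (L n) (bp n g)} | Inr (n, i) \<Rightarrow> Inl ` pr (vtx n) i (vpt (cc n g)))"

definition PX :: "nat + nat \<times> 'i \<Rightarrow> ('g \<Rightarrow> real) \<Rightarrow> ('p + real) set" where
  "PX j x = pg j (vx x)"

text \<open>If \<open>L n\<close> is a singleton, \<open>Inl n\<close> sits above all copies
  \<open>Inr (n, i)\<close>; in the other direction nothing is possible, as a singleton has no
  smaller class below it.\<close>

definition NX :: "nat + nat \<times> 'i \<Rightarrow> nat + nat \<times> 'i \<Rightarrow> bool" where
  "NX j k = (case k of Inl n \<Rightarrow> bnest (base j) n
     | Inr (n, i') \<Rightarrow> (case j of Inl m \<Rightarrow> False | Inr (m, i) \<Rightarrow> m = n \<and> nst (vtx n) i i'))"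

definition OX :: "nat + nat \<times> 'i \<Rightarrow> nat + nat \<times> 'i \<Rightarrow> bool" where
  "OX j k \<longleftrightarrow> borth (base j) (base k) \<or> (\<exists>n i i'. j = Inr (n, i) \<and> k = Inr (n, i') \<and> ort (vtx n) i i')"

definition same :: "nat + nat \<times> 'i \<Rightarrow> nat + nat \<times> 'i \<Rightarrow> bool" where
  "same j k \<longleftrightarrow> (\<exists>n i i'. j = Inr (n, i) \<and> k = Inr (n, i'))"

text \<open>Within one copy the product region projects onto everything and carries no information,
  so there the sets of the vertex group are used.\<close>

definition RX :: "nat + nat \<times> 'i \<Rightarrow> nat + nat \<times> 'i \<Rightarrow> ('p + real) set" where
  "RX j k = (if same j k then Inl ` rh (vtx (base k)) (snd (projr j)) (snd (projr k)) else (\<Union>g\<in>P (base j). pg k g))"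

lemma base_simps [simp]: "base (Inl n) = n" "base (Inr (n, i)) = n" by (simp_all add: base_def)

lemma CX_simps [simp]: "CX (Inl n) = cspace (L n)" "CX (Inr (n, i)) = map_metric Inl (CC (vtx n) i)"
  by (simp_all add: CX_def)

lemma pg_simps: "pg (Inl n) g = {cpt (L n) (bp n g)}" "pg (Inr (n, i)) g = Inl ` pr (vtx n) i (vpt (cc n g))"
  by (simp_all add: pg_def)

lemma NX_simps [simp]: "NX j (Inl n) \<longleftrightarrow> bnest (base j) n" "\<not> NX (Inl m) (Inr (n, i))"
  "NX (Inr (m, i)) (Inr (n, i')) \<longleftrightarrow> m = n \<and> nst (vtx n) i i'"
  by (simp_all add: NX_def)

lemma base_dom [simp]: "j \<in> dom \<Longrightarrow> base j \<in> D" by (cases rule: dom_cases) auto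

lemma isometry_Inl: "isometry_onto (CC v i) (map_metric Inl (CC v i) :: ('p + real) metric) Inl"
  by (rule isometry_map_metric) simp

lemma cc_closed: "n \<in> D \<Longrightarrow> L n = {v} \<Longrightarrow> g \<in> carrier \<G> \<Longrightarrow> cc n g \<in> carrier (G v)"
  using coord_closed[of v] L_V[of n] r_in[of n] by (simp add: cc_def vtx)

lemma incl_cc: "n \<in> D \<Longrightarrow> L n = {v} \<Longrightarrow> g \<in> carrier \<G> \<Longrightarrow> incl v (cc n g) = bp n g"
  using incl_coord[of v] L_V[of n] r_in[of n] by (simp add: cc_def vtx bp_def)

lemma cc_eq: "n \<in> D \<Longrightarrow> L n = {v} \<Longrightarrow> bp n g = bp n h \<Longrightarrow> cc n g = cc n h"
  unfolding cc_def bp_def by (rule coord_cong) (simp add: vtx)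

lemma cc_in: "n \<in> D \<Longrightarrow> L n = {v} \<Longrightarrow> a \<in> carrier (G v) \<Longrightarrow> cc n (r n \<otimes> incl v a) = a"
  using coord_incl[of v a] L_V[of n] r_in[of n] letter_closed[of v a] by (simp add: cc_def vtx)

lemma cc_bp: assumes "n \<in> D" "L n = {v}" "g \<in> carrier \<G>" "a \<in> carrier (G v)" "bp n g = incl v a" shows "cc n g = a"
  using assms incl_inj[of v "cc n g" a] incl_cc cc_closed L_V[of n] by auto

lemma pg_bp_eq: assumes "j \<in> dom" "bp (base j) g = bp (base j) h" shows "pg j g = pg j h"
  using assms(1)
proof (cases rule: dom_cases)
  case (vertex n i v)
  then have "cc n g = cc n h" using assms(2) by (intro cc_eq) auto
  then show ?thesis using vertex by (simp add: pg_simps)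
qed (use assms(2) in \<open>simp add: pg_simps\<close>)

lemma pg_props: 
  assumes j: "j \<in> dom" and g: "g \<in> carrier \<G>"
  shows pg_sub: "pg j g \<subseteq> mspace (CX j)" and pg_ne: "pg j g \<noteq> {}" and pg_diam: "diam_le (CX j) (pg j g) E0"
proof -
  have "pg j g \<subseteq> mspace (CX j) \<and> pg j g \<noteq> {} \<and> diam_le (CX j) (pg j g) E0"
    using j
  proof (cases rule: dom_cases)
    case (coset n)
    have m: "cpt (L n) (bp n g) \<in> mspace (cspace (L n) :: ('p + real) metric)" using coset g by simp
    then show ?thesis using coset E0 by (simp add: pg_simps diam_le_def)
  next
    case (vertex n i v)
    interpret X: equivariant_hhs_structure "G v" "T v" E0 "SS v" "CC v" "pr v" "nst v" "ort v" "rh v" "ac v" "tv v"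
      by (rule vertex_hhg[OF vertex(5)])
    have x: "vpt (cc n g) \<in> mspace (CV v)" using CV_vpt vertex cc_closed g by simp
    note s = X.proj_subset[OF vertex(6) x] X.proj_nonempty[OF vertex(6) x] X.proj_diam[OF vertex(6) x]
    show ?thesis using s isometry_onto_in[OF isometry_Inl] isometry_diam_le[OF isometry_Inl s(1)] vertex
      by (auto simp: pg_simps)
  qed
  then show "pg j g \<subseteq> mspace (CX j)" "pg j g \<noteq> {}" "diam_le (CX j) (pg j g) E0" by auto
qed

lemma PX_props:
  assumes "j \<in> dom" "x \<in> mspace CG"
  shows "PX j x \<subseteq> mspace (CX j)" "PX j x \<noteq> {}" "diam_le (CX j) (PX j x) E0"
  using pg_props assms CG_vx unfolding PX_def by auto

text \<open>By \<open>gate_snoc\<close> a generator is either kept or discarded by the gate. So a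
  coordinate moves by one generator or not at all, both in the coned-off space and in the Cayley
  graph of a vertex group.\<close>

lemma edge_step:
  assumes "(g, h) \<in> cayley_edges \<G> TT" "n \<in> D"
  shows "mdist (cspace (L n) :: ('p + real) metric) (cpt (L n) (bp n g)) (cpt (L n) (bp n h)) \<le> 1"
    and "L n = {v} \<Longrightarrow> cc n h = cc n g \<or> (cc n g, cc n h) \<in> cayley_edges (G v) (T v)"
proof -
  obtain s where s: "g \<in> carrier \<G>" "h = g \<otimes> s" "s \<in> TT \<or> inv s \<in> TT" "s \<in> carrier \<G>"
    using assms(1) by (auto simp: cayley_edges_def)
  obtain u t where u: "u \<in> V" "t \<in> carrier (G u)" "s = incl u t" "t \<in> T u \<or> inv\<^bsub>G u\<^esub> t \<in> T u"
  proof (cases "s \<in> TT")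
    case True
    then obtain u t where "u \<in> V" "t \<in> T u" "s = incl u t" by (auto simp: TT_def)
    then show ?thesis using that[of u t] subsetD[OF T_sub] by simp
  next
    case False
    then obtain u t where ut: "u \<in> V" "t \<in> T u" "inv s = incl u t" using s by (auto simp: TT_def)
    interpret Gu: group "G u" by (rule grp[OF ut(1)])
    have t: "t \<in> carrier (G u)" using ut T_sub by blast
    have "s = incl u (inv\<^bsub>G u\<^esub> t)" using ut incl_inv[OF ut(1) t] s(4) by (metis inv_inv)
    then show ?thesis using that[of u "inv\<^bsub>G u\<^esub> t"] ut t by simp
  qed
  have z: "inv (r n) \<otimes> g \<in> carrier \<G>" using s r_in assms by simp
  have "inv (r n) \<otimes> h = inv (r n) \<otimes> g \<otimes> incl u t" using s u r_in assms by (simp add: m_assoc)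
  then have bp: "bp n h = bp n g \<otimes> (if u \<in> L n \<and> near (L n) u (inv (r n) \<otimes> g) then incl u t else \<one>)"
    using gate_snoc[OF z u(1,2)] by (simp add: bp_def)
  have bg: "bp n g \<in> H (L n)" "bp n g \<in> carrier \<G>" using s assms H_closed[OF bp_H] by auto
  show "mdist (cspace (L n) :: ('p + real) metric) (cpt (L n) (bp n g)) (cpt (L n) (bp n h)) \<le> 1"
  proof (cases "u \<in> L n \<and> near (L n) u (inv (r n) \<otimes> g)")
    case True
    then have "incl u t \<in> cone (L n)" using u by (intro cone_vertex[of _ u] letter_H) auto
    from mdist_cpt_cone[OF bg(1) this] show ?thesis using bp True by simp
  next
    case False
    then have e: "bp n h = bp n g" using bp bg by auto
    have "cpt (L n) (bp n g) \<in> mspace (cspace (L n) :: ('p + real) metric)" using bg by simp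
    then show ?thesis unfolding e by simp
  qed
  show "cc n h = cc n g \<or> (cc n g, cc n h) \<in> cayley_edges (G v) (T v)" if v: "L n = {v}"
  proof (cases "u = v \<and> near (L n) u (inv (r n) \<otimes> g)")
    case True
    interpret Gv: group "G v" using grp u True by blast
    have c: "cc n g \<in> carrier (G v)" using cc_closed assms v s by blast
    have "bp n h = incl v (cc n g \<otimes>\<^bsub>G v\<^esub> t)"
      using bp True v incl_cc[OF assms(2) v s(1)] incl_mult[of v "cc n g" t] u c by auto
    then have e: "cc n h = cc n g \<otimes>\<^bsub>G v\<^esub> t"
      using u(2) True c s by (intro cc_bp[OF assms(2) v]) auto
    show ?thesis
    proof (cases "t = \<one>\<^bsub>G v\<^esub>")
      case False
      then have "(cc n g, cc n g \<otimes>\<^bsub>G v\<^esub> t) \<in> cayley_edges (G v) (T v)" unfolding cayley_edges_def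
        using c u(2,4) True by (intro CollectI exI[of _ "cc n g"] exI[of _ t]) simp
      then show ?thesis using e by simp
    qed (use e c in simp)
  next
    case False
    then have "bp n h = bp n g" using bp bg v by auto
    then show ?thesis using cc_eq[OF assms(2) v] by blast
  qed
qed

lemma path_step:
  assumes "(g, h) \<in> cayley_edges \<G> TT ^^ N" "n \<in> D" "g \<in> carrier \<G>" "h \<in> carrier \<G>"
  shows "mdist (cspace (L n) :: ('p + real) metric) (cpt (L n) (bp n g)) (cpt (L n) (bp n h)) \<le> real N"
    and "L n = {v} \<Longrightarrow> \<exists>M\<le>N. (cc n g, cc n h) \<in> cayley_edges (G v) (T v) ^^ M"
proof -
  have "mdist (cspace (L n) :: ('p + real) metric) (cpt (L n) (bp n g)) (cpt (L n) (bp n h)) \<le> real N \<and>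
    (L n = {v} \<longrightarrow> (\<exists>M\<le>N. (cc n g, cc n h) \<in> cayley_edges (G v) (T v) ^^ M))"
    using assms(1,4)
  proof (induction N arbitrary: h)
    case 0
    have "cpt (L n) (bp n g) \<in> mspace (cspace (L n) :: ('p + real) metric)" using assms by simp
    then show ?case using 0 by auto
  next
    case (Suc N)
    then obtain k where k: "(g, k) \<in> cayley_edges \<G> TT ^^ N" "(k, h) \<in> cayley_edges \<G> TT" by auto
    have kc: "k \<in> carrier \<G>" using k by (auto simp: cayley_edges_def)
    note IH = Suc.IH[OF k(1) kc]
    have "mdist (cspace (L n) :: ('p + real) metric) (cpt (L n) (bp n g)) (cpt (L n) (bp n h)) \<le> real N + 1"
      by (rule mdist_triangle'[OF cpt_in cpt_in cpt_in _ edge_step(1)[OF k(2)]]) (use IH assms kc Suc.prems in auto)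
    moreover have "\<exists>M\<le>Suc N. (cc n g, cc n h) \<in> cayley_edges (G v) (T v) ^^ M" if v: "L n = {v}"
    proof -
      obtain M where M: "M \<le> N" "(cc n g, cc n k) \<in> cayley_edges (G v) (T v) ^^ M" using IH v by blast
      show ?thesis
      proof (cases "cc n h = cc n k")
        case False
        then have "(cc n k, cc n h) \<in> cayley_edges (G v) (T v)" using edge_step(2)[OF k(2) assms(2) v] by blast
        then have "(cc n g, cc n h) \<in> cayley_edges (G v) (T v) ^^ Suc M" using M(2) by auto
        then show ?thesis using M(1) by (intro exI[of _ "Suc M"]) auto
      qed (use M in \<open>auto intro: le_SucI\<close>)
    qed
    ultimately show ?case by simp
  qed
  then show "mdist (cspace (L n) :: ('p + real) metric) (cpt (L n) (bp n g)) (cpt (L n) (bp n h)) \<le> real N"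
    "L n = {v} \<Longrightarrow> \<exists>M\<le>N. (cc n g, cc n h) \<in> cayley_edges (G v) (T v) ^^ M" by auto
qed

lemma vertex_close:
  assumes "v \<in> V" "i \<in> SS v" "p \<in> mspace (CV v)" "q \<in> mspace (CV v)" "mdist (CV v) p q \<le> s"
  shows "set_dist (CC v i) (pr v i p) (pr v i q) \<le> E0 * s + E0"
proof -
  interpret X: equivariant_hhs_structure "G v" "T v" E0 "SS v" "CC v" "pr v" "nst v" "ort v" "rh v" "ac v" "tv v"
    by (rule vertex_hhg[OF assms(1)])
  have "set_dist (CC v i) (pr v i p) (pr v i q) \<le> E0 * mdist (CV v) p q + E0"
    by (rule X.proj_coarsely_Lipschitz) fact+
  also have "\<dots> \<le> E0 * s + E0" using assms(5) E0 by simp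
  finally show ?thesis .
qed

lemma pg_Lipschitz:
  assumes "j \<in> dom" "g \<in> carrier \<G>" "h \<in> carrier \<G>"
  shows "set_dist (CX j) (pg j g) (pg j h) \<le> E0 * mdist CG (vpt g) (vpt h) + E0"
proof -
  define N where "N = vertex_dist (cayley_edges \<G> TT) g h"
  have N: "(g, h) \<in> cayley_edges \<G> TT ^^ N" "mdist CG (vpt g) (vpt h) = real N"
    using CG(3,4) assms by (auto simp: N_def)
  show ?thesis
    using assms(1)
  proof (cases rule: dom_cases)
    case (coset n)
    have "mdist (cspace (L n) :: ('p + real) metric) (cpt (L n) (bp n g)) (cpt (L n) (bp n h)) \<le> real N"
      using path_step(1)[OF N(1)] coset assms by blast
    also have "\<dots> \<le> E0 * real N" using E0 mult_right_mono[of 1 E0 "real N"] by simp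
    finally show ?thesis using coset N E0 by (simp add: pg_simps)
  next
    case (vertex n i v)
    obtain M where M: "M \<le> N" "(cc n g, cc n h) \<in> cayley_edges (G v) (T v) ^^ M"
      using path_step(2)[OF N(1) vertex(2) assms(2,3) vertex(3)] by blast
    have c: "cc n g \<in> carrier (G v)" "cc n h \<in> carrier (G v)" using cc_closed vertex assms by auto
    have "mdist (CV v) (vpt (cc n g)) (vpt (cc n h)) \<le> real M" by (rule CV_path_mdist) (use vertex c M in auto)
    then have d: "mdist (CV v) (vpt (cc n g)) (vpt (cc n h)) \<le> real N" using M by simp
    have m: "vpt (cc n g) \<in> mspace (CV v)" "vpt (cc n h) \<in> mspace (CV v)" using CV_vpt vertex c by auto
    interpret X: equivariant_hhs_structure "G v" "T v" E0 "SS v" "CC v" "pr v" "nst v" "ort v" "rh v" "ac v" "tv v"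
      by (rule vertex_hhg[OF vertex(5)])
    have "set_dist (CX j) (pg j g) (pg j h) = set_dist (CC v i) (pr v i (vpt (cc n g))) (pr v i (vpt (cc n h)))"
      using isometry_set_dist[OF isometry_Inl X.proj_subset[OF vertex(6) m(1)] X.proj_subset[OF vertex(6) m(2)]] vertex
      by (simp add: pg_simps)
    then show ?thesis using vertex_close[OF vertex(5,6) m d] N by simp
  qed
qed

text \<open>Replacing both points by vertices lengthens the distance by at most 2, which adds
  \<open>2 * E0\<close> to the constant for group elements.\<close>

lemma PX_Lipschitz:
  assumes "j \<in> dom" "x \<in> mspace CG" "y \<in> mspace CG"
  shows "set_dist (CX j) (PX j x) (PX j y) \<le> E0 * mdist CG x y + 3 * E0"
proof -
  note vx = CG_vx[OF assms(2)] CG_vx[OF assms(3)]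
  have m: "vpt (vx x) \<in> mspace CG" "vpt (vx y) \<in> mspace CG" using vx CG(2) by auto
  have "mdist CG (vpt (vx x)) x \<le> 1" using vx by (simp add: mdist_commute)
  from mdist_triangle'[OF m(1) assms(3) m(2) mdist_triangle'[OF m(1) assms(2,3) this order_refl] vx(4)]
  have "mdist CG (vpt (vx x)) (vpt (vx y)) \<le> mdist CG x y + 2" by simp
  then have "E0 * mdist CG (vpt (vx x)) (vpt (vx y)) \<le> E0 * (mdist CG x y + 2)" using E0 by (intro mult_left_mono) auto
  then show ?thesis using pg_Lipschitz[OF assms(1) vx(1,3)] by (simp add: PX_def algebra_simps)
qed

lemma PX_vpt: "PX j (vpt g) = pg j g"
proof -
  have "vx (vpt g) = g" unfolding vx_def by (rule some_equality) (auto split: if_splits)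
  then show ?thesis by (simp add: PX_def)
qed

lemma PX_onto: assumes "j \<in> dom" shows "mspace (CX j) \<subseteq> nbhd (CX j) KK (\<Union>x\<in>mspace CG. PX j x)"
proof
  fix p assume p: "p \<in> mspace (CX j)"
  show "p \<in> nbhd (CX j) KK (\<Union>x\<in>mspace CG. PX j x)"
    using assms
  proof (cases rule: dom_cases)
    case (coset n)
    then obtain a where a: "a \<in> H (L n)" "mdist (cspace (L n) :: ('p + real) metric) p (cpt (L n) a) \<le> 1"
      using p cspace_near by auto
    have c: "r n \<otimes> a \<in> carrier \<G>" using a r_in coset by simp
    then have "vpt (r n \<otimes> a) \<in> mspace CG" using CG(2) by blast
    moreover have "cpt (L n) a \<in> PX j (vpt (r n \<otimes> a))" using coset a bp_in by (simp add: PX_vpt pg_simps)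
    ultimately have "cpt (L n) a \<in> (\<Union>x\<in>mspace CG. PX j x)" by blast
    from nbhdI[OF p this] show ?thesis using a coset KK E0 by simp
  next
    case (vertex n i v)
    interpret X: equivariant_hhs_structure "G v" "T v" E0 "SS v" "CC v" "pr v" "nst v" "ort v" "rh v" "ac v" "tv v"
      by (rule vertex_hhg[OF vertex(5)])
    obtain c where c: "c \<in> mspace (CC v i)" "p = Inl c" using p vertex isometry_onto_mspace[OF isometry_Inl, of v i] by auto
    have one: "\<one>\<^bsub>G v\<^esub> \<in> carrier (G v)" using grp vertex by (simp add: group.is_monoid monoid.one_closed)
    then have "vpt \<one>\<^bsub>G v\<^esub> \<in> mspace (CV v)" using CV_vpt vertex by simp
    then have ne: "(\<Union>x\<in>mspace (CV v). pr v i x) \<noteq> {}" using X.proj_nonempty[OF vertex(6)] by blast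
    have "c \<in> nbhd (CC v i) E0 (\<Union>x\<in>mspace (CV v). pr v i x)" using X.proj_coarsely_onto[OF vertex(6)] c by blast
    from nbhdD[OF this ne, of "E0 + 1"] obtain x a where x: "x \<in> mspace (CV v)" "a \<in> pr v i x" "mdist (CC v i) c a \<le> E0 + 1"
      by auto
    define y where "y = vx x"
    have y: "y \<in> carrier (G v)" "mdist (CV v) x (vpt y) \<le> 1" using CV_vx'[OF vertex(5) x(1)] by (auto simp: y_def)
    have my: "vpt y \<in> mspace (CV v)" using CV_vpt vertex y by simp
    note xs = X.proj_subset[OF vertex(6) x(1)] X.proj_subset[OF vertex(6) my]
    have "set_dist (CC v i) (pr v i x) (pr v i (vpt y)) \<le> E0 * 1 + E0"
      by (rule vertex_close) (use vertex x y my in auto)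
    from set_dist_close[OF this] have cl: "close (CC v i) (E0 * 1 + E0 + 1) (pr v i x) (pr v i (vpt y))"
      using X.proj_nonempty vertex x my by blast
    have "close (CC v i) (E0 + 1) {c} (pr v i x)" using x(2,3) by (auto simp: close_def)
    from close_trans[OF this cl X.proj_diam[OF vertex(6) x(1)]] obtain b where
      b: "b \<in> pr v i (vpt y)" "mdist (CC v i) c b \<le> E0 + 1 + E0 + (E0 * 1 + E0 + 1)"
      using c xs by (auto simp: close_def)
    have g: "r n \<otimes> incl v y \<in> carrier \<G>" using vertex y r_in by simp
    have "Inl b \<in> PX j (vpt (r n \<otimes> incl v y))" using b vertex y by (simp add: PX_vpt pg_simps cc_in)
    then have "Inl b \<in> (\<Union>x\<in>mspace CG. PX j x)" using CG(2) g by blast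
    moreover have "mdist (CX j) p (Inl b) \<le> KK"
      using isometry_onto_mdist[OF isometry_Inl c(1), of b] b xs(2) c vertex KK E0 by auto
    ultimately show ?thesis by (rule nbhdI[OF p])
  qed
qed

section \<open>Nesting and orthogonality of domains\<close>

lemma NX_base: "j \<in> dom \<Longrightarrow> k \<in> dom \<Longrightarrow> NX j k \<Longrightarrow> bnest (base j) (base k)"
  by (cases j; cases k) (auto simp: NX_def bnest_refl Inr_dom)

lemma NX_same: "NX j k \<Longrightarrow> k = Inr b \<Longrightarrow> same j k"
  by (cases j) (auto simp: NX_def same_def split: prod.splits)

lemma bnest_vertex: "m \<in> D \<Longrightarrow> n \<in> D \<Longrightarrow> bnest m n \<Longrightarrow> L n = {v} \<Longrightarrow> m = n"
  using bnest_same[of m n] L_ne[of m] by (auto simp: bnest_def)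

lemma NX_refl: assumes "j \<in> dom" shows "NX j j"
  using assms
proof (cases rule: dom_cases)
  case (vertex n i v)
  interpret X: equivariant_hhs_structure "G v" "T v" E0 "SS v" "CC v" "pr v" "nst v" "ort v" "rh v" "ac v" "tv v"
    by (rule vertex_hhg[OF vertex(5)])
  show ?thesis using X.nest_refl vertex by (auto simp: reflp_on_def)
qed (auto simp: bnest_refl)

lemma NX_antisym: "j \<in> dom \<Longrightarrow> k \<in> dom \<Longrightarrow> NX j k \<Longrightarrow> NX k j \<Longrightarrow> j = k"
proof (cases j; cases k)
  fix a b assume *: "j \<in> dom" "k \<in> dom" "NX j k" "NX k j" "j = Inr a" "k = Inr b"
  obtain n i i' where e: "j = Inr (n, i)" "k = Inr (n, i')" "nst (vtx n) i i'" "nst (vtx n) i' i" 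
    using * by (cases a; cases b) auto
  interpret X: equivariant_hhs_structure "G (vtx n)" "T (vtx n)" E0 "SS (vtx n)" "CC (vtx n)" "pr (vtx n)" "nst (vtx n)"
    "ort (vtx n)" "rh (vtx n)" "ac (vtx n)" "tv (vtx n)"
    by (rule vertex_hhg) (use * e Inr_dom in auto)
  have "i \<in> SS (vtx n)" "i' \<in> SS (vtx n)" using * e Inr_dom by auto
  then show "j = k" using X.nest_antisym e by (auto simp: antisymp_on_def)
qed (auto dest: bnest_antisym)

lemma NX_trans: assumes "j \<in> dom" "k \<in> dom" "l \<in> dom" "NX j k" "NX k l" shows "NX j l"
proof (cases l)
  case (Inl n)
  then show ?thesis using assms NX_base bnest_trans[of "base j" "base k" n] by auto
next
  case (Inr b)
  obtain n i i' i'' where e: "j = Inr (n, i)" "k = Inr (n, i')" "l = Inr (n, i'')" "nst (vtx n) i i'" "nst (vtx n) i' i''"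
  proof -
    obtain n i' i'' where kl: "k = Inr (n, i')" "l = Inr (n, i'')" using NX_same[OF assms(5) Inr] by (auto simp: same_def)
    obtain i where "j = Inr (n, i)" using NX_same[OF assms(4) kl(1)] kl by (auto simp: same_def)
    then show ?thesis using that kl assms(4,5) by simp
  qed
  interpret X: equivariant_hhs_structure "G (vtx n)" "T (vtx n)" E0 "SS (vtx n)" "CC (vtx n)" "pr (vtx n)" "nst (vtx n)"
    "ort (vtx n)" "rh (vtx n)" "ac (vtx n)" "tv (vtx n)"
    by (rule vertex_hhg) (use assms e Inr_dom in auto)
  have "i \<in> SS (vtx n)" "i' \<in> SS (vtx n)" "i'' \<in> SS (vtx n)" using assms e Inr_dom by auto
  then show ?thesis using transp_onD[OF X.nest_trans, of i i' i''] e by simp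
qed

text \<open>The star of \<open>V\<close> is \<open>V\<close>, so its product region is the whole
  group and meets all others.\<close>

lemma top_ex: obtains n0 where "n0 \<in> D" "L n0 = V" "\<And>m. m \<in> D \<Longrightarrow> bnest m n0"
proof -
  obtain n0 where n0: "n0 \<in> D" "L n0 = V" using index_ex[of V \<one>] V_ne by auto
  have "P n0 = carrier \<G>"
  proof -
    have "st V = V" using lk_subset by (auto simp: st_def)
    then show ?thesis using n0 r_in by (auto simp: P_def H_V)
  qed
  then have "bnest m n0" if "m \<in> D" for m using n0 L_V[OF that] r_P[OF that] r_in[OF that] by (auto simp: bnest_def)
  then show ?thesis using that n0 by blast
qed

lemma NX_maximal: "\<exists>!M. M \<in> dom \<and> (\<forall>V\<in>dom. NX M V \<longrightarrow> V = M)"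
proof -
  obtain n0 where n0: "n0 \<in> D" "L n0 = V" "\<And>m. m \<in> D \<Longrightarrow> bnest m n0" using top_ex by blast
  have top: "NX j (Inl n0)" if "j \<in> dom" for j using n0(3) that by simp
  show ?thesis
  proof (rule ex1I[of _ "Inl n0"])
    show "Inl n0 \<in> dom \<and> (\<forall>V\<in>dom. NX (Inl n0) V \<longrightarrow> V = Inl n0)"
      using NX_antisym[OF _ _ top] n0(1) by simp
    show "M = Inl n0" if M: "M \<in> dom \<and> (\<forall>V\<in>dom. NX M V \<longrightarrow> V = M)" for M
    proof -
      have "Inl n0 \<in> dom" "NX M (Inl n0)" using n0(1) top M by auto
      then show ?thesis using M by blast
    qed
  qed
qed

lemma OX_sym: assumes "j \<in> dom" "k \<in> dom" "OX j k" shows "OX k j"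
proof (cases "borth (base j) (base k)")
  case True
  then show ?thesis using borth_sym[OF _ _ True] assms by (simp add: OX_def)
next
  case False
  then obtain n i i' where e: "j = Inr (n, i)" "k = Inr (n, i')" "ort (vtx n) i i'" using assms unfolding OX_def by blast
  interpret X: equivariant_hhs_structure "G (vtx n)" "T (vtx n)" E0 "SS (vtx n)" "CC (vtx n)" "pr (vtx n)" "nst (vtx n)"
    "ort (vtx n)" "rh (vtx n)" "ac (vtx n)" "tv (vtx n)"
    by (rule vertex_hhg) (use assms e Inr_dom in auto)
  have "i \<in> SS (vtx n)" "i' \<in> SS (vtx n)" using assms e Inr_dom by auto
  then have "ort (vtx n) i' i" using X.orth_sym e(3) by (meson symp_onD)
  then show ?thesis using e by (auto simp: OX_def)
qed

lemma OX_not_NX: assumes "j \<in> dom" "k \<in> dom" "OX j k" shows "\<not> NX j k"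
proof (cases "borth (base j) (base k)")
  case True
  then show ?thesis using NX_base assms borth_not_bnest base_dom by blast
next
  case False
  then obtain n i i' where e: "j = Inr (n, i)" "k = Inr (n, i')" "ort (vtx n) i i'" using assms unfolding OX_def by blast
  interpret X: equivariant_hhs_structure "G (vtx n)" "T (vtx n)" E0 "SS (vtx n)" "CC (vtx n)" "pr (vtx n)" "nst (vtx n)"
    "ort (vtx n)" "rh (vtx n)" "ac (vtx n)" "tv (vtx n)"
    by (rule vertex_hhg) (use assms e Inr_dom in auto)
  show ?thesis using X.orth_not_comparable assms e Inr_dom by auto
qed

lemma OX_nest: assumes "j \<in> dom" "k \<in> dom" "l \<in> dom" "NX j k" "OX k l" shows "OX j l"
proof (cases "borth (base k) (base l)")
  case True
  then have "borth (base j) (base l)" by (intro borth_bnest[OF _ _ _ NX_base[OF assms(1,2,4)]]) (use assms in auto)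
  then show ?thesis by (simp add: OX_def)
next
  case False
  then obtain n i' i'' where e: "k = Inr (n, i')" "l = Inr (n, i'')" "ort (vtx n) i' i''" using assms unfolding OX_def by blast
  then obtain i where i: "j = Inr (n, i)" "nst (vtx n) i i'" using assms(4) by (cases j) auto
  interpret X: equivariant_hhs_structure "G (vtx n)" "T (vtx n)" E0 "SS (vtx n)" "CC (vtx n)" "pr (vtx n)" "nst (vtx n)"
    "ort (vtx n)" "rh (vtx n)" "ac (vtx n)" "tv (vtx n)"
    by (rule vertex_hhg) (use assms e Inr_dom in auto)
  have "ort (vtx n) i i''" using X.orth_nest[of i i' i''] assms e i Inr_dom by auto
  then show ?thesis using e i by (auto simp: OX_def)
qed

section \<open>Relative projections between domains\<close>

definition btrans :: "nat \<Rightarrow> nat \<Rightarrow> bool" where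
  "btrans m n \<longleftrightarrow> \<not> borth m n \<and> \<not> bnest m n \<and> \<not> bnest n m"

text \<open>Comparable bases without comparable domains could only occur below a copied domain.
  There the bases coincide by \<open>bnest_vertex\<close>, and the domains lie in one copy or one is
  the top element of the other.\<close>

lemma transverse_base:
  assumes "j \<in> dom" "k \<in> dom" "\<not> OX j k" "\<not> NX j k" "\<not> NX k j" "\<not> same j k"
  shows "btrans (base j) (base k)"
proof -
  have "\<not> bnest (base j) (base k)"
  proof
    assume b: "bnest (base j) (base k)"
    then obtain n i where k: "k = Inr (n, i)" using assms(4) by (cases k) auto
    then have "base j = n" using bnest_vertex[of "base j" n] b assms by (auto simp: Inr_dom)
    then show False using assms k bnest_refl by (cases j) (auto simp: same_def)
  qed
  moreover have "\<not> bnest (base k) (base j)"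
  proof
    assume b: "bnest (base k) (base j)"
    then obtain n i where j: "j = Inr (n, i)" using assms(5) by (cases j) auto
    then have "base k = n" using bnest_vertex[of "base k" n] b assms by (auto simp: Inr_dom)
    then show False using assms j bnest_refl by (cases k) (auto simp: same_def)
  qed
  ultimately show ?thesis using assms by (simp add: btrans_def OX_def)
qed

text \<open>For a coset domain \<open>bp_region_diam\<close> bounds the projection of the region by
  2. For a copied domain the proper subset of \<open>L k\<close> provided by
  \<open>bp_region_small\<close> is empty, so the coordinates are even equal.\<close>

lemma region_points_close:
  assumes "j \<in> dom" "k \<in> dom" "\<not> same j k"
    and "btrans (base j) (base k) \<or> (\<exists>n. k = Inl n \<and> NX j k \<and> j \<noteq> k)" and g: "g \<in> P (base j)" "h \<in> P (base j)"
  shows "pg k g = pg k h \<or> (\<exists>n. k = Inl n \<and> mdist (CX k) (cpt (L n) (bp n g)) (cpt (L n) (bp n h)) \<le> 2)"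
  using assms(2)
proof (cases rule: dom_cases)
  case (coset n)
  define m where "m = base j"
  have m: "m \<in> D" using assms by (simp add: m_def)
  have gc: "g \<in> carrier \<G>" "h \<in> carrier \<G>" using g P_carrier by auto
  have "mdist (cspace (L n) :: ('p + real) metric) (cpt (L n) (bp n g)) (cpt (L n) (bp n h)) \<le> 2"
  proof (cases "m = n")
    case True
    \<comment> \<open>Equal bases only occur for a copied domain \<open>j\<close> below its top
      element, whose whole space is coned off.\<close>
    then have "\<exists>i v. j = Inr (n, i) \<and> L n = {v}"
      using assms coset bnest_refl Inr_dom by (cases j) (auto simp: btrans_def m_def)
    then obtain v where v: "L n = {v}" by blast
    have b: "bp n g \<in> H (L n)" "bp n h \<in> H (L n)" using gc coset by auto
    then have "inv (bp n g) \<otimes> bp n h \<in> cone (L n)" using v by (intro cone_vertex[of _ v]) auto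
    from mdist_cpt_cone[OF b(1) this] show ?thesis using H_closed[OF b(1)] H_closed[OF b(2)] by simp
  next
    case False
    have "\<not> bnest n m"
      using assms(4) False coset m bnest_antisym[of m n] by (auto simp: btrans_def m_def)
    moreover have "\<not> borth n m"
      using assms(4) coset m borth_sym[of n m] borth_not_bnest[of m n] by (auto simp: btrans_def m_def)
    ultimately show ?thesis using bp_region_diam[OF m coset(2)] g by (simp add: m_def)
  qed
  then show ?thesis using coset by auto
next
  case (vertex n i v)
  define m where "m = base j"
  have m: "m \<in> D" using assms by (simp add: m_def)
  have t: "btrans m n" using assms(4) vertex by (auto simp: m_def)
  have far: "\<not> (L n \<subseteq> st (L m) \<and> P m \<inter> P n \<noteq> {})"
    using t vertex(3) m vertex(2) borth_sym[of n m] by (auto simp: btrans_def bnest_def borth_def st_def)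
  then obtain \<Delta> where d: "\<Delta> \<subset> L n" "inv (bp n g) \<otimes> bp n h \<in> H \<Delta>"
    using bp_region_small[OF m vertex(2) g[folded m_def] far] by blast
  have "\<Delta> = {}" using d(1) vertex(3) by auto
  then have one: "inv (bp n g) \<otimes> bp n h = \<one>" using d(2) H_empty by blast
  have "bp n g \<in> carrier \<G>" "bp n h \<in> carrier \<G>" using H_closed[OF bp_H[OF vertex(2)]] g P_carrier by blast+
  then have "bp n h = bp n g" using one by (metis cancel_left(2) r_one)
  then show ?thesis using pg_bp_eq[of k g h] assms vertex by simp
qed

lemma RX_not_same: "\<not> same j k \<Longrightarrow> RX j k = (\<Union>g\<in>P (base j). pg k g)"
  by (simp add: RX_def)

lemma RX_same: "RX (Inr (n, i)) (Inr (n, i')) = Inl ` rh (vtx n) i i'"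
  by (auto simp: RX_def same_def)

lemma RX_union_props:
  assumes "j \<in> dom" "k \<in> dom" "\<not> same j k" "btrans (base j) (base k) \<or> (\<exists>n. k = Inl n \<and> NX j k \<and> j \<noteq> k)"
  shows "RX j k \<noteq> {} \<and> RX j k \<subseteq> mspace (CX k) \<and> diam_le (CX k) (RX j k) KK"
proof -
  have P: "g \<in> carrier \<G>" if "g \<in> P (base j)" for g using that P_carrier by blast
  have "diam_le (CX k) (RX j k) KK"
    unfolding diam_le_def RX_not_same[OF assms(3)]
  proof (intro ballI)
    fix a b assume "a \<in> (\<Union>g\<in>P (base j). pg k g)" "b \<in> (\<Union>g\<in>P (base j). pg k g)"
    then obtain g h where g: "g \<in> P (base j)" "a \<in> pg k g" "h \<in> P (base j)" "b \<in> pg k h" by blast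
    from region_points_close[OF assms g(1,3)] show "mdist (CX k) a b \<le> KK"
    proof
      assume "pg k g = pg k h"
      then have "mdist (CX k) a b \<le> E0" using pg_diam[OF assms(2) P[OF g(1)]] g unfolding diam_le_def by blast
      then show ?thesis using KK E0 by simp
    next
      assume "\<exists>n. k = Inl n \<and> mdist (CX k) (cpt (L n) (bp n g)) (cpt (L n) (bp n h)) \<le> 2"
      then show ?thesis using g KK E0 by (auto simp: pg_simps)
    qed
  qed
  moreover have "r (base j) \<in> P (base j)" using r_P assms by simp
  then have "RX j k \<noteq> {}" unfolding RX_not_same[OF assms(3)] using pg_ne[OF assms(2) P] by blast
  moreover have "RX j k \<subseteq> mspace (CX k)" unfolding RX_not_same[OF assms(3)] using pg_sub[OF assms(2) P] by blast
  ultimately show ?thesis by blast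
qed

lemma RX_nest:
  assumes "j \<in> dom" "k \<in> dom" "NX j k" "j \<noteq> k"
  shows "RX j k \<noteq> {} \<and> RX j k \<subseteq> mspace (CX k) \<and> diam_le (CX k) (RX j k) KK"
proof (cases "same j k")
  case True
  then obtain n i i' where e: "j = Inr (n, i)" "k = Inr (n, i')" by (auto simp: same_def)
  interpret X: equivariant_hhs_structure "G (vtx n)" "T (vtx n)" E0 "SS (vtx n)" "CC (vtx n)" "pr (vtx n)" "nst (vtx n)"
    "ort (vtx n)" "rh (vtx n)" "ac (vtx n)" "tv (vtx n)"
    by (rule vertex_hhg) (use assms e Inr_dom in auto)
  have *: "rh (vtx n) i i' \<noteq> {} \<and> rh (vtx n) i i' \<subseteq> mspace (CC (vtx n) i') \<and> diam_le (CC (vtx n) i') (rh (vtx n) i i') E0"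
    using X.rho_nest[of i i'] assms e Inr_dom by auto
  then have "diam_le (CX k) (RX j k) E0" using isometry_diam_le[OF isometry_Inl, of "rh (vtx n) i i'"] e by (auto simp: RX_same)
  then show ?thesis using * e isometry_onto_in[OF isometry_Inl] KK E0 by (auto simp: RX_same elim!: diam_le_mono)
next
  case False
  then have "\<exists>n. k = Inl n" using assms NX_same by (cases k) auto
  then show ?thesis using RX_union_props[OF assms(1,2) False] assms by blast
qed

lemma RX_transverse:
  assumes "j \<in> dom" "k \<in> dom" "\<not> OX j k" "\<not> NX j k" "\<not> NX k j"
  shows "RX j k \<noteq> {} \<and> RX j k \<subseteq> mspace (CX k) \<and> diam_le (CX k) (RX j k) KK"
proof (cases "same j k")
  case True
  then obtain n i i' where e: "j = Inr (n, i)" "k = Inr (n, i')" by (auto simp: same_def)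
  interpret X: equivariant_hhs_structure "G (vtx n)" "T (vtx n)" E0 "SS (vtx n)" "CC (vtx n)" "pr (vtx n)" "nst (vtx n)"
    "ort (vtx n)" "rh (vtx n)" "ac (vtx n)" "tv (vtx n)"
    by (rule vertex_hhg) (use assms e Inr_dom in auto)
  have *: "rh (vtx n) i i' \<noteq> {} \<and> rh (vtx n) i i' \<subseteq> mspace (CC (vtx n) i') \<and> diam_le (CC (vtx n) i') (rh (vtx n) i i') E0"
    using X.rho_transverse[of i i'] assms e Inr_dom by (auto simp: OX_def)
  then have "diam_le (CX k) (RX j k) E0" using isometry_diam_le[OF isometry_Inl, of "rh (vtx n) i i'"] e by (auto simp: RX_same)
  then show ?thesis using * e isometry_onto_in[OF isometry_Inl] KK E0 by (auto simp: RX_same elim!: diam_le_mono)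
next
  case False
  then show ?thesis using RX_union_props[OF assms(1,2) False] transverse_base[OF assms False] by blast
qed

lemma geodesic_CX: assumes "j \<in> dom" shows "geodesic_space (CX j)"
  using assms
proof (cases rule: dom_cases)
  case (coset n) then show ?thesis by (simp add: geodesic_cspace)
next
  case (vertex n i v)
  interpret X: equivariant_hhs_structure "G v" "T v" E0 "SS v" "CC v" "pr v" "nst v" "ort v" "rh v" "ac v" "tv v"
    by (rule vertex_hhg[OF vertex(5)])
  show ?thesis using isometry_geodesic_space[OF isometry_Inl X.geodesic[OF vertex(6)]] vertex by simp
qed

sublocale X: proto_hierarchy_structure CG KK dom CX PX NX OX RX
proof
  show "0 < KK" using KK E0 by simp
  show "quasi_geodesic_space CG" by (rule geodesic_quasi_geodesic[OF CG(1)])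
  show "reflp_on dom NX" using NX_refl by (auto simp: reflp_on_def)
  show "antisymp_on dom NX" using NX_antisym by (auto simp: antisymp_on_def)
  show "transp_on dom NX" using NX_trans unfolding transp_on_def by blast
  show "symp_on dom OX" using OX_sym by (auto simp: symp_on_def)
  fix W x y assume W: "W \<in> dom"
  show "geodesic_space (CX W)" by (rule geodesic_CX[OF W])
  show "mspace (CX W) \<subseteq> nbhd (CX W) KK (\<Union>x\<in>mspace CG. PX W x)" by (rule PX_onto[OF W])
  assume x: "x \<in> mspace CG"
  show "PX W x \<subseteq> mspace (CX W)" "PX W x \<noteq> {}" using PX_props[OF W x] by auto
  show "diam_le (CX W) (PX W x) KK" using diam_le_mono[OF PX_props(3)[OF W x]] KK E0 by simp
  assume y: "y \<in> mspace CG"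
  have "E0 * mdist CG x y \<le> KK * mdist CG x y" using KK E0 by (intro mult_right_mono) auto
  then show "set_dist (CX W) (PX W x) (PX W y) \<le> KK * mdist CG x y + KK" using PX_Lipschitz[OF W x y] KK E0 by linarith
next
  show "\<exists>!M. M \<in> dom \<and> (\<forall>V\<in>dom. NX M V \<longrightarrow> V = M)" by (rule NX_maximal)
next
  fix V W assume *: "V \<in> dom" "W \<in> dom" "NX V W" "V \<noteq> W"
  show "RX V W \<noteq> {} \<and> RX V W \<subseteq> mspace (CX W) \<and> diam_le (CX W) (RX V W) KK" by (rule RX_nest[OF *])
next
  fix V W assume *: "V \<in> dom" "W \<in> dom" "OX V W"
  show "\<not> NX V W \<and> \<not> NX W V" using OX_not_NX OX_sym * by blast
next
  fix V W U assume *: "V \<in> dom" "W \<in> dom" "U \<in> dom" "NX V W" "OX W U"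
  show "OX V U" by (rule OX_nest[OF *])
next
  fix V W assume *: "V \<in> dom" "W \<in> dom" "\<not> OX V W" "\<not> NX V W" "\<not> NX W V"
  show "RX V W \<noteq> {} \<and> RX V W \<subseteq> mspace (CX W) \<and> diam_le (CX W) (RX V W) KK" by (rule RX_transverse[OF *])
qed

end

section \<open>The hierarchy axioms\<close>

lemma set_dist_self: "A \<noteq> {} \<Longrightarrow> A \<subseteq> mspace m \<Longrightarrow> set_dist m A A \<le> 0"
  using close_refl[of A m 0] close_set_dist by blast

text \<open>Uniqueness of the maximal element alone does not make it greatest. Finite complexity
  forbids infinite ascending chains, so each element lies below some maximal one, and there is only
  one.\<close>

lemma (in hhs_structure) greatest_element:
  assumes "\<SS> \<noteq> {}" shows "\<exists>M\<in>\<SS>. \<forall>V\<in>\<SS>. V \<preceq> M"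
proof -
  define R where "R = {(j, i). i \<in> \<SS> \<and> j \<in> \<SS> \<and> i \<preceq> j \<and> i \<noteq> j}"
  have "wf R"
    unfolding wf_iff_no_infinite_down_chain
  proof
    assume "\<exists>f. \<forall>k. (f (Suc k), f k) \<in> R"
    then obtain f where f: "\<And>k. f k \<in> \<SS>" "\<And>k. f k \<preceq> f (Suc k)" "\<And>k. f k \<noteq> f (Suc k)"
      by (auto simp: R_def)
    have lt: "f a \<preceq> f (Suc (a + b)) \<and> f a \<noteq> f (Suc (a + b))" for a b
    proof (induction b)
      case 0 then show ?case using f by simp
    next
      case (Suc b)
      define c where "c = Suc (a + b)"
      have "f a \<preceq> f (Suc c)" using transp_onD[OF nest_trans f(1) f(1) f(1)] Suc f(2) by (auto simp: c_def)
      moreover have "f a \<noteq> f (Suc c)"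
      proof
        assume e: "f a = f (Suc c)"
        have "f c \<preceq> f a" using f(2)[of c] e by simp
        then have "f a = f c" using antisymp_onD[OF nest_antisym f(1) f(1)] Suc c_def by blast
        then show False using Suc by (simp add: c_def)
      qed
      ultimately show ?case by (simp add: c_def)
    qed
    have lt': "f a \<preceq> f b \<and> f a \<noteq> f b" if "a < b" for a b
      using lt[of a "b - Suc a"] that by simp
    have "inj f" by (rule linorder_injI) (use lt' in blast)
    moreover have "finite (range f)"
    proof -
      have "V \<preceq> W \<or> W \<preceq> V" if V: "V \<in> range f" and W: "W \<in> range f" for V W
      proof -
        obtain a b where ab: "V = f a" "W = f b" using V W by blast
        consider "a < b" | "b < a" | "a = b" by linarith
        then show ?thesis using lt' ab reflp_onD[OF nest_refl f(1)] by cases auto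
      qed
      then have "finite (range f) \<and> real (card (range f)) \<le> E" using f(1) by (intro finite_complexity) blast+
      then show ?thesis by simp
    qed
    ultimately show False using finite_imageD by blast
  qed
  obtain M where M: "M \<in> \<SS>" "\<And>N. N \<in> \<SS> \<Longrightarrow> (\<forall>V\<in>\<SS>. N \<preceq> V \<longrightarrow> V = N) \<Longrightarrow> N = M"
    using nest_maximal[OF assms] by blast
  have "V \<preceq> M" if V: "V \<in> \<SS>" for V
  proof -
    have "V \<in> {j \<in> \<SS>. V \<preceq> j}" using V reflp_onD[OF nest_refl V] by simp
    then obtain z where z: "z \<in> \<SS>" "V \<preceq> z" "\<And>y. (y, z) \<in> R \<Longrightarrow> y \<notin> {j \<in> \<SS>. V \<preceq> j}"
      using wfE_min[OF \<open>wf R\<close>] by (metis (no_types, lifting) mem_Collect_eq)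
    have "y = z" if y: "y \<in> \<SS>" "z \<preceq> y" for y
    proof (rule ccontr)
      assume "y \<noteq> z"
      then have "(y, z) \<in> R" using y z by (auto simp: R_def)
      moreover have "V \<preceq> y" using transp_onD[OF nest_trans V z(1) y(1) z(2) y(2)] .
      ultimately show False using z(3) y by blast
    qed
    then have "z = M" using M(2) z(1) by blast
    then show ?thesis using z by simp
  qed
  then show ?thesis using M by blast
qed

context hhg_product
begin

lemma same_cases:
  assumes "same j k" "j \<in> dom" "k \<in> dom"
  obtains n i i' v where "j = Inr (n, i)" "k = Inr (n, i')" "n \<in> D" "L n = {v}" "vtx n = v" "v \<in> V" "i \<in> SS v" "i' \<in> SS v"
proof -
  obtain n i i' where "j = Inr (n, i)" "k = Inr (n, i')" using assms by (auto simp: same_def)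
  then show ?thesis using that[of n i i' "vtx n"] assms by (simp add: Inr_dom)
qed

lemma hyperbolic_CX: assumes "j \<in> dom" shows "hyperbolic (CX j) KK"
  using assms
proof (cases rule: dom_cases)
  case (coset n)
  then show ?thesis using hyperbolic_mono[OF hyperbolic_cspace[of "L n"]] KK E0 by simp
next
  case (vertex n i v)
  interpret Y: equivariant_hhs_structure "G v" "T v" E0 "SS v" "CC v" "pr v" "nst v" "ort v" "rh v" "ac v" "tv v"
    by (rule vertex_hhg[OF vertex(5)])
  show ?thesis using hyperbolic_mono[OF isometry_hyperbolic[OF isometry_Inl Y.hyperbolicity[OF vertex(6)]]] vertex KK E0 by simp
qed

text \<open>On a chain the coset domains are determined by their sets of types, and the copied
  domains all lie in one copy, where the bound of the vertex group applies.\<close>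

lemma finite_complexity_CX:
  assumes A: "A \<subseteq> dom" and chain: "\<forall>V\<in>A. \<forall>W\<in>A. NX V W \<or> NX W V"
  shows "finite A \<and> real (card A) \<le> KK"
proof -
  define A1 where "A1 = {n. Inl n \<in> A}"
  define A2 where "A2 = {p. Inr p \<in> A}"
  have AA: "A = Inl ` A1 \<union> Inr ` A2"
  proof
    show "A \<subseteq> Inl ` A1 \<union> Inr ` A2"
    proof
      fix x assume "x \<in> A" then show "x \<in> Inl ` A1 \<union> Inr ` A2" by (cases x) (auto simp: A1_def A2_def)
    qed
  qed (auto simp: A1_def A2_def)
  have "inj_on L A1"
  proof (rule inj_onI)
    fix m n assume mn: "m \<in> A1" "n \<in> A1" "L m = L n"
    have "m \<in> D" "n \<in> D" using mn A by (auto simp: A1_def)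
    moreover have "NX (Inl m) (Inl n) \<or> NX (Inl n) (Inl m)" using mn chain unfolding A1_def by blast
    ultimately show "m = n" using bnest_same[of m n] bnest_same[of n m] mn by auto
  qed
  moreover have sub: "L ` A1 \<subseteq> Pow V"
  proof (intro image_subsetI PowI)
    fix n assume "n \<in> A1"
    then have "n \<in> D" using A by (auto simp: A1_def)
    then show "L n \<subseteq> V" by (rule L_V)
  qed
  ultimately have A1: "finite A1" "card A1 \<le> 2 ^ card V"
    using finV finite_imageD[of L A1] finite_subset[OF sub] card_mono[OF _ sub] by (auto simp: card_image card_Pow)
  have A2: "finite A2 \<and> real (card A2) \<le> E0"
  proof (cases "A2 = {}")
    case False
    then obtain n i0 where n: "Inr (n, i0) \<in> A" by (auto simp: A2_def)
    then have v: "L n = {vtx n}" "vtx n \<in> V" "n \<in> D" using A Inr_dom by auto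
    interpret Y: equivariant_hhs_structure "G (vtx n)" "T (vtx n)" E0 "SS (vtx n)" "CC (vtx n)" "pr (vtx n)" "nst (vtx n)"
      "ort (vtx n)" "rh (vtx n)" "ac (vtx n)" "tv (vtx n)"
      by (rule vertex_hhg[OF v(2)])
    define A3 where "A3 = {i. Inr (n, i) \<in> A}"
    have same_n: "m = n" if m: "Inr (m, i) \<in> A" for m i
    proof -
      have "NX (Inr (m, i)) (Inr (n, i0)) \<or> NX (Inr (n, i0)) (Inr (m, i))" using chain n m by blast
      then show ?thesis by auto
    qed
    have A2: "A2 = Pair n ` A3"
    proof (intro equalityI subsetI)
      fix p assume "p \<in> A2"
      then show "p \<in> Pair n ` A3" using same_n by (cases p) (auto simp: A2_def A3_def)
    qed (auto simp: A2_def A3_def)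
    have "A3 \<subseteq> SS (vtx n)"
    proof
      fix i assume "i \<in> A3"
      then have "Inr (n, i) \<in> dom" using A by (auto simp: A3_def)
      then show "i \<in> SS (vtx n)" by (simp add: Inr_dom)
    qed
    moreover have "nst (vtx n) i i' \<or> nst (vtx n) i' i" if i: "i \<in> A3" "i' \<in> A3" for i i'
    proof -
      have "NX (Inr (n, i)) (Inr (n, i')) \<or> NX (Inr (n, i')) (Inr (n, i))" using chain i unfolding A3_def by blast
      then show ?thesis by simp
    qed
    ultimately have "finite A3 \<and> real (card A3) \<le> E0" using Y.finite_complexity[of A3] by blast
    moreover have "card A2 = card A3" unfolding A2 by (rule card_image) (auto intro: inj_onI)
    ultimately show ?thesis using A2 by simp
  qed (use E0 in simp)
  have "card A \<le> card (Inl ` A1 :: (nat + nat \<times> 'i) set) + card (Inr ` A2 :: (nat + nat \<times> 'i) set)"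
    unfolding AA by (rule card_Un_le)
  also have "\<dots> = card A1 + card A2" by (simp add: card_image)
  finally have "real (card A) \<le> real (card A1) + real (card A2)" by (simp flip: of_nat_add)
  moreover have "real (card A1) \<le> 2 ^ card V" using A1(2) by (metis of_nat_le_iff of_nat_numeral of_nat_power)
  ultimately have "real (card A) \<le> KK" using A2 E0 unfolding KK_def by linarith
  then show ?thesis using A1 A2 AA by simp
qed

lemma proj_dist_PX: "X.proj_dist W x y = set_dist (CX W) (PX W x) (PX W y)"
  by (simp add: X.proj_dist_def)

lemma proj_dist_bp_eq:
  assumes "W \<in> dom" "x \<in> mspace CG" "y \<in> mspace CG" "bp (base W) (vx x) = bp (base W) (vx y)"
  shows "X.proj_dist W x y \<le> 0"
  using set_dist_self[OF PX_props(2,1)[OF assms(1,2)]] pg_bp_eq[OF assms(1,4)]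
  by (simp add: proj_dist_PX PX_def)

lemma vertex_point:
  assumes "n \<in> D" "L n = {v}" "g \<in> carrier \<G>" shows "vpt (cc n g) \<in> mspace (CV v)"
  using CV_vpt[of v] cc_closed[OF assms] L_V[OF assms(1)] assms(2) by auto

text \<open>For a coset domain it suffices that the base coordinates of the two points differ: equal
  coordinates would force the distance 0 in \<open>V'\<close>. A copied domain inherits the
  property, as everything nested in it lies in the same copy.\<close>

lemma bounded_geodesic_image_CX:
  assumes "V' \<in> dom" "W \<in> dom" "X.strictly_nested V' W" "x \<in> mspace CG" "y \<in> mspace CG"
    "KK \<le> X.proj_dist V' x y" "a \<in> PX W x" "b \<in> PX W y" "geodesic_segment (CX W) a b Q"
  shows "Q \<inter> nbhd (CX W) KK (RX V' W) \<noteq> {}"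
  using assms(2)
proof (cases rule: dom_cases)
  case (coset n)
  have N: "bnest (base V') n" "V' \<noteq> W" using assms(3) coset by (auto simp: X.strictly_nested_def)
  have ns: "\<not> same V' W" using coset by (auto simp: same_def)
  note c = CG_vx(1)[OF assms(4)] CG_vx(1)[OF assms(5)]
  have "bp (base V') (vx x) \<noteq> bp (base V') (vx y)"
    using proj_dist_bp_eq[OF assms(1,4,5)] assms(6) KK E0 by fastforce
  moreover have "geodesic_segment (cspace (L n)) (cpt (L n) (bp n (vx x))) (cpt (L n) (bp n (vx y))) Q"
    using assms(7-9) coset by (simp add: PX_def pg_simps)
  ultimately obtain g q where g: "g \<in> P (base V')" "q \<in> Q" "mdist (cspace (L n)) q (cpt (L n) (bp n g)) \<le> 7"
    using base_geodesic_image[OF base_dom[OF assms(1)] coset(2) N(1) c] by blast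
  have "q \<in> mspace (CX W)" using geodesic_segment_nonempty[OF assms(9)] g by blast
  moreover have "cpt (L n) (bp n g) \<in> RX V' W" using g ns coset by (auto simp: RX_not_same pg_simps)
  ultimately have "q \<in> nbhd (CX W) KK (RX V' W)" using g coset KK E0 by (intro nbhdI[of _ _ "cpt (L n) (bp n g)"]) auto
  then show ?thesis using g by blast
next
  case (vertex n i v)
  have "same V' W" using NX_same assms(3) vertex by (auto simp: X.strictly_nested_def)
  then obtain i' where e: "V' = Inr (n, i')" using vertex by (auto simp: same_def)
  have i': "i' \<in> SS v" using assms(1) e vertex by (simp add: Inr_dom)
  interpret Y: equivariant_hhs_structure "G v" "T v" E0 "SS v" "CC v" "pr v" "nst v" "ort v" "rh v" "ac v" "tv v"
    by (rule vertex_hhg[OF vertex(5)])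
  define x' y' where "x' = vpt (cc n (vx x))" and "y' = vpt (cc n (vx y))"
  have x': "x' \<in> mspace (CV v)" "y' \<in> mspace (CV v)"
    using vertex_point[OF vertex(2,3)] CG_vx assms by (auto simp: x'_def y'_def)
  obtain a' b' where ab: "a = Inl a'" "b = Inl b'" "a' \<in> pr v i x'" "b' \<in> pr v i y'"
    using assms(7,8) vertex by (auto simp: PX_def pg_simps x'_def y'_def)
  have m: "a' \<in> mspace (CC v i)" "b' \<in> mspace (CC v i)" using ab Y.proj_subset[OF vertex(6)] x' by blast+
  have "geodesic_segment (map_metric Inl (CC v i)) (Inl a') (Inl b') Q" using assms(9) ab vertex by simp
  from isometry_segment_back[OF isometry_Inl this m] obtain Q' where Q: "Q = Inl ` Q'" "geodesic_segment (CC v i) a' b' Q'" .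
  have "X.proj_dist V' x y = Y.proj_dist i' x' y'"
    using isometry_set_dist[OF isometry_Inl Y.proj_subset[OF i' x'(1)] Y.proj_subset[OF i' x'(2)]] vertex
    by (simp add: proj_dist_PX Y.proj_dist_def e PX_def pg_simps x'_def y'_def)
  then have d: "E0 \<le> Y.proj_dist i' x' y'" using assms(6) KK E0 by simp
  have sn: "Y.strictly_nested i' i" using assms(3) e vertex by (auto simp: X.strictly_nested_def Y.strictly_nested_def)
  obtain q where q: "q \<in> Q'" "q \<in> nbhd (CC v i) E0 (rh v i' i)"
    using Y.bounded_geodesic_image[OF i' vertex(6) sn x' d ab(3,4) Q(2)] by blast
  have rs: "rh v i' i \<subseteq> mspace (CC v i)" using Y.rho_nest[OF i' vertex(6)] sn by (auto simp: Y.strictly_nested_def)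
  have "Inl q \<in> nbhd (CX W) E0 (RX V' W)"
    using isometry_nbhd[OF isometry_Inl rs, of E0] q vertex e by (simp add: RX_same)
  moreover have le: "E0 \<le> KK" using KK E0 by simp
  ultimately have "Inl q \<in> nbhd (CX W) KK (RX V' W)" by (rule subsetD[OF nbhd_mono, rotated])
  then show ?thesis using Q q by blast
qed

text \<open>Three cases: a class with several types is handled by \<open>base_large_links\<close>;
  over a class with one type the links are replaced by a single domain; a copied domain uses the
  links of its vertex group.\<close>

lemma large_links_CX:
  assumes "W \<in> dom" "x \<in> mspace CG" "y \<in> mspace CG"
  shows "\<exists>\<V>. finite \<V> \<and> \<V> \<subseteq> X.below W - {W} \<and> real (card \<V>) \<le> KK * X.proj_dist W x y + KK \<and>
          (\<forall>U\<in>X.below W - {W}. (\<exists>V\<in>\<V>. NX U V) \<or> X.proj_dist U x y \<le> KK)"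
  using assms(1)
proof (cases rule: dom_cases)
  case (coset n)
  note c = CG_vx(1)[OF assms(2)] CG_vx(1)[OF assms(3)]
  let ?d = "mdist (cspace (L n) :: ('p + real) metric) (cpt (L n) (bp n (vx x))) (cpt (L n) (bp n (vx y)))"
  have pd: "X.proj_dist W x y = ?d" using coset by (simp add: proj_dist_PX PX_def pg_simps)
  have K0: "?d \<le> KK * ?d + KK"
  proof -
    have "0 \<le> ?d" by simp
    then have "1 * ?d \<le> KK * ?d" using KK E0 by (intro mult_right_mono) auto
    then show ?thesis using KK E0 by linarith
  qed
  show ?thesis
  proof (cases "card (L n) = 1")
    case False
    obtain K where K: "finite K" "K \<subseteq> D" "real (card K) \<le> ?d" "\<forall>k\<in>K. bnest k n \<and> k \<noteq> n"
      "\<forall>m\<in>D. bnest m n \<and> m \<noteq> n \<and> (\<forall>k\<in>K. \<not> bnest m k) \<longrightarrow>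
        (card (L m) = 1 \<longrightarrow> bp m (vx x) = bp m (vx y)) \<and>
        mdist (cspace (L m) :: ('p + real) metric) (cpt (L m) (bp m (vx x))) (cpt (L m) (bp m (vx y))) \<le> 9"
      using base_large_links[OF coset(2) False c] by (elim exE conjE) (rule that)
    let ?V = "Inl ` K :: (nat + nat \<times> 'i) set"
    have "finite ?V" using K by simp
    moreover have "?V \<subseteq> X.below W - {W}" using K(2,4) coset unfolding X.below_def by auto
    moreover have "real (card ?V) \<le> KK * X.proj_dist W x y + KK"
      using K(3) K0 pd by (simp add: card_image)
    moreover have "(\<exists>V\<in>?V. NX U V) \<or> X.proj_dist U x y \<le> KK" if U: "U \<in> X.below W - {W}" for U
    proof (rule disjCI)
      assume nd: "\<not> X.proj_dist U x y \<le> KK"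
      define m where "m = base U"
      have Ud: "U \<in> dom" "bnest m n" "U \<noteq> W" using U coset by (auto simp: X.below_def m_def)
      have mD: "m \<in> D" using Ud by (simp add: m_def)
      have "m \<noteq> n" using Ud(1)
      proof (cases rule: dom_cases)
        case (vertex n' i v)
        then show ?thesis using False by (auto simp: m_def)
      qed (use Ud coset in \<open>simp add: m_def\<close>)
      show "\<exists>V\<in>?V. NX U V"
      proof (rule ccontr)
        assume "\<not> (\<exists>V\<in>?V. NX U V)"
        then have "\<forall>k\<in>K. \<not> bnest m k" by (auto simp: m_def)
        then have far: "card (L m) = 1 \<longrightarrow> bp m (vx x) = bp m (vx y)"
          "mdist (cspace (L m) :: ('p + real) metric) (cpt (L m) (bp m (vx x))) (cpt (L m) (bp m (vx y))) \<le> 9"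
          using bspec[OF K(5) mD] Ud \<open>m \<noteq> n\<close> by auto
        from Ud(1) show False
        proof (cases rule: dom_cases)
          case (coset n')
          then show False using far nd KK E0 by (simp add: proj_dist_PX PX_def pg_simps m_def)
        next
          case (vertex n' i v)
          then have "bp (base U) (vx x) = bp (base U) (vx y)" using far by (simp add: m_def)
          then show False using proj_dist_bp_eq[OF Ud(1) assms(2,3)] nd KK E0 by simp
        qed
      qed
    qed
    ultimately show ?thesis by (intro exI[of _ ?V]) blast
  next
    case True
    then obtain v where v: "L n = {v}" by (rule card_1_singletonE)
    have vV: "v \<in> V" using v L_V[OF coset(2)] by auto
    \<comment> \<open>The space of this class is bounded and says nothing about what lies below, but
      below it are only the domains of one copy. Their greatest element, if there is one, is a
      sufficient set of links.\<close>
    have below: "\<exists>i. U = Inr (n, i) \<and> i \<in> SS v" if U: "U \<in> X.below W - {W}" for U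
    proof -
      have Ud: "U \<in> dom" "bnest (base U) n" "U \<noteq> W" using U coset by (auto simp: X.below_def)
      have "base U = n" using bnest_vertex[OF base_dom[OF Ud(1)] coset(2) Ud(2) v] .
      from Ud(1) show ?thesis
      proof (cases rule: dom_cases)
        case (coset n')
        then show ?thesis using Ud \<open>W = Inl n\<close> \<open>base U = n\<close> by simp
      next
        case (vertex n' i v')
        then show ?thesis using \<open>base U = n\<close> v by auto
      qed
    qed
    interpret Y: equivariant_hhs_structure "G v" "T v" E0 "SS v" "CC v" "pr v" "nst v" "ort v" "rh v" "ac v" "tv v"
      by (rule vertex_hhg[OF vV])
    show ?thesis
    proof (cases "SS v = {}")
      case True
      have "0 \<le> ?d" by simp
      then have "0 \<le> KK * ?d + KK" using K0 by linarith
      then show ?thesis using True below pd by (intro exI[of _ "{}"]) auto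
    next
      case False
      then obtain M where M: "M \<in> SS v" "\<And>i. i \<in> SS v \<Longrightarrow> nst v i M" using Y.greatest_element by blast
      have "Inr (n, M) \<in> X.below W - {W}" using M v vV coset vtx[OF v] bnest_refl by (auto simp: X.below_def Inr_dom)
      moreover have "NX U (Inr (n, M))" if "U \<in> X.below W - {W}" for U using below[OF that] M(2) vtx[OF v] by auto
      moreover have "1 \<le> KK * ?d + KK"
      proof -
        have "0 \<le> KK * ?d" using KK E0 by simp
        then show ?thesis using KK E0 by linarith
      qed
      ultimately show ?thesis using pd by (intro exI[of _ "{Inr (n, M)}"]) auto
    qed
  qed
next
  case (vertex n i v)
  interpret Y: equivariant_hhs_structure "G v" "T v" E0 "SS v" "CC v" "pr v" "nst v" "ort v" "rh v" "ac v" "tv v"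
    by (rule vertex_hhg[OF vertex(5)])
  define x' y' where "x' = vpt (cc n (vx x))" and "y' = vpt (cc n (vx y))"
  have x': "x' \<in> mspace (CV v)" "y' \<in> mspace (CV v)"
    using vertex_point[OF vertex(2,3)] CG_vx assms by (auto simp: x'_def y'_def)
  have pd: "X.proj_dist (Inr (n, i')) x y = Y.proj_dist i' x' y'" if i': "i' \<in> SS v" for i'
    using isometry_set_dist[OF isometry_Inl Y.proj_subset[OF i' x'(1)] Y.proj_subset[OF i' x'(2)]] vertex
    by (simp add: proj_dist_PX Y.proj_dist_def PX_def pg_simps x'_def y'_def)
  have bel: "X.below W = (\<lambda>i'. Inr (n, i')) ` Y.below i"
  proof (intro equalityI subsetI)
    fix U assume "U \<in> X.below W"
    then have U: "U \<in> dom" "NX U W" by (auto simp: X.below_def)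
    then obtain i' where "U = Inr (n, i')" using NX_same[OF U(2), of "(n, i)"] vertex by (auto simp: same_def)
    then show "U \<in> (\<lambda>i'. Inr (n, i')) ` Y.below i" using U vertex by (auto simp: Y.below_def Inr_dom)
  qed (use vertex in \<open>auto simp: X.below_def Y.below_def Inr_dom\<close>)
  obtain \<V> where V: "finite \<V>" "\<V> \<subseteq> Y.below i - {i}" "real (card \<V>) \<le> E0 * Y.proj_dist i x' y' + E0"
    "\<And>U. U \<in> Y.below i - {i} \<Longrightarrow> (\<exists>V\<in>\<V>. nst v U V) \<or> Y.proj_dist U x' y' \<le> E0"
    using Y.large_links[OF vertex(6) x'] by blast
  let ?V = "(\<lambda>i'. Inr (n, i')) ` \<V> :: (nat + nat \<times> 'i) set"
  have "0 \<le> Y.proj_dist i x' y'" unfolding Y.proj_dist_def using Y.proj_nonempty[OF vertex(6)] x' by (intro set_dist_nonneg) auto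
  then have "E0 * Y.proj_dist i x' y' + E0 \<le> KK * Y.proj_dist i x' y' + KK" using KK E0 by (intro add_mono mult_right_mono) auto
  moreover have "card ?V = card \<V>" by (rule card_image) (auto intro: inj_onI)
  ultimately have "real (card ?V) \<le> KK * X.proj_dist W x y + KK" using V(3) pd[OF vertex(6)] vertex by simp
  moreover have "(\<exists>V\<in>?V. NX U V) \<or> X.proj_dist U x y \<le> KK" if U: "U \<in> X.below W - {W}" for U
  proof -
    obtain i' where i': "U = Inr (n, i')" "i' \<in> Y.below i - {i}" using U bel vertex by auto
    then have "i' \<in> SS v" by (auto simp: Y.below_def)
    then show ?thesis using V(4)[OF i'(2)] i' pd KK E0 vertex by fastforce
  qed
  moreover have "?V \<subseteq> X.below W - {W}" using V(2) bel vertex by auto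
  ultimately show ?thesis using V(1) by (intro exI[of _ ?V]) blast
qed

text \<open>The first alternative of \<open>base_consistency\<close> gives distance at most 1, and
  equal coordinates over a vertex group; the second gives equal coordinates in
  \<open>V'\<close>.\<close>

lemma consistency_CX:
  assumes "V' \<in> dom" "W \<in> dom" "X.transverse V' W" "x \<in> mspace CG"
  shows "min (set_dist (CX W) (PX W x) (RX V' W)) (set_dist (CX V') (PX V' x) (RX W V')) \<le> KK"
proof (cases "same V' W")
  case True
  obtain n i i' v where e: "V' = Inr (n, i)" "W = Inr (n, i')" "n \<in> D" "L n = {v}" "vtx n = v" "v \<in> V" "i \<in> SS v" "i' \<in> SS v"
    using same_cases[OF True assms(1,2)] .
  interpret Y: equivariant_hhs_structure "G v" "T v" E0 "SS v" "CC v" "pr v" "nst v" "ort v" "rh v" "ac v" "tv v"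
    by (rule vertex_hhg[OF e(6)])
  define x' where "x' = vpt (cc n (vx x))"
  have x': "x' \<in> mspace (CV v)" using vertex_point[OF e(3,4)] CG_vx assms by (auto simp: x'_def)
  have t: "Y.transverse i i'" "Y.transverse i' i"
    using assms(3) e OX_sym[OF assms(2,1)] by (auto simp: X.transverse_def Y.transverse_def OX_def dest: symp_onD[OF Y.orth_sym])
  have rs: "rh v i i' \<subseteq> mspace (CC v i')" "rh v i' i \<subseteq> mspace (CC v i)"
    using Y.rho_transverse[OF e(7,8)] Y.rho_transverse[OF e(8,7)] t by (auto simp: Y.transverse_def)
  have "set_dist (CX W) (PX W x) (RX V' W) = set_dist (CC v i') (pr v i' x') (rh v i i')"
    using isometry_set_dist[OF isometry_Inl Y.proj_subset[OF e(8) x'] rs(1)] e by (simp add: PX_def pg_simps RX_same x'_def)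
  moreover have "set_dist (CX V') (PX V' x) (RX W V') = set_dist (CC v i) (pr v i x') (rh v i' i)"
    using isometry_set_dist[OF isometry_Inl Y.proj_subset[OF e(7) x'] rs(2)] e by (simp add: PX_def pg_simps RX_same x'_def)
  ultimately show ?thesis using Y.consistency[OF e(7,8) t(1) x'] KK E0 by simp
next
  case False
  then have ns: "\<not> same V' W" "\<not> same W V'" by (auto simp: same_def)
  define m n where "m = base V'" and "n = base W"
  have mn: "m \<in> D" "n \<in> D" using assms by (auto simp: m_def n_def)
  have c: "vx x \<in> carrier \<G>" using CG_vx assms by blast
  from base_consistency[OF mn c] show ?thesis
  proof
    assume "\<exists>q\<in>P m. \<exists>\<Delta>. \<Delta> \<subset> L n \<and> inv (bp n (vx x)) \<otimes> bp n q \<in> H \<Delta>"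
    then obtain q \<Delta> where q: "q \<in> P m" "\<Delta> \<subset> L n" "inv (bp n (vx x)) \<otimes> bp n q \<in> H \<Delta>" by blast
    have qc: "q \<in> carrier \<G>" using q P_carrier by blast
    have sub: "pg W q \<subseteq> RX V' W" using q ns by (auto simp: RX_not_same m_def)
    have b: "bp n (vx x) \<in> H (L n)" "bp n (vx x) \<in> carrier \<G>" "bp n q \<in> carrier \<G>"
      using c qc mn H_closed[OF bp_H] by auto
    have "set_dist (CX W) (PX W x) (RX V' W) \<le> KK"
      using assms(2)
    proof (cases rule: dom_cases)
      case (coset n')
      then have e: "n' = n" by (simp add: n_def)
      have "mdist (cspace (L n) :: ('p + real) metric) (cpt (L n) (bp n (vx x))) (cpt (L n) (bp n q)) \<le> 1"
        using mdist_cpt_cone[OF b(1) coneI[OF q(3,2)]] b by simp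
      then have "close (CX W) 1 (PX W x) (RX V' W)" using coset sub e by (auto simp: close_def PX_def pg_simps)
      then show ?thesis using close_set_dist KK E0 by fastforce
    next
      case (vertex n' i v)
      then have "\<Delta> = {}" using q(2) by (auto simp: n_def)
      then have "inv (bp n (vx x)) \<otimes> bp n q = \<one>" using q(3) H_empty by blast
      then have "bp n q = bp n (vx x)" using b by (metis cancel_left(2) r_one)
      then have "PX W x = pg W q" using pg_bp_eq[OF assms(2), of "vx x" q] by (simp add: PX_def n_def)
      then have "close (CX W) 0 (PX W x) (RX V' W)"
        using close_mono[OF close_refl[OF pg_ne pg_sub] order_refl sub] assms qc by simp
      then show ?thesis using close_set_dist KK E0 by fastforce
    qed
    then show ?thesis by simp
  next
    assume "\<exists>w\<in>P n. bp m w = bp m (vx x)"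
    then obtain w where w: "w \<in> P n" "bp m w = bp m (vx x)" by blast
    have wc: "w \<in> carrier \<G>" using w P_carrier by blast
    have e: "PX V' x = pg V' w" using pg_bp_eq[OF assms(1), of "vx x" w] w by (simp add: PX_def m_def)
    have sub: "pg V' w \<subseteq> RX W V'" using w ns by (auto simp: RX_not_same n_def)
    have "close (CX V') 0 (PX V' x) (RX W V')"
      using close_mono[OF close_refl[OF pg_ne pg_sub] order_refl sub] assms wc e by simp
    then have "set_dist (CX V') (PX V' x) (RX W V') \<le> KK" using close_set_dist KK E0 by fastforce
    then show ?thesis by simp
  qed
qed

text \<open>Outside a single copy: nested domains have product regions with a common point, whose
  projection belongs to both sets.\<close>

lemma rho_consistency_CX:
  assumes "U \<in> dom" "V' \<in> dom" "W \<in> dom" "NX U V'"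
    "X.strictly_nested V' W \<or> (X.transverse V' W \<and> \<not> OX W U)"
  shows "set_dist (CX W) (RX U W) (RX V' W) \<le> KK"
proof (cases "same U W")
  case True
  obtain n i i' v where e: "U = Inr (n, i)" "W = Inr (n, i')" "n \<in> D" "L n = {v}" "vtx n = v" "v \<in> V" "i \<in> SS v" "i' \<in> SS v"
    using same_cases[OF True assms(1,3)] .
  interpret Y: equivariant_hhs_structure "G v" "T v" E0 "SS v" "CC v" "pr v" "nst v" "ort v" "rh v" "ac v" "tv v"
    by (rule vertex_hhg[OF e(6)])
  have "same V' W"
  proof (cases V')
    case (Inl k)
    then have "NX W V'" using assms(4) e by simp
    then show ?thesis using assms(5) Inl e by (auto simp: X.strictly_nested_def X.transverse_def)
  next
    case (Inr b)
    then show ?thesis using NX_same[OF assms(4) Inr] e by (auto simp: same_def)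
  qed
  then obtain k where k: "V' = Inr (n, k)" "k \<in> SS v" using e assms(2) by (auto simp: same_def Inr_dom)
  have nk: "nst v i k" using assms(4) e k by simp
  have cond: "Y.strictly_nested k i' \<or> (Y.transverse k i' \<and> \<not> ort v i' i)"
    using assms(5) e k by (auto simp: X.strictly_nested_def X.transverse_def Y.strictly_nested_def Y.transverse_def OX_def)
  have "i \<noteq> i'" 
  proof
    assume "i = i'"
    then show False using cond nk Y.nest_antisym antisymp_onD[OF Y.nest_antisym k(2) e(8)]
      by (auto simp: Y.strictly_nested_def Y.transverse_def)
  qed
  have rk: "rh v k i' \<subseteq> mspace (CC v i')"
    using cond Y.rho_nest[OF k(2) e(8)] Y.rho_transverse[OF k(2) e(8)] by (auto simp: Y.strictly_nested_def Y.transverse_def)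
  have ri: "rh v i i' \<subseteq> mspace (CC v i')"
  proof (cases "nst v i i'")
    case True
    then show ?thesis using Y.rho_nest[OF e(7,8)] \<open>i \<noteq> i'\<close> by blast
  next
    case False
    then have t: "Y.transverse k i'" "\<not> ort v i' i"
      using cond transp_onD[OF Y.nest_trans e(7) k(2) e(8) nk] by (auto simp: Y.strictly_nested_def)
    have "\<not> nst v i' i" using transp_onD[OF Y.nest_trans e(8,7) k(2) _ nk] t(1) by (auto simp: Y.transverse_def)
    moreover have "\<not> ort v i i'" using t(2) symp_onD[OF Y.orth_sym e(7,8)] by blast
    ultimately show ?thesis using Y.rho_transverse[OF e(7,8)] False by blast
  qed
  have "set_dist (CX W) (RX U W) (RX V' W) = set_dist (CC v i') (rh v i i') (rh v k i')"
    using isometry_set_dist[OF isometry_Inl ri rk] e k by (simp add: RX_same)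
  then show ?thesis using Y.rho_consistency[OF e(7) k(2) e(8) nk cond] KK E0 by simp
next
  case ns: False
  have ns': "\<not> same V' W"
  proof
    assume s: "same V' W"
    then obtain b where "V' = Inr b" by (auto simp: same_def)
    then have "same U V'" using NX_same assms(4) by blast
    then show False using ns s by (auto simp: same_def)
  qed
  have "P (base U) \<inter> P (base V') \<noteq> {}" using NX_base[OF assms(1,2,4)] by (auto simp: bnest_def)
  then obtain g where g: "g \<in> P (base U)" "g \<in> P (base V')" by blast
  have gc: "g \<in> carrier \<G>" using g P_carrier by blast
  have "pg W g \<subseteq> RX U W" "pg W g \<subseteq> RX V' W" using g ns ns' by (auto simp: RX_not_same)
  then have "close (CX W) 0 (RX U W) (RX V' W)"
    using close_mono[OF close_refl[OF pg_ne[OF assms(3) gc] pg_sub[OF assms(3) gc]]] by blast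
  then show ?thesis using close_set_dist KK E0 by fastforce
qed

lemma vertex_adjust:
  assumes "v \<in> V" "i \<in> SS v" "y \<in> mspace (CV v)" "B \<subseteq> mspace (CC v i)" "B \<noteq> {}" "set_dist (CC v i) (pr v i y) B \<le> E0"
  shows "set_dist (CC v i) (pr v i (vpt (vx y))) B \<le> KK"
proof -
  interpret Y: equivariant_hhs_structure "G v" "T v" E0 "SS v" "CC v" "pr v" "nst v" "ort v" "rh v" "ac v" "tv v"
    by (rule vertex_hhg[OF assms(1)])
  note y = CV_vx'[OF assms(1,3)]
  have my: "vpt (vx y) \<in> mspace (CV v)" using CV_vpt assms(1) y by simp
  have "set_dist (CC v i) (pr v i y) (pr v i (vpt (vx y))) \<le> E0 * 1 + E0" by (rule vertex_close) (use assms y my in auto)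
  then have "close (CC v i) (E0 * 1 + E0 + 1) (pr v i y) (pr v i (vpt (vx y)))"
    by (rule set_dist_close) (use Y.proj_nonempty assms my in auto)
  then have 1: "close (CC v i) (E0 * 1 + E0 + 1) (pr v i (vpt (vx y))) (pr v i y)" by (rule close_sym)
  have 2: "close (CC v i) (E0 + 1) (pr v i y) B" using set_dist_close[OF assms(6)] Y.proj_nonempty assms by blast
  have "close (CC v i) (E0 * 1 + E0 + 1 + E0 + (E0 + 1)) (pr v i (vpt (vx y))) B"
    by (rule close_trans[OF 1 2 Y.proj_diam]) (use Y.proj_subset assms my in auto)
  then show ?thesis by (rule close_set_dist) (use KK E0 in simp)
qed

text \<open>The domains are grouped by their bases. The bases are pairwise orthogonal, so it is
  enough to choose one good coordinate for each base and to realise these by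
  \<open>base_realisation\<close>.\<close>

lemma partial_realisation_CX:
  assumes fin: "finite \<V>" and sub: "\<V> \<subseteq> dom" and pw: "pairwise OX \<V>" and p: "\<forall>V\<in>\<V>. p V \<in> mspace (CX V)"
  shows "\<exists>x\<in>mspace CG. (\<forall>V\<in>\<V>. set_dist (CX V) (PX V x) {p V} \<le> KK) \<and>
    (\<forall>V\<in>\<V>. \<forall>W\<in>dom. X.strictly_nested V W \<or> X.transverse W V \<longrightarrow> set_dist (CX W) (PX W x) (RX V W) \<le> KK)"
proof -
  define B where "B = base ` \<V>"
  \<comment> \<open>The coordinate \<open>a\<close> settles all requirements inside the copy over
    \<open>n\<close> and at the class \<open>n\<close> itself. For any other \<open>W\<close> a
    point of the region \<open>n\<close> already projects into the relative projection.\<close>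
  define good where "good n a \<longleftrightarrow> (\<forall>V'\<in>\<V>. \<forall>g\<in>P n. base V' = n \<longrightarrow> bp n g = a \<longrightarrow>
      set_dist (CX V') (pg V' g) {p V'} \<le> KK \<and>
      (\<forall>W\<in>dom. same V' W \<longrightarrow> X.strictly_nested V' W \<or> X.transverse W V' \<longrightarrow> set_dist (CX W) (pg W g) (RX V' W) \<le> KK))" for n a
  have ex: "\<exists>a\<in>H (L n). good n a" if n: "n \<in> B" for n
  proof (cases "Inl n \<in> \<V>")
    case True
    have nD: "n \<in> D" using True sub by auto
    \<comment> \<open>The copied domains over \<open>n\<close> are nested in the class
      \<open>n\<close>, hence not orthogonal to it.\<close>
    have only: "V' = Inl n" if V': "V' \<in> \<V>" "base V' = n" for V'
    proof (rule ccontr)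
      assume "V' \<noteq> Inl n"
      then have "OX V' (Inl n)" using pw True V' by (auto simp: pairwise_def)
      then have "borth n n" using V' by (auto simp: OX_def)
      then show False using borth_not_bnest[OF nD] bnest_refl[OF nD] by blast
    qed
    have "p (Inl n) \<in> mspace (cspace (L n))" using p True by fastforce
    then obtain a where a: "a \<in> H (L n)" "mdist (cspace (L n)) (p (Inl n)) (cpt (L n) a) \<le> 1" using cspace_near by metis
    have "good n a"
      unfolding good_def
    proof (intro ballI impI conjI)
      fix V' g W assume V': "V' \<in> \<V>" "base V' = n" and g: "bp n g = a"
      have e: "V' = Inl n" using only V' by blast
      have "mdist (cspace (L n)) (cpt (L n) a) (p (Inl n)) \<le> KK" using a(2) KK E0 by (simp add: mdist_commute)
      then show "set_dist (CX V') (pg V' g) {p V'} \<le> KK" using e g by (simp add: pg_simps)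
      assume "same V' W"
      then show "set_dist (CX W) (pg W g) (RX V' W) \<le> KK" using e by (simp add: same_def)
    qed
    then show ?thesis using a by blast
  next
    case False
    obtain V0 where V0: "V0 \<in> \<V>" "base V0 = n" using n by (auto simp: B_def)
    have "V0 \<in> dom" using V0 sub by blast
    then obtain i0 v where v: "V0 = Inr (n, i0)" "n \<in> D" "L n = {v}" "vtx n = v" "v \<in> V"
      using V0 False by (cases rule: dom_cases) auto
    interpret Y: equivariant_hhs_structure "G v" "T v" E0 "SS v" "CC v" "pr v" "nst v" "ort v" "rh v" "ac v" "tv v"
      by (rule vertex_hhg[OF v(5)])
    define I where "I = {i. Inr (n, i) \<in> \<V>}"
    have form: "\<exists>i\<in>I. V' = Inr (n, i)" if "V' \<in> \<V>" "base V' = n" for V'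
      using that False by (cases V') (auto simp: I_def)
    have "Inr ` Pair n ` I \<subseteq> \<V>" by (auto simp: I_def)
    then have "finite (Inr ` Pair n ` I :: (nat + nat \<times> 'i) set)" using fin finite_subset by blast
    then have "finite (Pair n ` I)" by (rule finite_imageD) simp
    then have finI: "finite I" by (rule finite_imageD) (auto intro: inj_onI)
    have subI: "I \<subseteq> SS v" using sub v by (auto simp: I_def Inr_dom)
    have "ort v i i'" if i: "i \<in> I" "i' \<in> I" "i \<noteq> i'" for i i'
    proof -
      have "OX (Inr (n, i)) (Inr (n, i'))" using pw i by (auto simp: pairwise_def I_def)
      moreover have "\<not> borth n n" using borth_not_bnest[OF v(2)] bnest_refl[OF v(2)] by blast
      ultimately show ?thesis using v by (auto simp: OX_def)
    qed
    then have pwI: "pairwise (ort v) I" by (auto simp: pairwise_def)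
    define p' where "p' i = projl (p (Inr (n, i)))" for i
    have p': "p' i \<in> mspace (CC v i) \<and> p (Inr (n, i)) = Inl (p' i)" if "i \<in> I" for i
    proof -
      have "p (Inr (n, i)) \<in> Inl ` mspace (CC v i)"
        using p that v isometry_onto_mspace[OF isometry_Inl, of v i] by (fastforce simp: I_def)
      then show ?thesis by (auto simp: p'_def)
    qed
    then obtain y where y: "y \<in> mspace (CV v)" "\<And>i. i \<in> I \<Longrightarrow> set_dist (CC v i) (pr v i y) {p' i} \<le> E0"
      "\<And>i j. i \<in> I \<Longrightarrow> j \<in> SS v \<Longrightarrow> Y.strictly_nested i j \<or> Y.transverse j i \<Longrightarrow> set_dist (CC v j) (pr v j y) (rh v i j) \<le> E0"
      using Y.partial_realisation[OF finI subI pwI, of p'] by blast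
    define a where "a = incl v (vx y)"
    have vy: "vx y \<in> carrier (G v)" "vpt (vx y) \<in> mspace (CV v)" using CV_vx'[OF v(5) y(1)] CV_vpt v by auto
    have aH: "a \<in> H (L n)" unfolding a_def v(3) by (rule letter_H) (use v vy in auto)
    have "set_dist (CX V') (pg V' g) {p V'} \<le> KK \<and>
      (\<forall>W\<in>dom. same V' W \<longrightarrow> X.strictly_nested V' W \<or> X.transverse W V' \<longrightarrow> set_dist (CX W) (pg W g) (RX V' W) \<le> KK)"
      if V': "V' \<in> \<V>" "base V' = n" and g: "g \<in> P n" "bp n g = a" for V' g
    proof -
      obtain i where i: "i \<in> I" "V' = Inr (n, i)" using form V' by blast
      have iS: "i \<in> SS v" using i subI by blast
      have gc: "g \<in> carrier \<G>" using g P_carrier by blast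
      have cc: "cc n g = vx y" using cc_bp[OF v(2,3) gc vy(1)] g(2) a_def by simp
      have "set_dist (CX V') (pg V' g) {p V'} = set_dist (CC v i) (pr v i (vpt (vx y))) {p' i}"
        using isometry_set_dist[OF isometry_Inl Y.proj_subset[OF iS vy(2)], of "{p' i}"] p'[OF i(1)] i v cc
        by (simp add: pg_simps)
      moreover have "set_dist (CC v i) (pr v i (vpt (vx y))) {p' i} \<le> KK"
        by (rule vertex_adjust[OF v(5) iS y(1)]) (use p'[OF i(1)] y(2)[OF i(1)] in auto)
      moreover have "set_dist (CX W) (pg W g) (RX V' W) \<le> KK"
        if W: "W \<in> dom" "same V' W" "X.strictly_nested V' W \<or> X.transverse W V'" for W
      proof -
        obtain j where j: "W = Inr (n, j)" "j \<in> SS v" using W i v by (auto simp: same_def Inr_dom)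
        have t: "Y.strictly_nested i j \<or> Y.transverse j i"
          using W(3) i j v by (auto simp: X.strictly_nested_def X.transverse_def Y.strictly_nested_def Y.transverse_def OX_def)
        have rj: "rh v i j \<noteq> {} \<and> rh v i j \<subseteq> mspace (CC v j)"
          using t Y.rho_nest[OF iS j(2)] Y.rho_transverse[OF iS j(2)] symp_onD[OF Y.orth_sym iS j(2)]
          by (auto simp: Y.strictly_nested_def Y.transverse_def)
        have "set_dist (CX W) (pg W g) (RX V' W) = set_dist (CC v j) (pr v j (vpt (vx y))) (rh v i j)"
          using isometry_set_dist[OF isometry_Inl Y.proj_subset[OF j(2) vy(2)], of "rh v i j"] rj i j v cc
          by (simp add: pg_simps RX_same)
        moreover have "set_dist (CC v j) (pr v j (vpt (vx y))) (rh v i j) \<le> KK"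
          by (rule vertex_adjust[OF v(5) j(2) y(1)]) (use rj y(3)[OF i(1) j(2) t] in auto)
        ultimately show ?thesis by simp
      qed
      ultimately show ?thesis by simp
    qed
    then have "good n a" unfolding good_def by blast
    then show ?thesis using aH by blast
  qed
  obtain a where a: "\<And>n. n \<in> B \<Longrightarrow> a n \<in> H (L n) \<and> good n (a n)" using ex by metis
  have "borth m n" if mn: "m \<in> B" "n \<in> B" "m \<noteq> n" for m n
  proof -
    obtain V1 V2 where "V1 \<in> \<V>" "V2 \<in> \<V>" "base V1 = m" "base V2 = n" using mn by (auto simp: B_def)
    moreover then have "OX V1 V2" using pw mn by (auto simp: pairwise_def)
    ultimately show ?thesis using mn by (auto simp: OX_def)
  qed
  moreover have "finite B" "B \<subseteq> D" using fin sub by (auto simp: B_def)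
  ultimately obtain g where g: "g \<in> carrier \<G>" "\<And>n. n \<in> B \<Longrightarrow> g \<in> P n \<and> bp n g = a n"
    using base_realisation[of B a] a by blast
  have gV: "g \<in> P (base V')" "bp (base V') g = a (base V')" "good (base V') (a (base V'))" if "V' \<in> \<V>" for V'
    using g(2)[of "base V'"] a[of "base V'"] that by (auto simp: B_def)
  have "set_dist (CX V') (PX V' (vpt g)) {p V'} \<le> KK" if "V' \<in> \<V>" for V'
    using gV[OF that] that unfolding good_def PX_vpt by blast
  moreover have "set_dist (CX W) (PX W (vpt g)) (RX V' W) \<le> KK"
    if V': "V' \<in> \<V>" "W \<in> dom" "X.strictly_nested V' W \<or> X.transverse W V'" for V' W
  proof (cases "same V' W")
    case True
    then show ?thesis using gV[OF V'(1)] V' unfolding good_def PX_vpt by blast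
  next
    case False
    have "pg W g \<subseteq> RX V' W" using gV(1)[OF V'(1)] False by (auto simp: RX_not_same)
    then have "close (CX W) 0 (pg W g) (RX V' W)"
      using close_mono[OF close_refl[OF pg_ne[OF V'(2) g(1)] pg_sub[OF V'(2) g(1)]] order_refl] by blast
    then show ?thesis using close_set_dist KK E0 unfolding PX_vpt by fastforce
  qed
  moreover have "vpt g \<in> mspace CG" using CG(2) g by blast
  ultimately show ?thesis by blast
qed

end

subsection \<open>Uniqueness\<close>

context graph_group
begin

definition small_words :: "'v set \<Rightarrow> ('v \<times> 'a) list set" where
  "small_words \<Lambda> = (\<Union>\<Delta>\<in>{\<Delta>. \<Delta> \<subset> \<Lambda>}. wd \<Delta>)"

text \<open>Formulated with blocks of words instead of group elements, so that letters absorbed by a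
  gate can be deleted without increasing the number of blocks.\<close>

definition small_products :: "'v set \<Rightarrow> nat \<Rightarrow> 'g set" where
  "small_products \<Lambda> n = {ev (concat ws) | ws. length ws = n \<and> set ws \<subseteq> small_words \<Lambda>}"

lemma small_words_V: "w \<in> small_words \<Lambda> \<Longrightarrow> w \<in> wd V"
  by (auto simp: small_words_def intro: wd_in_V)

lemma concat_small_V: "set ws \<subseteq> small_words \<Lambda> \<Longrightarrow> concat ws \<in> wd V"
  by (induction ws) (auto intro: small_words_V)

lemma rest_word_self: "w \<in> wd \<Delta> \<Longrightarrow> y \<in> H \<Delta> \<Longrightarrow> rest_word w \<Delta> y = []"
proof (induction w arbitrary: y)
  case (Cons s w)
  obtain v g where s: "s = (v, g)" by (cases s)
  have "near \<Delta> v y" unfolding near_def using Cons.prems(2) by (intro bexI[of _ y]) auto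
  moreover have "y \<otimes> incl v g \<in> H \<Delta>" using Cons.prems s letter_H by simp
  ultimately show ?case using Cons s by (simp add: letter_def)
qed simp

text \<open>Deleting letters from a block leaves its set of types small; blocks may become empty but
  are still counted.\<close>

lemma rest_word_concat:
  "set ws \<subseteq> small_words \<Lambda> \<Longrightarrow> x \<in> carrier \<G> \<Longrightarrow>
    \<exists>ws'. length ws' = length ws \<and> set ws' \<subseteq> small_words \<Lambda> \<and> rest_word (concat ws) \<Delta> x = concat ws'"
proof (induction ws arbitrary: x)
  case (Cons w ws)
  then obtain \<Delta>' where D: "\<Delta>' \<subset> \<Lambda>" "w \<in> wd \<Delta>'" by (auto simp: small_words_def)
  have "x \<otimes> ev w \<in> carrier \<G>" using Cons.prems D by simp
  then obtain ws' where ws': "length ws' = length ws" "set ws' \<subseteq> small_words \<Lambda>"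
    "rest_word (concat ws) \<Delta> (x \<otimes> ev w) = concat ws'" using Cons.IH[of "x \<otimes> ev w"] Cons.prems(1) by auto
  have "rest_word w \<Delta> x \<in> small_words \<Lambda>" using rest_word_wd[OF D(2)] D(1) by (auto simp: small_words_def)
  moreover have "rest_word (concat (w # ws)) \<Delta> x = concat (rest_word w \<Delta> x # ws')"
    using rest_word_append[OF D(2) concat_small_V[of ws \<Lambda>] Cons.prems(2)] Cons.prems ws' by simp
  ultimately show ?case using ws' by (intro exI[of _ "rest_word w \<Delta> x # ws'"]) auto
qed simp

end

context hhg_product
begin

lemma chain_small_products:
  assumes "\<not> card \<Lambda> \<le> 1" "(a, b) \<in> cone_edges \<Lambda> ^^ k" "a \<in> carrier \<G>"
  shows "inv a \<otimes> b \<in> small_products \<Lambda> k \<and> b \<in> carrier \<G>"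
  using assms(2)
proof (induction k arbitrary: b)
  case 0
  then show ?case using assms(3) by (simp add: small_products_def)
next
  case (Suc k)
  then obtain c where c: "(a, c) \<in> cone_edges \<Lambda> ^^ k" "(c, b) \<in> cone_edges \<Lambda>" by auto
  then have IH: "inv a \<otimes> c \<in> small_products \<Lambda> k" "c \<in> carrier \<G>" using Suc.IH by auto
  have b: "b \<in> carrier \<G>" using c(2) by (auto simp: cone_edges_def)
  obtain \<Delta> where D: "\<Delta> \<subset> \<Lambda>" "inv c \<otimes> b \<in> H \<Delta>" using c(2) assms(1) by (auto simp: cone_edges_def cone_def)
  obtain w where w: "w \<in> wd \<Delta>" "inv c \<otimes> b = ev w" using D(2) by (rule HE)
  obtain ws where ws: "length ws = k" "set ws \<subseteq> small_words \<Lambda>" "inv a \<otimes> c = ev (concat ws)"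
    using IH(1) by (auto simp: small_products_def)
  have "inv a \<otimes> b = (inv a \<otimes> c) \<otimes> (inv c \<otimes> b)" using assms(3) IH b by (simp add: m_assoc)
  also have "\<dots> = ev (concat (ws @ [w]))" using ev_append[OF concat_small_V[OF ws(2)] w(1)] w ws by simp
  finally show ?case using ws w D b unfolding small_products_def small_words_def
    by (intro conjI CollectI exI[of _ "ws @ [w]"]) auto
qed

text \<open>Passing to a point in between does not increase projection distances much: by 7 in a
  coned-off space (\<open>cbetween_mdist\<close>), and over a vertex group the coordinate is that of
  one of the ends. Using \<open>max s 0\<close> covers all values of \<open>s\<close>.\<close>

lemma pg_between:
  assumes "W \<in> dom" "x \<in> carrier \<G>" "p \<in> carrier \<G>" "y \<in> carrier \<G>" "between x p y"
    "set_dist (CX W) (pg W x) (pg W y) < s"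
  shows "set_dist (CX W) (pg W x) (pg W p) < max s 0 + 8 \<and> set_dist (CX W) (pg W p) (pg W y) < max s 0 + 8"
  using assms(1)
proof (cases rule: dom_cases)
  case (coset n)
  have rn: "r n \<in> carrier \<G>" using r_in coset by simp
  have sec: "sector g v (bp n z) = sector (r n \<otimes> g) v z" if "g \<in> H (L n)" "v \<in> L n" "z \<in> carrier \<G>" for g v z
  proof -
    have "sector g v (inv (r n) \<otimes> z) = sector (inv (inv (r n)) \<otimes> g) v z" by (rule sector_left) (use that rn in auto)
    then show ?thesis using sector_gate[OF that(1,2), of "inv (r n) \<otimes> z"] that(3) rn by (simp add: bp_def)
  qed
  have cb: "cbetween (L n) (bp n x) (bp n p) (bp n y)"
    unfolding cbetween_def
  proof (intro ballI)
    fix g v assume gv: "g \<in> H (L n)" "v \<in> L n"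
    have "v \<in> V" "r n \<otimes> g \<in> carrier \<G>" using gv L_V[OF coset(2)] rn by auto
    then show "sector g v (bp n p) \<in> {sector g v (bp n x), sector g v (bp n y)}"
      using assms(5) sec[OF gv] assms(2-4) unfolding between_def by simp
  qed
  then have cb': "cbetween (L n) (bp n y) (bp n p) (bp n x)" unfolding cbetween_def by blast
  have b: "bp n x \<in> H (L n)" "bp n p \<in> H (L n)" "bp n y \<in> H (L n)" using coset assms by auto
  have "s \<le> max s 0" by simp
  moreover have "mdist (cspace (L n)) (cpt (L n) (bp n x)) (cpt (L n) (bp n y)) < s"
    using assms(6) coset by (simp add: pg_simps)
  ultimately show ?thesis
    using cbetween_mdist[OF cb b] cbetween_mdist[OF cb' b(3,2,1)]
      mdist_commute[of "cspace (L n)" "cpt (L n) (bp n p)" "cpt (L n) (bp n y)"]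
      mdist_commute[of "cspace (L n)" "cpt (L n) (bp n x)" "cpt (L n) (bp n y)"]
    unfolding coset(1) CX_simps pg_simps set_dist_singletons by linarith
next
  case (vertex n i v)
  have rn: "r n \<in> carrier \<G>" using r_in vertex by simp
  have "sector (r n) v z = bp n z" for z using vertex by (simp add: sector_def bp_def)
  then have "bp n p = bp n x \<or> bp n p = bp n y" using assms(5) vertex rn unfolding between_def by fastforce
  then have "pg W p = pg W x \<or> pg W p = pg W y" using pg_bp_eq[OF assms(1), of p x] pg_bp_eq[OF assms(1), of p y] vertex by auto
  then show ?thesis
    using set_dist_self[OF pg_ne pg_sub, of W x] set_dist_self[OF pg_ne pg_sub, of W y] assms by fastforce
qed

lemma vertex_translate:
  assumes "v \<in> V" "x \<in> carrier \<G>" "a \<in> carrier (G v)" "(a, b) \<in> cayley_edges (G v) (T v) ^^ k"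
  shows "b \<in> carrier (G v) \<and> (x \<otimes> incl v a, x \<otimes> incl v b) \<in> cayley_edges \<G> TT ^^ k"
  using assms(4)
proof (induction k arbitrary: b)
  case 0 then show ?case using assms(3) by simp
next
  case (Suc k)
  interpret Gv: group "G v" by (rule grp[OF assms(1)])
  obtain c where c: "(a, c) \<in> cayley_edges (G v) (T v) ^^ k" "(c, b) \<in> cayley_edges (G v) (T v)" using Suc.prems by auto
  obtain s where s: "c \<in> carrier (G v)" "b = c \<otimes>\<^bsub>G v\<^esub> s" "s \<in> T v \<or> inv\<^bsub>G v\<^esub> s \<in> T v" "s \<in> carrier (G v)" "s \<noteq> \<one>\<^bsub>G v\<^esub>"
    using c(2) by (auto simp: cayley_edges_def)
  have "incl v s \<noteq> \<one>" using incl_inj[OF assms(1) s(4) Gv.one_closed] incl_one[OF assms(1)] s(5) by auto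
  moreover have "incl v s \<in> TT \<or> inv (incl v s) \<in> TT"
    using s(3,4) incl_inv[OF assms(1) s(4)] assms(1) unfolding TT_def by (metis UN_I imageI)
  moreover have "x \<otimes> incl v b = x \<otimes> incl v c \<otimes> incl v s" using s assms incl_mult by (simp add: m_assoc)
  ultimately have "(x \<otimes> incl v c, x \<otimes> incl v b) \<in> cayley_edges \<G> TT"
    unfolding cayley_edges_def using s assms by (intro CollectI exI[of _ "x \<otimes> incl v c"] exI[of _ "incl v s"]) simp
  then show ?case using Suc.IH[OF c(1)] s by auto
qed

definition near_all :: "real \<Rightarrow> 'g \<Rightarrow> 'g \<Rightarrow> bool" where
  "near_all s x y \<longleftrightarrow> (\<forall>W\<in>dom. set_dist (CX W) (pg W x) (pg W y) < s)"

text \<open>Uniqueness restricted to pairs of elements whose difference lies in \<open>S\<close>.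
  This form permits an induction over parabolic subgroups and over products of their
  elements.\<close>

definition controlled :: "'g set \<Rightarrow> bool" where
  "controlled S \<longleftrightarrow> (\<forall>s. \<exists>N\<ge>0. \<forall>x\<in>carrier \<G>. \<forall>y\<in>carrier \<G>. inv x \<otimes> y \<in> S \<longrightarrow> near_all s x y \<longrightarrow>
      mdist CG (vpt x) (vpt y) \<le> N)"

lemma controlled_one: "controlled {\<one>}"
  unfolding controlled_def
proof (intro allI exI[of _ 0] conjI ballI impI)
  fix s x y assume xy: "x \<in> carrier \<G>" "y \<in> carrier \<G>" "inv x \<otimes> y \<in> {\<one>}"
  then have "x = y" by (metis cancel_left(2) r_one singletonD)
  moreover have "vpt x \<in> mspace CG" using CG(2) xy by blast
  ultimately show "mdist CG (vpt x) (vpt y) \<le> 0" using mdist_self[of "vpt x" CG] by simp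
qed simp

text \<open>Inside one coset of \<open>H {v}\<close> the copied domains recover the hierarchy
  structure of \<open>G v\<close>, so uniqueness there bounds the distance of the coordinates; edges
  of the Cayley graph of \<open>G v\<close> translate to edges.\<close>

lemma controlled_vertex: assumes v: "v \<in> V" shows "controlled (H {v})"
  unfolding controlled_def
proof
  fix s :: real
  interpret Y: equivariant_hhs_structure "G v" "T v" E0 "SS v" "CC v" "pr v" "nst v" "ort v" "rh v" "ac v" "tv v"
    by (rule vertex_hhg[OF v])
  interpret Gv: group "G v" by (rule grp[OF v])
  define s' where "s' = max s 0"
  obtain \<theta> where \<theta>: "\<forall>r\<ge>0. 0 \<le> \<theta> r"
    "\<forall>r\<ge>0. \<forall>x\<in>mspace (CV v). \<forall>y\<in>mspace (CV v). \<theta> r \<le> mdist (CV v) x y \<longrightarrow> (\<exists>W\<in>SS v. r \<le> Y.proj_dist W x y)"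
    using Y.uniqueness by blast
  have "mdist CG (vpt x) (vpt y) \<le> \<theta> s'"
    if x: "x \<in> carrier \<G>" "y \<in> carrier \<G>" and xy: "inv x \<otimes> y \<in> H {v}" "near_all s x y" for x y
  proof -
    obtain n where n: "n \<in> D" "L n = {v}" "inv (r n) \<otimes> x \<in> H (st {v})" using index_ex[of "{v}" x] x v by blast
    have rn: "r n \<in> carrier \<G>" using r_in n by simp
    have vn: "vtx n = v" using n vtx by blast
    define a b where "a = cc n x" and "b = cc n y"
    have ab: "a \<in> carrier (G v)" "b \<in> carrier (G v)" using cc_closed n x by (auto simp: a_def b_def)
    have m: "vpt a \<in> mspace (CV v)" "vpt b \<in> mspace (CV v)" using ab CV_vpt v by auto
    have "Y.proj_dist i (vpt a) (vpt b) < s'" if i: "i \<in> SS v" for i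
    proof -
      have "Inr (n, i) \<in> dom" using n v i vn by (simp add: Inr_dom)
      then have "set_dist (CX (Inr (n, i))) (pg (Inr (n, i)) x) (pg (Inr (n, i)) y) < s" using xy by (auto simp: near_all_def)
      then show ?thesis
        using isometry_set_dist[OF isometry_Inl Y.proj_subset[OF i m(1)] Y.proj_subset[OF i m(2)]] vn
        by (simp add: pg_simps Y.proj_dist_def a_def b_def s'_def)
    qed
    moreover have "0 \<le> s'" by (simp add: s'_def)
    ultimately have d: "mdist (CV v) (vpt a) (vpt b) \<le> \<theta> s'" using \<theta>(2) m by (meson linorder_not_le less_imp_le)
    \<comment> \<open>The common left factor by which the coset of \<open>x\<close> and
      \<open>y\<close> is identified with the vertex group.\<close>
    define x0 where "x0 = x \<otimes> inv (incl v a)"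
    have x0: "x0 \<in> carrier \<G>" using x ab v by (simp add: x0_def)
    have ia: "incl v a = bp n x" "incl v b = bp n y" using incl_cc n x by (auto simp: a_def b_def)
    have iac: "bp n x \<in> carrier \<G>" "bp n y \<in> carrier \<G>" using H_closed[OF bp_H] n x by auto
    have "inv (r n) \<otimes> y = (inv (r n) \<otimes> x) \<otimes> (inv x \<otimes> y)" using rn x by (simp add: m_assoc)
    then have "bp n y = bp n x \<otimes> (inv x \<otimes> y)"
      using gate_left[OF n(3), of "inv x \<otimes> y"] gate_id[OF xy(1)] x n by (simp add: bp_def)
    then have e: "x = x0 \<otimes> incl v a" "y = x0 \<otimes> incl v b" using x iac by (simp_all add: x0_def ia m_assoc)
    define k where "k = vertex_dist (cayley_edges (G v) (T v)) a b"
    have "(a, b) \<in> cayley_edges (G v) (T v) ^^ k" "mdist (CV v) (vpt a) (vpt b) = real k"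
      using cayley_path[OF grp[OF v] T_sub[OF v] T_gen[OF v] ab] cayley_mdist[OF grp[OF v] T_sub[OF v] T_gen[OF v] ab]
      by (auto simp: k_def)
    moreover from this(1) have "(x, y) \<in> cayley_edges \<G> TT ^^ k" using vertex_translate[OF v x0 ab(1)] e by blast
    ultimately show ?thesis using CG(5)[OF x] d by fastforce
  qed
  moreover have "0 \<le> \<theta> s'" using \<theta>(1) by (simp add: s'_def)
  ultimately show "\<exists>N\<ge>0. \<forall>x\<in>carrier \<G>. \<forall>y\<in>carrier \<G>. inv x \<otimes> y \<in> H {v} \<longrightarrow> near_all s x y \<longrightarrow> mdist CG (vpt x) (vpt y) \<le> N"
    by blast
qed

text \<open>Split a product at a point \<open>p\<close> after the first block. The bound on
  projections weakens from \<open>s\<close> to \<open>max s 0 + 8\<close> for both halves, which is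
  harmless as the statement is for all \<open>s\<close>.\<close>

lemma controlled_products:
  assumes fin: "finite \<Lambda>" and IH: "\<And>\<Delta>. \<Delta> \<subset> \<Lambda> \<Longrightarrow> controlled (H \<Delta>)"
  shows "controlled (small_products \<Lambda> n)"
proof (induction n)
  case 0
  have "small_products \<Lambda> 0 = {\<one>}" by (auto simp: small_products_def)
  then show ?case by (simp add: controlled_one)
next
  case (Suc n)
  show ?case
    unfolding controlled_def
  proof
    fix s :: real
    define s' where "s' = max s 0 + 8"
    have "\<forall>\<Delta>. \<exists>N\<ge>0. \<Delta> \<subset> \<Lambda> \<longrightarrow> (\<forall>x\<in>carrier \<G>. \<forall>y\<in>carrier \<G>. inv x \<otimes> y \<in> H \<Delta> \<longrightarrow> near_all s' x y \<longrightarrow>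
      mdist CG (vpt x) (vpt y) \<le> N)"
      using IH unfolding controlled_def by (metis order_refl)
    then obtain N where N: "\<And>\<Delta>. 0 \<le> N \<Delta>"
      "\<And>\<Delta> x y. \<Delta> \<subset> \<Lambda> \<Longrightarrow> x \<in> carrier \<G> \<Longrightarrow> y \<in> carrier \<G> \<Longrightarrow> inv x \<otimes> y \<in> H \<Delta> \<Longrightarrow> near_all s' x y \<Longrightarrow>
        mdist CG (vpt x) (vpt y) \<le> (N \<Delta> :: real)"
      by metis
    obtain M where M: "0 \<le> M" "\<And>x y. x \<in> carrier \<G> \<Longrightarrow> y \<in> carrier \<G> \<Longrightarrow> inv x \<otimes> y \<in> small_products \<Lambda> n \<Longrightarrow> near_all s' x y \<Longrightarrow>
        mdist CG (vpt x) (vpt y) \<le> (M :: real)"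
      using Suc unfolding controlled_def by meson
    define B where "B = (\<Sum>\<Delta>\<in>{\<Delta>. \<Delta> \<subset> \<Lambda>}. N \<Delta>) + M"
    have finD: "finite {\<Delta>. \<Delta> \<subset> \<Lambda>}" by (rule finite_subset[of _ "Pow \<Lambda>"]) (use fin in auto)
    have "mdist CG (vpt x) (vpt y) \<le> B"
      if x: "x \<in> carrier \<G>" "y \<in> carrier \<G>" and xy: "inv x \<otimes> y \<in> small_products \<Lambda> (Suc n)" "near_all s x y" for x y
    proof -
      obtain w ws where ws: "length ws = n" "set ws \<subseteq> small_words \<Lambda>" "w \<in> small_words \<Lambda>" "inv x \<otimes> y = ev (w @ concat ws)"
        using xy(1) unfolding small_products_def by (auto simp: length_Suc_conv)
      obtain \<Delta> where D: "\<Delta> \<subset> \<Lambda>" "w \<in> wd \<Delta>" using ws(3) by (auto simp: small_words_def)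
      \<comment> \<open>The value of the first block need not lead to a point between
        \<open>x\<close> and \<open>y\<close>, but the gate does, by \<open>gate_between\<close>. It
        absorbs the whole first block (\<open>rest_word_self\<close>), and the remainder is spelled
        by \<open>n\<close> blocks.\<close>
      define g where "g = gate \<Delta> (inv x \<otimes> y)"
      define p where "p = x \<otimes> g"
      have g: "g \<in> H \<Delta>" "g \<in> carrier \<G>" using x by (simp_all add: g_def)
      have p: "p \<in> carrier \<G>" "inv x \<otimes> p = g" using x g by (simp_all add: p_def)
      have b: "between x p y" unfolding p_def g_def by (rule gate_between) fact+
      have cV: "concat ws \<in> wd V" by (rule concat_small_V[OF ws(2)])
      have "inv p \<otimes> y = inv g \<otimes> (inv x \<otimes> y)" using x g by (simp add: p_def group_simps)
      also have "\<dots> = ev (rest_word (w @ concat ws) \<Delta> \<one>)"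
        unfolding g_def ws(4) using rest_word_ev[of "w @ concat ws" \<Delta>] cV wd_in_V[OF D(2)] by simp
      also have "rest_word (w @ concat ws) \<Delta> \<one> = rest_word (concat ws) \<Delta> (ev w)"
        using rest_word_append[OF D(2) cV one_closed] rest_word_self[OF D(2) one_H] D(2) by simp
      finally have py: "inv p \<otimes> y = ev (rest_word (concat ws) \<Delta> (ev w))" .
      obtain ws' where "length ws' = length ws" "set ws' \<subseteq> small_words \<Lambda>" "rest_word (concat ws) \<Delta> (ev w) = concat ws'"
        using rest_word_concat[OF ws(2), of "ev w" \<Delta>] D(2) by auto
      then have py': "inv p \<otimes> y \<in> small_products \<Lambda> n" using py ws(1) by (auto simp: small_products_def)
      have na: "near_all s' x p" "near_all s' p y"
        using pg_between[OF _ x(1) p(1) x(2) b] xy(2) unfolding near_all_def s'_def by blast+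
      have "mdist CG (vpt x) (vpt p) \<le> N \<Delta>" using N(2)[OF D(1) x(1) p(1) _ na(1)] p g by simp
      moreover have "N \<Delta> \<le> (\<Sum>\<Delta>\<in>{\<Delta>. \<Delta> \<subset> \<Lambda>}. N \<Delta>)" using member_le_sum[of \<Delta> "{\<Delta>. \<Delta> \<subset> \<Lambda>}" N] D(1) N(1) finD by simp
      moreover have "mdist CG (vpt p) (vpt y) \<le> M" by (rule M(2)[OF p(1) x(2) py' na(2)])
      moreover have "mdist CG (vpt x) (vpt y) \<le> mdist CG (vpt x) (vpt p) + mdist CG (vpt p) (vpt y)"
        by (rule mdist_triangle) (use CG(2) x p in blast)+
      ultimately show ?thesis by (simp add: B_def)
    qed
    moreover have "0 \<le> B" unfolding B_def using N(1) M(1) by (intro add_nonneg_nonneg sum_nonneg) auto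
    ultimately show "\<exists>N\<ge>0. \<forall>x\<in>carrier \<G>. \<forall>y\<in>carrier \<G>. inv x \<otimes> y \<in> small_products \<Lambda> (Suc n) \<longrightarrow> near_all s x y \<longrightarrow>
      mdist CG (vpt x) (vpt y) \<le> N" by blast
  qed
qed

text \<open>A coned-off path of length \<open>k\<close> writes the difference as a product of
  \<open>k\<close> elements of smaller parabolic subgroups, and these products are controlled by the
  induction hypothesis. For at most one type this fails since everything is coned off; these cases
  are the trivial group and the vertex groups.\<close>

lemma controlled_H: assumes "\<Lambda> \<subseteq> V" shows "controlled (H \<Lambda>)"
proof -
  have "finite \<Lambda>" using finite_subset[OF assms finV] .
  then show ?thesis using assms
  proof (induction \<Lambda> rule: finite_psubset_induct)
    case (psubset \<Lambda>)
    show ?case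
    proof (cases "card \<Lambda> \<le> 1")
      case True
      then consider "\<Lambda> = {}" | v where "\<Lambda> = {v}"
        using psubset.hyps by (metis One_nat_def card_0_eq card_1_singletonE le_Suc_eq le_zero_eq)
      then show ?thesis
      proof cases
        case 1
        have "H \<Lambda> = {\<one>}" using 1 H_empty one_H by blast
        then show ?thesis using controlled_one by simp
      next
        case 2
        then show ?thesis using controlled_vertex psubset.prems by simp
      qed
    next
      case False
      have IH: "controlled (H \<Delta>)" if "\<Delta> \<subset> \<Lambda>" for \<Delta> using psubset that by blast
      note cp = controlled_products[OF psubset.hyps(1) IH]
      show ?thesis
        unfolding controlled_def
      proof
        fix s :: real
        have "\<forall>k. \<exists>N\<ge>0. \<forall>x\<in>carrier \<G>. \<forall>y\<in>carrier \<G>. inv x \<otimes> y \<in> small_products \<Lambda> k \<longrightarrow> near_all s x y \<longrightarrow>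
          mdist CG (vpt x) (vpt y) \<le> N" using cp unfolding controlled_def by blast
        then obtain N where N: "\<And>k. 0 \<le> (N k :: real)" "\<And>k x y. x \<in> carrier \<G> \<Longrightarrow> y \<in> carrier \<G> \<Longrightarrow>
          inv x \<otimes> y \<in> small_products \<Lambda> k \<Longrightarrow> near_all s x y \<Longrightarrow> mdist CG (vpt x) (vpt y) \<le> N k" by metis
        \<comment> \<open>The length \<open>k\<close> is an integer below \<open>s\<close>; summing
          the bounds over all such lengths gives one bound.\<close>
        define K where "K = nat \<lceil>s\<rceil>"
        have "mdist CG (vpt x) (vpt y) \<le> (\<Sum>k\<le>K. N k)"
          if x: "x \<in> carrier \<G>" "y \<in> carrier \<G>" and xy: "inv x \<otimes> y \<in> H \<Lambda>" "near_all s x y" for x y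
        proof -
          have "\<Lambda> \<noteq> {}" using False by auto
          then obtain n where n: "n \<in> D" "L n = \<Lambda>" "inv (r n) \<otimes> x \<in> H (st \<Lambda>)" using index_ex[of \<Lambda> x] psubset.prems x by blast
          have rn: "r n \<in> carrier \<G>" using r_in n by simp
          have b: "bp n x \<in> H \<Lambda>" "bp n y \<in> H \<Lambda>" "bp n x \<in> carrier \<G>" using n x H_closed[OF bp_H] bp_H by auto
          have "inv (r n) \<otimes> y = (inv (r n) \<otimes> x) \<otimes> (inv x \<otimes> y)" using rn x by (simp add: m_assoc)
          then have "bp n y = bp n x \<otimes> (inv x \<otimes> y)"
            using gate_left[OF n(3), of "inv x \<otimes> y"] gate_id[OF xy(1)] x n by (simp add: bp_def)
          then have e: "inv (bp n x) \<otimes> bp n y = inv x \<otimes> y" using b x by simp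
          obtain k where k: "mdist (cspace \<Lambda> :: ('p + real) metric) (cpt \<Lambda> (bp n x)) (cpt \<Lambda> (bp n y)) = real k"
            "(bp n x, bp n y) \<in> cone_edges \<Lambda> ^^ k" using cpt_chain[OF b(1,2)] .
          have "inv x \<otimes> y \<in> small_products \<Lambda> k" using chain_small_products[OF False k(2) b(3)] e by simp
          then have d: "mdist CG (vpt x) (vpt y) \<le> N k" using N(2) x xy by blast
          have "real k < s" using xy(2) n k(1) by (auto simp: near_all_def pg_simps dest!: bspec[of _ _ "Inl n"])
          then have "k \<le> K" unfolding K_def by linarith
          then have "N k \<le> (\<Sum>k\<le>K. N k)" using member_le_sum[of k "{..K}" N] N(1) by simp
          then show ?thesis using d by simp
        qed
        moreover have "0 \<le> (\<Sum>k\<le>K. N k)" using N(1) by (intro sum_nonneg) auto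
        ultimately show "\<exists>N\<ge>0. \<forall>x\<in>carrier \<G>. \<forall>y\<in>carrier \<G>. inv x \<otimes> y \<in> H \<Lambda> \<longrightarrow> near_all s x y \<longrightarrow> mdist CG (vpt x) (vpt y) \<le> N"
          by blast
      qed
    qed
  qed
qed

lemma uniqueness_CX:
  "\<exists>\<theta> :: real \<Rightarrow> real. (\<forall>s\<ge>0. 0 \<le> \<theta> s) \<and>
    (\<forall>s\<ge>0. \<forall>x\<in>mspace CG. \<forall>y\<in>mspace CG. \<theta> s \<le> mdist CG x y \<longrightarrow> (\<exists>W\<in>dom. s \<le> X.proj_dist W x y))"
proof -
  have "\<forall>s. \<exists>N\<ge>0. \<forall>x\<in>carrier \<G>. \<forall>y\<in>carrier \<G>. inv x \<otimes> y \<in> H V \<longrightarrow> near_all s x y \<longrightarrow> mdist CG (vpt x) (vpt y) \<le> N"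
    using controlled_H[of V] unfolding controlled_def by blast
  then obtain N where N: "\<And>s. 0 \<le> (N s :: real)" "\<And>s x y. x \<in> carrier \<G> \<Longrightarrow> y \<in> carrier \<G> \<Longrightarrow> near_all s x y \<Longrightarrow>
    mdist CG (vpt x) (vpt y) \<le> N s" by (metis H_V inv_closed m_closed)
  have "\<exists>W\<in>dom. s \<le> X.proj_dist W x y" if x: "x \<in> mspace CG" "y \<in> mspace CG" "N s + 3 \<le> mdist CG x y" for s x y
  proof (rule ccontr)
    assume "\<not> (\<exists>W\<in>dom. s \<le> X.proj_dist W x y)"
    then have "near_all s (vx x) (vx y)" by (auto simp: near_all_def proj_dist_PX PX_def not_le)
    note vx = CG_vx[OF x(1)] CG_vx[OF x(2)]
    have d: "mdist CG (vpt (vx x)) (vpt (vx y)) \<le> N s" by (rule N(2)) fact+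
    have m: "vpt (vx x) \<in> mspace CG" "vpt (vx y) \<in> mspace CG" using vx CG(2) by auto
    have "mdist CG (vpt (vx y)) y \<le> 1" using vx by (simp add: mdist_commute)
    from mdist_triangle'[OF x(1) m(1) x(2) vx(2) mdist_triangle'[OF m x(2) d this]]
    show False using x(3) by simp
  qed
  moreover have "0 \<le> N s + 3" for s using N(1)[of s] by simp
  ultimately show ?thesis by (intro exI[of _ "\<lambda>s. N s + 3"]) blast
qed

sublocale X: hhs_structure CG KK dom CX PX NX OX RX
proof
  show "\<exists>\<theta> :: real \<Rightarrow> real. (\<forall>r\<ge>0. 0 \<le> \<theta> r) \<and>
    (\<forall>r\<ge>0. \<forall>x\<in>mspace CG. \<forall>y\<in>mspace CG. \<theta> r \<le> mdist CG x y \<longrightarrow> (\<exists>W\<in>dom. r \<le> X.proj_dist W x y))"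
    by (rule uniqueness_CX)
next
  fix W U assume W: "W \<in> dom" and "U \<in> X.below W"
  \<comment> \<open>The container may be \<open>W\<close> itself.\<close>
  have "W \<in> X.below W" using W NX_refl by (simp add: X.below_def)
  then show "\<exists>Q\<in>X.below W. \<forall>V\<in>X.below W \<inter> X.orthogonal_to U. NX V Q" by (auto simp: X.below_def)
qed (fact hyperbolic_CX finite_complexity_CX bounded_geodesic_image_CX large_links_CX consistency_CX
  rho_consistency_CX partial_realisation_CX)+

end

section \<open>The action on the hierarchy structure\<close>

context hhg_product
begin

definition ck :: "'g \<Rightarrow> nat \<Rightarrow> 'a" where
  "ck g n = coord (vtx n) (kk g n)"

definition act0 :: "'g \<Rightarrow> nat + nat \<times> 'i \<Rightarrow> nat + nat \<times> 'i" where
  "act0 g j = (case j of Inl n \<Rightarrow> Inl (mv g n) | Inr (n, i) \<Rightarrow> Inr (mv g n, ac (vtx n) (ck g n) i))"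

text \<open>The elements of \<open>BijGroup\<close> are extensional functions, hence the
  restriction.\<close>

definition actX :: "'g \<Rightarrow> nat + nat \<times> 'i \<Rightarrow> nat + nat \<times> 'i" where
  "actX g = restrict (act0 g) dom"

text \<open>The error \<open>kk g n\<close> has a component in \<open>H (L n)\<close> and one in the
  link; only the first acts on the coordinate, by \<open>bp_mv\<close>, and the gate extracts
  it.\<close>

definition trX :: "'g \<Rightarrow> nat + nat \<times> 'i \<Rightarrow> 'p + real \<Rightarrow> 'p + real" where
  "trX g j = (case j of Inl n \<Rightarrow> cact (L n) (gate (L n) (kk g n))
    | Inr (n, i) \<Rightarrow> Inl \<circ> tv (vtx n) (ck g n) i \<circ> projl)"

lemma act0_simps [simp]: "act0 g (Inl n) = Inl (mv g n)" "act0 g (Inr (n, i)) = Inr (mv g n, ac (vtx n) (ck g n) i)"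
  by (simp_all add: act0_def)

lemma actX_act0 [simp]: "j \<in> dom \<Longrightarrow> actX g j = act0 g j" by (simp add: actX_def)

lemma trX_simps: "trX g (Inl n) = cact (L n) (gate (L n) (kk g n))"
  "trX g (Inr (n, i)) = Inl \<circ> tv (vtx n) (ck g n) i \<circ> projl"
  by (simp_all add: trX_def)

lemma vtx_mv: "g \<in> carrier \<G> \<Longrightarrow> n \<in> D \<Longrightarrow> vtx (mv g n) = vtx n"
  by (simp add: vtx_def L_mv)

lemma ck_closed: "g \<in> carrier \<G> \<Longrightarrow> n \<in> D \<Longrightarrow> L n = {v} \<Longrightarrow> ck g n \<in> carrier (G v)"
  using coord_closed[of v "kk g n"] kk_carrier L_V[of n] by (simp add: ck_def vtx)

lemma ck_mult:
  assumes "g \<in> carrier \<G>" "h \<in> carrier \<G>" "n \<in> D" "L n = {v}"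
  shows "ck (g \<otimes> h) n = ck g (mv h n) \<otimes>\<^bsub>G v\<^esub> ck h n"
proof -
  have v: "v \<in> V" "vtx n = v" "vtx (mv h n) = v" using L_V[OF assms(3)] assms vtx vtx_mv by auto
  have k: "kk g (mv h n) \<in> H (st {v})" "kk h n \<in> carrier \<G>"
    using kk_H[OF assms(1) mv_D[OF assms(2,3)]] L_mv[OF assms(2,3)] kk_carrier assms by auto
  show ?thesis unfolding ck_def kk_mult_arg(2)[OF assms(1-3)] v using coord_left[OF v(1) k] by simp
qed

lemma kk_one: "n \<in> D \<Longrightarrow> kk \<one> n = \<one>"
  by (simp add: kk_def mv_one r_in)

lemma ck_one: assumes "n \<in> D" "L n = {v}" shows "ck \<one> n = \<one>\<^bsub>G v\<^esub>"
proof -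
  have v: "v \<in> V" "vtx n = v" using L_V[OF assms(1)] assms vtx by auto
  have "\<one>\<^bsub>G v\<^esub> \<in> carrier (G v)" using grp[OF v(1)] by (simp add: group.is_monoid monoid.one_closed)
  then show ?thesis using coord_incl[OF v(1), of "\<one>\<^bsub>G v\<^esub>"] incl_one[OF v(1)] by (simp add: ck_def v kk_one assms)
qed

lemma act0_dom: assumes "g \<in> carrier \<G>" "j \<in> dom" shows "act0 g j \<in> dom" "base (act0 g j) = mv g (base j)"
proof -
  have "act0 g j \<in> dom \<and> base (act0 g j) = mv g (base j)"
    using assms(2)
  proof (cases rule: dom_cases)
    case (coset n) then show ?thesis using mv_D assms by simp
  next
    case (vertex n i v)
    interpret Y: equivariant_hhs_structure "G v" "T v" E0 "SS v" "CC v" "pr v" "nst v" "ort v" "rh v" "ac v" "tv v"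
      by (rule vertex_hhg[OF vertex(5)])
    have "ac v (ck g n) i \<in> SS v" using Y.element_image[OF ck_closed vertex(6) refl] assms vertex by blast
    then show ?thesis using vertex mv_D L_mv vtx_mv assms by (simp add: Inr_dom)
  qed
  then show "act0 g j \<in> dom" "base (act0 g j) = mv g (base j)" by auto
qed

lemma act0_mult:
  assumes "g \<in> carrier \<G>" "h \<in> carrier \<G>" "j \<in> dom" shows "act0 (g \<otimes> h) j = act0 g (act0 h j)"
  using assms(3)
proof (cases rule: dom_cases)
  case (coset n) then show ?thesis using kk_mult_arg(1) assms by simp
next
  case (vertex n i v)
  interpret Y: equivariant_hhs_structure "G v" "T v" E0 "SS v" "CC v" "pr v" "nst v" "ort v" "rh v" "ac v" "tv v"
    by (rule vertex_hhg[OF vertex(5)])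
  have "ck g (mv h n) \<in> carrier (G v)" using ck_closed[OF assms(1) mv_D] L_mv vertex assms by simp
  then show ?thesis
    using Y.composition_rule[OF vertex(6) _ ck_closed[OF assms(2) vertex(2,3)]] vertex assms
    by (simp add: ck_mult[OF assms(1,2) vertex(2,3)] kk_mult_arg vtx_mv)
qed

lemma act0_one: assumes "j \<in> dom" shows "act0 \<one> j = j"
  using assms
proof (cases rule: dom_cases)
  case (coset n) then show ?thesis by (simp add: mv_one)
next
  case (vertex n i v)
  interpret Y: equivariant_hhs_structure "G v" "T v" E0 "SS v" "CC v" "pr v" "nst v" "ort v" "rh v" "ac v" "tv v"
    by (rule vertex_hhg[OF vertex(5)])
  have "ac v \<one>\<^bsub>G v\<^esub> i = (\<lambda>x\<in>SS v. x) i" using Y.id_eq_one by simp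
  then show ?thesis using vertex by (simp add: mv_one ck_one)
qed

lemma actX_Bij: assumes "g \<in> carrier \<G>" shows "actX g \<in> carrier (BijGroup dom)"
proof -
  have "bij_betw (act0 g) dom dom"
    by (rule bij_betw_byWitness[where f' = "act0 (inv g)"])
      (use assms act0_mult[of "inv g" g] act0_mult[of g "inv g"] act0_one act0_dom in auto)
  then have "bij_betw (actX g) dom dom" by (rule bij_betw_cong[THEN iffD1, rotated]) simp
  then show ?thesis by (simp add: BijGroup_def Bij_def actX_def)
qed

lemma group_action_actX: "group_action \<G> dom actX"
proof -
  have "actX (g \<otimes> h) = actX g \<otimes>\<^bsub>BijGroup dom\<^esub> actX h" if gh: "g \<in> carrier \<G>" "h \<in> carrier \<G>" for g h
  proof -
    have B: "actX g \<in> Bij dom" "actX h \<in> Bij dom" using actX_Bij gh by (auto simp: BijGroup_def)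
    have "actX (g \<otimes> h) = compose dom (actX g) (actX h)"
      using gh act0_mult act0_dom by (auto simp: fun_eq_iff compose_def actX_def)
    then show ?thesis using B by (simp add: BijGroup_def)
  qed
  then have "actX \<in> hom \<G> (BijGroup dom)" using actX_Bij by (intro homI) auto
  then show ?thesis
    unfolding group_action_def by (intro group_hom.intro group_hom_axioms.intro is_group group_BijGroup)
qed

lemma same_act: assumes "g \<in> carrier \<G>" "j \<in> dom" "k \<in> dom" shows "same (act0 g j) (act0 g k) \<longleftrightarrow> same j k"
proof -
  have "same a b \<longleftrightarrow> (\<exists>x y. a = Inr x \<and> b = Inr y) \<and> base a = base b" for a b :: "nat + nat \<times> 'i"
    by (auto simp: same_def)
  moreover have "(\<exists>x. act0 g j = Inr x) \<longleftrightarrow> (\<exists>x. j = Inr x)" for j :: "nat + nat \<times> 'i"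
    by (cases j) auto
  moreover have "mv g (base j) = mv g (base k) \<longleftrightarrow> base j = base k"
    using mv_inj[OF assms(1) base_dom[OF assms(2)] base_dom[OF assms(3)]] by auto
  ultimately show ?thesis using act0_dom(2)[OF assms(1,2)] act0_dom(2)[OF assms(1,3)]
    by (cases j; cases k) (auto simp: same_def)
qed

lemma act_NX: assumes "g \<in> carrier \<G>" "j \<in> dom" "k \<in> dom" shows "NX (act0 g j) (act0 g k) \<longleftrightarrow> NX j k"
proof (cases k)
  case (Inl n)
  then show ?thesis using bnest_mv[OF assms(1), of n "base j"] act0_dom[OF assms(1,2)] assms by simp
next
  case (Inr b)
  show ?thesis
  proof (cases "same j k")
    case False
    have "\<not> NX j k" using NX_same False Inr by blast
    moreover have "\<not> NX (act0 g j) (act0 g k)"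
      using NX_same[of "act0 g j" "act0 g k"] same_act[OF assms] False Inr by (cases b) auto
    ultimately show ?thesis by simp
  next
    case True
    obtain n i i' v where e: "j = Inr (n, i)" "k = Inr (n, i')" "n \<in> D" "L n = {v}" "vtx n = v" "v \<in> V" "i \<in> SS v" "i' \<in> SS v"
      using same_cases[OF True assms(2,3)] .
    interpret Y: equivariant_hhs_structure "G v" "T v" E0 "SS v" "CC v" "pr v" "nst v" "ort v" "rh v" "ac v" "tv v"
      by (rule vertex_hhg[OF e(6)])
    show ?thesis using Y.act_nest[OF ck_closed[OF assms(1) e(3,4)] e(7,8)] e vtx_mv[OF assms(1) e(3)] by simp
  qed
qed

lemma act_OX: assumes "g \<in> carrier \<G>" "j \<in> dom" "k \<in> dom" shows "OX (act0 g j) (act0 g k) \<longleftrightarrow> OX j k"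
proof (cases "same j k")
  case True
  obtain n i i' v where e: "j = Inr (n, i)" "k = Inr (n, i')" "n \<in> D" "L n = {v}" "vtx n = v" "v \<in> V" "i \<in> SS v" "i' \<in> SS v"
    using same_cases[OF True assms(2,3)] .
  interpret Y: equivariant_hhs_structure "G v" "T v" E0 "SS v" "CC v" "pr v" "nst v" "ort v" "rh v" "ac v" "tv v"
    by (rule vertex_hhg[OF e(6)])
  show ?thesis
    using Y.act_orth[OF ck_closed[OF assms(1) e(3,4)] e(7,8)] e vtx_mv[OF assms(1) e(3)] borth_mv[OF assms(1) e(3,3)]
    by (simp add: OX_def)
next
  case False
  have "OX j k \<longleftrightarrow> borth (base j) (base k)" using False by (auto simp: OX_def same_def)
  moreover have "OX (act0 g j) (act0 g k) \<longleftrightarrow> borth (base (act0 g j)) (base (act0 g k))"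
    using False same_act[OF assms] by (auto simp: OX_def same_def)
  ultimately show ?thesis using borth_mv act0_dom assms by simp
qed

lemma isometry_projl: "isometry_onto (map_metric Inl m :: ('p + real) metric) m projl"
proof -
  have i: "isometry_onto m (map_metric Inl m :: ('p + real) metric) Inl" by (rule isometry_map_metric) simp
  have "bij_betw projl (mspace (map_metric Inl m :: ('p + real) metric)) (mspace m)"
    unfolding isometry_onto_mspace[OF i, symmetric] by (rule bij_betw_byWitness[where f' = Inl]) auto
  then show ?thesis unfolding isometry_onto_def isometry_onto_mspace[OF i, symmetric]
    using isometry_onto_mdist[OF i] by auto
qed

lemma gate_kk: "g \<in> carrier \<G> \<Longrightarrow> n \<in> D \<Longrightarrow> gate (L n) (kk g n) \<in> H (L n)"
  using kk_carrier by simp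

lemma isometry_trX:
  assumes "g \<in> carrier \<G>" "j \<in> dom" shows "isometry_onto (CX j) (CX (act0 g j)) (trX g j)"
  using assms(2)
proof (cases rule: dom_cases)
  case (coset n)
  then show ?thesis using isometry_cact[OF gate_kk[OF assms(1)]] L_mv assms by (simp add: trX_simps)
next
  case (vertex n i v)
  interpret Y: equivariant_hhs_structure "G v" "T v" E0 "SS v" "CC v" "pr v" "nst v" "ort v" "rh v" "ac v" "tv v"
    by (rule vertex_hhg[OF vertex(5)])
  have "isometry_onto (CC v i) (CC v (ac v (ck g n) i)) (tv v (ck g n) i)"
    using Y.tr_isometry[OF ck_closed[OF assms(1) vertex(2,3)] vertex(6)] .
  from isometry_onto_comp[OF isometry_projl isometry_onto_comp[OF this isometry_Inl]] show ?thesis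
    using vertex vtx_mv[OF assms(1) vertex(2)] by (simp add: trX_simps comp_assoc)
qed

lemma trX_mult:
  assumes "g \<in> carrier \<G>" "h \<in> carrier \<G>" "j \<in> dom" "c \<in> mspace (CX j)"
  shows "trX (g \<otimes> h) j c = trX g (act0 h j) (trX h j c)"
  using assms(3)
proof (cases rule: dom_cases)
  case (coset n)
  have m: "mv h n \<in> D" "L (mv h n) = L n" using mv assms coset by auto
  have "gate (L n) (kk (g \<otimes> h) n) = gate (L n) (kk g (mv h n)) \<otimes> gate (L n) (kk h n)"
    using gate_left[of "kk g (mv h n)" "L n" "kk h n"] kk_H[OF assms(1) m(1)] kk_carrier m assms coset
    by (simp add: kk_mult_arg)
  then show ?thesis
    using cact_mult[of "gate (L n) (kk g (mv h n))" "L n" "gate (L n) (kk h n)" c] gate_kk[OF assms(1) m(1)]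
      gate_kk[OF assms(2)] assms m coset
    by (simp add: trX_simps)
next
  case (vertex n i v)
  interpret Y: equivariant_hhs_structure "G v" "T v" E0 "SS v" "CC v" "pr v" "nst v" "ort v" "rh v" "ac v" "tv v"
    by (rule vertex_hhg[OF vertex(5)])
  obtain c' where c: "c = Inl c'" "c' \<in> mspace (CC v i)"
    using assms(4) vertex isometry_onto_mspace[OF isometry_Inl, of v i] by auto
  have k: "ck g (mv h n) \<in> carrier (G v)" using ck_closed[OF assms(1) mv_D] L_mv vertex assms by simp
  show ?thesis
    using Y.tr_mult[OF k ck_closed[OF assms(2) vertex(2,3)] vertex(6) c(2)] vertex c vtx_mv[OF assms(2) vertex(2)]
    by (simp add: trX_simps ck_mult[OF assms(1,2) vertex(2,3)])
qed

lemma cc_mv: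
  assumes "g \<in> carrier \<G>" "n \<in> D" "L n = {v}" "a \<in> carrier \<G>"
  shows "cc (mv g n) (g \<otimes> a) = ck g n \<otimes>\<^bsub>G v\<^esub> cc n a"
proof -
  have v: "v \<in> V" "vtx n = v" "vtx (mv g n) = v" using L_V[OF assms(2)] assms vtx vtx_mv by auto
  have k: "kk g n \<in> H (st {v})" using kk_H[OF assms(1,2)] assms(3) by simp
  show ?thesis using coord_left[OF v(1) k, of "inv (r n) \<otimes> a"] kk_eq[OF assms(1,2,4)] r_in[OF assms(2)] assms(4) v
    by (simp add: cc_def ck_def)
qed

lemma cayley_act_vpt:
  assumes "group K" "k \<in> carrier K" "c \<in> carrier K" shows "cayley_act K k (vpt c) = vpt (k \<otimes>\<^bsub>K\<^esub> c)"
proof -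
  interpret K: group K by fact
  have "inv\<^bsub>K\<^esub> k \<otimes>\<^bsub>K\<^esub> h = c \<longleftrightarrow> h = k \<otimes>\<^bsub>K\<^esub> c" if "h \<in> carrier K" for h
    using assms that K.inv_solve_left' by (metis K.inv_closed K.inv_inv K.m_assoc K.l_inv K.l_one K.r_inv)
  then show ?thesis using assms by (auto simp: cayley_act_def fun_eq_iff)
qed

text \<open>For group elements the maps commute exactly on coset domains; the error
  \<open>E0\<close> stems from the vertex groups.\<close>

lemma trX_pg:
  assumes "g \<in> carrier \<G>" "j \<in> dom" "a \<in> carrier \<G>"
  shows "set_dist (CX (act0 g j)) (trX g j ` pg j a) (pg (act0 g j) (g \<otimes> a)) \<le> E0"
  using assms(2)
proof (cases rule: dom_cases)
  case (coset n)
  have b: "bp n a \<in> H (L n)" using coset assms by simp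
  have "trX g j ` pg j a = pg (act0 g j) (g \<otimes> a)"
    using coset cact_cpt[OF gate_kk[OF assms(1)] b] bp_mv[OF assms(1) _ assms(3)] L_mv assms
    by (simp add: pg_simps trX_simps)
  moreover have "pg (act0 g j) (g \<otimes> a) \<noteq> {} \<and> pg (act0 g j) (g \<otimes> a) \<subseteq> mspace (CX (act0 g j))"
    using pg_ne pg_sub act0_dom assms by simp
  ultimately show ?thesis using set_dist_self[of "pg (act0 g j) (g \<otimes> a)" "CX (act0 g j)"] E0 by simp
next
  case (vertex n i v)
  interpret Y: equivariant_hhs_structure "G v" "T v" E0 "SS v" "CC v" "pr v" "nst v" "ort v" "rh v" "ac v" "tv v"
    by (rule vertex_hhg[OF vertex(5)])
  interpret Gv: group "G v" by (rule grp[OF vertex(5)])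
  define k c i' where "k = ck g n" and "c = cc n a" and "i' = ac v k i"
  have k: "k \<in> carrier (G v)" "c \<in> carrier (G v)" using ck_closed cc_closed vertex assms by (auto simp: k_def c_def)
  have m: "vpt c \<in> mspace (CV v)" "vpt (k \<otimes>\<^bsub>G v\<^esub> c) \<in> mspace (CV v)" using CV_vpt vertex k by auto
  have i': "i' \<in> SS v" using Y.element_image[OF k(1) vertex(6) refl] by (simp add: i'_def)
  have "set_dist (CC v i') (tv v k i ` pr v i (vpt c)) (pr v i' (vpt (k \<otimes>\<^bsub>G v\<^esub> c))) \<le> E0"
    using Y.tr_proj[OF k(1) vertex(6) m(1)] cayley_act_vpt[OF grp[OF vertex(5)] k] by (simp add: i'_def)
  moreover have "tv v k i ` pr v i (vpt c) \<subseteq> mspace (CC v i')"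
    using isometry_onto_in[OF Y.tr_isometry[OF k(1) vertex(6)]] Y.proj_subset[OF vertex(6) m(1)] by (auto simp: i'_def)
  ultimately have "set_dist (map_metric Inl (CC v i') :: ('p + real) metric) (Inl ` tv v k i ` pr v i (vpt c))
      (Inl ` pr v i' (vpt (k \<otimes>\<^bsub>G v\<^esub> c))) \<le> E0"
    using isometry_set_dist[OF isometry_Inl _ Y.proj_subset[OF i' m(2)]] by simp
  moreover have "trX g j ` pg j a = Inl ` tv v k i ` pr v i (vpt c)"
    using vertex by (simp add: pg_simps trX_simps k_def c_def image_image)
  moreover have "pg (act0 g j) (g \<otimes> a) = Inl ` pr v i' (vpt (k \<otimes>\<^bsub>G v\<^esub> c))"
    using vertex vtx_mv[OF assms(1) vertex(2)] cc_mv[OF assms(1) vertex(2,3) assms(3)]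
    by (simp add: pg_simps k_def c_def i'_def)
  ultimately show ?thesis using vertex vtx_mv[OF assms(1) vertex(2)] by (simp add: i'_def k_def)
qed

text \<open>The chosen vertex of the translated point need not be the translate of the chosen
  vertex, but pulled back it is again a vertex in the support of \<open>x\<close>, at distance at
  most 2 from the chosen one.\<close>

lemma trX_proj:
  assumes "g \<in> carrier \<G>" "j \<in> dom" "x \<in> mspace CG"
  shows "set_dist (CX (act0 g j)) (trX g j ` PX j x) (PX (act0 g j) (cayley_act \<G> g x)) \<le> KK"
proof -
  note vx = CG_vx[OF assms(3)]
  define b where "b = vx (cayley_act \<G> g x)"
  have "cayley_act \<G> g x (g \<otimes> vx x) \<noteq> 0" using CG(7)[OF assms(3)] vx assms(1) by (simp add: cayley_act_def)
  then have "cayley_act \<G> g x b \<noteq> 0" unfolding b_def vx_def by (rule someI)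
  then have b: "b \<in> carrier \<G>" "x (inv g \<otimes> b) \<noteq> 0" by (auto simp: cayley_act_def split: if_splits)
  define a where "a = inv g \<otimes> b"
  have a: "a \<in> carrier \<G>" "mdist CG x (vpt a) \<le> 1" "b = g \<otimes> a"
    using CG(6)[OF assms(3) b(2)] b assms(1) by (auto simp: a_def)
  have m: "vpt (vx x) \<in> mspace CG" "vpt a \<in> mspace CG" using vx a CG(2) by auto
  have "mdist CG (vpt (vx x)) x \<le> 1" using vx by (simp add: mdist_commute)
  from mdist_triangle'[OF m(1) assms(3) m(2) this a(2)] have "mdist CG (vpt (vx x)) (vpt a) \<le> 2" by simp
  then have "E0 * mdist CG (vpt (vx x)) (vpt a) \<le> E0 * 2" using E0 by (intro mult_left_mono) auto
  then have sd: "set_dist (CX j) (pg j (vx x)) (pg j a) \<le> E0 * 2 + E0" using pg_Lipschitz[OF assms(2) vx(1) a(1)] by simp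
  note pgs = pg_sub[OF assms(2)] pg_ne[OF assms(2)]
  have 1: "close (CX j) (E0 * 2 + E0 + 1) (pg j (vx x)) (pg j a)"
    by (rule set_dist_close) (use pgs vx a sd in auto)
  have tr1: "close (CX (act0 g j)) (E0 * 2 + E0 + 1) (trX g j ` pg j (vx x)) (trX g j ` pg j a)"
    by (rule close_isometry[OF isometry_trX[OF assms(1,2)] _ _ 1]) (use pgs vx a in auto)
  have d: "act0 g j \<in> dom" "g \<otimes> a \<in> carrier \<G>" using act0_dom assms a by auto
  have 2: "close (CX (act0 g j)) (E0 + 1) (trX g j ` pg j a) (pg (act0 g j) (g \<otimes> a))"
    by (rule set_dist_close[OF trX_pg]) (use assms a pgs pg_ne d in auto)
  have "diam_le (CX (act0 g j)) (trX g j ` pg j a) E0"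
    using isometry_diam_le[OF isometry_trX[OF assms(1,2)] pgs(1)[OF a(1)]] pg_diam[OF assms(2) a(1)] by simp
  from close_trans[OF tr1 2 this]
  have "close (CX (act0 g j)) (E0 * 2 + E0 + 1 + E0 + (E0 + 1)) (trX g j ` pg j (vx x)) (pg (act0 g j) (g \<otimes> a))"
    using isometry_onto_in[OF isometry_trX[OF assms(1,2)]] pgs vx(1) a(1) pg_sub[OF d] by blast
  then have "close (CX (act0 g j)) (E0 * 2 + E0 + 1 + E0 + (E0 + 1)) (trX g j ` PX j x) (PX (act0 g j) (cayley_act \<G> g x))"
    using a(3) by (simp add: PX_def b_def)
  then show ?thesis by (rule close_set_dist) (use KK E0 in simp)
qed

text \<open>The infimal distance needs a single pair of points: outside one copy the base point of
  the region and its translate, which lies in the translated region, suffice.\<close>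

lemma trX_rho:
  assumes "g \<in> carrier \<G>" "V' \<in> dom" "W \<in> dom" "X.transverse V' W \<or> X.strictly_nested V' W"
  shows "set_dist (CX (act0 g W)) (trX g W ` RX V' W) (RX (act0 g V') (act0 g W)) \<le> KK"
proof (cases "same V' W")
  case True
  obtain n i i' v where e: "V' = Inr (n, i)" "W = Inr (n, i')" "n \<in> D" "L n = {v}" "vtx n = v" "v \<in> V" "i \<in> SS v" "i' \<in> SS v"
    using same_cases[OF True assms(2,3)] .
  interpret Y: equivariant_hhs_structure "G v" "T v" E0 "SS v" "CC v" "pr v" "nst v" "ort v" "rh v" "ac v" "tv v"
    by (rule vertex_hhg[OF e(6)])
  define k where "k = ck g n"
  have k: "k \<in> carrier (G v)" using ck_closed[OF assms(1) e(3,4)] by (simp add: k_def)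
  have im: "ac v k i \<in> SS v" "ac v k i' \<in> SS v" using Y.element_image[OF k _ refl] e by auto
  have t: "Y.transverse i i' \<or> Y.strictly_nested i i'"
    using assms(4) e by (auto simp: X.strictly_nested_def X.transverse_def Y.strictly_nested_def Y.transverse_def OX_def)
  have t': "Y.transverse (ac v k i) (ac v k i') \<or> Y.strictly_nested (ac v k i) (ac v k i')"
    using t Y.act_transverse[OF k e(7,8)] Y.act_nest[OF k e(7,8)] Y.inj_prop[OF k] e(7,8)
    by (auto simp: Y.strictly_nested_def inj_on_def)
  have rs: "rh v i i' \<subseteq> mspace (CC v i')"
    using t Y.rho_nest[OF e(7,8)] Y.rho_transverse[OF e(7,8)] by (auto simp: Y.strictly_nested_def Y.transverse_def)
  have rs': "rh v (ac v k i) (ac v k i') \<subseteq> mspace (CC v (ac v k i'))"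
    using t' Y.rho_nest[OF im] Y.rho_transverse[OF im] by (auto simp: Y.strictly_nested_def Y.transverse_def)
  have ts: "tv v k i' ` rh v i i' \<subseteq> mspace (CC v (ac v k i'))"
    using isometry_onto_in[OF Y.tr_isometry[OF k e(8)]] rs by auto
  have "trX g W ` RX V' W = Inl ` tv v k i' ` rh v i i'" using e by (simp add: RX_same trX_simps k_def image_image)
  moreover have "RX (act0 g V') (act0 g W) = Inl ` rh v (ac v k i) (ac v k i')"
    using e vtx_mv[OF assms(1) e(3)] by (simp add: RX_same k_def)
  ultimately show ?thesis
    using isometry_set_dist[OF isometry_Inl ts rs'] Y.tr_rho[OF k e(7,8) t] e vtx_mv[OF assms(1) e(3)] KK E0
    by (simp add: k_def)
next
  case False
  have ns: "\<not> same (act0 g V') (act0 g W)" using same_act[OF assms(1-3)] False by simp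
  define a where "a = r (base V')"
  have a: "a \<in> P (base V')" "a \<in> carrier \<G>" using r_P r_in assms by (auto simp: a_def)
  have "g \<otimes> a \<in> P (base (act0 g V'))" using P_mv[OF assms(1) base_dom[OF assms(2)] a(1)] act0_dom(2)[OF assms(1,2)] by simp
  then have sub: "pg (act0 g W) (g \<otimes> a) \<subseteq> RX (act0 g V') (act0 g W)" using ns by (auto simp: RX_not_same)
  have sub': "trX g W ` pg W a \<subseteq> trX g W ` RX V' W" using a False by (intro image_mono) (auto simp: RX_not_same)
  have "close (CX (act0 g W)) (E0 + 1) (trX g W ` pg W a) (pg (act0 g W) (g \<otimes> a))"
    by (rule set_dist_close[OF trX_pg[OF assms(1,3) a(2)]]) (use pg_ne act0_dom assms a in auto)
  from close_mono[OF this sub' sub] show ?thesis by (rule close_set_dist) (use KK E0 in simp)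
qed

text \<open>An orbit is determined by the set of types of a class, or by a vertex and an orbit of
  domains of its group; there are finitely many of these.\<close>

lemma finite_orbits: "finite (orbits \<G> dom actX)"
proof -
  define type where "type j = (case j of Inl n \<Rightarrow> Inl (L n) | Inr (n, i) \<Rightarrow> Inr (vtx n, orbit (G (vtx n)) (ac (vtx n)) i))"
    for j :: "nat + nat \<times> 'i"
  have "orbits (G v) (SS v) (ac v) = orbit (G v) (ac v) ` SS v" for v by (auto simp: orbits_def)
  then have "type ` dom \<subseteq> Inl ` Pow V \<union> Inr ` (SIGMA v:V. orbits (G v) (SS v) (ac v))"
    using L_V by (auto simp: type_def Inr_dom split: sum.splits)
  moreover have "finite (orbits (G v) (SS v) (ac v))" if v: "v \<in> V" for v
  proof -
    interpret Y: equivariant_hhs_structure "G v" "T v" E0 "SS v" "CC v" "pr v" "nst v" "ort v" "rh v" "ac v" "tv v"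
      by (rule vertex_hhg[OF v])
    show ?thesis by (rule Y.finitely_many_orbits)
  qed
  ultimately have fin: "finite (type ` dom)" using finV finite_subset by (metis (no_types, lifting) finite_Pow_iff finite_SigmaI finite_Un finite_imageI)
  have move: "\<exists>g\<in>carrier \<G>. act0 g j = k" if jk: "j \<in> dom" "k \<in> dom" "type j = type k" for j k
  proof -
    \<comment> \<open>Any class can be moved to any other with the same types, with a prescribed
      error \<open>s\<close>. The freedom in \<open>s\<close> is used to move also the domain inside
      the copy.\<close>
    have transit: "\<exists>g\<in>carrier \<G>. mv g m = n \<and> kk g m = s"
      if mn: "m \<in> D" "n \<in> D" "L m = L n" "s \<in> H (L m)" for m n s
    proof -
      define g where "g = r n \<otimes> s \<otimes> inv (r m)"
      have c: "r m \<in> carrier \<G>" "r n \<in> carrier \<G>" "s \<in> carrier \<G>" using r_in mn by auto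
      then have g: "g \<in> carrier \<G>" "inv (r n) \<otimes> g \<otimes> r m = s" by (simp_all add: g_def m_assoc)
      have "mv g m = n" by (rule mv_eqI) (use g mn H_st in auto)
      then show ?thesis using g by (auto simp: kk_def)
    qed
    from jk(1) show ?thesis
    proof (cases rule: dom_cases)
      case (coset m)
      obtain n where n: "k = Inl n" "n \<in> D" "L n = L m" using jk coset by (cases k) (auto simp: type_def)
      then show ?thesis using transit[of m n \<one>] coset by auto
    next
      case (vertex m i v)
      obtain n i' where n: "k = Inr (n, i')" "n \<in> D" "L n = {v}" "i' \<in> SS v" "orbit (G v) (ac v) i = orbit (G v) (ac v) i'"
        using jk vertex by (cases k) (auto simp: type_def Inr_dom)
      interpret Y: equivariant_hhs_structure "G v" "T v" E0 "SS v" "CC v" "pr v" "nst v" "ort v" "rh v" "ac v" "tv v"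
        by (rule vertex_hhg[OF vertex(5)])
      have "i' \<in> orbit (G v) (ac v) i" using Y.orbit_refl[OF n(4)] n(5) by simp
      then obtain t where t: "t \<in> carrier (G v)" "ac v t i = i'" by (auto simp: orbit_def)
      obtain g where g: "g \<in> carrier \<G>" "mv g m = n" "kk g m = incl v t"
        using transit[of m n "incl v t"] letter_H[of v "{v}" t] t vertex n by auto
      then have "ck g m = t" using coord_incl[OF vertex(5) t(1)] vertex by (simp add: ck_def)
      then show ?thesis using g t n vertex by auto
    qed
  qed
  have orb: "orbit \<G> actX j = orbit \<G> actX k" if jk: "j \<in> dom" "k \<in> dom" "type j = type k" for j k
  proof -
    have *: "orbit \<G> actX a \<subseteq> orbit \<G> actX b" if ab: "a \<in> dom" "b \<in> dom" and t: "type a = type b" for a b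
    proof
      fix x assume "x \<in> orbit \<G> actX a"
      then obtain h where h: "h \<in> carrier \<G>" "x = act0 h a" using ab by (auto simp: orbit_def)
      obtain g where g: "g \<in> carrier \<G>" "act0 g b = a" using move[OF ab(2,1) t[symmetric]] by blast
      have "x = act0 (h \<otimes> g) b" using act0_mult[OF h(1) g(1) ab(2)] h g by simp
      then show "x \<in> orbit \<G> actX b" using h g ab by (auto simp: orbit_def intro!: exI[of _ "h \<otimes> g"])
    qed
    show ?thesis using *[of j k] *[of k j] jk by auto
  qed
  have "orbits \<G> dom actX = (\<lambda>z. orbit \<G> actX (SOME j. j \<in> dom \<and> type j = z)) ` type ` dom"
  proof -
    have "orbit \<G> actX (SOME k. k \<in> dom \<and> type k = type j) = orbit \<G> actX j" if "j \<in> dom" for j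
      using someI[of "\<lambda>k. k \<in> dom \<and> type k = type j" j] that orb by blast
    then have "(\<lambda>z. orbit \<G> actX (SOME j. j \<in> dom \<and> type j = z)) ` type ` dom = orbit \<G> actX ` dom"
      unfolding image_image by (intro image_cong) auto
    then show ?thesis by (auto simp: orbits_def)
  qed
  then show ?thesis using fin by simp
qed

lemma equivariant_CX: "equivariant_hhs_structure \<G> TT KK dom CX PX NX OX RX actX trX"
proof -
  interpret A: group_action \<G> dom actX by (rule group_action_actX)
  show ?thesis
  proof
    show "finite (orbits \<G> dom actX)" by (rule finite_orbits)
    fix g V' W assume g: "g \<in> carrier \<G>" "V' \<in> dom" "W \<in> dom"
    show 1: "NX (actX g V') (actX g W) \<longleftrightarrow> NX V' W" using act_NX g by simp
    show 2: "OX (actX g V') (actX g W) \<longleftrightarrow> OX V' W" using act_OX g by simp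
    show "X.transverse (actX g V') (actX g W) \<longleftrightarrow> X.transverse V' W" using 1 2 act_NX g by (simp add: X.transverse_def)
    show "set_dist (CX (actX g W)) (trX g W ` RX V' W) (RX (actX g V') (actX g W)) \<le> KK"
      if "X.transverse V' W \<or> X.strictly_nested V' W" using trX_rho[OF g that] g by simp
  next
    fix g W assume g: "g \<in> carrier \<G>" "W \<in> dom"
    show "isometry_onto (CX W) (CX (actX g W)) (trX g W)" using isometry_trX g by simp
    show "set_dist (CX (actX g W)) (trX g W ` PX W x) (PX (actX g W) (cayley_act \<G> g x)) \<le> KK" if "x \<in> mspace CG" for x
      using trX_proj[OF g that] g by simp
  next
    fix g h W c assume "g \<in> carrier \<G>" "h \<in> carrier \<G>" "W \<in> dom" "c \<in> mspace (CX W)"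
    then show "trX (g \<otimes> h) W c = trX g (actX h W) (trX h W c)" using trX_mult by simp
  qed
qed

end

section \<open>Graph products of hierarchically hyperbolic groups\<close>

text \<open>Each ball of the Cayley graph is countable, as each vertex has finitely many
  neighbours.\<close>

lemma countable_generated_group:
  assumes "group G" "finite T" "T \<subseteq> carrier G" "generate G T = carrier G"
  shows "countable (carrier G)"
proof -
  interpret G: group G by fact
  interpret connected_graph "carrier G" "cayley_edges G T" by (rule connected_graph_cayley) (use assms in auto)
  let ?R = "cayley_edges G T"
  have ball: "countable {b. (\<one>\<^bsub>G\<^esub>, b) \<in> ?R ^^ n}" for n
  proof (induction n)
    case (Suc n)
    have sub: "{b. (a, b) \<in> ?R} \<subseteq> (\<lambda>s. a \<otimes>\<^bsub>G\<^esub> s) ` (T \<union> m_inv G ` T)" for a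
    proof
      fix b assume "b \<in> {b. (a, b) \<in> ?R}"
      then obtain s where s: "b = a \<otimes>\<^bsub>G\<^esub> s" "s \<in> carrier G" "s \<in> T \<or> inv\<^bsub>G\<^esub> s \<in> T" by (auto simp: cayley_edges_def)
      have "s \<in> T \<union> m_inv G ` T" using s G.inv_inv[OF s(2)] by (metis UnCI imageI)
      then show "b \<in> (\<lambda>s. a \<otimes>\<^bsub>G\<^esub> s) ` (T \<union> m_inv G ` T)" using s by blast
    qed
    have "countable {b. (a, b) \<in> ?R}" for a
      using countable_subset[OF sub countable_image[OF countable_finite]] assms(2) by auto
    then have "countable (\<Union>a\<in>{b. (\<one>\<^bsub>G\<^esub>, b) \<in> ?R ^^ n}. {b. (a, b) \<in> ?R})" using Suc by (intro countable_UN) auto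
    moreover have "{b. (\<one>\<^bsub>G\<^esub>, b) \<in> ?R ^^ Suc n} = (\<Union>a\<in>{b. (\<one>\<^bsub>G\<^esub>, b) \<in> ?R ^^ n}. {b. (a, b) \<in> ?R})" by auto
    ultimately show ?case by metis
  qed simp
  have "carrier G \<subseteq> (\<Union>n. {b. (\<one>\<^bsub>G\<^esub>, b) \<in> ?R ^^ n})"
    using conn[OF G.one_closed] by (auto dest!: rtrancl_imp_relpow)
  then show ?thesis by (rule countable_subset) (use ball in simp)
qed

section \<open>Numbering the parallelism classes\<close>

context graph_group
begin

lemma countable_carrier:
  assumes "\<And>v. v \<in> V \<Longrightarrow> countable (carrier (G v))" shows "countable (carrier \<G>)"
proof -
  have "countable (wd V)" unfolding wd_def fp_words_def
    by (intro countable_lists countable_SIGMA) (use assms finV in \<open>auto intro: countable_finite\<close>)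
  moreover have "carrier \<G> \<subseteq> ev ` wd V" using ev_surj by blast
  ultimately show ?thesis using countable_subset by blast
qed

lemma index_exists:
  assumes "countable (carrier \<G>)"
  obtains D L r where "indexed_graph_group_axioms \<G> V E G incl D L r"
proof -
  define coset where "coset \<Lambda> g = {h \<in> carrier \<G>. inv h \<otimes> g \<in> H (st \<Lambda>)}" for \<Lambda> g
  \<comment> \<open>The choice is made from the coset as a set, so equal cosets receive the same
    representative.\<close>
  define rep where "rep \<Lambda> g = (SOME h. h \<in> coset \<Lambda> g)" for \<Lambda> g
  have rep: "rep \<Lambda> g \<in> carrier \<G>" "inv (rep \<Lambda> g) \<otimes> g \<in> H (st \<Lambda>)" if "g \<in> carrier \<G>" for \<Lambda> g
  proof -
    have "g \<in> coset \<Lambda> g" using that by (simp add: coset_def)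
    then have "rep \<Lambda> g \<in> coset \<Lambda> g" unfolding rep_def by (rule someI)
    then show "rep \<Lambda> g \<in> carrier \<G>" "inv (rep \<Lambda> g) \<otimes> g \<in> H (st \<Lambda>)" by (simp_all add: coset_def)
  qed
  have coset_sub: "coset \<Lambda> g \<subseteq> coset \<Lambda> h" if "g \<in> carrier \<G>" "h \<in> carrier \<G>" "inv g \<otimes> h \<in> H (st \<Lambda>)" for \<Lambda> g h
  proof
    fix x assume x: "x \<in> coset \<Lambda> g"
    then have "inv x \<otimes> h = (inv x \<otimes> g) \<otimes> (inv g \<otimes> h)" using that by (simp add: coset_def group_simps)
    then show "x \<in> coset \<Lambda> h" using x that by (simp add: coset_def)
  qed
  have swap: "inv h \<otimes> g \<in> H (st \<Lambda>)" if "g \<in> carrier \<G>" "h \<in> carrier \<G>" "inv g \<otimes> h \<in> H (st \<Lambda>)" for \<Lambda> g h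
  proof -
    have "inv h \<otimes> g = inv (inv g \<otimes> h)" using that by (simp add: group_simps)
    then show ?thesis using that by simp
  qed
  have coset_eq: "coset \<Lambda> g = coset \<Lambda> h" if "g \<in> carrier \<G>" "h \<in> carrier \<G>" "inv g \<otimes> h \<in> H (st \<Lambda>)" for \<Lambda> g h
    using coset_sub[OF that] coset_sub[OF that(2,1) swap[OF that]] by blast
  define A where "A = (\<lambda>(\<Lambda>, g). (\<Lambda>, rep \<Lambda> g)) ` ((Pow V - {{}}) \<times> carrier \<G>)"
  have "countable A" unfolding A_def using finV assms by (intro countable_image countable_SIGMA) (auto intro: countable_finite)
  define D where "D = to_nat_on A ` A"
  define L where "L n = fst (from_nat_into A n)" for n
  define r where "r n = snd (from_nat_into A n)" for n
  have from_to: "from_nat_into A (to_nat_on A p) = p" if "p \<in> A" for p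
    using \<open>countable A\<close> that by simp
  have D: "L n \<subseteq> V \<and> L n \<noteq> {} \<and> (\<exists>g\<in>carrier \<G>. r n = rep (L n) g) \<and> to_nat_on A (L n, r n) = n" if n: "n \<in> D" for n
  proof -
    obtain p where p: "p \<in> A" "n = to_nat_on A p" using n by (auto simp: D_def)
    obtain \<Lambda> g where "p = (\<Lambda>, rep \<Lambda> g)" "\<Lambda> \<subseteq> V" "\<Lambda> \<noteq> {}" "g \<in> carrier \<G>" using p(1) by (auto simp: A_def)
    then show ?thesis using p from_to[OF p(1)] by (auto simp: L_def r_def)
  qed
  have "indexed_graph_group_axioms \<G> V E G incl D L r"
  proof
    show "L n \<subseteq> V" "L n \<noteq> {}" if "n \<in> D" for n using D[OF that] by auto
    show "r n \<in> carrier \<G>" if "n \<in> D" for n using D[OF that] rep(1) by auto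
    show "\<exists>n\<in>D. L n = \<Lambda> \<and> inv (r n) \<otimes> g \<in> H (st \<Lambda>)" if "\<Lambda> \<subseteq> V" "\<Lambda> \<noteq> {}" "g \<in> carrier \<G>" for \<Lambda> g
    proof -
      have p: "(\<Lambda>, rep \<Lambda> g) \<in> A" using that by (auto simp: A_def)
      then have "L (to_nat_on A (\<Lambda>, rep \<Lambda> g)) = \<Lambda>" "r (to_nat_on A (\<Lambda>, rep \<Lambda> g)) = rep \<Lambda> g"
        using from_to by (simp_all add: L_def r_def)
      then show ?thesis using rep(2)[OF that(3)] p by (intro bexI[of _ "to_nat_on A (\<Lambda>, rep \<Lambda> g)"]) (simp_all add: D_def)
    qed
    show "n = m" if nm: "n \<in> D" "m \<in> D" "L n = L m" "inv (r n) \<otimes> r m \<in> H (st (L n))" for n m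
    proof -
      obtain g where n: "g \<in> carrier \<G>" "r n = rep (L n) g" using D[OF nm(1)] by auto
      obtain h where m: "h \<in> carrier \<G>" "r m = rep (L n) h" using D[OF nm(2)] nm(3) by auto
      have "coset (L n) (rep (L n) g) = coset (L n) (rep (L n) h)"
        using coset_eq[OF rep(1)[OF n(1)] rep(1)[OF m(1)]] nm(4) n m by simp
      then have "coset (L n) g = coset (L n) h"
        using coset_eq[OF rep(1)[OF n(1)] n(1) rep(2)[OF n(1)]] coset_eq[OF rep(1)[OF m(1)] m(1) rep(2)[OF m(1)]] by simp
      then have e: "(L n, r n) = (L m, r m)" using n m nm(3) by (simp add: rep_def)
      have t: "to_nat_on A (L n, r n) = n" "to_nat_on A (L m, r m) = m" using D nm(1,2) by blast+
      show "n = m" by (rule trans[OF t(1)[symmetric] t(2)[folded e]])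
    qed
  qed
  then show thesis by (rule that)
qed

end

section \<open>Enlarging the constant of a hierarchy structure\<close>

lemma proto_hierarchy_structure_mono:
  assumes "proto_hierarchy_structure X E SS C \<pi> nest orth \<rho>" "E \<le> E'"
  shows "proto_hierarchy_structure X E' SS C \<pi> nest orth \<rho>"
proof -
  interpret X: proto_hierarchy_structure X E SS C \<pi> nest orth \<rho> by fact
  show ?thesis
  proof
    show "0 < E'" using X.E_pos assms(2) by simp
    show "diam_le (C W) (\<pi> W x) E'" if "W \<in> SS" "x \<in> mspace X" for W x
      using diam_le_mono[OF X.proj_diam[OF that] assms(2)] .
    show "set_dist (C W) (\<pi> W x) (\<pi> W y) \<le> E' * mdist X x y + E'" if "W \<in> SS" "x \<in> mspace X" "y \<in> mspace X" for W x y
      using X.proj_coarsely_Lipschitz[OF that] mult_right_mono[OF assms(2) mdist_nonneg[of X x y]] assms(2) by linarith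
    show "mspace (C W) \<subseteq> nbhd (C W) E' (\<Union>x\<in>mspace X. \<pi> W x)" if "W \<in> SS" for W
      using order_trans[OF X.proj_coarsely_onto[OF that] nbhd_mono[OF assms(2)]] .
    show "\<rho> V W \<noteq> {} \<and> \<rho> V W \<subseteq> mspace (C W) \<and> diam_le (C W) (\<rho> V W) E'"
      if "V \<in> SS" "W \<in> SS" "nest V W" "V \<noteq> W" for V W
      using X.rho_nest[OF that] diam_le_mono[OF _ assms(2)] by blast
    show "\<rho> V W \<noteq> {} \<and> \<rho> V W \<subseteq> mspace (C W) \<and> diam_le (C W) (\<rho> V W) E'"
      if "V \<in> SS" "W \<in> SS" "\<not> orth V W" "\<not> nest V W" "\<not> nest W V" for V W
      using X.rho_transverse[OF that] diam_le_mono[OF _ assms(2)] by blast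
  qed (fact X.quasi_geodesic X.geodesic X.proj_subset X.proj_nonempty X.nest_refl X.nest_antisym X.nest_trans
      X.nest_maximal X.orth_sym X.orth_not_comparable X.orth_nest)+
qed

lemma hhs_structure_mono:
  assumes "hhs_structure X E SS C \<pi> nest orth \<rho>" "E \<le> E'"
  shows "hhs_structure X E' SS C \<pi> nest orth \<rho>"
proof -
  interpret X: hhs_structure X E SS C \<pi> nest orth \<rho> by fact
  interpret X': proto_hierarchy_structure X E' SS C \<pi> nest orth \<rho>
    by (rule proto_hierarchy_structure_mono[OF X.proto_hierarchy_structure_axioms assms(2)])
  show ?thesis
  proof
    show "hyperbolic (C W) E'" if "W \<in> SS" for W using hyperbolic_mono[OF X.hyperbolicity[OF that] assms(2)] .
    show "finite A \<and> real (card A) \<le> E'" if "A \<subseteq> SS" "\<forall>V\<in>A. \<forall>W\<in>A. nest V W \<or> nest W V" for A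
      using X.finite_complexity[OF that] assms(2) by simp
    show "P \<inter> nbhd (C W) E' (\<rho> V W) \<noteq> {}"
      if "V \<in> SS" "W \<in> SS" "X.strictly_nested V W" "x \<in> mspace X" "y \<in> mspace X" "E' \<le> X.proj_dist V x y"
        "a \<in> \<pi> W x" "b \<in> \<pi> W y" "geodesic_segment (C W) a b P" for V W x y a b P
      using X.bounded_geodesic_image[OF that(1-5) order_trans[OF assms(2) that(6)] that(7-9)]
        Int_mono[OF subset_refl[of P] nbhd_mono[OF assms(2), of "C W" "\<rho> V W"]] by auto
    show "\<exists>\<V>. finite \<V> \<and> \<V> \<subseteq> X.below W - {W} \<and> real (card \<V>) \<le> E' * X.proj_dist W x y + E' \<and>
        (\<forall>U\<in>X.below W - {W}. (\<exists>V\<in>\<V>. nest U V) \<or> X.proj_dist U x y \<le> E')"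
      if w: "W \<in> SS" "x \<in> mspace X" "y \<in> mspace X" for W x y
    proof -
      have "E * X.proj_dist W x y + E \<le> E' * X.proj_dist W x y + E'"
        unfolding X.proj_dist_def using set_dist_nonneg[OF X.proj_nonempty[OF w(1,2)] X.proj_nonempty[OF w(1,3)]] assms(2)
        by (intro add_mono mult_right_mono) auto
      then show ?thesis using X.large_links[OF w] assms(2) by (meson order_trans)
    qed
    show "min (set_dist (C W) (\<pi> W x) (\<rho> V W)) (set_dist (C V) (\<pi> V x) (\<rho> W V)) \<le> E'"
      if "V \<in> SS" "W \<in> SS" "X.transverse V W" "x \<in> mspace X" for V W x
      using X.consistency[OF that] assms(2) by linarith
    show "set_dist (C W) (\<rho> U W) (\<rho> V W) \<le> E'"
      if "U \<in> SS" "V \<in> SS" "W \<in> SS" "nest U V" "X.strictly_nested V W \<or> X.transverse V W \<and> \<not> orth W U" for U V W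
      using X.rho_consistency[OF that] assms(2) by linarith
    show "\<exists>x\<in>mspace X. (\<forall>V\<in>\<V>. set_dist (C V) (\<pi> V x) {p V} \<le> E') \<and>
        (\<forall>V\<in>\<V>. \<forall>W\<in>SS. X.strictly_nested V W \<or> X.transverse W V \<longrightarrow> set_dist (C W) (\<pi> W x) (\<rho> V W) \<le> E')"
      if "finite \<V>" "\<V> \<subseteq> SS" "pairwise orth \<V>" "\<forall>V\<in>\<V>. p V \<in> mspace (C V)" for \<V> p
      using X.partial_realisation[OF that] assms(2) by (meson order_trans)
  qed (fact X.containers X.uniqueness)+
qed

lemma equivariant_hhs_structure_mono:
  assumes "equivariant_hhs_structure G T E SS C \<pi> nest orth \<rho> act tr" "E \<le> E'"
  shows "equivariant_hhs_structure G T E' SS C \<pi> nest orth \<rho> act tr"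
proof -
  interpret X: equivariant_hhs_structure G T E SS C \<pi> nest orth \<rho> act tr by fact
  interpret X': hhs_structure "cayley_graph G T" E' SS C \<pi> nest orth \<rho>
    by (rule hhs_structure_mono[OF X.hhs_structure_axioms assms(2)])
  show ?thesis
  proof
    show "set_dist (C (act g W)) (tr g W ` \<pi> W x) (\<pi> (act g W) (cayley_act G g x)) \<le> E'"
      if "g \<in> carrier G" "W \<in> SS" "x \<in> mspace (cayley_graph G T)" for g W x
      using X.tr_proj[OF that] assms(2) by linarith
    show "set_dist (C (act g W)) (tr g W ` \<rho> V W) (\<rho> (act g V) (act g W)) \<le> E'"
      if "g \<in> carrier G" "V \<in> SS" "W \<in> SS" "X.transverse V W \<or> X.strictly_nested V W" for g V W
      using X.tr_rho[OF that] assms(2) by linarith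
  qed (fact X.act_nest X.act_orth X.act_transverse X.finitely_many_orbits X.tr_isometry X.tr_mult)+
qed

theorem theoremC:
  fixes V :: "'v set" and E :: "'v set set" and G :: "'v \<Rightarrow> 'a monoid"
  assumes "finite V" and "V \<noteq> {}" and "simplicial_graph V E"
    and "\<And>v. v \<in> V \<Longrightarrow> carrier (G v) \<noteq> {\<one>\<^bsub>G v\<^esub>}"
    and "\<And>v. v \<in> V \<Longrightarrow> hierarchically_hyperbolic_group TYPE('i) TYPE('p) (G v)"
  shows "hierarchically_hyperbolic_group TYPE(nat + nat \<times> 'i) TYPE('p + real) (graph_product V E G)"
proof -
  have grp: "group (G v)" if "v \<in> V" for v
    using assms(5)[OF that] by (simp add: hierarchically_hyperbolic_group_def)
  interpret GP: graph_product_data V E G using assms(1,3) grp by (rule graph_product_data.intro)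
  interpret GG: graph_group "graph_product V E G" V E G GP.gp_incl by (rule GP.graph_group_graph_product)
  have "\<forall>v\<in>V. \<exists>T. finite T \<and> T \<subseteq> carrier (G v) \<and> generate (G v) T = carrier (G v) \<and>
      (\<exists>e (SS :: 'i set) (CC :: 'i \<Rightarrow> 'p metric) pr nst ort rh ac tv.
        equivariant_hhs_structure (G v) T e SS CC pr nst ort rh ac tv)"
    using assms(5) by (simp add: hierarchically_hyperbolic_group_def)
  then obtain T where T: "\<forall>v\<in>V. finite (T v) \<and> T v \<subseteq> carrier (G v) \<and> generate (G v) (T v) = carrier (G v) \<and>
      (\<exists>e (SS :: 'i set) (CC :: 'i \<Rightarrow> 'p metric) pr nst ort rh ac tv.
        equivariant_hhs_structure (G v) (T v) e SS CC pr nst ort rh ac tv)"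
    using bchoice[of V "\<lambda>v T. finite T \<and> T \<subseteq> carrier (G v) \<and> generate (G v) T = carrier (G v) \<and>
      (\<exists>e (SS :: 'i set) (CC :: 'i \<Rightarrow> 'p metric) pr nst ort rh ac tv.
        equivariant_hhs_structure (G v) T e SS CC pr nst ort rh ac tv)"] by blast
  have "\<forall>v\<in>V. \<exists>e. \<exists>(SS :: 'i set) (CC :: 'i \<Rightarrow> 'p metric) pr nst ort rh ac tv.
      equivariant_hhs_structure (G v) (T v) e SS CC pr nst ort rh ac tv" using T by blast
  from bchoice[OF this] obtain e where e: "\<forall>v\<in>V. \<exists>(SS :: 'i set) (CC :: 'i \<Rightarrow> 'p metric) pr nst ort rh ac tv.
      equivariant_hhs_structure (G v) (T v) (e v) SS CC pr nst ort rh ac tv" by blast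
  \<comment> \<open>One constant for all vertex groups, and at least 1, as the later estimates
    compare it with single steps.\<close>
  define E0 where "E0 = 1 + (\<Sum>v\<in>V. \<bar>e v\<bar>)"
  have E0: "1 \<le> E0" "e v \<le> E0" if "v \<in> V" for v
    using member_le_sum[OF that, of "\<lambda>v. \<bar>e v\<bar>"] assms(1) by (auto simp: E0_def sum_nonneg)
  \<comment> \<open>Packing the components into a tuple lets one choice function select the whole
    structure for each vertex.\<close>
  have "\<forall>v\<in>V. \<exists>x. case x of (SS :: 'i set, CC :: 'i \<Rightarrow> 'p metric, pr, nst, ort, rh, ac, tv) \<Rightarrow>
      equivariant_hhs_structure (G v) (T v) E0 SS CC pr nst ort rh ac tv"
  proof
    fix v assume v: "v \<in> V"
    obtain SS :: "'i set" and CC :: "'i \<Rightarrow> 'p metric" and pr nst ort rh ac tv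
      where "equivariant_hhs_structure (G v) (T v) (e v) SS CC pr nst ort rh ac tv" using e v by blast
    from equivariant_hhs_structure_mono[OF this E0(2)[OF v]]
    show "\<exists>x. case x of (SS :: 'i set, CC :: 'i \<Rightarrow> 'p metric, pr, nst, ort, rh, ac, tv) \<Rightarrow>
      equivariant_hhs_structure (G v) (T v) E0 SS CC pr nst ort rh ac tv"
      by (intro exI[of _ "(SS, CC, pr, nst, ort, rh, ac, tv)"]) simp
  qed
  from bchoice[OF this] obtain x where x: "\<forall>v\<in>V. case x v of (SS :: 'i set, CC :: 'i \<Rightarrow> 'p metric, pr, nst, ort, rh, ac, tv) \<Rightarrow>
      equivariant_hhs_structure (G v) (T v) E0 SS CC pr nst ort rh ac tv" by blast
  have count: "countable (carrier (G v))" if "v \<in> V" for v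
    by (rule countable_generated_group[OF grp[OF that], of "T v"]) (use bspec[OF T that] in simp_all)
  obtain D L r where ind: "indexed_graph_group_axioms (graph_product V E G) V E G GP.gp_incl D L r"
    using GG.index_exists[OF GG.countable_carrier[OF count]] by blast
  interpret X: hhg_product "graph_product V E G" V E G GP.gp_incl D L r T E0 "\<lambda>v. fst (x v)" "\<lambda>v. fst (snd (x v))"
      "\<lambda>v. fst (snd (snd (x v)))" "\<lambda>v. fst (snd (snd (snd (x v))))" "\<lambda>v. fst (snd (snd (snd (snd (x v)))))"
      "\<lambda>v. fst (snd (snd (snd (snd (snd (x v))))))" "\<lambda>v. fst (snd (snd (snd (snd (snd (snd (x v)))))))"
      "\<lambda>v. snd (snd (snd (snd (snd (snd (snd (x v)))))))"
  proof (intro hhg_product.intro indexed_graph_group.intro countable_graph_group.intro)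
    show "countable_graph_group_axioms (graph_product V E G) (Inr :: real \<Rightarrow> 'p + real)"
      using GG.countable_carrier[OF count] by unfold_locales auto
    show "hhg_product_axioms V G T E0 (\<lambda>v. fst (x v)) (\<lambda>v. fst (snd (x v)))
      (\<lambda>v. fst (snd (snd (x v)))) (\<lambda>v. fst (snd (snd (snd (x v))))) (\<lambda>v. fst (snd (snd (snd (snd (x v))))))
      (\<lambda>v. fst (snd (snd (snd (snd (snd (x v))))))) (\<lambda>v. fst (snd (snd (snd (snd (snd (snd (x v))))))))
      (\<lambda>v. snd (snd (snd (snd (snd (snd (snd (x v))))))))"
    proof (rule hhg_product_axioms.intro)
      show "equivariant_hhs_structure (G v) (T v) E0 (fst (x v)) (fst (snd (x v))) (fst (snd (snd (x v))))
          (fst (snd (snd (snd (x v))))) (fst (snd (snd (snd (snd (x v)))))) (fst (snd (snd (snd (snd (snd (x v)))))))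
          (fst (snd (snd (snd (snd (snd (snd (x v)))))))) (snd (snd (snd (snd (snd (snd (snd (x v))))))))" if "v \<in> V" for v
        using bspec[OF x that] by (simp add: case_prod_beta)
    qed (use T E0 assms(2) in auto)
  qed (use ind GG.graph_group_axioms in simp_all)
  show ?thesis
    unfolding hierarchically_hyperbolic_group_def
    by (intro conjI exI[of _ X.TT] GG.is_group X.TT_finite X.TT_sub X.TT_gen) (rule exI X.equivariant_CX)+
qed

end
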